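(* Assume (A1). Then the forward map $\mathcal G:\dot W^{2,\infty}\to F_\beta$, $\mathcal G(W)=\rho_W$, is infinitely Fréchet differentiable. For $W,H\in\dot W^{2,\infty}$, the first derivative $D\rho_W[H]$ is the unique $v\in F_\beta$ solving $$(\partial_t-\mathcal L_W)v=\nabla\cdot(\rho_W\nabla H*\rho_W),\qquad v(0)=0,$$ and for $W,H_1,H_2\in\dot W^{2,\infty}$, the second derivative $D^2\rho_W[H_1,H_2]$ is the unique $v\in F_\beta$ solving $v(0)=0$ and $$\begin{aligned}(\partial_t-\mathcal L_W)v=&\ \nabla\cdot(D\rho_W[H_2]\nabla H_1*\rho_W)+\nabla\cdot(\rho_W\nabla H_1*D\rho_W[H_2])\\&+\nabla\cdot(D\rho_W[H_1]\nabla H_2*\rho_W)+\nabla\cdot(\rho_W\nabla H_2*D\rho_W[H_1])\\&+\nabla\cdot(D\rho_W[H_1]\nabla W*D\rho_W[H_2])+\nabla\cdot(D\rho_W[H_2]\nabla W*D\rho_W[H_1]).\end{aligned}$$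
   Context: $\mathbb T^d=\mathbb R^d/\mathbb Z^d$. For $s\in\mathbb R$, $H^s=H^s(\mathbb T^d)$ is the periodic Sobolev space with norm $\|u\|_{H^s}^2=\sum_{k\in\mathbb Z^d}(1+|k|^2)^s|\hat u_k|^2$; $W^{2,\infty}$ is the Sobolev space with derivatives up to order 2 in $L^\infty$; a dot denotes mean-zero subspace. $L^2([0,T];B)$, $H^1([0,T];B)$ are Bochner spaces; intersections carry the sum norm. $F_\beta:=L^2([0,T];H^{\beta+1})\cap H^1([0,T];H^{\beta-1})$. Assumption (A1): $\phi$ is a probability density on $\mathbb T^d$ with $\phi\in H^\beta$ for some even integer $\beta\ge3+d$. For $W\in\dot W^{2,\infty}$, $\rho_W$ denotes the unique solution in $F_\beta$ of $\partial_t\rho=\Delta\rho+\nabla\cdot(\rho\nabla W*\rho)$ on $[0,T]\times\mathbb T^d$, $\rho(0)=\phi$. The linear operator $\mathcal L_W$ is $\mathcal L_Wu=\Delta u+\nabla\cdot(u\nabla W*\rho_W)+\nabla\cdot(\rho_W\nabla W*u)$; convolution is on the torus. *)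

theory Defs
  imports "HOL-Probability.Probability"
begin

section \<open>Functions on the torus T^d = R^d / Z^d, represented as Z^d-periodic functions on R^d\<close>

definition cube :: "(real^'d) set" where
  "cube = {x. \<forall>i. 0 \<le> x$i \<and> x$i \<le> 1}"

definition lattice_vec :: "int^'d \<Rightarrow> real^'d" where
  "lattice_vec k = (\<chi> i. real_of_int (k$i))"

definition periodic :: "(real^'d \<Rightarrow> real) \<Rightarrow> bool" where
  "periodic f \<longleftrightarrow> (\<forall>x k. f (x + lattice_vec k) = f x)"

text \<open>Square integrable periodic functions (representatives of elements of L^2(T^d)).\<close>
definition L2per :: "(real^'d \<Rightarrow> real) \<Rightarrow> bool" where
  "L2per f \<longleftrightarrow> periodic f \<and> f \<in> borel_measurable lebesgue
      \<and> integrable (lebesgue_on cube) (\<lambda>x. (f x)^2)"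

definition fcoef :: "(real^'d \<Rightarrow> real) \<Rightarrow> int^'d \<Rightarrow> complex" where
  "fcoef f k = (LINT x|lebesgue_on cube.
      complex_of_real (f x) * cis (- 2 * pi * (\<Sum>i\<in>UNIV. real_of_int (k$i) * x$i)))"

definition knorm2 :: "int^'d \<Rightarrow> real" where
  "knorm2 k = (\<Sum>i\<in>UNIV. (real_of_int (k$i))^2)"

definition sobn2 :: "real \<Rightarrow> (real^'d \<Rightarrow> real) \<Rightarrow> ennreal" where
  "sobn2 s f = (\<integral>\<^sup>+ k. ennreal ((1 + knorm2 k) powr s * (cmod (fcoef f k))^2) \<partial>count_space UNIV)"

definition Hs :: "real \<Rightarrow> (real^'d \<Rightarrow> real) \<Rightarrow> bool" where
  "Hs s f \<longleftrightarrow> L2per f \<and> sobn2 s f < \<infinity>"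

definition has_wpd :: "(real^'d \<Rightarrow> real) \<Rightarrow> 'd \<Rightarrow> (real^'d \<Rightarrow> real) \<Rightarrow> bool" where
  "has_wpd u j v \<longleftrightarrow> L2per v \<and>
     (\<forall>k. fcoef v k = 2 * pi * \<i> * of_int (k$j) * fcoef u k)"

definition wpd :: "(real^'d \<Rightarrow> real) \<Rightarrow> 'd \<Rightarrow> (real^'d \<Rightarrow> real)" where
  "wpd u j = (SOME v. has_wpd u j v)"

definition esup :: "(real^'d \<Rightarrow> real) \<Rightarrow> ereal" where
  "esup f = esssup (lebesgue_on cube) (\<lambda>x. ereal \<bar>f x\<bar>)"

definition Wdot :: "(real^'d \<Rightarrow> real) \<Rightarrow> bool" where
  "Wdot W \<longleftrightarrow> periodic W \<and> W \<in> borel_measurable lebesgue \<and> esup W < \<infinity>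
     \<and> fcoef W 0 = 0
     \<and> (\<forall>j. \<exists>v. has_wpd W j v \<and> esup v < \<infinity>
            \<and> (\<forall>i. \<exists>w. has_wpd v i w \<and> esup w < \<infinity>))"

definition Wnorm :: "(real^'d \<Rightarrow> real) \<Rightarrow> real" where
  "Wnorm W = real_of_ereal (esup W) + (\<Sum>j\<in>UNIV. real_of_ereal (esup (wpd W j)))
     + (\<Sum>j\<in>UNIV. \<Sum>i\<in>UNIV. real_of_ereal (esup (wpd (wpd W j) i)))"

definition conv :: "(real^'d \<Rightarrow> real) \<Rightarrow> (real^'d \<Rightarrow> real) \<Rightarrow> real^'d \<Rightarrow> real" where
  "conv f g x = (LINT y|lebesgue_on cube. f (x - y) * g y)"

text \<open>v is the weak time derivative of u on [0,T] (as H^s-valued functions; stated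
  coefficientwise, with u the time-continuous representative).\<close>
definition has_tderiv :: "real \<Rightarrow> (real \<Rightarrow> real^'d \<Rightarrow> real) \<Rightarrow> (real \<Rightarrow> real^'d \<Rightarrow> real) \<Rightarrow> bool" where
  "has_tderiv T u v \<longleftrightarrow> (\<forall>k. set_integrable lborel {0..T} (\<lambda>s. fcoef (v s) k)
      \<and> (\<forall>t\<in>{0..T}. fcoef (u t) k = fcoef (u 0) k + (LBINT s=0..t. fcoef (v s) k)))"

definition tderiv :: "real \<Rightarrow> (real \<Rightarrow> real^'d \<Rightarrow> real) \<Rightarrow> (real \<Rightarrow> real^'d \<Rightarrow> real)" where
  "tderiv T u = (SOME v. has_tderiv T u v)"

definition L2H :: "real \<Rightarrow> real \<Rightarrow> (real \<Rightarrow> real^'d \<Rightarrow> real) \<Rightarrow> ennreal" where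
  "L2H T s u = (\<integral>\<^sup>+ t. sobn2 s (u t) * indicator {0..T} t \<partial>lborel)"

definition inF :: "real \<Rightarrow> nat \<Rightarrow> (real \<Rightarrow> real^'d \<Rightarrow> real) \<Rightarrow> bool" where
  "inF T b u \<longleftrightarrow> (\<forall>t\<in>{0..T}. L2per (u t)) \<and> L2H T (real b + 1) u < \<infinity>
     \<and> (\<exists>v. has_tderiv T u v \<and> (\<forall>t\<in>{0..T}. L2per (v t))
          \<and> (\<forall>k. (\<lambda>s. fcoef (v s) k) \<in> borel_measurable lborel)
          \<and> L2H T (real b - 1) v < \<infinity>)"

definition Fnorm :: "real \<Rightarrow> nat \<Rightarrow> (real \<Rightarrow> real^'d \<Rightarrow> real) \<Rightarrow> real" where
  "Fnorm T b u = sqrt (enn2real (L2H T (real b + 1) u)) + sqrt (enn2real (L2H T (real b - 1) u))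
     + sqrt (enn2real (L2H T (real b - 1) (tderiv T u)))"

text \<open>Equality as elements of F_beta (time-continuous representatives, equal a.e. in x).\<close>
definition feq :: "real \<Rightarrow> (real \<Rightarrow> real^'d \<Rightarrow> real) \<Rightarrow> (real \<Rightarrow> real^'d \<Rightarrow> real) \<Rightarrow> bool" where
  "feq T u v \<longleftrightarrow> (\<forall>t\<in>{0..T}. \<forall>k. fcoef (u t) k = fcoef (v t) k)"

definition lapc :: "(real^'d \<Rightarrow> real) \<Rightarrow> int^'d \<Rightarrow> complex" where
  "lapc f k = - of_real (4 * pi^2 * knorm2 k) * fcoef f k"

definition driftc :: "(real^'d \<Rightarrow> real) \<Rightarrow> (real^'d \<Rightarrow> real) \<Rightarrow> (real^'d \<Rightarrow> real) \<Rightarrow> int^'d \<Rightarrow> complex" where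
  "driftc a W b k = (\<Sum>j\<in>UNIV. 2 * pi * \<i> * of_int (k$j) *
                       fcoef (\<lambda>x. a x * conv (wpd W j) b x) k)"

text \<open>u(t) = u(0) + integral_0^t g(s) ds in H^{beta-1}, with g given by its Fourier coefficients;
  together with u in F_beta this is the equation d/dt u = g in L^2([0,T];H^{beta-1}).\<close>
definition evolves :: "real \<Rightarrow> (real \<Rightarrow> real^'d \<Rightarrow> real) \<Rightarrow> (real \<Rightarrow> int^'d \<Rightarrow> complex) \<Rightarrow> bool" where
  "evolves T u g \<longleftrightarrow> (\<forall>k. set_integrable lborel {0..T} (\<lambda>s. g s k)
      \<and> (\<forall>t\<in>{0..T}. fcoef (u t) k = fcoef (u 0) k + (LBINT s=0..t. g s k)))"

definition A1 :: "nat \<Rightarrow> (real^'d \<Rightarrow> real) \<Rightarrow> bool" where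
  "A1 b \<phi> \<longleftrightarrow> periodic \<phi> \<and> \<phi> \<in> borel_measurable lebesgue \<and> (\<forall>x. 0 \<le> \<phi> x)
     \<and> (LINT x|lebesgue_on cube. \<phi> x) = 1 \<and> Hs (real b) \<phi>
     \<and> even b \<and> b \<ge> 3 + CARD('d)"

text \<open>rho_W: the (unique, by well-posedness) solution in F_beta of the nonlinear equation.\<close>
definition solves_nl :: "real \<Rightarrow> nat \<Rightarrow> (real^'d \<Rightarrow> real) \<Rightarrow> (real^'d \<Rightarrow> real) \<Rightarrow> (real \<Rightarrow> real^'d \<Rightarrow> real) \<Rightarrow> bool" where
  "solves_nl T b \<phi> W \<rho> \<longleftrightarrow> inF T b \<rho> \<and> (\<forall>k. fcoef (\<rho> 0) k = fcoef \<phi> k)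
     \<and> evolves T \<rho> (\<lambda>s k. lapc (\<rho> s) k + driftc (\<rho> s) W (\<rho> s) k)"

definition rhoW :: "real \<Rightarrow> nat \<Rightarrow> (real^'d \<Rightarrow> real) \<Rightarrow> (real^'d \<Rightarrow> real) \<Rightarrow> (real \<Rightarrow> real^'d \<Rightarrow> real)" where
  "rhoW T b \<phi> W = (SOME \<rho>. solves_nl T b \<phi> W \<rho>)"

definition solves_lin :: "real \<Rightarrow> nat \<Rightarrow> (real^'d \<Rightarrow> real) \<Rightarrow> (real^'d \<Rightarrow> real)
     \<Rightarrow> (real \<Rightarrow> int^'d \<Rightarrow> complex) \<Rightarrow> (real \<Rightarrow> real^'d \<Rightarrow> real) \<Rightarrow> bool" where
  "solves_lin T b \<phi> W f v \<longleftrightarrow> inF T b v \<and> (\<forall>k. fcoef (v 0) k = 0)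
     \<and> evolves T v (\<lambda>s k. lapc (v s) k + driftc (v s) W (rhoW T b \<phi> W s) k
                          + driftc (rhoW T b \<phi> W s) W (v s) k + f s k)"

definition Wcomb :: "real \<Rightarrow> (real^'d \<Rightarrow> real) \<Rightarrow> (real^'d \<Rightarrow> real) \<Rightarrow> (real^'d \<Rightarrow> real)" where
  "Wcomb a H H' = (\<lambda>x. a * H x + H' x)"

text \<open>D n W is the n-th Frechet derivative at W, a bounded n-linear map (arguments as a list);
  D (n+1) W [H, H_1..H_n] is the derivative of W |-> D n W [H_1..H_n] in direction H,
  with the remainder small uniformly in the operator norm.\<close>
definition smooth_with_derivs :: "real \<Rightarrow> nat \<Rightarrow> ((real^'d \<Rightarrow> real) \<Rightarrow> (real \<Rightarrow> real^'d \<Rightarrow> real))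
     \<Rightarrow> (nat \<Rightarrow> (real^'d \<Rightarrow> real) \<Rightarrow> (real^'d \<Rightarrow> real) list \<Rightarrow> (real \<Rightarrow> real^'d \<Rightarrow> real)) \<Rightarrow> bool" where
  "smooth_with_derivs T b G D \<longleftrightarrow>
    (\<forall>W. Wdot W \<longrightarrow> inF T b (G W) \<and> feq T (D 0 W []) (G W)) \<and>
    (\<forall>n W. Wdot W \<longrightarrow>
       (\<forall>Hs. set Hs \<subseteq> Collect Wdot \<and> length Hs = n \<longrightarrow> inF T b (D n W Hs)) \<and>
       (\<forall>Hs1 Hs2 H H' a. set Hs1 \<subseteq> Collect Wdot \<and> set Hs2 \<subseteq> Collect Wdot \<and> Wdot H \<and> Wdot H'
           \<and> length Hs1 + length Hs2 + 1 = n \<longrightarrow>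
          feq T (D n W (Hs1 @ Wcomb a H H' # Hs2))
                (\<lambda>t x. a * D n W (Hs1 @ H # Hs2) t x + D n W (Hs1 @ H' # Hs2) t x)) \<and>
       (\<exists>C. \<forall>Hs. set Hs \<subseteq> Collect Wdot \<and> length Hs = n \<longrightarrow>
          Fnorm T b (D n W Hs) \<le> C * prod_list (map Wnorm Hs)) \<and>
       (\<forall>\<epsilon>>0. \<exists>\<delta>>0. \<forall>H. Wdot H \<and> Wnorm H < \<delta> \<longrightarrow>
          (\<forall>Hs. set Hs \<subseteq> Collect Wdot \<and> length Hs = n \<longrightarrow>
             Fnorm T b (\<lambda>t x. D n (\<lambda>y. W y + H y) Hs t x - D n W Hs t x - D (Suc n) W (H # Hs) t x)
               \<le> \<epsilon> * Wnorm H * prod_list (map Wnorm Hs))))"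

end

theory Submission
  imports Defs
begin

text \<open>On the Fourier side, weighting the coefficients by \<open>(1 + |k|\<^sup>2)\<^bsup>\<beta>/2\<^esup>\<close> turns the equation into
  \<open>x = x\<^sub>0 + Q(W, x, x)\<close>, where \<open>x\<close> is the pair of initial datum and source, both in \<open>\<ell>\<^sup>2\<close>, and \<open>Q\<close> is a
  bounded trilinear map that is Volterra in time. Hence the linearised equation \<open>v = f + Q(W, v, x) + Q(W, x, v)\<close> is
  uniquely solvable with uniform bounds, and differentiating the fixed point identity formally defines all
  derivatives; the Taylor remainders solve the same linearised equation with a quadratically small right-hand
  side. Global solvability needs an a priori bound locally uniform in \<open>W\<close>: the maximum principle keeps the
  solution a probability density, so \<open>\<nabla>W * \<rho>\<close> is bounded by \<open>\<parallel>\<nabla>W\<parallel>\<^sub>\<infinity>\<close>, which gives an \<open>L\<^sup>2\<close> energy estimate,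
  and the tame estimate for \<open>Q\<close> lifts it to \<open>H\<^sup>\<beta>\<close>. Every element of \<open>F\<^sub>\<beta>\<close> solving the weak equation has
  \<open>\<ell>\<^sup>2\<close>-bounded continuous coefficients, so uniqueness is a Gronwall argument in \<open>\<ell>\<^sup>2\<close>.\<close>

section \<open>Smooth dependence of quadratic fixed points on a parameter\<close>

text \<open>With the source rather than the solution as unknown, the fixed point problem lives in a
  Banach space of bounded continuous l2-valued functions, and the F_beta norm is read off from the
  data by energy estimates. The divergence contributes the factor |k|, whose square is at most the
  decay rate 4 pi^2 |k|^2: half of the dissipation absorbs the source mode by mode, with constants
  independent of k. The gradient of the potential enters \<open>Q\<close> only through the l2 family
  |m| W_m, so parameters are such families. The a priori bound, however, rests on the sup norm of
  the gradient, which this parameter space does not see. Solvability is therefore a predicate in the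
  abstract part, whose estimates are uniform where parameter and solution are bounded; concrete
  potentials are placed in such sets afterwards. Members of F_beta are representatives compared by
  Fourier coefficients, and their drift terms are rewritten on the Fourier side where these
  coefficients are absolutely summable. For a general member this is known for almost every time, so
  uniqueness works with identities almost everywhere in time.\<close>

primrec split_sum :: "'p list \<Rightarrow> ('p list \<Rightarrow> 'p list \<Rightarrow> 'x::real_normed_vector) \<Rightarrow> 'x" where
  "split_sum [] f = f [] []"
| "split_sum (h # hs) f = split_sum hs (\<lambda>a b. f (h # a) b) + split_sum hs (\<lambda>a b. f a (h # b))"

text \<open>The two halves of the Leibniz rule. \<open>split_sum\<close> distributes the directions
  over the two factors of a quadratic term, keeping their order; \<open>pick_sum\<close> lets one
  direction fall on the parameter, in which the term is linear, and hands on the others.\<close>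

primrec pick_sum :: "'p list \<Rightarrow> ('p \<Rightarrow> 'p list \<Rightarrow> 'x::real_normed_vector) \<Rightarrow> 'x" where
  "pick_sum [] f = 0"
| "pick_sum (h # hs) f = f h hs + pick_sum hs (\<lambda>k r. f k (h # r))"

text \<open>Three lists that agree except at one unnamed position, where they hold
  \<open>c *\<^sub>R h + h'\<close>, \<open>h\<close> and \<open>h'\<close>. As a relation it
  follows the list recursions without index bookkeeping.\<close>

inductive list_comb :: "real \<Rightarrow> 'p::real_vector list \<Rightarrow> 'p list \<Rightarrow> 'p list \<Rightarrow> bool" for c where
  here: "list_comb c ((c *\<^sub>R h + h') # hs) (h # hs) (h' # hs)"
| there: "list_comb c l0 l1 l2 \<Longrightarrow> list_comb c (h # l0) (h # l1) (h # l2)"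

lemma list_comb_length: "list_comb c l0 l1 l2 \<Longrightarrow> length l1 = length l0 \<and> length l2 = length l0"
  by (induction rule: list_comb.induct) auto

lemma list_comb_append: "list_comb c (xs @ (c *\<^sub>R h + h') # ys) (xs @ h # ys) (xs @ h' # ys)"
  by (induction xs) (auto intro: list_comb.intros)

lemma split_sum_cong:
  "(\<And>a b. length a + length b = length hs \<Longrightarrow> f a b = g a b) \<Longrightarrow> split_sum hs f = split_sum hs g"
proof (induction hs arbitrary: f g)
  case (Cons h hs)
  have "split_sum hs (\<lambda>a b. f (h # a) b) = split_sum hs (\<lambda>a b. g (h # a) b)"
    "split_sum hs (\<lambda>a b. f a (h # b)) = split_sum hs (\<lambda>a b. g a (h # b))"
    by (rule Cons.IH, rule Cons.prems, simp)+
  then show ?case by simp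
qed auto

lemma pick_sum_cong:
  "(\<And>h r. Suc (length r) = length hs \<Longrightarrow> f h r = g h r) \<Longrightarrow> pick_sum hs f = pick_sum hs g"
proof (induction hs arbitrary: f g)
  case (Cons h hs)
  have "pick_sum hs (\<lambda>k r. f k (h # r)) = pick_sum hs (\<lambda>k r. g k (h # r))"
    by (rule Cons.IH, rule Cons.prems, simp)
  with Cons.prems show ?case by simp
qed auto

lemma split_sum_add: "split_sum hs (\<lambda>a b. f a b + g a b) = split_sum hs f + split_sum hs g"
  by (induction hs arbitrary: f g) (auto simp: algebra_simps)

lemma split_sum_scaleR: "split_sum hs (\<lambda>a b. c *\<^sub>R f a b) = c *\<^sub>R split_sum hs f"
  by (induction hs arbitrary: f) (auto simp: algebra_simps)

lemma split_sum_diff: "split_sum hs (\<lambda>a b. f a b - g a b) = split_sum hs f - split_sum hs g"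
  using split_sum_add[of hs "\<lambda>a b. f a b - g a b" g] by simp

lemma pick_sum_add: "pick_sum hs (\<lambda>a b. f a b + g a b) = pick_sum hs f + pick_sum hs g"
  by (induction hs arbitrary: f g) (auto simp: algebra_simps)

lemma pick_sum_scaleR: "pick_sum hs (\<lambda>a b. c *\<^sub>R f a b) = c *\<^sub>R pick_sum hs f"
  by (induction hs arbitrary: f) (auto simp: algebra_simps)

lemma pick_sum_diff: "pick_sum hs (\<lambda>a b. f a b - g a b) = pick_sum hs f - pick_sum hs g"
  using pick_sum_add[of hs "\<lambda>a b. f a b - g a b" g] by simp

abbreviation norm_prod :: "'p::real_normed_vector list \<Rightarrow> real" where
  "norm_prod hs \<equiv> prod_list (map norm hs)"

lemma norm_prod_nonneg: "0 \<le> norm_prod hs"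
  by (induction hs) auto

text \<open>There are \<open>2 ^ length hs\<close> distributions, and \<open>norm_prod\<close> of
  the whole list is the product over the two parts.\<close>

lemma norm_split_sum_le:
  assumes "\<And>a b. length a + length b = length hs \<Longrightarrow> norm (f a b) \<le> C * norm_prod a * norm_prod b"
  shows "norm (split_sum hs f) \<le> 2 ^ length hs * C * norm_prod hs"
  using assms
proof (induction hs arbitrary: f C)
  case (Cons h hs)
  have "norm (split_sum hs (\<lambda>a b. f (h # a) b)) \<le> 2 ^ length hs * (C * norm h) * norm_prod hs"
    by (rule Cons.IH) (use Cons.prems[of "h # _"] in \<open>auto simp: algebra_simps\<close>)
  moreover have "norm (split_sum hs (\<lambda>a b. f a (h # b))) \<le> 2 ^ length hs * (C * norm h) * norm_prod hs"
    by (rule Cons.IH) (use Cons.prems[of _ "h # _"] in \<open>auto simp: algebra_simps\<close>)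
  ultimately show ?case
    using norm_triangle_ineq[of "split_sum hs (\<lambda>a b. f (h # a) b)" "split_sum hs (\<lambda>a b. f a (h # b))"]
    by (simp add: algebra_simps)
qed (use assms in simp)

lemma norm_pick_sum_le:
  assumes "\<And>h r. Suc (length r) = length hs \<Longrightarrow> norm (f h r) \<le> C * norm h * norm_prod r"
  shows "norm (pick_sum hs f) \<le> real (length hs) * C * norm_prod hs"
  using assms
proof (induction hs arbitrary: f C)
  case (Cons h hs)
  have "norm (pick_sum hs (\<lambda>k r. f k (h # r))) \<le> real (length hs) * (C * norm h) * norm_prod hs"
    by (rule Cons.IH) (use Cons.prems[of "h # _"] in \<open>auto simp: algebra_simps\<close>)
  moreover have "norm (f h hs) \<le> C * norm h * norm_prod hs"
    using Cons.prems by simp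
  ultimately show ?case
    using norm_triangle_ineq[of "f h hs" "pick_sum hs (\<lambda>k r. f k (h # r))"]
    by (simp add: algebra_simps)
qed simp

text \<open>Every distribution puts the distinguished position into exactly one of the two lists, so
  linearity in each list separately suffices.\<close>

lemma split_sum_list_comb:
  assumes "list_comb c l0 l1 l2"
    and "\<And>a0 a1 a2 b. list_comb c a0 a1 a2 \<Longrightarrow> length a0 + length b = length l0 \<Longrightarrow>
          f a0 b = c *\<^sub>R f a1 b + f a2 b"
    and "\<And>a b0 b1 b2. list_comb c b0 b1 b2 \<Longrightarrow> length a + length b0 = length l0 \<Longrightarrow>
          f a b0 = c *\<^sub>R f a b1 + f a b2"
  shows "split_sum l0 f = c *\<^sub>R split_sum l1 f + split_sum l2 f"
  using assms
proof (induction arbitrary: f rule: list_comb.induct)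
  case (here h h' hs)
  have "split_sum hs (\<lambda>a b. f ((c *\<^sub>R h + h') # a) b)
      = split_sum hs (\<lambda>a b. c *\<^sub>R f (h # a) b + f (h' # a) b)"
    by (rule split_sum_cong, rule here.prems(1), auto intro: list_comb.here)
  moreover have "split_sum hs (\<lambda>a b. f a ((c *\<^sub>R h + h') # b))
      = split_sum hs (\<lambda>a b. c *\<^sub>R f a (h # b) + f a (h' # b))"
    by (rule split_sum_cong, rule here.prems(2), auto intro: list_comb.here)
  ultimately show ?case by (simp add: split_sum_add split_sum_scaleR algebra_simps)
next
  case (there l0 l1 l2 h)
  have "split_sum l0 (\<lambda>a b. f (h # a) b) = c *\<^sub>R split_sum l1 (\<lambda>a b. f (h # a) b) + split_sum l2 (\<lambda>a b. f (h # a) b)"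
    by (rule there.IH) (auto intro!: there.prems list_comb.there)
  moreover have "split_sum l0 (\<lambda>a b. f a (h # b)) = c *\<^sub>R split_sum l1 (\<lambda>a b. f a (h # b)) + split_sum l2 (\<lambda>a b. f a (h # b))"
    by (rule there.IH) (auto intro!: there.prems list_comb.there)
  ultimately show ?case by (simp add: algebra_simps)
qed

lemma pick_sum_list_comb:
  assumes "list_comb c l0 l1 l2"
    and "\<And>h h' r. Suc (length r) = length l0 \<Longrightarrow> f (c *\<^sub>R h + h') r = c *\<^sub>R f h r + f h' r"
    and "\<And>h r0 r1 r2. list_comb c r0 r1 r2 \<Longrightarrow> Suc (length r0) = length l0 \<Longrightarrow>
          f h r0 = c *\<^sub>R f h r1 + f h r2"
  shows "pick_sum l0 f = c *\<^sub>R pick_sum l1 f + pick_sum l2 f"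
  using assms
proof (induction arbitrary: f rule: list_comb.induct)
  case (here h h' hs)
  have "pick_sum hs (\<lambda>k r. f k ((c *\<^sub>R h + h') # r))
      = pick_sum hs (\<lambda>k r. c *\<^sub>R f k (h # r) + f k (h' # r))"
    by (rule pick_sum_cong, rule here.prems(2), auto intro: list_comb.here)
  with here.prems(1) show ?case by (simp add: pick_sum_add pick_sum_scaleR algebra_simps)
next
  case (there l0 l1 l2 h)
  have "pick_sum l0 (\<lambda>k r. f k (h # r)) = c *\<^sub>R pick_sum l1 (\<lambda>k r. f k (h # r)) + pick_sum l2 (\<lambda>k r. f k (h # r))"
    by (rule there.IH) (auto intro!: there.prems list_comb.there)
  moreover have "f h l0 = c *\<^sub>R f h l1 + f h l2"
    by (rule there.prems(2)) (use there.hyps in auto)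
  ultimately show ?case by (simp add: algebra_simps)
qed

text \<open>The distributions in which neither factor receives all directions. The two excluded ones
  contain the derivative of full order, the unknown of the differentiated equation.\<close>

abbreviation proper_sum :: "'p list \<Rightarrow> ('p list \<Rightarrow> 'p list \<Rightarrow> 'x::real_normed_vector) \<Rightarrow> 'x" where
  "proper_sum hs f \<equiv> split_sum hs (\<lambda>a b. if length a < length hs \<and> length b < length hs then f a b else 0)"

text \<open>A nonempty list has two distinct extreme distributions; each is peeled off by its own
  induction.\<close>

lemma split_sum_extremes:
  assumes "hs \<noteq> []"
  shows "split_sum hs f = f hs [] + f [] hs
    + proper_sum hs (\<lambda>a b. f a b)"
proof -
  have right: "split_sum hs f = f [] hs + split_sum hs (\<lambda>a b. if length b < length hs then f a b else 0)" for hs :: "'a list" and f :: "'a list \<Rightarrow> 'a list \<Rightarrow> 'b"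
  proof (induction hs arbitrary: f)
    case (Cons h hs)
    have "split_sum hs (\<lambda>a b. f (h # a) b)
      = split_sum hs (\<lambda>a b. if length b < Suc (length hs) then f (h # a) b else 0)"
      by (rule split_sum_cong) auto
    with Cons.IH[of "\<lambda>a b. f a (h # b)"] show ?case by simp
  qed auto
  have left: "split_sum hs f = f hs [] + split_sum hs (\<lambda>a b. if length a < length hs then f a b else 0)" for hs :: "'a list" and f :: "'a list \<Rightarrow> 'a list \<Rightarrow> 'b"
  proof (induction hs arbitrary: f)
    case (Cons h hs)
    have "split_sum hs (\<lambda>a b. f a (h # b))
      = split_sum hs (\<lambda>a b. if length a < Suc (length hs) then f a (h # b) else 0)"
      by (rule split_sum_cong) auto
    with Cons.IH[of "\<lambda>a b. f (h # a) b"] show ?case by simp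
  qed auto
  have "split_sum hs (\<lambda>a b. if length b < length hs then if length a < length hs then f a b else 0 else 0)
     = proper_sum hs (\<lambda>a b. f a b)"
    by (rule split_sum_cong) auto
  then show ?thesis
    using assms left[of hs f] right[of hs "\<lambda>a b. if length a < length hs then f a b else 0"]
    by simp
qed

text \<open>The linear equation has independent base points \<open>y\<close> and \<open>z\<close>:
  the difference of two solutions, or of derivatives taken at two parameters, solves it with the
  newer point in one slot and the older in the other. The constant depends on \<open>M\<close>
  alone, which makes the later estimates uniform. Existence for the quadratic equation itself is not
  assumed.\<close>

locale quadratic_fixed_point =
  fixes Q :: "'p::real_normed_vector \<Rightarrow> 'x::real_normed_vector \<Rightarrow> 'x \<Rightarrow> 'x" and x0 :: 'x and K :: real
  assumes Q_lin1: "Q (c *\<^sub>R p + q) x y = c *\<^sub>R Q p x y + Q q x y"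
    and Q_lin2: "Q p (c *\<^sub>R x + x') y = c *\<^sub>R Q p x y + Q p x' y"
    and Q_lin3: "Q p x (c *\<^sub>R y + y') = c *\<^sub>R Q p x y + Q p x y'"
    and Q_bound: "norm (Q p x y) \<le> K * norm p * norm x * norm y" and K_nonneg: "0 \<le> K"
    and resolvent_ex: "\<exists>v. v = f + Q p v y + Q p z v"
    and resolvent_bound: "\<exists>C\<ge>0. \<forall>p y z f v. norm p \<le> M \<longrightarrow> norm y \<le> M \<longrightarrow> norm z \<le> M \<longrightarrow>
          v = f + Q p v y + Q p z v \<longrightarrow> norm v \<le> C * norm f"
begin

lemma Q_add1: "Q (p + q) x y = Q p x y + Q q x y" using Q_lin1[of 1 p q] by simp
lemma Q_add2: "Q p (x + x') y = Q p x y + Q p x' y" using Q_lin2[of p 1 x x'] by simp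
lemma Q_add3: "Q p x (y + y') = Q p x y + Q p x y'" using Q_lin3[of p x 1 y y'] by simp
lemma Q_zero2 [simp]: "Q p 0 y = 0" using Q_add2[of p 0 0 y] by simp
lemma Q_zero3 [simp]: "Q p y 0 = 0" using Q_add3[of p y 0 0] by simp
lemma Q_zero1 [simp]: "Q 0 x y = 0" using Q_add1[of 0 0 x y] by simp
lemma Q_diff1: "Q (p - q) x y = Q p x y - Q q x y" using Q_add1[of "p - q" q x y] by simp
lemma Q_diff2: "Q p (x - x') y = Q p x y - Q p x' y" using Q_add2[of p "x - x'" x' y] by simp
lemma Q_diff3: "Q p y (x - x') = Q p y x - Q p y x'" using Q_add3[of p y "x - x'" x'] by simp

text \<open>The telescoping order keeps the new value on the right and the old one on the left, the
  shape of the linear equation with \<open>y\<close> new and \<open>z\<close> old.\<close>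

lemma Q_diff_split: "Q q x' y' - Q p x y = Q (q - p) x' y' + Q p (x' - x) y' + Q p x (y' - y)"
  by (simp add: Q_diff1 Q_diff2 Q_diff3)

lemma Q_bound_le: "norm p \<le> P \<Longrightarrow> norm x \<le> A \<Longrightarrow> norm y \<le> B \<Longrightarrow> norm (Q p x y) \<le> K * P * A * B"
  using order_trans[OF norm_ge_zero[of p]] order_trans[OF norm_ge_zero[of x]]
    order_trans[OF norm_ge_zero[of y]] K_nonneg
  by (intro order_trans[OF Q_bound] mult_mono mult_nonneg_nonneg) auto

text \<open>The difference has source 0, and \<open>M\<close> may be taken as large as all three
  norms.\<close>

lemma resolvent_unique:
  assumes "v = f + Q p v y + Q p z v" "w = f + Q p w y + Q p z w" shows "v = w"
proof -
  obtain C where C: "\<forall>p' y' z' f v. norm p' \<le> norm p + norm y + norm z \<longrightarrow> norm y' \<le> norm p + norm y + norm z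
      \<longrightarrow> norm z' \<le> norm p + norm y + norm z \<longrightarrow>
          v = f + Q p' v y' + Q p' z' v \<longrightarrow> norm v \<le> C * norm f"
    using resolvent_bound[of "norm p + norm y + norm z"] by blast
  have "v - w = 0 + Q p (v - w) y + Q p z (v - w)"
    using arg_cong2[where f = "(-)", OF assms] unfolding Q_diff2 Q_diff3 by (simp add: algebra_simps)
  then have "norm (v - w) \<le> C * norm (0::'x)"
    using C[rule_format, of p y z "v - w" 0] by simp
  then show ?thesis by simp
qed

section \<open>Solutions and their formal derivatives\<close>

definition solution :: "'p \<Rightarrow> 'x \<Rightarrow> bool" where
  "solution p x \<longleftrightarrow> x = x0 + Q p x x"

definition sol :: "'p \<Rightarrow> 'x" where "sol p = (SOME x. solution p x)"

definition solvable :: "'p \<Rightarrow> bool" where "solvable p \<longleftrightarrow> (\<exists>x. solution p x)"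

lemma sol_eq: "solvable p \<Longrightarrow> sol p = x0 + Q p (sol p) (sol p)"
  unfolding solvable_def sol_def by (metis someI_ex solution_def)

lemma solution_unique:
  assumes "solution p x" "solution p y" shows "x = y"
proof -
  have "x - y = 0 + Q p (x - y) x + Q p y (x - y)"
    using arg_cong2[where f = "(-)", OF assms[unfolded solution_def]] Q_diff_split[of p x x p y y] by simp
  moreover have "0 = 0 + Q p 0 x + Q p y 0" by simp
  ultimately have "x - y = 0" by (rule resolvent_unique)
  then show ?thesis by simp
qed

lemma solution_sol: "solution p x \<Longrightarrow> sol p = x"
  unfolding sol_def using solution_unique by blast

definition resolve :: "'p \<Rightarrow> 'x \<Rightarrow> 'x" where
  "resolve p f = (SOME v. v = f + Q p v (sol p) + Q p (sol p) v)"

lemma resolve_eq: "resolve p f = f + Q p (resolve p f) (sol p) + Q p (sol p) (resolve p f)"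
  unfolding resolve_def by (rule someI_ex) (rule resolvent_ex)

text \<open>The differentiated equation solved for its highest derivative: all terms of lower order
  form the source of the linear equation behind \<open>resolve\<close>. The length guards show the
  termination proof that only shorter lists are called.\<close>

function dsol :: "'p \<Rightarrow> 'p list \<Rightarrow> 'x" where
  "dsol p hs = (if hs = [] then sol p else resolve p
     (pick_sum hs (\<lambda>h r. split_sum r (\<lambda>a b.
         if length a < length hs \<and> length b < length hs then Q h (dsol p a) (dsol p b) else 0))
      + split_sum hs (\<lambda>a b.
         if length a < length hs \<and> length b < length hs then Q p (dsol p a) (dsol p b) else 0)))"
  by pat_completeness auto
termination by (relation "Wellfounded.measure (\<lambda>(p, hs). length hs)") auto

declare dsol.simps [simp del]

lemma dsol_Nil [simp]: "dsol p [] = sol p" by (simp add: dsol.simps)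

text \<open>The formally differentiated equation \<open>x = x0 + Q p x x\<close>.\<close>
lemma dsol_eq:
  assumes "solvable p"
  shows "dsol p hs = (if hs = [] then x0 else 0)
    + pick_sum hs (\<lambda>h r. split_sum r (\<lambda>a b. Q h (dsol p a) (dsol p b)))
    + split_sum hs (\<lambda>a b. Q p (dsol p a) (dsol p b))"
proof (cases "hs = []")
  case True
  then show ?thesis using sol_eq[OF assms] by simp
next
  case False
  let ?f = "pick_sum hs (\<lambda>h r. split_sum r (\<lambda>a b. Q h (dsol p a) (dsol p b)))"
  let ?g = "split_sum hs (\<lambda>a b.
         if length a < length hs \<and> length b < length hs then Q p (dsol p a) (dsol p b) else 0)"
  have "pick_sum hs (\<lambda>h r. split_sum r (\<lambda>a b.
         if length a < length hs \<and> length b < length hs then Q h (dsol p a) (dsol p b) else 0)) = ?f"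
    by (intro pick_sum_cong split_sum_cong) auto
  then have "dsol p hs = resolve p (?f + ?g)"
    using False by (subst dsol.simps) simp
  then have "dsol p hs = ?f + ?g + Q p (dsol p hs) (sol p) + Q p (sol p) (dsol p hs)"
    using resolve_eq[of p "?f + ?g"] by (simp only:)
  then show ?thesis
    using False split_sum_extremes[OF False, of "\<lambda>a b. Q p (dsol p a) (dsol p b)"] by (simp add: algebra_simps)
qed

text \<open>Both sides solve the same linear equation: by induction on the length its source depends
  linearly on the distinguished position, and \<open>resolvent_unique\<close> finishes.\<close>

lemma dsol_list_comb:
  assumes p: "solvable p" and l: "list_comb c l0 l1 l2"
  shows "dsol p l0 = c *\<^sub>R dsol p l1 + dsol p l2"
  using l
proof (induction "length l0" arbitrary: l0 l1 l2 rule: less_induct)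
  case less
  have ne: "l0 \<noteq> []" "l1 \<noteq> []" "l2 \<noteq> []"
    using less.prems by (auto elim: list_comb.cases)
  have len: "length l1 = length l0" "length l2 = length l0"
    using list_comb_length[OF less.prems] by auto
  let ?F = "\<lambda>hs. pick_sum hs (\<lambda>h r. split_sum r (\<lambda>a b. Q h (dsol p a) (dsol p b)))"
  \<comment> \<open>All three lists have length \<open>length l0\<close>, so one guard serves
    them.\<close>
  let ?q = "\<lambda>a b. if length a < length l0 \<and> length b < length l0 then Q p (dsol p a) (dsol p b) else 0"
  have F: "?F l0 = c *\<^sub>R ?F l1 + ?F l2"
  proof (rule pick_sum_list_comb[OF less.prems])
    show "split_sum r (\<lambda>a b. Q (c *\<^sub>R h + h') (dsol p a) (dsol p b))
       = c *\<^sub>R split_sum r (\<lambda>a b. Q h (dsol p a) (dsol p b)) + split_sum r (\<lambda>a b. Q h' (dsol p a) (dsol p b))" for h h' r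
      by (simp add: Q_lin1 split_sum_add split_sum_scaleR)
    show "split_sum r0 (\<lambda>a b. Q h (dsol p a) (dsol p b))
       = c *\<^sub>R split_sum r1 (\<lambda>a b. Q h (dsol p a) (dsol p b)) + split_sum r2 (\<lambda>a b. Q h (dsol p a) (dsol p b))"
      if "list_comb c r0 r1 r2" "Suc (length r0) = length l0" for h r0 r1 r2
      using that(2) by (intro split_sum_list_comb[OF that(1)])
        (simp_all add: less.hyps Q_lin2 Q_lin3)
  qed
  have G: "split_sum l0 ?q = c *\<^sub>R split_sum l1 ?q + split_sum l2 ?q"
  proof (rule split_sum_list_comb[OF less.prems])
    show "?q a0 b = c *\<^sub>R ?q a1 b + ?q a2 b" if "list_comb c a0 a1 a2" for a0 a1 a2 b
    proof (cases "length a0 < length l0 \<and> length b < length l0")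
      case True
      then show ?thesis using less.hyps[OF _ that] list_comb_length[OF that] by (simp add: Q_lin2)
    next
      case False
      then show ?thesis using list_comb_length[OF that] by auto
    qed
    show "?q b a0 = c *\<^sub>R ?q b a1 + ?q b a2" if "list_comb c a0 a1 a2" for a0 a1 a2 b
    proof (cases "length a0 < length l0 \<and> length b < length l0")
      case True
      then show ?thesis using less.hyps[OF _ that] list_comb_length[OF that] by (simp add: Q_lin3)
    next
      case False
      then show ?thesis using list_comb_length[OF that] by auto
    qed
  qed
  have eq: "dsol p l = ?F l + split_sum l ?q + Q p (dsol p l) (sol p) + Q p (sol p) (dsol p l)"
    if "length l = length l0" for l
    using that ne dsol_eq[OF p, of l] split_sum_extremes[of l "\<lambda>a b. Q p (dsol p a) (dsol p b)"]
    by (auto simp: algebra_simps)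
  show ?case
  proof (rule resolvent_unique)
    show "dsol p l0 = ?F l0 + split_sum l0 ?q + Q p (dsol p l0) (sol p) + Q p (sol p) (dsol p l0)"
      by (rule eq) simp
    show "c *\<^sub>R dsol p l1 + dsol p l2 = ?F l0 + split_sum l0 ?q + Q p (c *\<^sub>R dsol p l1 + dsol p l2) (sol p)
        + Q p (sol p) (c *\<^sub>R dsol p l1 + dsol p l2)"
      using arg_cong[OF eq[OF len(1)], of "\<lambda>v. c *\<^sub>R v"] eq[OF len(2)]
      unfolding F G Q_lin2 Q_lin3 by (simp add: algebra_simps)
  qed
qed

section \<open>Uniform bounds, Lipschitz estimates and Taylor remainders\<close>

definition controlled :: "real \<Rightarrow> 'p \<Rightarrow> bool" where
  "controlled M p \<longleftrightarrow> solvable p \<and> norm p \<le> M \<and> norm (sol p) \<le> M"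

definition linear_const :: "real \<Rightarrow> real" where
  "linear_const M = (SOME C. C \<ge> 0 \<and> (\<forall>p y z f v. norm p \<le> M \<longrightarrow> norm y \<le> M \<longrightarrow> norm z \<le> M \<longrightarrow>
     v = f + Q p v y + Q p z v \<longrightarrow> norm v \<le> C * norm f))"

lemma linear_const:
  shows "0 \<le> linear_const M"
    and "controlled M p \<Longrightarrow> controlled M q \<Longrightarrow> v = f + Q p v (sol q) + Q p (sol p) v \<Longrightarrow> norm f \<le> B \<Longrightarrow>
      norm v \<le> linear_const M * B"
proof -
  have C: "linear_const M \<ge> 0 \<and> (\<forall>p y z f v. norm p \<le> M \<longrightarrow> norm y \<le> M \<longrightarrow> norm z \<le> M \<longrightarrow>
     v = f + Q p v y + Q p z v \<longrightarrow> norm v \<le> linear_const M * norm f)"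
    unfolding linear_const_def by (rule someI_ex) (rule resolvent_bound)
  then show "0 \<le> linear_const M" ..
  assume *: "controlled M p" "controlled M q" "v = f + Q p v (sol q) + Q p (sol p) v" "norm f \<le> B"
  from *(1,2) have "norm v \<le> linear_const M * norm f"
    by (intro C[THEN conjunct2, rule_format, OF _ _ _ *(3)]) (auto simp: controlled_def)
  also have "\<dots> \<le> linear_const M * B" using *(4) C by (intro mult_left_mono) auto
  finally show "norm v \<le> linear_const M * B" .
qed

lemma dsol_guarded_eq:
  assumes "solvable p" "hs \<noteq> []"
  shows "dsol p hs = pick_sum hs (\<lambda>h r. split_sum r (\<lambda>a b. Q h (dsol p a) (dsol p b)))
    + proper_sum hs (\<lambda>a b. Q p (dsol p a) (dsol p b))
    + Q p (dsol p hs) (sol p) + Q p (sol p) (dsol p hs)"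
  using assms dsol_eq[of p hs] split_sum_extremes[OF assms(2), of "\<lambda>a b. Q p (dsol p a) (dsol p b)"]
  by (simp add: algebra_simps)

text \<open>There are \<open>length hs\<close> choices of the direction on the parameter, each with
  at most \<open>2 ^ length hs\<close> distributions of the others, and \<open>2 ^ length hs\<close>
  distributions in the second sum.\<close>

lemma norm_source_le:
  assumes C: "0 \<le> C" "0 \<le> B"
    and F: "\<And>k a b. length a < length hs \<Longrightarrow> length b < length hs \<Longrightarrow>
      norm (F k a b) \<le> B * norm k * (C * norm_prod a * norm_prod b)"
    and G: "\<And>a b. length a < length hs \<Longrightarrow> length b < length hs \<Longrightarrow>
      norm (G a b) \<le> C * norm_prod a * norm_prod b"
  shows "norm (pick_sum hs (\<lambda>h r. split_sum r (F h))
      + proper_sum hs (\<lambda>a b. G a b))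
    \<le> (real (length hs) * 2 ^ length hs * B + 2 ^ length hs) * C * norm_prod hs"
proof -
  have "norm (pick_sum hs (\<lambda>h r. split_sum r (F h))) \<le> real (length hs) * (2 ^ length hs * B * C) * norm_prod hs"
  proof (rule norm_pick_sum_le)
    fix h and r :: "'a list"
    assume r: "Suc (length r) = length hs"
    have "norm (split_sum r (F h)) \<le> 2 ^ length r * (B * norm h * C) * norm_prod r"
      using F[of _ _ h] r by (intro norm_split_sum_le) (simp add: mult.assoc)
    also have "\<dots> \<le> 2 ^ length hs * (B * norm h * C) * norm_prod r"
      using r C by (intro mult_right_mono norm_prod_nonneg power_increasing mult_nonneg_nonneg) auto
    finally show "norm (split_sum r (F h)) \<le> 2 ^ length hs * B * C * norm h * norm_prod r"
      by (simp add: algebra_simps)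
  qed
  moreover have "norm (proper_sum hs (\<lambda>a b. G a b))
      \<le> 2 ^ length hs * C * norm_prod hs"
    using G C by (intro norm_split_sum_le) (auto intro!: mult_nonneg_nonneg norm_prod_nonneg)
  ultimately show ?thesis by (intro order_trans[OF norm_triangle_ineq]) (simp add: algebra_simps)
qed

lemma bound_Suc:
  fixes x u g :: real
  assumes "l \<le> n \<Longrightarrow> x \<le> A * u * g" "l = Suc n \<Longrightarrow> x \<le> C * u * g" "l \<le> Suc n" "0 \<le> u" "0 \<le> g"
  shows "x \<le> max A C * u * g"
proof -
  have "A * u * g \<le> max A C * u * g" "C * u * g \<le> max A C * u * g" using assms(4,5) by (intro mult_right_mono; simp)+
  then show ?thesis using assms(1,2,3) by (cases "l = Suc n") auto
qed

text \<open>Induction on the order: \<open>dsol_guarded_eq\<close> is linear in the top derivative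
  with a source made of lower orders, so \<open>linear_const\<close> bounds it.\<close>

lemma dsol_bound:
  "\<exists>C\<ge>0. \<forall>p hs. controlled M p \<longrightarrow> length hs \<le> n \<longrightarrow> norm (dsol p hs) \<le> C * norm_prod hs"
proof (induction n)
  case 0
  show ?case by (rule exI[of _ "max 0 M"]) (auto simp: controlled_def)
next
  case (Suc n)
  then obtain C where C: "0 \<le> C" "\<And>p hs. controlled M p \<Longrightarrow> length hs \<le> n \<Longrightarrow> norm (dsol p hs) \<le> C * norm_prod hs"
    by blast
  define R where "R = linear_const M"
  note R = linear_const[of M, folded R_def]
  \<comment> \<open>The factor \<open>1 + \<bar>M\<bar>\<close> covers both kinds of source terms:
    coefficient 1 when a direction sits on the parameter, and \<open>norm p\<close>, at most
    \<open>\<bar>M\<bar>\<close>, otherwise.\<close>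
  define C' where "C' = R * ((real (Suc n) * 2 ^ Suc n * 1 + 2 ^ Suc n) * (K * C * C * (1 + \<bar>M\<bar>)))"
  have C'0: "0 \<le> C'" unfolding C'_def using C R K_nonneg by auto
  have "norm (dsol p hs) \<le> C' * norm_prod hs" if p: "controlled M p" and hs: "length hs = Suc n" for p hs
  proof -
    have ne: "hs \<noteq> []" using hs by auto
    have sp: "solvable p" "norm p \<le> \<bar>M\<bar>" using p by (auto simp: controlled_def)
    let ?f = "pick_sum hs (\<lambda>h r. split_sum r (\<lambda>a b. Q h (dsol p a) (dsol p b)))
      + proper_sum hs (\<lambda>a b. Q p (dsol p a) (dsol p b))"
    have B: "norm (Q k (dsol p a) (dsol p b)) \<le> K * norm k * (C * norm_prod a) * (C * norm_prod b)"
      if "length a < length hs" "length b < length hs" for k a b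
      using that hs by (intro Q_bound_le C(2) p) auto
    have "norm ?f \<le> (real (length hs) * 2 ^ length hs * 1 + 2 ^ length hs) * (K * C * C * (1 + \<bar>M\<bar>)) * norm_prod hs"
    proof (rule norm_source_le)
      fix k :: 'p and a b :: "'p list" assume ab: "length a < length hs" "length b < length hs"
      have *: "0 \<le> K * C * C * norm_prod a * norm_prod b"
        using C K_nonneg norm_prod_nonneg[of a] norm_prod_nonneg[of b] by simp
      show "norm (Q k (dsol p a) (dsol p b)) \<le> 1 * norm k * (K * C * C * (1 + \<bar>M\<bar>) * norm_prod a * norm_prod b)"
        using B[OF ab, of k] mult_left_mono[OF *, of "\<bar>M\<bar> * norm k"] by (simp add: algebra_simps)
      show "norm (Q p (dsol p a) (dsol p b)) \<le> K * C * C * (1 + \<bar>M\<bar>) * norm_prod a * norm_prod b"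
        using B[OF ab, of p] * mult_right_mono[OF sp(2) *] by (simp add: algebra_simps)
    qed (use C K_nonneg in auto)
    then have "norm (dsol p hs) \<le> R * ((real (length hs) * 2 ^ length hs * 1 + 2 ^ length hs) * (K * C * C * (1 + \<bar>M\<bar>)) * norm_prod hs)"
      by (intro R(2)[OF p p dsol_guarded_eq[OF sp(1) ne]])
    then show ?thesis unfolding C'_def hs by (simp add: algebra_simps)
  qed
  then have "norm (dsol p hs) \<le> max C C' * norm_prod hs" if "controlled M p" "length hs \<le> Suc n" for p hs
  proof -
    have "norm (dsol p hs) \<le> C * norm_prod hs \<or> norm (dsol p hs) \<le> C' * norm_prod hs"
      using that C(2)[of p hs] \<open>\<And>p hs. controlled M p \<Longrightarrow> length hs = Suc n \<Longrightarrow> norm (dsol p hs) \<le> C' * norm_prod hs\<close>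
      by (metis le_Suc_eq)
    moreover have "C * norm_prod hs \<le> max C C' * norm_prod hs" "C' * norm_prod hs \<le> max C C' * norm_prod hs"
      by (intro mult_right_mono norm_prod_nonneg; simp)+
    ultimately show ?thesis by linarith
  qed
  then show ?case using C by (intro exI[of _ "max C C'"]) auto
qed

text \<open>Subtracting the equations at \<open>q\<close> and \<open>p\<close> gives a linear
  equation for the difference with base points \<open>sol q\<close> and \<open>sol p\<close>. Its
  source is of first order in \<open>q - p\<close>: lower derivatives by induction, the change of
  base point by the case of order 0, the change of parameter by linearity.\<close>

lemma dsol_lipschitz:
  "\<exists>C\<ge>0. \<forall>p q hs. controlled M p \<longrightarrow> controlled M q \<longrightarrow> length hs \<le> n \<longrightarrow>
    norm (dsol q hs - dsol p hs) \<le> C * norm (q - p) * norm_prod hs"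
proof (induction n)
  case 0
  define R where "R = linear_const M"
  note R = linear_const[of M, folded R_def]
  have "norm (sol q - sol p) \<le> R * (K * norm (q - p) * M * M)" if pq: "controlled M p" "controlled M q" for p q
  proof (rule R(2)[OF pq])
    show "sol q - sol p = Q (q - p) (sol q) (sol q) + Q p (sol q - sol p) (sol q) + Q p (sol p) (sol q - sol p)"
      using arg_cong2[where f = "(-)", OF sol_eq[of q] sol_eq[of p]] pq
        Q_diff_split[of q "sol q" "sol q" p "sol p" "sol p"] by (simp add: controlled_def)
    show "norm (Q (q - p) (sol q) (sol q)) \<le> K * norm (q - p) * M * M"
      using pq by (intro Q_bound_le) (auto simp: controlled_def)
  qed
  moreover have "0 \<le> R * (K * (M * M))" using R(1) K_nonneg by simp
  ultimately show ?case
    by (intro exI[of _ "R * (K * (M * M))"]) (auto simp: mult_ac)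
next
  case (Suc n)
  then obtain L where L: "0 \<le> L" "\<And>p q hs. controlled M p \<Longrightarrow> controlled M q \<Longrightarrow> length hs \<le> n \<Longrightarrow>
    norm (dsol q hs - dsol p hs) \<le> L * norm (q - p) * norm_prod hs"
    by blast
  obtain C where C: "0 \<le> C" "\<And>p hs. controlled M p \<Longrightarrow> length hs \<le> Suc n \<Longrightarrow> norm (dsol p hs) \<le> C * norm_prod hs"
    using dsol_bound[of M "Suc n"] by blast
  define R where "R = linear_const M"
  note R = linear_const[of M, folded R_def]
  define A where "A = K * C * C + 2 * K * C * L * (1 + \<bar>M\<bar>)"
  have A0: "0 \<le> A" unfolding A_def using C L K_nonneg by auto
  define C' where "C' = R * ((real (Suc n) * 2 ^ Suc n * 1 + 2 ^ Suc n) * A + 2 * K * C * M + 2 * K * \<bar>M\<bar> * C * L)"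
  have step: "norm (dsol q hs - dsol p hs) \<le> C' * norm (q - p) * norm_prod hs"
    if pq: "controlled M p" "controlled M q" and hs: "length hs = Suc n" for p q hs
  proof -
    have ne: "hs \<noteq> []" using hs by auto
    have sp: "solvable p" "norm p \<le> \<bar>M\<bar>" "norm (sol p) \<le> M"
      and sq: "solvable q" "norm (sol q) \<le> M" using pq by (auto simp: controlled_def)
    define d where "d = norm (q - p)"
    have d0: "0 \<le> d" by (simp add: d_def)
    let ?F = "\<lambda>k a b. Q k (dsol q a) (dsol q b) - Q k (dsol p a) (dsol p b)"
    let ?G = "\<lambda>a b. Q q (dsol q a) (dsol q b) - Q p (dsol p a) (dsol p b)"
    let ?S = "pick_sum hs (\<lambda>h r. split_sum r (?F h))
      + proper_sum hs (\<lambda>a b. ?G a b)"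
    let ?D = "dsol q hs - dsol p hs"
    \<comment> \<open>The four extra terms are what remains of the two full-order products after
      \<open>Q_diff_split\<close> has extracted the difference \<open>?D\<close> itself.\<close>
    let ?f = "?S + (Q (q - p) (dsol q hs) (sol q) + Q p (dsol p hs) (sol q - sol p)
        + Q (q - p) (sol q) (dsol q hs) + Q p (sol q - sol p) (dsol q hs))"
    have D1: "norm (Q k (dsol q a - dsol p a) (dsol q b)) + norm (Q k (dsol p a) (dsol q b - dsol p b))
         \<le> 2 * K * norm k * C * L * d * norm_prod a * norm_prod b"
      if "length a < length hs" "length b < length hs" for k a b
    proof -
      have l: "length a \<le> n" "length b \<le> n" "length a \<le> Suc n" "length b \<le> Suc n" using that hs by auto
      have "norm (Q k (dsol q a - dsol p a) (dsol q b)) \<le> K * norm k * (L * d * norm_prod a) * (C * norm_prod b)"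
        unfolding d_def by (intro Q_bound_le L(2) C(2) pq l order_refl)
      moreover have "norm (Q k (dsol p a) (dsol q b - dsol p b)) \<le> K * norm k * (C * norm_prod a) * (L * d * norm_prod b)"
        unfolding d_def by (intro Q_bound_le L(2) C(2) pq l order_refl)
      ultimately show ?thesis by (simp add: mult_ac)
    qed
    have nn: "0 \<le> norm_prod a * norm_prod b" for a b :: "'p list"
      using norm_prod_nonneg[of a] norm_prod_nonneg[of b] by simp
    have F: "norm (?F k a b) \<le> 2 * K * norm k * C * L * d * norm_prod a * norm_prod b"
      if "length a < length hs" "length b < length hs" for k a b
      using D1[OF that, of k] Q_diff_split[of k "dsol q a" "dsol q b" k "dsol p a" "dsol p b"]
        norm_triangle_ineq[of "Q k (dsol q a - dsol p a) (dsol q b)" "Q k (dsol p a) (dsol q b - dsol p b)"]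
      by simp
    have "norm ?S \<le> (real (length hs) * 2 ^ length hs * 1 + 2 ^ length hs) * (A * d) * norm_prod hs"
    proof (rule norm_source_le)
      fix k :: 'p and a b :: "'p list" assume ab: "length a < length hs" "length b < length hs"
      let ?N = "norm_prod a * norm_prod b"
      have "2 * K * C * L * norm k * d * ?N \<le> (A * norm k) * d * ?N"
        unfolding A_def using C L K_nonneg d0 nn[of a b]
        by (intro mult_right_mono) (auto simp: algebra_simps intro!: add_nonneg_nonneg mult_nonneg_nonneg)
      then show "norm (?F k a b) \<le> 1 * norm k * (A * d * norm_prod a * norm_prod b)"
        using F[OF ab, of k] by (simp add: algebra_simps)
      have "norm (Q (q - p) (dsol q a) (dsol q b)) \<le> K * d * (C * norm_prod a) * (C * norm_prod b)"
        unfolding d_def using ab hs by (intro Q_bound_le C(2) pq) auto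
      moreover have "2 * K * norm p * C * L * d * ?N \<le> 2 * K * (1 + \<bar>M\<bar>) * C * L * d * ?N"
        using C L K_nonneg d0 nn[of a b] sp(2) by (intro mult_right_mono mult_left_mono) auto
      ultimately show "norm (?G a b) \<le> A * d * norm_prod a * norm_prod b"
        unfolding Q_diff_split A_def using D1[OF ab, of p]
        by (intro order_trans[OF norm_triangle_ineq] order_trans[OF add_right_mono[OF norm_triangle_ineq]])
          (simp add: algebra_simps)
    qed (use A0 d0 in auto)
    moreover have "norm (Q (q - p) (dsol q hs) (sol q)) \<le> K * d * (C * norm_prod hs) * M"
      "norm (Q (q - p) (sol q) (dsol q hs)) \<le> K * d * M * (C * norm_prod hs)"
      unfolding d_def using hs by (intro Q_bound_le C(2) pq sq order_refl; simp)+
    moreover have "norm (sol q - sol p) \<le> L * d"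
      using L(2)[OF pq, of "[]"] by (simp add: d_def)
    then have "norm (Q p (dsol p hs) (sol q - sol p)) \<le> K * \<bar>M\<bar> * (C * norm_prod hs) * (L * d)"
      "norm (Q p (sol q - sol p) (dsol q hs)) \<le> K * \<bar>M\<bar> * (L * d) * (C * norm_prod hs)"
      using hs by (intro Q_bound_le C(2) pq sp order_refl; simp)+
    ultimately have f: "norm ?f \<le> (real (length hs) * 2 ^ length hs * 1 + 2 ^ length hs) * (A * d) * norm_prod hs
       + (K * d * (C * norm_prod hs) * M + K * \<bar>M\<bar> * (C * norm_prod hs) * (L * d)
       + K * d * M * (C * norm_prod hs) + K * \<bar>M\<bar> * (L * d) * (C * norm_prod hs))"
      by - (rule norm_triangle_le, rule add_mono, assumption, (rule norm_triangle_le, rule add_mono)+; assumption)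
    have "?S = (pick_sum hs (\<lambda>h r. split_sum r (\<lambda>a b. Q h (dsol q a) (dsol q b)))
       + proper_sum hs (\<lambda>a b. Q q (dsol q a) (dsol q b)))
      - (pick_sum hs (\<lambda>h r. split_sum r (\<lambda>a b. Q h (dsol p a) (dsol p b)))
       + proper_sum hs (\<lambda>a b. Q p (dsol p a) (dsol p b)))"
    proof -
      have "proper_sum hs (\<lambda>a b. ?G a b)
        = split_sum hs (\<lambda>a b. (if length a < length hs \<and> length b < length hs then Q q (dsol q a) (dsol q b) else 0)
            - (if length a < length hs \<and> length b < length hs then Q p (dsol p a) (dsol p b) else 0))"
        by (rule split_sum_cong) auto
      then show ?thesis by (simp add: split_sum_diff pick_sum_diff)
    qed
    moreover have "?D = (pick_sum hs (\<lambda>h r. split_sum r (\<lambda>a b. Q h (dsol q a) (dsol q b)))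
       + proper_sum hs (\<lambda>a b. Q q (dsol q a) (dsol q b)))
      - (pick_sum hs (\<lambda>h r. split_sum r (\<lambda>a b. Q h (dsol p a) (dsol p b)))
       + proper_sum hs (\<lambda>a b. Q p (dsol p a) (dsol p b)))
      + (Q q (dsol q hs) (sol q) - Q p (dsol p hs) (sol p)) + (Q q (sol q) (dsol q hs) - Q p (sol p) (dsol p hs))"
      using arg_cong2[where f = "(-)", OF dsol_guarded_eq[OF sq(1) ne] dsol_guarded_eq[OF sp(1) ne]] by simp
    ultimately have "?D = ?f + Q p ?D (sol q) + Q p (sol p) ?D"
      unfolding Q_diff_split[of q "dsol q hs" "sol q" p "dsol p hs" "sol p"]
        Q_diff_split[of q "sol q" "dsol q hs" p "sol p" "dsol p hs"]
      by (simp only: ac_simps)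
    from R(2)[OF pq this f] show ?thesis unfolding C'_def hs d_def by (simp add: algebra_simps)
  qed
  show ?case
  proof (intro exI[of _ "max L C'"] conjI allI impI)
    fix p q and hs :: "'p list" assume pq: "controlled M p" "controlled M q" and l: "length hs \<le> Suc n"
    show "norm (dsol q hs - dsol p hs) \<le> max L C' * norm (q - p) * norm_prod hs"
      by (rule bound_Suc[OF L(2)[OF pq] step[OF pq] l norm_ge_zero norm_prod_nonneg])
  qed (use L(1) in simp)
qed

text \<open>The Taylor remainder of a product expands into lower remainders times bounded factors
  and products of two first-order quantities. The remainder of order \<open>n\<close> thus solves
  the linear equation with a source that is quadratic in \<open>q - p\<close>.\<close>

lemma dsol_remainder:
  "\<exists>C\<ge>0. \<forall>p q hs. controlled M p \<longrightarrow> controlled M q \<longrightarrow> length hs \<le> n \<longrightarrow>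
    norm (dsol q hs - dsol p hs - dsol p ((q - p) # hs)) \<le> C * (norm (q - p))\<^sup>2 * norm_prod hs"
proof (induction n)
  case 0
  obtain L where L: "0 \<le> L" "\<And>p q hs. controlled M p \<Longrightarrow> controlled M q \<Longrightarrow> length hs \<le> 0 \<Longrightarrow>
    norm (dsol q hs - dsol p hs) \<le> L * norm (q - p) * norm_prod hs"
    using dsol_lipschitz[of M 0] by blast
  obtain C where C: "0 \<le> C" "\<And>p hs. controlled M p \<Longrightarrow> length hs \<le> 1 \<Longrightarrow> norm (dsol p hs) \<le> C * norm_prod hs"
    using dsol_bound[of M 1] by blast
  define R where "R = linear_const M"
  note R = linear_const[of M, folded R_def]
  have "norm (sol q - sol p - dsol p [q - p])
      \<le> R * (K * norm (q - p) * (L * norm (q - p)) * M + K * norm (q - p) * M * (L * norm (q - p))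
         + K * M * (C * norm (q - p)) * (L * norm (q - p)))"
    if pq: "controlled M p" "controlled M q" for p q
  proof (rule R(2)[OF pq])
    let ?h = "q - p" let ?e = "dsol p [q - p]" let ?D = "sol q - sol p"
    have sp: "solvable p" "norm p \<le> M" "norm (sol p) \<le> M" and sq: "solvable q" "norm (sol q) \<le> M"
      using pq by (auto simp: controlled_def)
    have "?e = Q ?h (sol p) (sol p) + Q p ?e (sol p) + Q p (sol p) ?e"
      using dsol_eq[OF sp(1), of "[?h]"] by (simp add: add.assoc)
    moreover have "?D = Q ?h (sol q) (sol q) + Q p ?D (sol q) + Q p (sol p) ?D"
      using arg_cong2[where f = "(-)", OF sol_eq[OF sq(1)] sol_eq[OF sp(1)]]
        Q_diff_split[of q "sol q" "sol q" p "sol p" "sol p"] by simp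
    ultimately have "?D - ?e = (Q ?h (sol q) (sol q) + Q p ?D (sol q) + Q p (sol p) ?D)
        - (Q ?h (sol p) (sol p) + Q p ?e (sol p) + Q p (sol p) ?e)"
      by (rule arg_cong2[where f = "(-)", rotated])
    also have "\<dots> = (Q ?h ?D (sol q) + Q ?h (sol p) ?D + Q p ?e ?D) + Q p (?D - ?e) (sol q) + Q p (sol p) (?D - ?e)"
      by (simp add: Q_diff2 Q_diff3)
    finally show "?D - ?e = (Q ?h ?D (sol q) + Q ?h (sol p) ?D + Q p ?e ?D) + Q p (?D - ?e) (sol q) + Q p (sol p) (?D - ?e)" .
    have D: "norm ?D \<le> L * norm ?h" using L(2)[OF pq, of "[]"] by simp
    have e: "norm ?e \<le> C * norm ?h" using C(2)[OF pq(1), of "[?h]"] by simp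
    show "norm (Q ?h ?D (sol q) + Q ?h (sol p) ?D + Q p ?e ?D) \<le>
      K * norm ?h * (L * norm ?h) * M + K * norm ?h * M * (L * norm ?h) + K * M * (C * norm ?h) * (L * norm ?h)"
      by (intro order_trans[OF norm_triangle_ineq] add_mono Q_bound_le order_refl D e sp sq)
  qed
  moreover have "0 \<le> R * (K * (L * (\<bar>M\<bar> + \<bar>M\<bar>) + \<bar>M\<bar> * (C * L)))"
    using L C R K_nonneg by simp
  moreover have "R * (K * d * (L * d) * M + K * d * M * (L * d) + K * M * (C * d) * (L * d))
      \<le> R * (K * (L * (\<bar>M\<bar> + \<bar>M\<bar>) + \<bar>M\<bar> * (C * L))) * d\<^sup>2" for d
  proof -
    have "R * (K * d * (L * d) * M + K * d * M * (L * d) + K * M * (C * d) * (L * d))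
        = M * (R * K * L * (2 + C) * d\<^sup>2)" by (simp add: power2_eq_square algebra_simps)
    also have "\<dots> \<le> \<bar>M\<bar> * (R * K * L * (2 + C) * d\<^sup>2)"
      using L C R K_nonneg by (intro mult_right_mono) auto
    finally show ?thesis by (simp add: algebra_simps)
  qed
  ultimately have "norm (sol q - sol p - dsol p [q - p])
      \<le> R * (K * (L * (\<bar>M\<bar> + \<bar>M\<bar>) + \<bar>M\<bar> * (C * L))) * (norm (q - p))\<^sup>2"
    if "controlled M p" "controlled M q" for p q
    using that order_trans by blast
  with \<open>0 \<le> R * (K * (L * (\<bar>M\<bar> + \<bar>M\<bar>) + \<bar>M\<bar> * (C * L)))\<close> show ?case
    by (intro exI[of _ "R * (K * (L * (\<bar>M\<bar> + \<bar>M\<bar>) + \<bar>M\<bar> * (C * L)))"]) simp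
next
  case (Suc n)
  then obtain A where A: "0 \<le> A" "\<And>p q hs. controlled M p \<Longrightarrow> controlled M q \<Longrightarrow> length hs \<le> n \<Longrightarrow>
    norm (dsol q hs - dsol p hs - dsol p ((q - p) # hs)) \<le> A * (norm (q - p))\<^sup>2 * norm_prod hs"
    by blast
  obtain L where L: "0 \<le> L" "\<And>p q hs. controlled M p \<Longrightarrow> controlled M q \<Longrightarrow> length hs \<le> Suc n \<Longrightarrow>
    norm (dsol q hs - dsol p hs) \<le> L * norm (q - p) * norm_prod hs"
    using dsol_lipschitz[of M "Suc n"] by blast
  obtain C where C: "0 \<le> C" "\<And>p hs. controlled M p \<Longrightarrow> length hs \<le> Suc (Suc n) \<Longrightarrow> norm (dsol p hs) \<le> C * norm_prod hs"
    using dsol_bound[of M "Suc (Suc n)"] by blast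
  define R where "R = linear_const M"
  note R = linear_const[of M, folded R_def]
  define G where "G = (2 * K * A * C + K * C * L) * (1 + \<bar>M\<bar>) + 2 * K * C * L"
  have G0: "0 \<le> G" unfolding G_def using C L A K_nonneg by auto
  define C' where "C' = R * ((real (Suc n) * 2 ^ Suc n * 1 + 2 ^ Suc n) * G
     + (2 * K * \<bar>M\<bar> * C * L + 2 * K * \<bar>M\<bar> * C * A) + 2 ^ Suc n * G)"
  have C'0: "0 \<le> C'" unfolding C'_def using C R L A G0 K_nonneg by (intro mult_nonneg_nonneg add_nonneg_nonneg) auto
  have step: "norm (dsol q hs - dsol p hs - dsol p ((q - p) # hs)) \<le> C' * (norm (q - p))\<^sup>2 * norm_prod hs"
    if pq: "controlled M p" "controlled M q" and hs: "length hs = Suc n" for p q hs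
  proof -
    have ne: "hs \<noteq> []" using hs by auto
    have sp: "solvable p" "norm p \<le> \<bar>M\<bar>" "norm (sol p) \<le> M"
      and sq: "solvable q" "norm (sol q) \<le> M" using pq by (auto simp: controlled_def)
    define h where "h = q - p"
    define d where "d = norm h"
    have d0: "0 \<le> d" by (simp add: d_def)
    let ?p = "dsol p" let ?q = "dsol q"
    let ?D = "\<lambda>a. ?q a - ?p a"
    let ?R = "\<lambda>a. ?q a - ?p a - ?p (h # a)"
    \<comment> \<open>The first-order Taylor remainder of a product with fixed parameter
      \<open>k\<close>; \<open>F_eq\<close> displays it as three terms, each of second
      order.\<close>
    let ?F = "\<lambda>k a b. Q k (?q a) (?q b) - Q k (?p a) (?p b) - Q k (?p (h # a)) (?p b) - Q k (?p a) (?p (h # b))"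
    let ?H = "\<lambda>a b. Q h (?q a) (?q b) - Q h (?p a) (?p b)"
    let ?S = "pick_sum hs (\<lambda>h r. split_sum r (?F h))
      + proper_sum hs (\<lambda>a b. ?F p a b)"
    \<comment> \<open>From the extreme distributions \<open>?F p hs []\<close> and
      \<open>?F p [] hs\<close>, everything except the two terms with the unknown remainder
      \<open>?R hs\<close>.\<close>
    let ?E = "Q p (?p (h # hs)) (sol q - sol p) + Q p (?p hs) (?R [])
        + Q p (?R []) (?q hs) + Q p (?p [h]) (?D hs)"
    let ?f = "?S + ?E + split_sum hs ?H"
    have Rb: "norm (?R a) \<le> A * d\<^sup>2 * norm_prod a" if "length a \<le> n" for a
      unfolding h_def d_def using that by (intro A(2) pq)
    have Db: "norm (?D a) \<le> L * d * norm_prod a" if "length a \<le> Suc n" for a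
      unfolding h_def d_def using that by (intro L(2) pq)
    have hb: "norm (?p (h # a)) \<le> C * d * norm_prod a" if "length a \<le> Suc n" for a
      using C(2)[OF pq(1), of "h # a"] that by (simp add: d_def mult_ac)
    have pb: "norm (?p a) \<le> C * norm_prod a" "norm (?q a) \<le> C * norm_prod a" if "length a \<le> Suc n" for a
      using C(2)[OF pq(1), of a] C(2)[OF pq(2), of a] that by auto
    have nn: "0 \<le> norm_prod a * norm_prod b" for a b :: "'p list"
      using norm_prod_nonneg[of a] norm_prod_nonneg[of b] by simp
    have F_eq: "?F k a b = Q k (?R a) (?q b) + Q k (?p (h # a)) (?D b) + Q k (?p a) (?R b)" for k a b
      by (simp add: Q_diff2 Q_diff3)
    have F: "norm (?F k a b) \<le> (2 * K * A * C + K * C * L) * norm k * d\<^sup>2 * norm_prod a * norm_prod b"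
      if "length a < length hs" "length b < length hs" for k a b
    proof -
      have l: "length a \<le> n" "length b \<le> n" "length a \<le> Suc n" "length b \<le> Suc n" using that hs by auto
      have "norm (?F k a b) \<le> K * norm k * (A * d\<^sup>2 * norm_prod a) * (C * norm_prod b)
         + K * norm k * (C * d * norm_prod a) * (L * d * norm_prod b)
         + K * norm k * (C * norm_prod a) * (A * d\<^sup>2 * norm_prod b)"
        unfolding F_eq
        by (intro order_trans[OF norm_triangle_ineq] add_mono Q_bound_le order_refl Rb Db hb pb l)
      then show ?thesis by (simp add: algebra_simps power2_eq_square)
    qed
    have "norm ?S \<le> (real (length hs) * 2 ^ length hs * 1 + 2 ^ length hs) * (G * d\<^sup>2) * norm_prod hs"
    proof (rule norm_source_le)
      fix k :: 'p and a b :: "'p list" assume ab: "length a < length hs" "length b < length hs"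
      let ?N = "norm_prod a * norm_prod b" let ?g = "2 * K * A * C + K * C * L"
      have g: "0 \<le> ?g" using K_nonneg A C L by simp
      have "?g \<le> G" "?g * \<bar>M\<bar> \<le> G" unfolding G_def using K_nonneg A C L
        by (auto simp: algebra_simps intro!: add_nonneg_nonneg mult_nonneg_nonneg)
      then have "?g * (norm k * d\<^sup>2 * ?N) \<le> G * (norm k * d\<^sup>2 * ?N)"
        and 2: "(?g * \<bar>M\<bar>) * (d\<^sup>2 * ?N) \<le> G * (d\<^sup>2 * ?N)"
        using nn[of a b] by (intro mult_right_mono; simp)+
      then show "norm (?F k a b) \<le> 1 * norm k * (G * d\<^sup>2 * norm_prod a * norm_prod b)"
        using F[OF ab, of k] by (simp add: mult_ac)
      have "(?g * norm p) * (d\<^sup>2 * ?N) \<le> (?g * \<bar>M\<bar>) * (d\<^sup>2 * ?N)"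
        using nn[of a b] g sp(2) by (intro mult_right_mono mult_left_mono) auto
      with 2 show "norm (?F p a b) \<le> G * d\<^sup>2 * norm_prod a * norm_prod b"
        using F[OF ab, of p] by (simp add: mult_ac)
    qed (use G0 in auto)
    moreover have "norm ?E \<le> K * \<bar>M\<bar> * (C * d * norm_prod hs) * (L * d) + K * \<bar>M\<bar> * (C * norm_prod hs) * (A * d\<^sup>2)
       + K * \<bar>M\<bar> * (A * d\<^sup>2) * (C * norm_prod hs) + K * \<bar>M\<bar> * (C * d) * (L * d * norm_prod hs)"
    proof -
      have "norm (sol q - sol p) \<le> L * d" "norm (?R []) \<le> A * d\<^sup>2" "norm (?p [h]) \<le> C * d"
        using Db[of "[]"] Rb[of "[]"] hb[of "[]"] by auto
      then show ?thesis
        using hs by (intro order_trans[OF norm_triangle_ineq] add_mono Q_bound_le sp hb pb Db) auto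
    qed
    moreover have "norm (split_sum hs ?H) \<le> 2 ^ length hs * (G * d\<^sup>2) * norm_prod hs"
    proof (rule norm_split_sum_le)
      fix a b :: "'p list" assume "length a + length b = length hs"
      then have l: "length a \<le> Suc n" "length b \<le> Suc n" using hs by auto
      have "?H a b = Q h (?D a) (?q b) + Q h (?p a) (?D b)" by (simp add: Q_diff2 Q_diff3)
      then have "norm (?H a b) \<le> norm (Q h (?D a) (?q b)) + norm (Q h (?p a) (?D b))"
        by (simp add: norm_triangle_ineq)
      also have "\<dots> \<le> K * d * (L * d * norm_prod a) * (C * norm_prod b)
         + K * d * (C * norm_prod a) * (L * d * norm_prod b)"
        unfolding d_def[symmetric] using d_def by (intro add_mono Q_bound_le Db pb l) auto
      also have "\<dots> = (2 * K * C * L) * (d\<^sup>2 * (norm_prod a * norm_prod b))"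
        by (simp add: algebra_simps power2_eq_square)
      also have "\<dots> \<le> G * (d\<^sup>2 * (norm_prod a * norm_prod b))"
        unfolding G_def using nn[of a b] K_nonneg A C L
        by (intro mult_right_mono) auto
      finally show "norm (?H a b) \<le> G * d\<^sup>2 * norm_prod a * norm_prod b" by (simp add: mult_ac)
    qed
    ultimately have f: "norm ?f \<le> (real (length hs) * 2 ^ length hs * 1 + 2 ^ length hs) * (G * d\<^sup>2) * norm_prod hs
       + (K * \<bar>M\<bar> * (C * d * norm_prod hs) * (L * d) + K * \<bar>M\<bar> * (C * norm_prod hs) * (A * d\<^sup>2)
       + K * \<bar>M\<bar> * (A * d\<^sup>2) * (C * norm_prod hs) + K * \<bar>M\<bar> * (C * d) * (L * d * norm_prod hs))
       + 2 ^ length hs * (G * d\<^sup>2) * norm_prod hs"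
      by - (rule norm_triangle_le, rule add_mono, rule norm_triangle_le, rule add_mono; assumption)
    have regroup: "a + (u + v + w + (x + y + z) + b) + c = a + b + (v + w + x + y) + c + u + z"
      for a b c u v w x y z :: 'x by (simp add: ac_simps)
    have x1: "?F p hs [] = Q p (?R hs) (sol q) + Q p (?p (h # hs)) (sol q - sol p) + Q p (?p hs) (?R [])"
      using F_eq[of p hs "[]"] by (simp only: dsol_Nil)
    have x2: "?F p [] hs = Q p (?R []) (?q hs) + Q p (?p [h]) (?D hs) + Q p (sol p) (?R hs)"
      using F_eq[of p "[]" hs] by (simp only: dsol_Nil)
    \<comment> \<open>The equation of \<open>dsol p (h # hs)\<close> lists the terms with
      \<open>h\<close> on either factor and those with \<open>h\<close> on the parameter. The former
      complete \<open>?F\<close>; the latter meet the change of parameter in the equation at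
      \<open>q\<close>, which leaves \<open>?H\<close>.\<close>
    have "?R hs = pick_sum hs (\<lambda>h r. split_sum r (?F h)) + split_sum hs (?F p) + split_sum hs ?H"
    proof -
      have "?q hs = pick_sum hs (\<lambda>k r. split_sum r (\<lambda>a b. Q k (?q a) (?q b)))
         + split_sum hs (\<lambda>a b. Q p (?q a) (?q b) + Q h (?q a) (?q b))"
        using dsol_eq[OF sq(1), of hs] ne by (simp add: h_def Q_diff1)
      then show ?thesis
        using dsol_eq[OF sp(1), of hs] dsol_eq[OF sp(1), of "h # hs"] ne
        by (simp add: split_sum_diff pick_sum_diff split_sum_add pick_sum_add)
    qed
    also have "split_sum hs (?F p) = ?F p hs [] + ?F p [] hs
       + proper_sum hs (\<lambda>a b. ?F p a b)"
      by (rule split_sum_extremes[OF ne])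
    finally have "?R hs = ?f + Q p (?R hs) (sol q) + Q p (sol p) (?R hs)"
      unfolding x1 x2 by (rule trans[OF _ regroup])
    from R(2)[OF pq this f] have "norm (?R hs) \<le> C' * d\<^sup>2 * norm_prod hs"
      unfolding C'_def hs by (rule order_trans) (rule eq_refl, simp add: algebra_simps power2_eq_square)
    then show ?thesis unfolding h_def d_def .
  qed
  show ?case
  proof (intro exI[of _ "max A C'"] conjI allI impI)
    fix p q and hs :: "'p list" assume pq: "controlled M p" "controlled M q" and l: "length hs \<le> Suc n"
    show "norm (dsol q hs - dsol p hs - dsol p ((q - p) # hs)) \<le> max A C' * (norm (q - p))\<^sup>2 * norm_prod hs"
      by (rule bound_Suc[OF A(2)[OF pq] step[OF pq] l zero_le_power2 norm_prod_nonneg])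
  qed (use A(1) in simp)
qed

end

section \<open>Hermitian square-summable families\<close>

text \<open>Square summability stated through finite sets: such bounds pass to coefficientwise
  limits, where only finitely many coefficients are involved at a time.\<close>

definition l2_bound :: "('k \<Rightarrow> complex) \<Rightarrow> real \<Rightarrow> bool" where
  "l2_bound c C \<longleftrightarrow> (\<forall>F. finite F \<longrightarrow> L2_set (\<lambda>k. cmod (c k)) F \<le> C)"

lemma l2_bound_nonneg: "l2_bound c C \<Longrightarrow> 0 \<le> C"
  unfolding l2_bound_def by (metis L2_set_empty finite.emptyI)

lemma l2_bound_cmod: "l2_bound c C \<Longrightarrow> cmod (c k) \<le> C"
  unfolding l2_bound_def by (drule spec[of _ "{k}"]) simp

lemma l2_bound_mono: "l2_bound c C \<Longrightarrow> C \<le> D \<Longrightarrow> l2_bound c D"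
  unfolding l2_bound_def by fastforce

lemma l2_bound_add: "l2_bound c C \<Longrightarrow> l2_bound d D \<Longrightarrow> l2_bound (\<lambda>k. c k + d k) (C + D)"
  unfolding l2_bound_def
proof (intro allI impI)
  fix F :: "'a set"
  assume c: "\<forall>F. finite F \<longrightarrow> L2_set (\<lambda>k. cmod (c k)) F \<le> C"
    and d: "\<forall>F. finite F \<longrightarrow> L2_set (\<lambda>k. cmod (d k)) F \<le> D" and F: "finite F"
  have "L2_set (\<lambda>k. cmod (c k + d k)) F \<le> L2_set (\<lambda>k. cmod (c k) + cmod (d k)) F"
    by (rule L2_set_mono) (auto intro: norm_triangle_ineq)
  also have "\<dots> \<le> L2_set (\<lambda>k. cmod (c k)) F + L2_set (\<lambda>k. cmod (d k)) F"
    by (rule L2_set_triangle_ineq)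
  finally show "L2_set (\<lambda>k. cmod (c k + d k)) F \<le> C + D" using c d F by fastforce
qed

lemma l2_bound_scale: "l2_bound c C \<Longrightarrow> l2_bound (\<lambda>k. a * c k) (cmod a * C)"
  unfolding l2_bound_def by (auto simp: norm_mult L2_set_right_distrib[symmetric] intro!: mult_left_mono)

lemma l2_bound_sum: "l2_bound c C \<Longrightarrow> finite F \<Longrightarrow> (\<Sum>k\<in>F. (cmod (c k))\<^sup>2) \<le> C\<^sup>2"
  unfolding l2_bound_def L2_set_def by (metis real_sqrt_le_iff real_sqrt_unique l2_bound_nonneg
      l2_bound_def L2_set_def real_sqrt_le_mono real_le_lsqrt sqrt_le_D)

lemma l2_boundI: "0 \<le> C \<Longrightarrow> (\<And>F. finite F \<Longrightarrow> (\<Sum>k\<in>F. (cmod (c k))\<^sup>2) \<le> C\<^sup>2) \<Longrightarrow> l2_bound c C"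
  unfolding l2_bound_def L2_set_def by (auto intro: real_le_lsqrt sum_nonneg)

lemma l2_bound_comparison: "l2_bound c C \<Longrightarrow> (\<And>k. cmod (d k) \<le> cmod (c k)) \<Longrightarrow> l2_bound d C"
  unfolding l2_bound_def by (meson L2_set_mono norm_ge_zero order_trans)

text \<open>The coefficient families of real functions. The symmetry makes this a real vector space,
  as real Frechet derivatives require; the index type is a group because negation and differences of
  indices occur.\<close>

typedef (overloaded) 'k hl2 = "{c :: 'k::ab_group_add \<Rightarrow> complex.
    (\<forall>k. c (- k) = cnj (c k)) \<and> (\<exists>C. l2_bound c C)}"
  morphisms coef Hl2
  by (rule exI[of _ "\<lambda>_. 0"]) (auto intro!: exI[of _ 0] simp: l2_bound_def L2_set_def)

setup_lifting type_definition_hl2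

lemma coef_Hl2: "(\<And>k. c (- k) = cnj (c k)) \<Longrightarrow> l2_bound c C \<Longrightarrow> coef (Hl2 c) = c"
  by (subst Hl2_inverse) auto

lemma coef_uminus: "coef f (- k) = cnj (coef f k)" using coef[of f] by simp

lemma hl2_eqI: "(\<And>k. coef f k = coef g k) \<Longrightarrow> f = g"
  by (simp add: coef_inject[symmetric] fun_eq_iff)

instantiation hl2 :: (ab_group_add) real_vector
begin
lift_definition zero_hl2 :: "'a hl2" is "\<lambda>_. 0"
  by (auto intro!: exI[of _ 0] simp: l2_bound_def L2_set_def)
lift_definition plus_hl2 :: "'a hl2 \<Rightarrow> 'a hl2 \<Rightarrow> 'a hl2" is "\<lambda>f g k. f k + g k"
  by (auto dest: l2_bound_add)
lift_definition uminus_hl2 :: "'a hl2 \<Rightarrow> 'a hl2" is "\<lambda>f k. - f k"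
  by (auto simp: l2_bound_def)
lift_definition minus_hl2 :: "'a hl2 \<Rightarrow> 'a hl2 \<Rightarrow> 'a hl2" is "\<lambda>f g k. f k - g k"
proof (intro conjI allI)
  fix f g :: "'a \<Rightarrow> complex" and k
  assume f: "(\<forall>k. f (- k) = cnj (f k)) \<and> (\<exists>C. l2_bound f C)" and g: "(\<forall>k. g (- k) = cnj (g k)) \<and> (\<exists>C. l2_bound g C)"
  then show "f (- k) - g (- k) = cnj (f k - g k)" by simp
  from f g obtain C D where "l2_bound f C" "l2_bound g D" by blast
  from l2_bound_add[OF this(1) l2_bound_scale[OF this(2), of "-1"]]
  show "\<exists>C. l2_bound (\<lambda>k. f k - g k) C" by auto
qed
lift_definition scaleR_hl2 :: "real \<Rightarrow> 'a hl2 \<Rightarrow> 'a hl2" is "\<lambda>r f k. of_real r * f k"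
  by (auto dest: l2_bound_scale)
instance
  by standard (transfer, simp add: algebra_simps fun_eq_iff)+
end

lemma coef_zero [simp]: "coef 0 k = 0" by transfer simp
lemma coef_add [simp]: "coef (f + g) k = coef f k + coef g k" by transfer simp
lemma coef_diff [simp]: "coef (f - g) k = coef f k - coef g k" by transfer simp
lemma coef_scaleR [simp]: "coef (r *\<^sub>R f) k = of_real r * coef f k" by transfer simp

instantiation hl2 :: (ab_group_add) real_normed_vector
begin

definition norm_hl2 :: "'a hl2 \<Rightarrow> real" where
  "norm_hl2 f = (SUP F\<in>Collect finite. L2_set (\<lambda>k. cmod (coef f k)) F)"
definition dist_hl2 :: "'a hl2 \<Rightarrow> 'a hl2 \<Rightarrow> real" where "dist_hl2 f g = norm (f - g)"
definition sgn_hl2 :: "'a hl2 \<Rightarrow> 'a hl2" where "sgn_hl2 f = f /\<^sub>R norm f"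
definition uniformity_hl2 :: "('a hl2 \<times> 'a hl2) filter" where
  "uniformity_hl2 = (INF e\<in>{0<..}. principal {(x, y). dist x y < e})"
definition open_hl2 :: "'a hl2 set \<Rightarrow> bool" where
  "open_hl2 S = (\<forall>x\<in>S. \<forall>\<^sub>F (x', y) in uniformity. x' = x \<longrightarrow> y \<in> S)"

lemma l2_bound_norm: "l2_bound (coef f) (norm f)" for f :: "'a hl2"
proof -
  obtain C where "l2_bound (coef f) C" using coef[of f] by blast
  then have "bdd_above ((\<lambda>F. L2_set (\<lambda>k. cmod (coef f k)) F) ` Collect finite)"
    unfolding l2_bound_def by (intro bdd_aboveI2[of _ _ C]) auto
  then show ?thesis unfolding l2_bound_def norm_hl2_def by (auto intro!: cSUP_upper)
qed

lemma norm_hl2_le: "l2_bound (coef f) C \<Longrightarrow> norm f \<le> C" for f :: "'a hl2"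
  unfolding norm_hl2_def l2_bound_def by (intro cSUP_least) auto

instance
proof
  fix f g :: "'a hl2" and r :: real
  show "norm f = 0 \<longleftrightarrow> f = 0"
  proof
    assume "norm f = 0"
    then show "f = 0" using l2_bound_cmod[OF l2_bound_norm, of f] by (intro hl2_eqI) auto
  next
    assume "f = 0"
    then have "norm f \<le> 0" by (intro norm_hl2_le) (auto simp: l2_bound_def L2_set_def)
    then show "norm f = 0" using l2_bound_nonneg[OF l2_bound_norm, of f] by simp
  qed
  show "norm (f + g) \<le> norm f + norm g"
    using l2_bound_add[OF l2_bound_norm[of f] l2_bound_norm[of g]] by (intro norm_hl2_le) (simp add: l2_bound_def)
  have le: "norm (r *\<^sub>R f) \<le> \<bar>r\<bar> * norm f" for r :: real and f :: "'a hl2"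
    using l2_bound_scale[OF l2_bound_norm[of f], of "of_real r"] by (intro norm_hl2_le) (simp add: l2_bound_def)
  show "norm (r *\<^sub>R f) = \<bar>r\<bar> * norm f"
  proof (cases "r = 0")
    case True
    then show ?thesis using le[of 0 f] l2_bound_nonneg[OF l2_bound_norm, of "0 *\<^sub>R f"] by simp
  next
    case False
    have "norm f \<le> \<bar>inverse r\<bar> * norm (r *\<^sub>R f)" using le[of "inverse r" "r *\<^sub>R f"] False by simp
    then have "\<bar>r\<bar> * norm f \<le> norm (r *\<^sub>R f)" using False by (simp add: field_simps)
    then show ?thesis using le[of r f] by simp
  qed
qed (auto simp: dist_hl2_def sgn_hl2_def uniformity_hl2_def open_hl2_def)

end

lemma norm_coef_le: "cmod (coef f k) \<le> norm f"
  by (rule l2_bound_cmod[OF l2_bound_norm])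

lemma sum_coef_le: "finite F \<Longrightarrow> (\<Sum>k\<in>F. (cmod (coef f k))\<^sup>2) \<le> (norm f)\<^sup>2"
  by (rule l2_bound_sum[OF l2_bound_norm])

lemma bounded_linear_coef: "bounded_linear (\<lambda>f. coef f k)"
  by (rule bounded_linear_intro[where K = 1]) (auto simp: norm_coef_le scaleR_conv_of_real)

text \<open>Limits exist coefficientwise; the Cauchy bound holds on every finite set and survives
  the limit there, and so does the symmetry.\<close>

instance hl2 :: (ab_group_add) banach
proof
  fix X :: "nat \<Rightarrow> 'a hl2"
  assume X: "Cauchy X"
  have "convergent (\<lambda>n. coef (X n) k)" for k
    using bounded_linear.Cauchy[OF bounded_linear_coef X] by (simp add: Cauchy_convergent_iff)
  then obtain c where c: "(\<lambda>n. coef (X n) k) \<longlonglongrightarrow> c k" for k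
    unfolding convergent_def by metis
  have tail: "l2_bound (\<lambda>k. coef (X n) k - c k) e"
    if "\<And>m. m \<ge> N \<Longrightarrow> norm (X n - X m) \<le> e" for n N e
    unfolding l2_bound_def
  proof (intro allI impI)
    fix F :: "'a set" assume "finite F"
    have "(\<lambda>m. L2_set (\<lambda>k. cmod (coef (X n) k - coef (X m) k)) F) \<longlonglongrightarrow> L2_set (\<lambda>k. cmod (coef (X n) k - c k)) F"
      unfolding L2_set_def by (intro tendsto_intros c)
    then show "L2_set (\<lambda>k. cmod (coef (X n) k - c k)) F \<le> e"
    proof (rule tendsto_upperbound)
      show "\<forall>\<^sub>F m in sequentially. L2_set (\<lambda>k. cmod (coef (X n) k - coef (X m) k)) F \<le> e"
        using eventually_ge_at_top[of N]
      proof eventually_elim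
        case (elim m)
        then show ?case using l2_bound_norm[of "X n - X m"] that[of m] \<open>finite F\<close>
          by (auto simp: l2_bound_def intro: order_trans)
      qed
    qed simp
  qed
  have "\<exists>N. \<forall>n\<ge>N. \<forall>m\<ge>N. norm (X n - X m) \<le> e" if "e > 0" for e
    using metric_CauchyD[OF X that] by (auto simp: dist_norm intro: less_imp_le)
  then obtain N where N: "norm (X n - X m) \<le> e" if "e > 0" "n \<ge> N e" "m \<ge> N e" for e n m
    by metis
  have herm: "c (- k) = cnj (c k)" for k
  proof (rule LIMSEQ_unique[OF c])
    show "(\<lambda>n. coef (X n) (- k)) \<longlonglongrightarrow> cnj (c k)"
      unfolding coef_uminus using c[of k] by (rule tendsto_cnj)
  qed
  have "l2_bound (\<lambda>k. coef (X (N 1)) k - c k) 1"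
    by (rule tail[of "N 1"]) (auto intro: N)
  from l2_bound_add[OF l2_bound_norm[of "X (N 1)"] l2_bound_scale[OF this, of "-1"]]
  have lim: "coef (Hl2 c) = c" by (intro coef_Hl2[of c, OF herm]) simp
  have "X \<longlonglongrightarrow> Hl2 c"
  proof (rule metric_LIMSEQ_I)
    fix e :: real assume "e > 0"
    have "norm (X n - Hl2 c) \<le> e / 2" if "n \<ge> N (e / 2)" for n
      using tail[of "N (e / 2)" n "e / 2"] that N[of "e / 2" n] \<open>e > 0\<close>
      by (intro norm_hl2_le) (simp add: l2_bound_def lim)
    then show "\<exists>no. \<forall>n\<ge>no. dist (X n) (Hl2 c) < e"
      using \<open>e > 0\<close> by (intro exI[of _ "N (e / 2)"]) (force simp: dist_norm)
  qed
  then show "convergent X" by (rule convergentI)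
qed

lemma norm_sq_hl2_le: "(\<And>F. finite F \<Longrightarrow> (\<Sum>k\<in>F. (cmod (coef f k))\<^sup>2) \<le> C) \<Longrightarrow> (norm f)\<^sup>2 \<le> C"
proof -
  assume *: "\<And>F. finite F \<Longrightarrow> (\<Sum>k\<in>F. (cmod (coef f k))\<^sup>2) \<le> C"
  have "0 \<le> C" using *[of "{}"] by simp
  then have "norm f \<le> sqrt C" using * by (intro norm_hl2_le l2_boundI) auto
  then have "(norm f)\<^sup>2 \<le> (sqrt C)\<^sup>2" by (rule power_mono) simp
  then show ?thesis using \<open>0 \<le> C\<close> by simp
qed

subsection \<open>Twisted convolutions\<close>

lemma l2_bound_mult_summable:
  assumes "l2_bound p P" "l2_bound b B"
  shows "finite F \<Longrightarrow> (\<Sum>m\<in>F. cmod (p m * b m)) \<le> P * B"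
    and "(\<lambda>m. cmod (p m * b m)) summable_on UNIV"
proof -
  show *: "(\<Sum>m\<in>F. cmod (p m * b m)) \<le> P * B" if "finite F" for F
  proof -
    have "(\<Sum>m\<in>F. cmod (p m * b m)) \<le> L2_set (\<lambda>m. cmod (p m)) F * L2_set (\<lambda>m. cmod (b m)) F"
      using L2_set_mult_ineq[of "\<lambda>m. cmod (p m)" "\<lambda>m. cmod (b m)" F] by (simp add: norm_mult)
    also have "\<dots> \<le> P * B" using assms that by (intro mult_mono) (auto simp: l2_bound_def l2_bound_nonneg[OF assms(1)])
    finally show ?thesis .
  qed
  show "(\<lambda>m. cmod (p m * b m)) summable_on UNIV"
    by (rule nonneg_bdd_above_summable_on) (auto intro!: bdd_aboveI2 *)
qed

text \<open>Minkowski's inequality and translation invariance: the finite form of Young's inequality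
  for l1 against l2.\<close>

lemma l2_bound_young_finite:
  fixes a :: "'k::ab_group_add \<Rightarrow> complex"
  assumes "l2_bound a A" "finite F" "finite G" "\<And>m. 0 \<le> q m"
  shows "L2_set (\<lambda>k. \<Sum>m\<in>G. q m * cmod (a (k - m))) F \<le> (\<Sum>m\<in>G. q m) * A"
  using assms(3)
proof induction
  case (insert m G)
  have "L2_set (\<lambda>k. cmod (a (k - m))) F = L2_set (\<lambda>k. cmod (a k)) ((\<lambda>k. k - m) ` F)"
    unfolding L2_set_def by (subst sum.reindex) (auto simp: inj_on_def)
  also have "\<dots> \<le> A" using assms by (simp add: l2_bound_def)
  finally have "q m * L2_set (\<lambda>k. cmod (a (k - m))) F \<le> q m * A"
    using assms(4) by (rule mult_left_mono)
  moreover have "L2_set (\<lambda>k. \<Sum>m\<in>insert m G. q m * cmod (a (k - m))) F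
    \<le> L2_set (\<lambda>k. q m * cmod (a (k - m))) F + L2_set (\<lambda>k. \<Sum>m\<in>G. q m * cmod (a (k - m))) F"
    using insert by (simp add: L2_set_triangle_ineq)
  ultimately show ?case using insert assms(4)
    by (simp add: L2_set_right_distrib[symmetric] algebra_simps)
qed (simp add: L2_set_def)

text \<open>The coefficients of a function times a convolution: the kernel \<open>p\<close>
  multiplies \<open>b\<close> at the same index, and the product with \<open>a\<close> convolves the
  result. The multiplier \<open>\<sigma>\<close> carries derivatives and weights.\<close>

definition twist_conv :: "('k::ab_group_add \<Rightarrow> 'k \<Rightarrow> real) \<Rightarrow> ('k \<Rightarrow> complex) \<Rightarrow> ('k \<Rightarrow> complex) \<Rightarrow> ('k \<Rightarrow> complex) \<Rightarrow> 'k \<Rightarrow> complex" where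
  "twist_conv \<sigma> p a b k = (\<Sum>\<^sub>\<infinity>m. of_real (\<sigma> k m) * (p m * b m) * a (k - m))"

lemma twist_conv_summable:
  assumes "l2_bound p P" "l2_bound b B" "l2_bound a A" "\<And>k m. \<bar>\<sigma> k m\<bar> \<le> S"
  shows "(\<lambda>m. cmod (of_real (\<sigma> k m) * (p m * b m) * a (k - m))) summable_on UNIV"
    and "(\<lambda>m. of_real (\<sigma> k m) * (p m * b m) * a (k - m)) summable_on UNIV"
proof -
  have S: "0 \<le> S" using assms(4) by (meson abs_ge_zero order_trans)
  show 1: "(\<lambda>m. cmod (of_real (\<sigma> k m) * (p m * b m) * a (k - m))) summable_on UNIV"
  proof (rule summable_on_comparison_test)
    show "(\<lambda>m. (S * A) * cmod (p m * b m)) summable_on UNIV"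
      using l2_bound_mult_summable(2)[OF assms(1,2)] by (rule summable_on_cmult_right)
    show "cmod (of_real (\<sigma> k m) * (p m * b m) * a (k - m)) \<le> (S * A) * cmod (p m * b m)" for m
    proof -
      have "\<bar>\<sigma> k m\<bar> * cmod (a (k - m)) \<le> S * A"
        using assms(4) l2_bound_cmod[OF assms(3)] S by (intro mult_mono) auto
      from mult_right_mono[OF this, of "cmod (p m * b m)"] show ?thesis by (simp add: norm_mult mult_ac)
    qed
  qed auto
  then show "(\<lambda>m. of_real (\<sigma> k m) * (p m * b m) * a (k - m)) summable_on UNIV"
    by (rule abs_summable_summable)
qed

text \<open>By Cauchy-Schwarz the products \<open>p m * b m\<close> are absolutely summable, and
  Young's inequality against \<open>a\<close> in l2 does the rest; the multiplier costs its
  supremum.\<close>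

lemma l2_bound_twist_conv:
  assumes p: "l2_bound p P" and b: "l2_bound b B" and a: "l2_bound a A" and S: "\<And>k m. \<bar>\<sigma> k m\<bar> \<le> S"
  shows "l2_bound (twist_conv \<sigma> p a b) (S * P * B * A)"
  unfolding l2_bound_def
proof (intro allI impI)
  fix F :: "'a set" assume F: "finite F"
  have S0: "0 \<le> S" using S[of 0 0] by linarith
  have A0: "0 \<le> A" and P0: "0 \<le> P" using a p by (auto intro: l2_bound_nonneg)
  let ?f = "\<lambda>k m. cmod (of_real (\<sigma> k m) * (p m * b m) * a (k - m))"
  have "L2_set (\<lambda>k. cmod (twist_conv \<sigma> p a b k)) F \<le> L2_set (\<lambda>k. \<Sum>\<^sub>\<infinity>m. ?f k m) F"
    unfolding twist_conv_def by (intro L2_set_mono norm_infsum_bound twist_conv_summable[OF p b a S]) auto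
  also have "\<dots> \<le> S * P * B * A"
  proof (rule tendsto_upperbound)
    show "((\<lambda>G. L2_set (\<lambda>k. \<Sum>m\<in>G. ?f k m) F) \<longlongrightarrow> L2_set (\<lambda>k. \<Sum>\<^sub>\<infinity>m. ?f k m) F) (finite_subsets_at_top UNIV)"
      unfolding L2_set_def by (intro tendsto_intros infsum_tendsto twist_conv_summable[OF p b a S])
    show "\<forall>\<^sub>F G in finite_subsets_at_top UNIV. L2_set (\<lambda>k. \<Sum>m\<in>G. ?f k m) F \<le> S * P * B * A"
    proof (rule eventually_finite_subsets_at_top_weakI)
      fix G :: "'a set" assume G: "finite G"
      have "L2_set (\<lambda>k. \<Sum>m\<in>G. ?f k m) F \<le> L2_set (\<lambda>k. \<Sum>m\<in>G. (S * cmod (p m * b m)) * cmod (a (k - m))) F"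
      proof (intro L2_set_mono sum_mono sum_nonneg)
        show "?f k m \<le> (S * cmod (p m * b m)) * cmod (a (k - m))" for k m
          using mult_right_mono[OF S, of "cmod (p m * b m) * cmod (a (k - m))" k m] by (simp add: norm_mult mult_ac)
      qed auto
      also have "\<dots> \<le> (\<Sum>m\<in>G. S * cmod (p m * b m)) * A"
        using S0 by (intro l2_bound_young_finite[OF a F G]) auto
      also have "\<dots> = S * (\<Sum>m\<in>G. cmod (p m * b m)) * A" by (simp add: sum_distrib_left)
      also have "\<dots> \<le> S * (P * B) * A"
        using l2_bound_mult_summable(1)[OF p b G] S0 A0 by (intro mult_right_mono mult_left_mono)
      finally show "L2_set (\<lambda>k. \<Sum>m\<in>G. ?f k m) F \<le> S * P * B * A" by (simp add: mult_ac)
    qed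
  qed simp
  finally show "L2_set (\<lambda>k. cmod (twist_conv \<sigma> p a b k)) F \<le> S * P * B * A" .
qed

lemma twist_conv_uminus:
  assumes "\<And>k. p (- k) = cnj (p k)" "\<And>k. a (- k) = cnj (a k)" "\<And>k. b (- k) = cnj (b k)"
    "\<And>k m. \<sigma> (- k) (- m) = \<sigma> k m"
  shows "twist_conv \<sigma> p a b (- k) = cnj (twist_conv \<sigma> p a b k)"
proof -
  have "twist_conv \<sigma> p a b (- k) = (\<Sum>\<^sub>\<infinity>m. of_real (\<sigma> (- k) (- m)) * (p (- m) * b (- m)) * a (- k - (- m)))"
    unfolding twist_conv_def
    by (rule infsum_reindex_bij_betw[symmetric]) (auto intro!: bij_betwI[of uminus _ _ uminus])
  also have "\<dots> = (\<Sum>\<^sub>\<infinity>m. cnj (of_real (\<sigma> k m) * (p m * b m) * a (k - m)))"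
    using assms(2)[of "k - _"] by (simp add: assms)
  finally show ?thesis unfolding twist_conv_def infsum_cnj .
qed

definition tconv :: "('k::ab_group_add \<Rightarrow> 'k \<Rightarrow> real) \<Rightarrow> 'k hl2 \<Rightarrow> 'k hl2 \<Rightarrow> 'k hl2 \<Rightarrow> 'k hl2" where
  "tconv \<sigma> p a b = Hl2 (twist_conv \<sigma> (coef p) (coef a) (coef b))"

locale twist_kernel =
  fixes \<sigma> :: "'k::ab_group_add \<Rightarrow> 'k \<Rightarrow> real" and S :: real
  assumes kernel_bound: "\<bar>\<sigma> k m\<bar> \<le> S" and kernel_even: "\<sigma> (- k) (- m) = \<sigma> k m"
begin

lemma kernel_bound_nonneg: "0 \<le> S" using kernel_bound[of 0 0] by linarith

lemma coef_tconv': "coef (tconv \<sigma> p a b) = twist_conv \<sigma> (coef p) (coef a) (coef b)"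
  unfolding tconv_def
  by (rule coef_Hl2[OF twist_conv_uminus l2_bound_twist_conv[where \<sigma> = \<sigma>,
        OF l2_bound_norm[of p] l2_bound_norm[of b] l2_bound_norm[of a] kernel_bound]])
    (simp_all add: coef_uminus kernel_even)

lemma coef_tconv: "coef (tconv \<sigma> p a b) k = (\<Sum>\<^sub>\<infinity>m. of_real (\<sigma> k m) * (coef p m * coef b m) * coef a (k - m))"
  by (simp add: coef_tconv' twist_conv_def)

lemma norm_tconv: "norm (tconv \<sigma> p a b) \<le> S * norm p * norm b * norm a"
  by (rule norm_hl2_le) (unfold coef_tconv', rule l2_bound_twist_conv[where \<sigma> = \<sigma>, OF l2_bound_norm l2_bound_norm l2_bound_norm kernel_bound])

lemmas tconv_summable = twist_conv_summable(2)[where \<sigma> = \<sigma>, OF l2_bound_norm l2_bound_norm l2_bound_norm kernel_bound]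

lemma tconv_lin1: "tconv \<sigma> (c *\<^sub>R p + q) a b = c *\<^sub>R tconv \<sigma> p a b + tconv \<sigma> q a b"
proof (rule hl2_eqI)
  fix k
  have "coef (tconv \<sigma> (c *\<^sub>R p + q) a b) k = (\<Sum>\<^sub>\<infinity>m. of_real c * (of_real (\<sigma> k m) * (coef p m * coef b m) * coef a (k - m))
     + of_real (\<sigma> k m) * (coef q m * coef b m) * coef a (k - m))"
    by (simp add: coef_tconv algebra_simps)
  then show "coef (tconv \<sigma> (c *\<^sub>R p + q) a b) k = coef (c *\<^sub>R tconv \<sigma> p a b + tconv \<sigma> q a b) k"
    by (simp add: coef_tconv infsum_add[OF summable_on_cmult_right[OF tconv_summable] tconv_summable] infsum_cmult_right' )
qed

lemma tconv_lin2: "tconv \<sigma> p (c *\<^sub>R a + a') b = c *\<^sub>R tconv \<sigma> p a b + tconv \<sigma> p a' b"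
proof (rule hl2_eqI)
  fix k
  have "coef (tconv \<sigma> p (c *\<^sub>R a + a') b) k = (\<Sum>\<^sub>\<infinity>m. of_real c * (of_real (\<sigma> k m) * (coef p m * coef b m) * coef a (k - m))
     + of_real (\<sigma> k m) * (coef p m * coef b m) * coef a' (k - m))"
    by (simp add: coef_tconv algebra_simps)
  then show "coef (tconv \<sigma> p (c *\<^sub>R a + a') b) k = coef (c *\<^sub>R tconv \<sigma> p a b + tconv \<sigma> p a' b) k"
    by (simp add: coef_tconv infsum_add[OF summable_on_cmult_right[OF tconv_summable] tconv_summable] infsum_cmult_right' )
qed

lemma tconv_lin3: "tconv \<sigma> p a (c *\<^sub>R b + b') = c *\<^sub>R tconv \<sigma> p a b + tconv \<sigma> p a b'"
proof (rule hl2_eqI)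
  fix k
  have "coef (tconv \<sigma> p a (c *\<^sub>R b + b')) k = (\<Sum>\<^sub>\<infinity>m. of_real c * (of_real (\<sigma> k m) * (coef p m * coef b m) * coef a (k - m))
     + of_real (\<sigma> k m) * (coef p m * coef b' m) * coef a (k - m))"
    by (simp add: coef_tconv algebra_simps)
  then show "coef (tconv \<sigma> p a (c *\<^sub>R b + b')) k = coef (c *\<^sub>R tconv \<sigma> p a b + tconv \<sigma> p a b') k"
    by (simp add: coef_tconv infsum_add[OF summable_on_cmult_right[OF tconv_summable] tconv_summable] infsum_cmult_right' )
qed

lemma bounded_bilinear_tconv: "bounded_bilinear (tconv \<sigma> p)"
proof
  show "tconv \<sigma> p (a + a') b = tconv \<sigma> p a b + tconv \<sigma> p a' b" for a a' b using tconv_lin2[of p 1 a a' b] by simp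
  show "tconv \<sigma> p a (b + b') = tconv \<sigma> p a b + tconv \<sigma> p a b'" for a b b' using tconv_lin3[of p a 1 b b'] by simp
  have z: "tconv \<sigma> p 0 b = 0" "tconv \<sigma> p b 0 = 0" for b
    using tconv_lin2[of p 1 0 0 b] tconv_lin3[of p b 1 0 0] by auto
  show "tconv \<sigma> p (r *\<^sub>R a) b = r *\<^sub>R tconv \<sigma> p a b" for r a b using tconv_lin2[of p r a 0 b] z by simp
  show "tconv \<sigma> p a (r *\<^sub>R b) = r *\<^sub>R tconv \<sigma> p a b" for r a b using tconv_lin3[of p a r b 0] z by simp
  show "\<exists>K. \<forall>a b. norm (tconv \<sigma> p a b) \<le> norm a * norm b * K"
  proof (intro exI allI)
    show "norm (tconv \<sigma> p a b) \<le> norm a * norm b * (S * norm p)" for a b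
      using norm_tconv[of p a b] by (simp add: mult_ac)
  qed
qed

end

section \<open>Diagonal parabolic systems\<close>

text \<open>Summable Lipschitz constants of the iterates take the place of a contraction constant
  below 1. The same telescoping bounds the distance of an arbitrary \<open>w\<close> from a fixed
  point by its defect, which later yields the bound on the resolvent.\<close>

lemma iterated_contraction:
  fixes F :: "'x::banach \<Rightarrow> 'x"
  assumes sum: "summable a" and lip: "\<And>n x y. norm ((F ^^ n) x - (F ^^ n) y) \<le> a n * norm (x - y)"
  shows "\<exists>v. F v = v" and "F v = v \<Longrightarrow> norm (w - v) \<le> suminf a * norm (w - F w)"
proof -
  have a0: "0 \<le> a n" if "(x::'x) \<noteq> y" for n x y
    using order_trans[OF norm_ge_zero lip[of n x y]] that by (simp add: zero_le_mult_iff)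
  have step: "norm ((F ^^ n) w - (F ^^ Suc n) w) \<le> a n * norm (w - F w)" for n w
    using lip[of n w "F w"] by (simp add: funpow_swap1)
  show "\<exists>v. F v = v"
  proof -
    let ?X = "\<lambda>n. (F ^^ n) 0"
    have "summable (\<lambda>n. (F ^^ Suc n) 0 - (F ^^ n) 0)"
    proof (rule summable_norm_cancel, rule summable_comparison_test')
      show "summable (\<lambda>n. a n * norm (0 - F 0))" using sum by (rule summable_mult2)
      show "norm (norm ((F ^^ Suc n) 0 - (F ^^ n) 0)) \<le> a n * norm (0 - F 0)" for n
        using step[of n 0] by (simp add: norm_minus_commute)
    qed
    then have "convergent (\<lambda>n. \<Sum>i<n. (F ^^ Suc i) 0 - (F ^^ i) 0)" by (simp only: summable_iff_convergent)
    then have "convergent ?X" unfolding sum_lessThan_telescope[of "\<lambda>i. (F ^^ i) 0"] by simp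
    then obtain v where v: "?X \<longlonglongrightarrow> v" by (auto simp: convergent_def)
    have "(\<lambda>n. a 1 * norm (?X n - v)) \<longlonglongrightarrow> a 1 * norm (v - v)" by (intro tendsto_intros v)
    then have lim: "(\<lambda>n. a 1 * norm (?X n - v)) \<longlonglongrightarrow> 0" by simp
    have "norm (?X (Suc n) - F v) \<le> a 1 * norm (?X n - v)" for n using lip[of 1 "?X n" v] by simp
    then have "(\<lambda>n. ?X (Suc n) - F v) \<longlonglongrightarrow> 0"
      by (rule Lim_null_comparison[OF always_eventually[OF allI] lim])
    then have "(\<lambda>n. ?X (Suc n)) \<longlonglongrightarrow> F v" by (simp add: LIM_zero_iff)
    moreover have "(\<lambda>n. ?X (Suc n)) \<longlonglongrightarrow> v" using v by (rule LIMSEQ_Suc)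
    ultimately have "F v = v" by (rule LIMSEQ_unique)
    then show ?thesis ..
  qed
  assume v: "F v = v"
  then have vn: "(F ^^ n) v = v" for n by (induction n) auto
  \<comment> \<open>\<open>norm (w - v)\<close> stands on both sides; its factor \<open>a n\<close>
    tends to 0 because \<open>a\<close> is summable.\<close>
  have le: "norm (w - v) \<le> (\<Sum>i<n. a i * norm (w - F w)) + a n * norm (w - v)" for n
  proof -
    have "norm (w - (F ^^ n) w) \<le> (\<Sum>i<n. a i * norm (w - F w))"
    proof (induction n)
      case (Suc n)
      have "w - (F ^^ Suc n) w = (w - (F ^^ n) w) + ((F ^^ n) w - (F ^^ Suc n) w)" by simp
      then show ?case using Suc step[of n w] norm_triangle_ineq[of "w - (F ^^ n) w" "(F ^^ n) w - (F ^^ Suc n) w"]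
        by simp
    qed simp
    moreover have "norm ((F ^^ n) w - v) \<le> a n * norm (w - v)" using lip[of n w v] by (simp add: vn)
    ultimately show ?thesis using norm_triangle_ineq[of "w - (F ^^ n) w" "(F ^^ n) w - v"] by simp
  qed
  have "(\<lambda>n. (\<Sum>i<n. a i * norm (w - F w)) + a n * norm (w - v)) \<longlonglongrightarrow> suminf a * norm (w - F w) + 0 * norm (w - v)"
    unfolding sum_distrib_right[symmetric]
    by (intro tendsto_intros summable_LIMSEQ sum summable_LIMSEQ_zero)
  then show "norm (w - v) \<le> suminf a * norm (w - F w)"
    using le by (intro tendsto_lowerbound[of _ "suminf a * norm (w - F w)"]) auto
qed

text \<open>Duhamel's formula for the scalar equation with decay rate \<open>\<nu>\<close>, forcing
  \<open>\<kappa>\<close> times \<open>g\<close> and initial value \<open>z\<close>.\<close>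

definition mode :: "real \<Rightarrow> real \<Rightarrow> complex \<Rightarrow> (real \<Rightarrow> complex) \<Rightarrow> real \<Rightarrow> complex" where
  "mode \<nu> \<kappa> z g t = exp (- \<nu> * t) *\<^sub>R (z + \<kappa> *\<^sub>R integral {0..t} (\<lambda>s. exp (\<nu> * s) *\<^sub>R g s))"

lemma mode_has_vector_derivative:
  assumes "continuous_on {0..T} g" "t \<in> {0..T}"
  shows "(mode \<nu> \<kappa> z g has_vector_derivative (- \<nu>) *\<^sub>R mode \<nu> \<kappa> z g t + \<kappa> *\<^sub>R g t) (at t within {0..T})"
proof -
  let ?I = "\<lambda>t. integral {0..t} (\<lambda>s. exp (\<nu> * s) *\<^sub>R g s)"
  have "(?I has_vector_derivative exp (\<nu> * t) *\<^sub>R g t) (at t within {0..T})"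
    using assms by (intro integral_has_vector_derivative continuous_intros)
  then have I: "((\<lambda>t. z + \<kappa> *\<^sub>R ?I t) has_vector_derivative \<kappa> *\<^sub>R (exp (\<nu> * t) *\<^sub>R g t)) (at t within {0..T})"
    by (auto intro!: derivative_eq_intros)
  have e: "((\<lambda>t. exp (- \<nu> * t)) has_real_derivative - \<nu> * exp (- \<nu> * t)) (at t within {0..T})"
    by (auto intro!: derivative_eq_intros)
  have "exp (- \<nu> * t) * (\<kappa> * exp (\<nu> * t)) = \<kappa>"
    by (simp add: exp_minus field_simps)
  then have *: "exp (- \<nu> * t) *\<^sub>R (\<kappa> *\<^sub>R (exp (\<nu> * t) *\<^sub>R g t)) + (- \<nu> * exp (- \<nu> * t)) *\<^sub>R (z + \<kappa> *\<^sub>R ?I t)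
      = (- \<nu>) *\<^sub>R mode \<nu> \<kappa> z g t + \<kappa> *\<^sub>R g t"
    by (simp only: mode_def scaleR_scaleR add.commute)
  show ?thesis
    using has_vector_derivative_scaleR[OF e I] unfolding * by (simp only: mode_def[abs_def])
qed

lemma mode_0 [simp]: "mode \<nu> \<kappa> z g 0 = z"
  by (simp add: mode_def)

lemma mode_continuous: "continuous_on {0..T} g \<Longrightarrow> continuous_on {0..T} (mode \<nu> \<kappa> z g)"
  by (rule continuous_on_vector_derivative, rule mode_has_vector_derivative)

lemma mode_cnj: "mode \<nu> \<kappa> (cnj z) (\<lambda>s. cnj (g s)) t = cnj (mode \<nu> \<kappa> z g t)"
proof -
  have "integral {0..t} (\<lambda>s. exp (\<nu> * s) *\<^sub>R cnj (g s)) = cnj (integral {0..t} (\<lambda>s. exp (\<nu> * s) *\<^sub>R g s))"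
    unfolding integral_cnj by simp
  then show ?thesis by (simp add: mode_def)
qed

lemma mode_lin:
  assumes "continuous_on {0..T} g" "continuous_on {0..T} h" "t \<in> {0..T}"
  shows "mode \<nu> \<kappa> (of_real c * z + w) (\<lambda>s. of_real c * g s + h s) t = of_real c * mode \<nu> \<kappa> z g t + mode \<nu> \<kappa> w h t"
proof -
  have i: "(\<lambda>s. exp (\<nu> * s) *\<^sub>R f s) integrable_on {0..t}" if "continuous_on {0..T} f" for f :: "real \<Rightarrow> complex"
    using that assms(3) by (intro integrable_continuous_interval continuous_intros continuous_on_subset[OF that]) auto
  have "integral {0..t} (\<lambda>s. exp (\<nu> * s) *\<^sub>R (of_real c * g s + h s))
    = integral {0..t} (\<lambda>s. c *\<^sub>R (exp (\<nu> * s) *\<^sub>R g s) + exp (\<nu> * s) *\<^sub>R h s)"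
    by (simp add: scaleR_conv_of_real algebra_simps)
  also have "\<dots> = c *\<^sub>R integral {0..t} (\<lambda>s. exp (\<nu> * s) *\<^sub>R g s) + integral {0..t} (\<lambda>s. exp (\<nu> * s) *\<^sub>R h s)"
    by (subst integral_add[OF integrable_cmul[OF i[OF assms(1)]] i[OF assms(2)]]) (simp only: integral_cmul)
  finally show ?thesis unfolding mode_def by (simp add: scaleR_conv_of_real algebra_simps)
qed

text \<open>Young's inequality with \<open>\<kappa>\<^sup>2 \<le> \<nu>\<close> lets half of the
  dissipation absorb the forcing. The constants do not depend on the mode, so the inequality can be
  summed over all modes.\<close>

lemma parabolic_energy:
  fixes z g :: "real \<Rightarrow> complex"
  assumes z: "\<And>t. t \<in> {0..T} \<Longrightarrow> (z has_vector_derivative (- \<nu>) *\<^sub>R z t + \<kappa> *\<^sub>R g t) (at t within {0..T})"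
    and g: "continuous_on {0..T} g" and \<nu>: "\<kappa>\<^sup>2 \<le> \<nu>" and t: "t \<in> {0..T}"
  shows "(cmod (z t))\<^sup>2 + \<nu> * integral {0..t} (\<lambda>s. (cmod (z s))\<^sup>2)
    \<le> (cmod (z 0))\<^sup>2 + integral {0..t} (\<lambda>s. (cmod (g s))\<^sup>2)"
proof -
  have "continuous_on {0..T} z" by (rule continuous_on_vector_derivative[OF z])
  then have zc: "continuous_on {0..t} z" using t by (auto intro: continuous_on_subset)
  have gc: "continuous_on {0..t} g" using g t by (auto intro: continuous_on_subset)
  let ?d = "\<lambda>s. 2 * (z s \<bullet> ((- \<nu>) *\<^sub>R z s + \<kappa> *\<^sub>R g s))"
  have d: "((\<lambda>s. z s \<bullet> z s) has_vector_derivative ?d s) (at s within {0..t})" if "s \<in> {0..t}" for s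
  proof -
    have "(z has_vector_derivative (- \<nu>) *\<^sub>R z s + \<kappa> *\<^sub>R g s) (at s within {0..t})"
      using has_vector_derivative_within_subset[OF z[of s], of "{0..t}"] that t by auto
    from bounded_bilinear.has_vector_derivative[OF bounded_bilinear_inner this this]
    show ?thesis by (simp add: inner_commute)
  qed
  have "(?d has_integral (z t \<bullet> z t - z 0 \<bullet> z 0)) {0..t}"
    using t by (intro fundamental_theorem_of_calculus d) auto
  moreover have "((\<lambda>s. - \<nu> * (cmod (z s))\<^sup>2 + (cmod (g s))\<^sup>2) has_integral
      (- \<nu> * integral {0..t} (\<lambda>s. (cmod (z s))\<^sup>2) + integral {0..t} (\<lambda>s. (cmod (g s))\<^sup>2))) {0..t}"
    by (intro has_integral_add has_integral_mult_right integrable_integral integrable_continuous_interval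
        continuous_intros zc gc)
  moreover have "?d s \<le> - \<nu> * (cmod (z s))\<^sup>2 + (cmod (g s))\<^sup>2" for s
  proof -
    have "2 * (\<kappa> * (z s \<bullet> g s)) \<le> \<kappa>\<^sup>2 * (z s \<bullet> z s) + g s \<bullet> g s"
      using inner_ge_zero[of "\<kappa> *\<^sub>R z s - g s"]
      by (simp add: inner_diff_left inner_diff_right inner_commute power2_eq_square algebra_simps)
    then have "2 * (\<kappa> * (z s \<bullet> g s)) \<le> \<kappa>\<^sup>2 * (cmod (z s))\<^sup>2 + (cmod (g s))\<^sup>2"
      unfolding power2_norm_eq_inner .
    moreover have "\<kappa>\<^sup>2 * (cmod (z s))\<^sup>2 \<le> \<nu> * (cmod (z s))\<^sup>2" using \<nu> by (rule mult_right_mono) simp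
    ultimately show ?thesis by (simp add: inner_add_right power2_norm_eq_inner algebra_simps)
  qed
  ultimately have "z t \<bullet> z t - z 0 \<bullet> z 0 \<le> - \<nu> * integral {0..t} (\<lambda>s. (cmod (z s))\<^sup>2) + integral {0..t} (\<lambda>s. (cmod (g s))\<^sup>2)"
    by (rule has_integral_le)
  then show ?thesis by (simp add: power2_norm_eq_inner)
qed

text \<open>A summable majorant of the squares makes the tails uniformly small, so finitely many
  continuous coefficients decide.\<close>

lemma continuous_on_hl2I:
  fixes f :: "'a::metric_space \<Rightarrow> 'k::ab_group_add hl2"
  assumes cont: "\<And>k. continuous_on A (\<lambda>t. coef (f t) k)"
    and le: "\<And>t k. t \<in> A \<Longrightarrow> (cmod (coef (f t) k))\<^sup>2 \<le> M k" and sum: "M summable_on UNIV"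
  shows "continuous_on A f"
  unfolding continuous_on_def
proof (intro ballI tendstoI)
  fix x and e :: real assume x: "x \<in> A" and e: "e > 0"
  \<comment> \<open>The finite block will contribute less than \<open>d\<close> and the tail at most
    \<open>4 * d\<close>, because a squared difference is at most \<open>4 * M k\<close>; the total
    stays below \<open>e\<^sup>2\<close>.\<close>
  define d where "d = e\<^sup>2 / 6"
  have d: "d > 0" using e by (simp add: d_def)
  have M0: "0 \<le> M k" for k using order_trans[OF zero_le_power2 le[OF x]] .
  obtain F where F: "finite F" "dist (sum M F) (infsum M UNIV) \<le> d"
    using infsum_finite_approximation[OF sum d] by blast
  have tail: "sum M G \<le> d" if "finite G" "G \<inter> F = {}" for G
  proof -
    have "sum M (G \<union> F) \<le> infsum M UNIV" using F that M0 by (intro finite_sum_le_infsum sum) auto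
    then show ?thesis using F that by (simp add: sum.union_disjoint dist_real_def)
  qed
  have "((\<lambda>t. \<Sum>k\<in>F. (cmod (coef (f t) k - coef (f x) k))\<^sup>2) \<longlongrightarrow> (\<Sum>k\<in>F. (cmod (coef (f x) k - coef (f x) k))\<^sup>2)) (at x within A)"
    using cont x by (intro tendsto_intros) (auto simp: continuous_on_def)
  then have "\<forall>\<^sub>F t in at x within A. (\<Sum>k\<in>F. (cmod (coef (f t) k - coef (f x) k))\<^sup>2) < d"
    using d by (intro order_tendstoD(2)) auto
  moreover have "\<forall>\<^sub>F t in at x within A. t \<in> A" by (simp add: eventually_at_filter)
  ultimately show "\<forall>\<^sub>F t in at x within A. dist (f t) (f x) < e"
  proof eventually_elim
    case (elim t)
    have "(norm (f t - f x))\<^sup>2 \<le> 5 * d"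
    proof (rule norm_sq_hl2_le)
      fix G :: "'k set" assume G: "finite G"
      let ?s = "\<lambda>k. (cmod (coef (f t) k - coef (f x) k))\<^sup>2"
      have s: "?s k \<le> 4 * M k" for k
      proof -
        have "?s k \<le> (cmod (coef (f t) k) + cmod (coef (f x) k))\<^sup>2" by (intro power_mono norm_triangle_ineq4) simp
        also have "\<dots> \<le> 2 * (cmod (coef (f t) k))\<^sup>2 + 2 * (cmod (coef (f x) k))\<^sup>2"
          using zero_le_power2[of "cmod (coef (f t) k) - cmod (coef (f x) k)"] by (simp add: power2_eq_square algebra_simps)
        also have "\<dots> \<le> 4 * M k" using le[OF elim(2)] le[OF x] by (smt (verit))
        finally show ?thesis .
      qed
      have "sum ?s G \<le> sum ?s (F \<union> (G - F))" using F G by (intro sum_mono2) auto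
      also have "\<dots> = sum ?s F + sum ?s (G - F)" using F G by (subst sum.union_disjoint) auto
      also have "sum ?s (G - F) \<le> 4 * sum M (G - F)" unfolding sum_distrib_left by (intro sum_mono s)
      also have "sum M (G - F) \<le> d" using G by (intro tail) auto
      finally show "(\<Sum>k\<in>G. (cmod (coef (f t - f x) k))\<^sup>2) \<le> 5 * d" using elim by simp
    qed
    also have "\<dots> < e\<^sup>2" using e by (simp add: d_def)
    finally have "norm (f t - f x) < e" by (rule power_less_imp_less_base) (use e in simp)
    then show ?case by (simp add: dist_norm)
  qed
qed

section \<open>Trajectories generated by initial datum and source\<close>

instance bcontfun :: (metric_space, banach) banach ..

text \<open>The source is bounded and continuous on the whole line so that \<open>bcontfun\<close>
  provides a Banach space; trajectories use it on \<open>{0..T}\<close> and are frozen outside by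
  clamping the time.\<close>

type_synonym 'k traj_data = "'k hl2 \<times> (real \<Rightarrow>\<^sub>C 'k hl2)"

abbreviation src :: "'k::ab_group_add traj_data \<Rightarrow> real \<Rightarrow> 'k hl2" where
  "src x \<equiv> apply_bcontfun (snd x)"

text \<open>\<open>kappa_le\<close> says that the forcing carries at most half the order of the
  dissipation. The parity conditions keep symmetric families symmetric.\<close>

locale parabolic =
  fixes \<nu> \<kappa> :: "'k::ab_group_add \<Rightarrow> real" and T :: real
  assumes kappa_le: "(\<kappa> k)\<^sup>2 \<le> \<nu> k" and nu_even: "\<nu> (- k) = \<nu> k" and kappa_even: "\<kappa> (- k) = \<kappa> k"
    and T_pos: "0 < T"
begin

definition clampT :: "real \<Rightarrow> real" where "clampT t = max 0 (min T t)"

lemma clampT_in: "clampT t \<in> {0..T}" using T_pos by (auto simp: clampT_def)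
lemma clampT_id: "t \<in> {0..T} \<Longrightarrow> clampT t = t" by (auto simp: clampT_def)

definition traj_coef :: "'k traj_data \<Rightarrow> real \<Rightarrow> 'k \<Rightarrow> complex" where
  "traj_coef x t k = mode (\<nu> k) (\<kappa> k) (coef (fst x) k) (\<lambda>s. coef (src x s) k) (clampT t)"

definition traj :: "'k traj_data \<Rightarrow> real \<Rightarrow> 'k hl2" where "traj x t = Hl2 (traj_coef x t)"

lemma coef_snd_continuous: "continuous_on A (\<lambda>s. coef (src x s) k)"
  by (intro bounded_linear.continuous_on[OF bounded_linear_coef] continuous_on_apply_bcontfun)

lemma traj_coef_deriv:
  assumes "t \<in> {0..T}"
  shows "((\<lambda>t. traj_coef x t k) has_vector_derivative (- \<nu> k) *\<^sub>R traj_coef x t k + \<kappa> k *\<^sub>R coef (src x t) k) (at t within {0..T})"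
proof (rule has_vector_derivative_transform[OF assms])
  let ?m = "mode (\<nu> k) (\<kappa> k) (coef (fst x) k) (\<lambda>s. coef (src x s) k)"
  show "(?m has_vector_derivative (- \<nu> k) *\<^sub>R traj_coef x t k + \<kappa> k *\<^sub>R coef (src x t) k) (at t within {0..T})"
    unfolding traj_coef_def clampT_id[OF assms] by (rule mode_has_vector_derivative[OF coef_snd_continuous assms])
qed (simp add: traj_coef_def clampT_id)

lemma traj_coef_continuous: "continuous_on UNIV (\<lambda>t. traj_coef x t k)"
proof -
  have "continuous_on UNIV (mode (\<nu> k) (\<kappa> k) (coef (fst x) k) (\<lambda>s. coef (src x s) k) \<circ> clampT)"
  proof (rule continuous_on_compose)
    show "continuous_on UNIV clampT" unfolding clampT_def by (intro continuous_intros)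
    show "continuous_on (clampT ` UNIV) (mode (\<nu> k) (\<kappa> k) (coef (fst x) k) (\<lambda>s. coef (src x s) k))"
      by (rule continuous_on_subset[OF mode_continuous[where T = T, OF coef_snd_continuous]]) (use clampT_in in auto)
  qed
  then show ?thesis by (simp add: traj_coef_def comp_def)
qed

lemma norm_snd_continuous: "continuous_on A (\<lambda>s. (norm (src x s))\<^sup>2)" for x :: "'k traj_data"
  by (intro continuous_intros continuous_on_apply_bcontfun)

lemma traj_coef_energy1:
  assumes "t \<in> {0..T}"
  shows "(cmod (traj_coef x t k))\<^sup>2 + \<nu> k * integral {0..t} (\<lambda>s. (cmod (traj_coef x s k))\<^sup>2)
    \<le> (cmod (coef (fst x) k))\<^sup>2 + integral {0..t} (\<lambda>s. (cmod (coef (src x s) k))\<^sup>2)"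
proof -
  have "traj_coef x 0 k = coef (fst x) k" using T_pos by (simp add: traj_coef_def clampT_def)
  then show ?thesis
    using parabolic_energy[OF traj_coef_deriv coef_snd_continuous kappa_le assms, of x k] by simp
qed

lemma traj_coef_energy:
  assumes t: "t \<in> {0..T}" and F: "finite F"
  shows "(\<Sum>k\<in>F. (cmod (traj_coef x t k))\<^sup>2 + \<nu> k * integral {0..t} (\<lambda>s. (cmod (traj_coef x s k))\<^sup>2))
    \<le> (norm (fst x))\<^sup>2 + integral {0..t} (\<lambda>s. (norm (src x s))\<^sup>2)"
proof -
  have "(\<Sum>k\<in>F. (cmod (traj_coef x t k))\<^sup>2 + \<nu> k * integral {0..t} (\<lambda>s. (cmod (traj_coef x s k))\<^sup>2))
    \<le> (\<Sum>k\<in>F. (cmod (coef (fst x) k))\<^sup>2 + integral {0..t} (\<lambda>s. (cmod (coef (src x s) k))\<^sup>2))"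
    by (intro sum_mono traj_coef_energy1 t)
  also have "\<dots> = (\<Sum>k\<in>F. (cmod (coef (fst x) k))\<^sup>2) + integral {0..t} (\<lambda>s. \<Sum>k\<in>F. (cmod (coef (src x s) k))\<^sup>2)"
    using F by (subst integral_sum)
      (auto simp: sum.distrib intro!: integrable_continuous_interval continuous_intros coef_snd_continuous)
  also have "\<dots> \<le> (norm (fst x))\<^sup>2 + integral {0..t} (\<lambda>s. (norm (src x s))\<^sup>2)"
    using F by (intro add_mono sum_coef_le integral_le integrable_continuous_interval continuous_intros
        coef_snd_continuous norm_snd_continuous)
  finally show ?thesis .
qed

lemma nu_nonneg: "0 \<le> \<nu> k" using order_trans[OF zero_le_power2 kappa_le] .

lemma traj_coef_sum:
  assumes F: "finite F"
  shows "(\<Sum>k\<in>F. (cmod (traj_coef x t k))\<^sup>2) \<le> (norm (fst x))\<^sup>2 + integral {0..clampT t} (\<lambda>s. (norm (src x s))\<^sup>2)"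
proof -
  have "traj_coef x (clampT t) k = traj_coef x t k" for k
    unfolding traj_coef_def clampT_id[OF clampT_in] ..
  moreover have "(\<Sum>k\<in>F. (cmod (traj_coef x (clampT t) k))\<^sup>2) \<le> (\<Sum>k\<in>F. (cmod (traj_coef x (clampT t) k))\<^sup>2
      + \<nu> k * integral {0..clampT t} (\<lambda>s. (cmod (traj_coef x s k))\<^sup>2))"
    by (intro sum_mono)
      (auto intro!: mult_nonneg_nonneg nu_nonneg integral_nonneg integrable_continuous_interval continuous_intros
        continuous_on_subset[OF traj_coef_continuous])
  ultimately show ?thesis using traj_coef_energy[OF clampT_in F, of x t] by simp
qed

lemma coef_traj: "coef (traj x t) k = traj_coef x t k"
proof -
  let ?C = "(norm (fst x))\<^sup>2 + integral {0..clampT t} (\<lambda>s. (norm (src x s))\<^sup>2)"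
  have C0: "0 \<le> ?C" using traj_coef_sum[of "{}"] by simp
  have "coef (traj x t) = traj_coef x t"
    unfolding traj_def
  proof (rule coef_Hl2)
    show "traj_coef x t (- k) = cnj (traj_coef x t k)" for k
      unfolding traj_coef_def nu_even kappa_even coef_uminus mode_cnj ..
    show "l2_bound (traj_coef x t) (sqrt ?C)"
      using traj_coef_sum C0 by (intro l2_boundI) auto
  qed
  then show ?thesis by simp
qed

lemma traj_energy: "(norm (traj x t))\<^sup>2 \<le> (norm (fst x))\<^sup>2 + integral {0..clampT t} (\<lambda>s. (norm (src x s))\<^sup>2)"
  by (rule norm_sq_hl2_le) (simp add: coef_traj traj_coef_sum)

lemma norm_src_le: "norm (src x s) \<le> norm x" for x :: "'k traj_data"
proof -
  have "norm (src x s) \<le> norm (snd x)" by (rule norm_bounded)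
  also have "\<dots> \<le> norm x" using norm_snd_le[of "snd x" "fst x"] by simp
  finally show ?thesis .
qed

lemma norm_traj_le: "norm (traj x t) \<le> sqrt (1 + T) * norm x"
proof -
  have "integral {0..clampT t} (\<lambda>s. (norm (src x s))\<^sup>2) \<le> integral {0..clampT t} (\<lambda>s. (norm x)\<^sup>2)"
    by (intro integral_le integrable_continuous_interval norm_snd_continuous continuous_intros power_mono norm_src_le norm_ge_zero)
  also have "\<dots> \<le> T * (norm x)\<^sup>2" using clampT_in[of t] by (auto intro: mult_right_mono)
  finally have "(norm (traj x t))\<^sup>2 \<le> (norm (fst x))\<^sup>2 + T * (norm x)\<^sup>2" using traj_energy[of x t] by simp
  also have "(norm (fst x))\<^sup>2 \<le> (norm x)\<^sup>2" using norm_fst_le[of "fst x" "snd x"] by (intro power_mono) auto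
  finally have "(norm (traj x t))\<^sup>2 \<le> (1 + T) * (norm x)\<^sup>2" by (simp add: algebra_simps)
  also have "\<dots> = (sqrt (1 + T) * norm x)\<^sup>2" using T_pos by (simp add: power_mult_distrib)
  finally show ?thesis by (rule power2_le_imp_le) (use T_pos in simp)
qed

text \<open>The energy inequality of each mode, with the source integral extended to
  \<open>{0..T}\<close>, gives a majorant independent of time that is summable by the bounds on the
  data.\<close>

lemma traj_continuous: "continuous_on A (traj x)"
proof -
  let ?M = "\<lambda>k. (cmod (coef (fst x) k))\<^sup>2 + integral {0..T} (\<lambda>s. (cmod (coef (src x s) k))\<^sup>2)"
  have "continuous_on UNIV (traj x)"
  proof (rule continuous_on_hl2I)
    show "continuous_on UNIV (\<lambda>t. coef (traj x t) k)" for k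
      unfolding coef_traj by (rule traj_coef_continuous)
    have int0: "0 \<le> integral {a..b} (\<lambda>s. (cmod (coef (src x s) k))\<^sup>2)" for k a b
      by (intro integral_nonneg integrable_continuous_interval continuous_intros coef_snd_continuous) auto
    show "(cmod (coef (traj x t) k))\<^sup>2 \<le> ?M k" for t k
    proof -
      have "traj_coef x (clampT t) k = traj_coef x t k"
        unfolding traj_coef_def clampT_id[OF clampT_in] ..
      then have "(cmod (traj_coef x t k))\<^sup>2 \<le> (cmod (coef (fst x) k))\<^sup>2 + integral {0..clampT t} (\<lambda>s. (cmod (coef (src x s) k))\<^sup>2)"
        using traj_coef_energy1[OF clampT_in, of x t k]
          mult_nonneg_nonneg[OF nu_nonneg[of k] integral_nonneg[of "\<lambda>s. (cmod (traj_coef x s k))\<^sup>2" "{0..clampT t}"]]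
          integrable_continuous_interval[OF continuous_on_power[OF continuous_on_norm[OF continuous_on_subset[OF traj_coef_continuous[of x k] subset_UNIV[of "{0..clampT t}"]]], of 2]]
        by simp
      also have "integral {0..clampT t} (\<lambda>s. (cmod (coef (src x s) k))\<^sup>2) \<le> integral {0..T} (\<lambda>s. (cmod (coef (src x s) k))\<^sup>2)"
        using clampT_in[of t]
        by (intro integral_subset_le integrable_continuous_interval continuous_intros coef_snd_continuous) auto
      finally show ?thesis by (simp add: coef_traj)
    qed
    show "?M summable_on UNIV"
    proof (rule nonneg_bdd_above_summable_on)
      show "bdd_above (sum ?M ` {F. F \<subseteq> UNIV \<and> finite F})"
      proof (rule bdd_aboveI2)
        fix F :: "'k set" assume "F \<in> {F. F \<subseteq> UNIV \<and> finite F}"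
        then have F: "finite F" by simp
        have "sum ?M F = (\<Sum>k\<in>F. (cmod (coef (fst x) k))\<^sup>2) + integral {0..T} (\<lambda>s. \<Sum>k\<in>F. (cmod (coef (src x s) k))\<^sup>2)"
          using F by (subst integral_sum)
            (auto simp: sum.distrib intro!: integrable_continuous_interval continuous_intros coef_snd_continuous)
        also have "\<dots> \<le> (norm (fst x))\<^sup>2 + integral {0..T} (\<lambda>s. (norm (src x s))\<^sup>2)"
          using F by (intro add_mono sum_coef_le integral_le integrable_continuous_interval continuous_intros
              coef_snd_continuous norm_snd_continuous)
        finally show "sum ?M F \<le> (norm (fst x))\<^sup>2 + integral {0..T} (\<lambda>s. (norm (src x s))\<^sup>2)" .
      qed
    qed (use int0 in simp)
  qed
  then show ?thesis by (rule continuous_on_subset) simp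
qed

lemma traj_lin: "traj (c *\<^sub>R x + y) t = c *\<^sub>R traj x t + traj y t"
proof (rule hl2_eqI)
  fix k
  have "(\<lambda>s. coef (src (c *\<^sub>R x + y) s) k) = (\<lambda>s. of_real c * coef (src x s) k + coef (src y s) k)"
    by (simp add: fun_eq_iff)
  then show "coef (traj (c *\<^sub>R x + y) t) k = coef (c *\<^sub>R traj x t + traj y t) k"
    using mode_lin[OF coef_snd_continuous coef_snd_continuous clampT_in, of "\<nu> k" "\<kappa> k" c "coef (fst x) k" "coef (fst y) k" x k y k t]
    by (simp add: coef_traj traj_coef_def)
qed

lemma traj_diff: "traj (x - y) t = traj x t - traj y t"
  using traj_lin[of "-1" y x t] by (simp add: algebra_simps)

text \<open>Square roots appear because the iteration runs on squared norms. The shift by one: the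
  first application compares source and trajectory without gaining an integration, every later one
  integrates once in time.\<close>

definition volterra_coeff :: "real \<Rightarrow> nat \<Rightarrow> real" where
  "volterra_coeff A n = (if n = 0 then 1 else sqrt (A * (1 + T) * (A * T) ^ (n - 1) / fact (n - 1)))"

lemma summable_volterra_coeff: assumes "0 \<le> A" shows "summable (volterra_coeff A)"
proof -
  have half: "x / 2 \<le> x" if "0 \<le> x" for x :: real using that by simp
  have "summable (\<lambda>n. sqrt (A * (1 + T)) * (((4 * A * T) ^ n /\<^sub>R fact n + (1 / 4) ^ n)))"
    by (intro summable_mult summable_add summable_exp_generic summable_geometric) simp
  then have "summable (\<lambda>n. volterra_coeff A (Suc n))"
  proof (rule summable_comparison_test')
    fix n
    let ?u = "(4 * A * T) ^ n / fact n" and ?w = "(1 / 4 :: real) ^ n"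
    have u: "0 \<le> ?u" using assms T_pos by simp
    \<comment> \<open>The arithmetic-geometric mean splits the square root into an exponential
      series in \<open>4 * A * T\<close> and a geometric series of ratio 1/4.\<close>
    have "sqrt (?u * ?w) \<le> (?u + ?w) / 2" using u by (intro arith_geo_mean_sqrt) auto
    then have "sqrt ((A * T) ^ n / fact n) \<le> (?u + ?w) / 2"
      by (simp add: power_mult_distrib power_divide)
    moreover have "0 \<le> ?u + ?w" using u by (intro add_nonneg_nonneg) auto
    then have "(?u + ?w) / 2 \<le> ?u + ?w" by (rule half)
    ultimately have "sqrt ((A * T) ^ n / fact n) \<le> ?u + ?w" by (meson order_trans)
    then have *: "sqrt (A * (1 + T)) * sqrt ((A * T) ^ n / fact n) \<le> sqrt (A * (1 + T)) * (?u + ?w)"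
      using assms T_pos by (intro mult_left_mono) auto
    then show "norm (volterra_coeff A (Suc n)) \<le> sqrt (A * (1 + T)) * (((4 * A * T) ^ n /\<^sub>R fact n + (1 / 4) ^ n))"
    proof -
      have "volterra_coeff A (Suc n) = sqrt ((A * (1 + T)) * ((A * T) ^ n / fact n))"
        by (simp add: volterra_coeff_def)
      then have "volterra_coeff A (Suc n) = sqrt (A * (1 + T)) * sqrt ((A * T) ^ n / fact n)"
        by (simp only: real_sqrt_mult)
      moreover have "0 \<le> volterra_coeff A (Suc n)"
        using assms T_pos by (simp add: volterra_coeff_def)
      moreover have "(4 * A * T) ^ n /\<^sub>R fact n = ?u" by (simp add: divide_inverse)
      ultimately show ?thesis using * by (simp only: real_norm_def abs_of_nonneg)
    qed
  qed
  then show ?thesis by (simp only: summable_Suc_iff)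
qed

text \<open>The bound is kept pointwise in time, since integrating a power of the time up to
  \<open>t\<close> produces the next factorial. The initial component of \<open>F x\<close> is the
  same for all \<open>x\<close>, so it cancels after one step.\<close>

lemma volterra_iterates:
  fixes F :: "'k traj_data \<Rightarrow> 'k traj_data"
  assumes A: "0 \<le> A" and fst: "\<And>x y. fst (F x) = fst (F y)"
    and snd: "\<And>x y t. (norm (src (F x) t - src (F y) t))\<^sup>2 \<le> A * (norm (traj x t - traj y t))\<^sup>2"
  shows "norm ((F ^^ n) x - (F ^^ n) y) \<le> volterra_coeff A n * norm (x - y)"
proof (cases n)
  case 0
  then show ?thesis by (simp add: volterra_coeff_def)
next
  case (Suc n')
  have fsts: "fst ((F ^^ Suc m) x - (F ^^ Suc m) y) = 0" for m using fst[of "(F ^^ m) x" "(F ^^ m) y"] by simp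
  have "(norm (src ((F ^^ Suc m) x - (F ^^ Suc m) y) t))\<^sup>2 \<le> A * (1 + T) * (norm (x - y))\<^sup>2 * ((A * clampT t) ^ m / fact m)" for m t
  proof (induction m arbitrary: t)
    case 0
    have "(norm (traj x t - traj y t))\<^sup>2 \<le> (sqrt (1 + T) * norm (x - y))\<^sup>2"
      using norm_traj_le[of "x - y" t] by (intro power_mono) (auto simp: traj_diff)
    also have "\<dots> = (1 + T) * (norm (x - y))\<^sup>2" using T_pos by (simp add: power_mult_distrib)
    finally have "A * (norm (traj x t - traj y t))\<^sup>2 \<le> A * ((1 + T) * (norm (x - y))\<^sup>2)"
      using A by (rule mult_left_mono)
    then show ?case using snd[of x t y] by simp
  next
    case (Suc m)
    let ?X = "(F ^^ Suc m) x" and ?Y = "(F ^^ Suc m) y"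
    let ?C = "A * (1 + T) * (norm (x - y))\<^sup>2"
    let ?t = "clampT t"
    have t: "0 \<le> ?t" using clampT_in[of t] by simp
    have "(norm (traj ?X t - traj ?Y t))\<^sup>2 \<le> integral {0..?t} (\<lambda>s. (norm (src (?X - ?Y) s))\<^sup>2)"
      using traj_energy[of "?X - ?Y" t] unfolding fsts by (simp add: traj_diff)
    also have "\<dots> \<le> integral {0..?t} (\<lambda>s. ?C * ((A * s) ^ m / fact m))"
    proof (intro integral_le integrable_continuous_interval norm_snd_continuous continuous_intros)
      fix s assume "s \<in> {0..?t}"
      then have "s \<in> {0..T}" using clampT_in[of t] by auto
      then show "(norm (src (?X - ?Y) s))\<^sup>2 \<le> ?C * ((A * s) ^ m / fact m)"
        using Suc.IH[of s] by (simp only: clampT_id)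
    qed simp
    also have "\<dots> = ?C * (A ^ m * ?t ^ Suc m / fact (Suc m))"
    proof -
      have "((\<lambda>s. ?C * ((A * s) ^ m / fact m)) has_integral (?C * (A ^ m * ?t ^ Suc m / fact (Suc m)) - ?C * (A ^ m * 0 ^ Suc m / fact (Suc m)))) {0..?t}"
      proof (rule fundamental_theorem_of_calculus[OF t])
        fix s assume "s \<in> {0..?t}"
        have "((\<lambda>s. (?C * A ^ m / fact (Suc m)) * s ^ Suc m) has_real_derivative
            (?C * A ^ m / fact (Suc m)) * (real (Suc m) * s ^ m)) (at s within {0..?t})"
          by (auto intro!: derivative_eq_intros simp del: power_Suc)
        moreover have "(?C * A ^ m / fact (Suc m)) * (real (Suc m) * s ^ m) = ?C * ((A * s) ^ m / fact m)"
          unfolding fact_Suc by (simp add: power_mult_distrib del: of_nat_Suc)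
        moreover have "(\<lambda>s. (?C * A ^ m / fact (Suc m)) * s ^ Suc m) = (\<lambda>s. ?C * (A ^ m * s ^ Suc m / fact (Suc m)))"
          by (simp add: fun_eq_iff)
        ultimately have "((\<lambda>s. ?C * (A ^ m * s ^ Suc m / fact (Suc m))) has_real_derivative ?C * ((A * s) ^ m / fact m)) (at s within {0..?t})"
          by (simp only:)
        then show "((\<lambda>s. ?C * (A ^ m * s ^ Suc m / fact (Suc m))) has_vector_derivative ?C * ((A * s) ^ m / fact m)) (at s within {0..?t})"
          by (simp add: has_real_derivative_iff_has_vector_derivative)
      qed
      moreover have "?C * (A ^ m * 0 ^ Suc m / fact (Suc m)) = 0" by simp
      ultimately show ?thesis by (simp only: integral_unique diff_zero)
    qed
    finally have "A * (norm (traj ?X t - traj ?Y t))\<^sup>2 \<le> A * (?C * (A ^ m * ?t ^ Suc m / fact (Suc m)))"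
      using A by (rule mult_left_mono)
    also have "\<dots> = ?C * ((A * ?t) ^ Suc m / fact (Suc m))" by (simp add: power_mult_distrib)
    finally show ?case using snd[of ?X t ?Y] by simp
  qed
  note bd = this
  have norm_z: "fst z = 0 \<Longrightarrow> norm z = norm (snd z)" for z :: "'k traj_data"
    by (simp add: norm_prod_def)
  have "norm ((F ^^ n) x - (F ^^ n) y) = norm (snd ((F ^^ n) x - (F ^^ n) y))"
    unfolding Suc by (rule norm_z[OF fsts])
  also have "\<dots> \<le> volterra_coeff A n * norm (x - y)"
  proof (rule norm_bound)
    fix t
    have "(A * clampT t) ^ n' / fact n' \<le> (A * T) ^ n' / fact n'"
      using clampT_in[of t] A by (intro divide_right_mono power_mono mult_left_mono mult_nonneg_nonneg) auto
    then have "A * (1 + T) * (norm (x - y))\<^sup>2 * ((A * clampT t) ^ n' / fact n') \<le> A * (1 + T) * (norm (x - y))\<^sup>2 * ((A * T) ^ n' / fact n')"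
      using A T_pos by (intro mult_left_mono) auto
    with bd[of n' t] have "(norm (src ((F ^^ n) x - (F ^^ n) y) t))\<^sup>2 \<le> A * (1 + T) * (norm (x - y))\<^sup>2 * ((A * T) ^ n' / fact n')"
      unfolding Suc by (rule order_trans)
    also have "\<dots> = (volterra_coeff A n * norm (x - y))\<^sup>2"
      using A T_pos Suc by (simp add: volterra_coeff_def power_mult_distrib)
    finally show "norm (src ((F ^^ n) x - (F ^^ n) y) t) \<le> volterra_coeff A n * norm (x - y)"
      by (rule power2_le_imp_le) (use A T_pos in \<open>simp add: volterra_coeff_def\<close>)
  qed
  finally show ?thesis .
qed

text \<open>The factorials beat every \<open>A\<close> and \<open>T\<close>, so the fixed point is
  global in time. The second part measures a candidate by its defect.\<close>

lemma volterra_fixpoint: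
  fixes F :: "'k traj_data \<Rightarrow> 'k traj_data"
  assumes "0 \<le> A" "\<And>x y. fst (F x) = fst (F y)"
    "\<And>x y t. (norm (src (F x) t - src (F y) t))\<^sup>2 \<le> A * (norm (traj x t - traj y t))\<^sup>2"
  shows "\<exists>v. F v = v" "F v = v \<Longrightarrow> norm (w - v) \<le> suminf (volterra_coeff A) * norm (w - F w)"
proof -
  note it = iterated_contraction[where F = F and a = "volterra_coeff A", OF summable_volterra_coeff[OF assms(1)]]
  show "\<exists>v. F v = v" by (rule it(1)) (rule volterra_iterates[OF assms])
  show "F v = v \<Longrightarrow> norm (w - v) \<le> suminf (volterra_coeff A) * norm (w - F w)"
    by (rule it(2)) (rule volterra_iterates[OF assms])
qed

end

section \<open>Quadratic parabolic systems\<close>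

lemma norm_infsum_diff_le:
  fixes f :: "'k \<Rightarrow> 'b::banach"
  assumes "f summable_on UNIV" "finite F" "\<And>G. finite G \<Longrightarrow> G \<inter> F = {} \<Longrightarrow> norm (sum f G) \<le> e"
  shows "norm (infsum f UNIV - sum f F) \<le> e"
proof (rule tendsto_upperbound)
  show "((\<lambda>G. norm (sum f G - sum f F)) \<longlongrightarrow> norm (infsum f UNIV - sum f F)) (finite_subsets_at_top UNIV)"
    by (intro tendsto_intros infsum_tendsto assms)
  show "\<forall>\<^sub>F G in finite_subsets_at_top UNIV. norm (sum f G - sum f F) \<le> e"
    unfolding eventually_finite_subsets_at_top
  proof (intro exI[of _ F] conjI allI impI)
    fix G assume G: "finite G \<and> F \<subseteq> G \<and> G \<subseteq> UNIV"
    then have "sum f G - sum f F = sum f (G - F)" using assms(2) by (simp add: sum_diff)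
    then show "norm (sum f G - sum f F) \<le> e" using assms(3)[of "G - F"] G by auto
  qed (use assms in auto)
qed simp

text \<open>Uniformly small tails replace a summable majorant. Time-uniform bounds in l2 against
  fixed square-summable weights give the former, but no termwise domination.\<close>

lemma tendsto_infsum_uniform:
  fixes f :: "'a \<Rightarrow> 'k \<Rightarrow> 'b::banach"
  assumes lim: "\<And>k. ((\<lambda>s. f s k) \<longlongrightarrow> l k) \<F>" and sum: "\<forall>\<^sub>F s in \<F>. f s summable_on UNIV" "l summable_on UNIV"
    and tail: "\<And>e. e > 0 \<Longrightarrow> \<exists>F. finite F \<and> (\<forall>\<^sub>F s in \<F>. \<forall>G. finite G \<and> G \<inter> F = {} \<longrightarrow> norm (sum (f s) G) \<le> e)"
  shows "((\<lambda>s. infsum (f s) UNIV) \<longlongrightarrow> infsum l UNIV) \<F>"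
proof (cases "\<F> = bot")
  case False
  show ?thesis
  proof (rule tendstoI)
    fix e :: real assume "e > 0"
    then obtain F where F: "finite F" "\<forall>\<^sub>F s in \<F>. \<forall>G. finite G \<and> G \<inter> F = {} \<longrightarrow> norm (sum (f s) G) \<le> e / 4"
      using tail[of "e / 4"] by auto
    have "norm (sum l G) \<le> e / 4" if "finite G" "G \<inter> F = {}" for G
    proof (rule tendsto_upperbound[OF _ _ False])
      show "((\<lambda>s. norm (sum (f s) G)) \<longlongrightarrow> norm (sum l G)) \<F>" by (intro tendsto_intros lim)
      show "\<forall>\<^sub>F s in \<F>. norm (sum (f s) G) \<le> e / 4" using F(2) by eventually_elim (use that in blast)
    qed
    then have l: "norm (infsum l UNIV - sum l F) \<le> e / 4" by (intro norm_infsum_diff_le sum F)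
    have "((\<lambda>s. sum (f s) F) \<longlongrightarrow> sum l F) \<F>" by (intro tendsto_intros lim)
    then have "\<forall>\<^sub>F s in \<F>. dist (sum (f s) F) (sum l F) < e / 4" using \<open>e > 0\<close> by (intro tendstoD) auto
    with F(2) sum(1) show "\<forall>\<^sub>F s in \<F>. dist (infsum (f s) UNIV) (infsum l UNIV) < e"
    proof eventually_elim
      case (elim s)
      then have "norm (infsum (f s) UNIV - sum (f s) F) \<le> e / 4" by (intro norm_infsum_diff_le F) auto
      with l elim(3) \<open>e > 0\<close> show ?case
        using norm_triangle_ineq[of "infsum (f s) UNIV - sum (f s) F" "sum (f s) F - sum l F"]
          norm_triangle_ineq4[of "infsum (f s) UNIV - sum l F" "infsum l UNIV - sum l F"]
        by (simp add: dist_norm)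
    qed
  qed
qed simp

lemma continuous_on_infsum_uniform:
  fixes f :: "'a::topological_space \<Rightarrow> 'k \<Rightarrow> 'b::banach"
  assumes "\<And>k. continuous_on A (\<lambda>s. f s k)" "\<And>s. s \<in> A \<Longrightarrow> f s summable_on UNIV"
    and "\<And>e. e > 0 \<Longrightarrow> \<exists>F. finite F \<and> (\<forall>s\<in>A. \<forall>G. finite G \<and> G \<inter> F = {} \<longrightarrow> norm (sum (f s) G) \<le> e)"
  shows "continuous_on A (\<lambda>s. infsum (f s) UNIV)"
  unfolding continuous_on_def
proof
  fix x assume x: "x \<in> A"
  have ev: "\<forall>\<^sub>F s in at x within A. s \<in> A" by (simp add: eventually_at_filter)
  show "((\<lambda>s. infsum (f s) UNIV) \<longlongrightarrow> infsum (f x) UNIV) (at x within A)"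
  proof (rule tendsto_infsum_uniform)
    show "((\<lambda>s. f s k) \<longlongrightarrow> f x k) (at x within A)" for k using assms(1) x by (auto simp: continuous_on_def)
    show "\<forall>\<^sub>F s in at x within A. f s summable_on UNIV" using ev by eventually_elim (rule assms(2))
    fix e :: real assume "e > 0"
    from assms(3)[OF this] obtain F
      where F: "finite F \<and> (\<forall>s\<in>A. \<forall>G. finite G \<and> G \<inter> F = {} \<longrightarrow> norm (sum (f s) G) \<le> e)" ..
    have "\<forall>\<^sub>F s in at x within A. \<forall>G. finite G \<and> G \<inter> F = {} \<longrightarrow> norm (sum (f s) G) \<le> e"
      using ev by (rule eventually_mono) (rule bspec[OF conjunct2[OF F]])
    then show "\<exists>F. finite F \<and> (\<forall>\<^sub>F s in at x within A. \<forall>G. finite G \<and> G \<inter> F = {} \<longrightarrow> norm (sum (f s) G) \<le> e)"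
      by (intro exI[of _ F] conjI conjunct1[OF F])
  qed (use assms x in auto)
qed

lemma summable_tail:
  fixes M :: "'k \<Rightarrow> real"
  assumes sum: "M summable_on UNIV" and M0: "\<And>k. 0 \<le> M k" and e: "e > 0"
  obtains F where "finite F" "\<And>G. finite G \<Longrightarrow> G \<inter> F = {} \<Longrightarrow> sum M G \<le> e"
proof -
  obtain F where F: "finite F" "dist (sum M F) (infsum M UNIV) \<le> e"
    using infsum_finite_approximation[OF sum e] by blast
  have "sum M G \<le> e" if "finite G" "G \<inter> F = {}" for G
  proof -
    have "sum M (G \<union> F) \<le> infsum M UNIV" using F that M0 by (intro finite_sum_le_infsum sum) auto
    then show ?thesis using F that by (simp add: sum.union_disjoint dist_real_def)
  qed
  with F(1) show ?thesis by (rule that)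
qed

lemma tendsto_infsum_dominated:
  fixes f :: "'a \<Rightarrow> 'k \<Rightarrow> 'b::banach"
  assumes lim: "\<And>k. ((\<lambda>s. f s k) \<longlongrightarrow> l k) \<F>" and M: "M summable_on UNIV"
    and le: "\<forall>\<^sub>F s in \<F>. \<forall>k. norm (f s k) \<le> M k" and bot: "\<F> \<noteq> bot"
  shows "((\<lambda>s. infsum (f s) UNIV) \<longlongrightarrow> infsum l UNIV) \<F>" "l summable_on UNIV"
proof -
  have lle: "norm (l k) \<le> M k" for k
  proof (rule tendsto_upperbound[OF tendsto_norm[OF lim] _ bot])
    show "\<forall>\<^sub>F s in \<F>. norm (f s k) \<le> M k" using le by eventually_elim blast
  qed
  have M0: "0 \<le> M k" for k using order_trans[OF norm_ge_zero lle] .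
  have sm: "g summable_on UNIV" if "\<forall>k. norm (g k) \<le> M k" for g :: "'k \<Rightarrow> 'b"
    by (rule abs_summable_summable, rule summable_on_comparison_test[OF M]) (use that in auto)
  show l: "l summable_on UNIV" using lle by (intro sm) auto
  show "((\<lambda>s. infsum (f s) UNIV) \<longlongrightarrow> infsum l UNIV) \<F>"
  proof (rule tendsto_infsum_uniform[OF lim _ l])
    show "\<forall>\<^sub>F s in \<F>. f s summable_on UNIV" using le by eventually_elim (rule sm)
    fix e :: real assume "e > 0"
    then obtain F where F: "finite F" "\<And>G. finite G \<Longrightarrow> G \<inter> F = {} \<Longrightarrow> sum M G \<le> e"
      using summable_tail[OF M M0] by metis
    have "\<forall>\<^sub>F s in \<F>. \<forall>G. finite G \<and> G \<inter> F = {} \<longrightarrow> norm (sum (f s) G) \<le> e"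
      using le
    proof eventually_elim
      case (elim s)
      show ?case
      proof (intro allI impI)
        fix G assume "finite G \<and> G \<inter> F = {}"
        moreover have "norm (sum (f s) G) \<le> sum M G" using elim by (intro sum_norm_le) auto
        ultimately show "norm (sum (f s) G) \<le> e" using F(2)[of G] by linarith
      qed
    qed
    with F(1) show "\<exists>F. finite F \<and> (\<forall>\<^sub>F s in \<F>. \<forall>G. finite G \<and> G \<inter> F = {} \<longrightarrow> norm (sum (f s) G) \<le> e)" by blast
  qed
qed

text \<open>For members of F_beta only coefficientwise continuity in time and an l2 bound are at
  hand. The fixed family \<open>p\<close> supplies the uniform tail, by Cauchy-Schwarz against
  \<open>b\<close>.\<close>

lemma continuous_on_twist_conv:
  fixes a b :: "'a::topological_space \<Rightarrow> 'k::ab_group_add \<Rightarrow> complex"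
  assumes p: "l2_bound p P" and \<sigma>: "\<And>k m. \<bar>\<sigma> k m\<bar> \<le> S"
    and a: "\<And>k. continuous_on A (\<lambda>s. a s k)" "\<And>s. s \<in> A \<Longrightarrow> l2_bound (a s) Ma"
    and b: "\<And>k. continuous_on A (\<lambda>s. b s k)" "\<And>s. s \<in> A \<Longrightarrow> l2_bound (b s) Mb"
  shows "continuous_on A (\<lambda>s. twist_conv \<sigma> p (a s) (b s) k)"
  unfolding twist_conv_def
proof (rule continuous_on_infsum_uniform)
  show "continuous_on A (\<lambda>s. of_real (\<sigma> k m) * (p m * b s m) * a s (k - m))" for m
    by (intro continuous_intros a b)
  show "(\<lambda>m. of_real (\<sigma> k m) * (p m * b s m) * a s (k - m)) summable_on UNIV" if "s \<in> A" for s
    by (rule twist_conv_summable(2)[where \<sigma> = \<sigma>, OF p b(2) a(2) \<sigma>]) (use that in auto)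
  fix e :: real assume e: "e > 0"
  have p2: "(\<lambda>m. (cmod (p m))\<^sup>2) summable_on UNIV"
    by (rule nonneg_bdd_above_summable_on) (auto intro!: bdd_aboveI2[of _ _ "P\<^sup>2"] l2_bound_sum[OF p])
  define C where "C = \<bar>S\<bar> * \<bar>Ma\<bar> * \<bar>Mb\<bar> + 1"
  have C: "C > 0" unfolding C_def by (intro add_nonneg_pos mult_nonneg_nonneg) auto
  have ee: "(e / C)\<^sup>2 > 0" using e C by simp
  obtain F where F: "finite F" "\<And>G. finite G \<Longrightarrow> G \<inter> F = {} \<Longrightarrow> (\<Sum>m\<in>G. (cmod (p m))\<^sup>2) \<le> (e / C)\<^sup>2"
    using summable_tail[OF p2 _ ee] by (metis zero_le_power2)
  have "norm (\<Sum>m\<in>G. of_real (\<sigma> k m) * (p m * b s m) * a s (k - m)) \<le> e"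
    if s: "s \<in> A" and G: "finite G" "G \<inter> F = {}" for s G
  proof -
    have S0: "0 \<le> S" using \<sigma>[of 0 0] by linarith
    have Ma0: "0 \<le> Ma" and Mb0: "0 \<le> Mb" using l2_bound_nonneg a(2)[OF s] b(2)[OF s] by auto
    have "norm (\<Sum>m\<in>G. of_real (\<sigma> k m) * (p m * b s m) * a s (k - m)) \<le> (\<Sum>m\<in>G. (S * Ma) * (cmod (p m) * cmod (b s m)))"
    proof (rule sum_norm_le)
      fix m
      have "\<bar>\<sigma> k m\<bar> * cmod (a s (k - m)) \<le> S * Ma"
        using \<sigma> l2_bound_cmod[OF a(2)[OF s]] S0 by (intro mult_mono) auto
      from mult_right_mono[OF this, of "cmod (p m) * cmod (b s m)"]
      show "cmod (of_real (\<sigma> k m) * (p m * b s m) * a s (k - m)) \<le> (S * Ma) * (cmod (p m) * cmod (b s m))"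
        by (simp add: norm_mult mult_ac)
    qed
    also have "\<dots> \<le> (S * Ma) * (L2_set (\<lambda>m. cmod (p m)) G * L2_set (\<lambda>m. cmod (b s m)) G)"
      using L2_set_mult_ineq[of "\<lambda>m. cmod (p m)" "\<lambda>m. cmod (b s m)" G] S0 Ma0
      unfolding sum_distrib_left[symmetric] by (intro mult_left_mono) auto
    also have "\<dots> \<le> (S * Ma) * ((e / C) * Mb)"
    proof (intro mult_left_mono mult_mono)
      show "L2_set (\<lambda>m. cmod (p m)) G \<le> e / C"
        unfolding L2_set_def using F(2)[OF G] e C by (intro real_le_lsqrt) (auto intro: sum_nonneg)
      show "L2_set (\<lambda>m. cmod (b s m)) G \<le> Mb" using b(2)[OF s] G by (simp add: l2_bound_def)
    qed (use S0 Ma0 e C in auto)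
    also have "\<dots> \<le> e"
    proof -
      have "S * Ma * Mb \<le> C" unfolding C_def using S0 Ma0 Mb0 by simp
      then have "e * (S * Ma * Mb) \<le> e * C" using e by (intro mult_left_mono) auto
      then show ?thesis using C by (simp add: field_simps)
    qed
    finally show ?thesis .
  qed
  with F(1) show "\<exists>F. finite F \<and> (\<forall>s\<in>A. \<forall>G. finite G \<and> G \<inter> F = {} \<longrightarrow>
      norm (\<Sum>m\<in>G. of_real (\<sigma> k m) * (p m * b s m) * a s (k - m)) \<le> e)" by blast
qed

section \<open>Gronwall arguments and truncation\<close>

lemma integral_cmult_power:
  fixes K t :: real
  assumes "0 \<le> t"
  shows "integral {0..t} (\<lambda>s. K * s ^ m) = K * t ^ Suc m / real (Suc m)"
proof -
  have "((\<lambda>s. K * s ^ m) has_integral (K * t ^ Suc m / real (Suc m) - K * 0 ^ Suc m / real (Suc m))) {0..t}"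
  proof (rule fundamental_theorem_of_calculus[OF assms])
    fix s
    have "((\<lambda>s. K / real (Suc m) * s ^ Suc m) has_real_derivative K / real (Suc m) * (real (Suc m) * s ^ m)) (at s within {0..t})"
      by (auto intro!: derivative_eq_intros simp del: power_Suc)
    moreover have "K / real (Suc m) * (real (Suc m) * s ^ m) = K * s ^ m" by (simp del: of_nat_Suc)
    moreover have "(\<lambda>s. K / real (Suc m) * s ^ Suc m) = (\<lambda>s. K * s ^ Suc m / real (Suc m))" by (simp add: fun_eq_iff)
    ultimately show "((\<lambda>s. K * s ^ Suc m / real (Suc m)) has_vector_derivative K * s ^ m) (at s within {0..t})"
      by (simp only: has_real_derivative_iff_has_vector_derivative[symmetric])
  qed
  from integral_unique[OF this] show ?thesis by simp
qed

lemma gronwall_integral: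
  fixes f :: "real \<Rightarrow> real"
  assumes f: "continuous_on {0..T} f" and c: "0 \<le> c"
    and le: "\<And>t. t \<in> {0..T} \<Longrightarrow> f t \<le> a + c * integral {0..t} f" and t: "t \<in> {0..T}"
  shows "f t \<le> a * exp (c * t)"
proof -
  let ?h = "\<lambda>t. integral {0..t} f"
  let ?G = "\<lambda>t. (a + c * ?h t) * exp (- c * t)"
  let ?G' = "\<lambda>s. c * (f s - (a + c * ?h s)) * exp (- c * s)"
  have "(?G' has_integral (?G t - ?G 0)) {0..t}"
  proof (rule fundamental_theorem_of_calculus)
    fix s assume s: "s \<in> {0..t}"
    have "(?h has_real_derivative f s) (at s within {0..T})"
      using s t by (intro integral_has_real_derivative f) auto
    then have "(?h has_real_derivative f s) (at s within {0..t})"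
      by (rule DERIV_subset) (use t in auto)
    then have "(?G has_real_derivative (0 + c * f s) * exp (- c * s) + (exp (- c * s) * (- c)) * (a + c * ?h s)) (at s within {0..t})"
      by (intro DERIV_mult DERIV_add DERIV_cmult DERIV_const) (auto intro!: derivative_eq_intros)
    moreover have "(0 + c * f s) * exp (- c * s) + (exp (- c * s) * (- c)) * (a + c * ?h s) = ?G' s"
      by (simp add: algebra_simps)
    ultimately show "(?G has_vector_derivative ?G' s) (at s within {0..t})"
      by (simp only: has_real_derivative_iff_has_vector_derivative[symmetric])
  qed (use t in simp)
  moreover have "((\<lambda>_. 0) has_integral 0) {0..t}" by simp
  moreover have "?G' s \<le> 0" if "s \<in> {0..t}" for s
    using le[of s] that t c by (intro mult_nonpos_nonneg mult_nonneg_nonpos) auto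
  ultimately have "?G t - ?G 0 \<le> 0" by (rule has_integral_le)
  then have "(a + c * ?h t) * exp (- c * t) \<le> a" by simp
  then have "(a + c * ?h t) * exp (- c * t) * exp (c * t) \<le> a * exp (c * t)"
    by (rule mult_right_mono) simp
  moreover have "exp (- c * t) * exp (c * t) = 1" by (simp add: mult_exp_exp)
  ultimately have "a + c * ?h t \<le> a * exp (c * t)" by (simp only: mult.assoc mult_1_right)
  then show ?thesis using le[OF t] by linarith
qed

text \<open>In a general normed space this is only 2-Lipschitz.\<close>
definition retract :: "real \<Rightarrow> 'a::real_normed_vector \<Rightarrow> 'a" where
  "retract R u = (if norm u \<le> R then u else (R / norm u) *\<^sub>R u)"

lemma norm_retract_le: "0 \<le> R \<Longrightarrow> norm (retract R u) \<le> R"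
  by (auto simp: retract_def)

lemma retract_lipschitz:
  assumes R: "0 \<le> R"
  shows "norm (retract R u - retract R v) \<le> 2 * norm (u - v)"
proof -
  have one: "norm (retract R u - v) \<le> 2 * norm (u - v)" if u: "norm u > R" and v: "norm v \<le> R" for u v :: 'a
  proof -
    have u0: "norm u > 0" using u R by linarith
    have "retract R u - v = (R / norm u) *\<^sub>R (u - v) + (R / norm u - 1) *\<^sub>R v"
      using u by (simp add: retract_def algebra_simps)
    then have "norm (retract R u - v) \<le> \<bar>R / norm u\<bar> * norm (u - v) + \<bar>R / norm u - 1\<bar> * norm v"
      by (metis norm_triangle_ineq norm_scaleR)
    moreover have "\<bar>R / norm u\<bar> * norm (u - v) \<le> 1 * norm (u - v)"
      using u R u0 by (intro mult_right_mono) (auto simp: field_simps)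
    moreover have "\<bar>R / norm u - 1\<bar> * norm v \<le> norm (u - v)"
    proof -
      have "\<bar>R / norm u - 1\<bar> = (norm u - R) / norm u" using u u0 by (simp add: field_simps abs_if)
      moreover have "(norm u - R) / norm u * norm v \<le> (norm u - R) / norm u * norm u"
        using u v u0 by (intro mult_left_mono) auto
      ultimately have "\<bar>R / norm u - 1\<bar> * norm v \<le> norm u - R" using u0 by (metis nonzero_eq_divide_eq order_less_irrefl)
      also have "\<dots> \<le> norm (u - v)" using v norm_triangle_ineq2[of u v] by linarith
      finally show ?thesis .
    qed
    ultimately show ?thesis by linarith
  qed
  consider "norm u \<le> R" "norm v \<le> R" | "norm u > R" "norm v \<le> R" | "norm u \<le> R" "norm v > R" | "norm u > R" "norm v > R"
    by linarith
  then show ?thesis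
  proof cases
    case 1
    then show ?thesis by (simp add: retract_def)
  next
    case 2
    then show ?thesis using one[of u v] by (simp add: retract_def[of R v])
  next
    case 3
    then show ?thesis using one[of v u] by (simp add: retract_def[of R u] norm_minus_commute)
  next
    case 4
    then have u0: "norm u > 0" and v0: "norm v > 0" using R by linarith+
    have "retract R u - retract R v = (R / norm u) *\<^sub>R (u - v) + (R / norm u - R / norm v) *\<^sub>R v"
      using 4 by (simp add: retract_def algebra_simps)
    then have "norm (retract R u - retract R v) \<le> \<bar>R / norm u\<bar> * norm (u - v) + \<bar>R / norm u - R / norm v\<bar> * norm v"
      by (metis norm_triangle_ineq norm_scaleR)
    moreover have Ru: "\<bar>R / norm u\<bar> \<le> 1" using 4 R u0 by (auto simp: field_simps)
    then have "\<bar>R / norm u\<bar> * norm (u - v) \<le> 1 * norm (u - v)" by (intro mult_right_mono) auto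
    moreover have "\<bar>R / norm u - R / norm v\<bar> * norm v \<le> norm (u - v)"
    proof -
      have "(R / norm u - R / norm v) * norm v = R / norm u * (norm v - norm u)"
        using u0 v0 by (simp add: field_simps)
      then have "\<bar>R / norm u - R / norm v\<bar> * norm v = \<bar>R / norm u\<bar> * \<bar>norm v - norm u\<bar>"
        by (metis abs_mult abs_norm_cancel)
      also have "\<dots> \<le> 1 * \<bar>norm v - norm u\<bar>" by (rule mult_right_mono[OF Ru]) simp
      also have "\<dots> \<le> norm (u - v)" using norm_triangle_ineq3[of v u] by (simp add: norm_minus_commute)
      finally show ?thesis .
    qed
    ultimately show ?thesis by linarith
  qed
qed

lemma retract_continuous: "0 \<le> R \<Longrightarrow> continuous_on A (retract R)"
  by (rule lipschitz_on_continuous_on[of 2])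
    (auto simp: lipschitz_on_def dist_norm retract_lipschitz)

text \<open>Iterating the energy inequality improves the given bound by a factor that decays like
  the square root of \<open>(C\<^sup>2 * t) ^ n / fact n\<close>. The iteration stays with finite
  sets of modes, because coefficientwise continuity does not give the continuity of the l2 norm that
  \<open>gronwall_integral\<close> asks for.\<close>

lemma parabolic_unique:
  fixes w g :: "real \<Rightarrow> 'k \<Rightarrow> complex"
  assumes w: "\<And>t k. t \<in> {0..T} \<Longrightarrow> ((\<lambda>t. w t k) has_vector_derivative (- \<nu> k) *\<^sub>R w t k + \<kappa> k *\<^sub>R g t k) (at t within {0..T})"
    and g: "\<And>k. continuous_on {0..T} (\<lambda>t. g t k)" and \<nu>: "\<And>k. (\<kappa> k)\<^sup>2 \<le> \<nu> k"
    and bdd: "\<And>t. t \<in> {0..T} \<Longrightarrow> l2_bound (w t) W" and w0: "\<And>k. w 0 k = 0"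
    and lip: "\<And>t N. t \<in> {0..T} \<Longrightarrow> l2_bound (w t) N \<Longrightarrow> l2_bound (g t) (C * N)"
    and t: "t \<in> {0..T}"
  shows "w t k = 0"
proof -
  have C: "0 \<le> C * W" if "t \<in> {0..T}" for t using l2_bound_nonneg[OF lip[OF that bdd[OF that]]] .
  have W0: "0 \<le> W" using l2_bound_nonneg[OF bdd[OF t]] .
  have wc: "continuous_on {0..T} (\<lambda>t. w t k)" for k by (rule continuous_on_vector_derivative[OF w])
  have bound: "l2_bound (w t) (sqrt (W\<^sup>2 * (C\<^sup>2 * t) ^ n / fact n))" if "t \<in> {0..T}" for t n
    using that
  proof (induction n arbitrary: t)
    case 0
    then show ?case using bdd[OF 0] W0 by simp
  next
    case (Suc n)
    have nn: "0 \<le> W\<^sup>2 * (C\<^sup>2 * s) ^ m / fact m" if "0 \<le> s" for s m using that by simp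
    have t0: "0 \<le> t" using Suc.prems by simp
    show ?case
    proof (rule l2_boundI)
      fix F :: "'k set" assume F: "finite F"
      have "(cmod (w t k))\<^sup>2 \<le> integral {0..t} (\<lambda>s. (cmod (g s k))\<^sup>2)" for k
      proof -
        have "0 \<le> \<nu> k" using order_trans[OF zero_le_power2 \<nu>] .
        moreover have "0 \<le> integral {0..t} (\<lambda>s. (cmod (w s k))\<^sup>2)"
          using Suc.prems by (intro integral_nonneg integrable_continuous_interval continuous_intros continuous_on_subset[OF wc]) auto
        ultimately have "0 \<le> \<nu> k * integral {0..t} (\<lambda>s. (cmod (w s k))\<^sup>2)" by simp
        then show ?thesis using parabolic_energy[OF w g \<nu> Suc.prems, of k] by (simp add: w0)
      qed
      then have "(\<Sum>k\<in>F. (cmod (w t k))\<^sup>2) \<le> (\<Sum>k\<in>F. integral {0..t} (\<lambda>s. (cmod (g s k))\<^sup>2))" by (rule sum_mono)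
      also have "\<dots> = integral {0..t} (\<lambda>s. \<Sum>k\<in>F. (cmod (g s k))\<^sup>2)"
        using F Suc.prems by (subst integral_sum) (auto intro!: integrable_continuous_interval continuous_intros continuous_on_subset[OF g])
      also have "\<dots> \<le> integral {0..t} (\<lambda>s. (W\<^sup>2 * C\<^sup>2 ^ Suc n / fact n) * s ^ n)"
      proof (intro integral_le)
        fix s assume s: "s \<in> {0..t}"
        then have s': "s \<in> {0..T}" using Suc.prems by auto
        have "(\<Sum>k\<in>F. (cmod (g s k))\<^sup>2) \<le> (C * sqrt (W\<^sup>2 * (C\<^sup>2 * s) ^ n / fact n))\<^sup>2"
          by (intro l2_bound_sum[OF lip[OF s' Suc.IH[OF s']]] F)
        also have "\<dots> = (W\<^sup>2 * C\<^sup>2 ^ Suc n / fact n) * s ^ n"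
          using nn[of s n] s by (simp add: power_mult_distrib)
        finally show "(\<Sum>k\<in>F. (cmod (g s k))\<^sup>2) \<le> (W\<^sup>2 * C\<^sup>2 ^ Suc n / fact n) * s ^ n" .
      qed (use Suc.prems in \<open>auto intro!: integrable_continuous_interval continuous_intros continuous_on_subset[OF g]\<close>)
      also have "\<dots> = W\<^sup>2 * (C\<^sup>2 * t) ^ Suc n / fact (Suc n)"
        unfolding integral_cmult_power[OF t0] by (simp add: power_mult_distrib mult_ac)
      also have "\<dots> = (sqrt (W\<^sup>2 * (C\<^sup>2 * t) ^ Suc n / fact (Suc n)))\<^sup>2" using nn[OF t0] by (simp del: power_Suc fact_Suc)
      finally show "(\<Sum>k\<in>F. (cmod (w t k))\<^sup>2) \<le> (sqrt (W\<^sup>2 * (C\<^sup>2 * t) ^ Suc n / fact (Suc n)))\<^sup>2" .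
    qed (use nn[OF t0] in \<open>simp del: power_Suc fact_Suc\<close>)
  qed
  have "(\<lambda>n. sqrt (W\<^sup>2 * ((C\<^sup>2 * t) ^ n /\<^sub>R fact n))) \<longlonglongrightarrow> sqrt (W\<^sup>2 * 0)"
    by (intro tendsto_intros summable_LIMSEQ_zero summable_exp_generic)
  moreover have "cmod (w t k) \<le> sqrt (W\<^sup>2 * ((C\<^sup>2 * t) ^ n /\<^sub>R fact n))" for n
    using l2_bound_cmod[OF bound[OF t]] by (simp add: divide_inverse mult_ac)
  ultimately have "cmod (w t k) \<le> sqrt (W\<^sup>2 * 0)" by (intro tendsto_lowerbound) auto
  then show ?thesis by simp
qed

section \<open>Global solutions of the quadratic system\<close>

locale parabolic_quadratic = parabolic \<nu> \<kappa> T + twist_kernel \<sigma> S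
  for \<nu> \<kappa> :: "'k::ab_group_add \<Rightarrow> real" and T :: real and \<sigma> :: "'k \<Rightarrow> 'k \<Rightarrow> real" and S :: real
begin

text \<open>The initial component is 0, so in \<open>x = (u0, 0) + Q p x x\<close> the first summand
  fixes the datum and \<open>Q\<close> feeds only the source.\<close>

definition Q :: "'k hl2 \<Rightarrow> 'k traj_data \<Rightarrow> 'k traj_data \<Rightarrow> 'k traj_data" where
  "Q p x y = (0, Bcontfun (\<lambda>t. tconv \<sigma> p (traj x t) (traj y t)))"

lemma norm_tconv_le: "norm p \<le> P \<Longrightarrow> norm a \<le> A \<Longrightarrow> norm b \<le> B \<Longrightarrow> norm (tconv \<sigma> p a b) \<le> S * P * B * A"
  using order_trans[OF norm_ge_zero[of p]] order_trans[OF norm_ge_zero[of a]]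
    order_trans[OF norm_ge_zero[of b]] kernel_bound_nonneg
  by (intro order_trans[OF norm_tconv] mult_mono mult_nonneg_nonneg) auto

lemma tconv_bcontfun:
  assumes "continuous_on UNIV a" "continuous_on UNIV b" "\<And>t. norm (a t) \<le> A" "\<And>t. norm (b t) \<le> B"
  shows "(\<lambda>t::real. tconv \<sigma> p (a t) (b t)) \<in> bcontfun"
  unfolding bcontfun_def using assms
  by (auto intro!: bounded_bilinear.continuous_on[OF bounded_bilinear_tconv] norm_tconv_le[OF order_refl] simp: bounded_iff
      intro: exI[of _ "S * norm p * B * A"])

lemma fst_Q [simp]: "fst (Q p x y) = 0" by (simp add: Q_def)

lemma src_Q [simp]: "src (Q p x y) t = tconv \<sigma> p (traj x t) (traj y t)"
proof -
  have "(\<lambda>t. tconv \<sigma> p (traj x t) (traj y t)) \<in> bcontfun"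
    by (rule tconv_bcontfun[OF traj_continuous traj_continuous norm_traj_le norm_traj_le])
  then show ?thesis by (simp add: Q_def Bcontfun_inverse)
qed

lemma traj_data_eqI: "fst x = fst y \<Longrightarrow> (\<And>t. src x t = src y t) \<Longrightarrow> x = y" for x y :: "'k traj_data"
  by (simp add: prod_eq_iff bcontfun_eqI)

lemma norm_traj_data_le:
  fixes x :: "'k traj_data"
  assumes "fst x = 0" "\<And>t. norm (src x t) \<le> C" shows "norm x \<le> C"
proof -
  have "norm x = norm (snd x)" using assms(1) by (simp add: norm_prod_def)
  also have "\<dots> \<le> C" by (rule norm_bound) (rule assms(2))
  finally show ?thesis .
qed

text \<open>The right-hand side is a Volterra map in \<open>v\<close> with squared Lipschitz
  constant \<open>A\<close>. The candidate \<open>f\<close> has defect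
  \<open>Q p f y + Q p z f\<close> up to sign, which is linear in \<open>f\<close>, so its distance
  from \<open>v\<close> is bounded by a multiple of \<open>norm f\<close>.\<close>

lemma Q_resolvent:
  assumes M: "norm p \<le> M" "norm y \<le> M" "norm z \<le> M"
  defines "A \<equiv> (S * M * (sqrt (1 + T) * M) + S * M * (sqrt (1 + T) * M))\<^sup>2"
  shows "\<exists>v. v = f + Q p v y + Q p z v"
    and "v = f + Q p v y + Q p z v \<Longrightarrow> norm v \<le> (1 + suminf (volterra_coeff A) * (2 * (S * (1 + T)) * M * M)) * norm f"
proof -
  let ?F = "\<lambda>v. f + Q p v y + Q p z v"
  have M0: "0 \<le> M" using M(1) norm_ge_zero order_trans by blast
  have A: "0 \<le> A" by (simp add: A_def)
  have tM: "norm (traj y t) \<le> sqrt (1 + T) * M" "norm (traj z t) \<le> sqrt (1 + T) * M" for t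
    using M T_pos by (auto intro!: order_trans[OF norm_traj_le] mult_left_mono)
  have fst: "fst (?F v) = fst (?F w)" for v w by simp
  have lip: "(norm (src (?F v) t - src (?F w) t))\<^sup>2 \<le> A * (norm (traj v t - traj w t))\<^sup>2" for v w t
  proof -
    let ?d = "traj v t - traj w t"
    have "src (?F v) t - src (?F w) t = tconv \<sigma> p ?d (traj y t) + tconv \<sigma> p (traj z t) ?d"
      by (simp add: bounded_bilinear.diff_left[OF bounded_bilinear_tconv] bounded_bilinear.diff_right[OF bounded_bilinear_tconv])
    then have "norm (src (?F v) t - src (?F w) t) \<le> norm (tconv \<sigma> p ?d (traj y t)) + norm (tconv \<sigma> p (traj z t) ?d)"
      by (simp only: norm_triangle_ineq)
    also have "\<dots> \<le> S * M * (sqrt (1 + T) * M) * norm ?d + S * M * norm ?d * (sqrt (1 + T) * M)"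
      by (intro add_mono norm_tconv_le tM M order_refl)
    also have "\<dots> = (S * M * (sqrt (1 + T) * M) + S * M * (sqrt (1 + T) * M)) * norm ?d" by (simp add: algebra_simps)
    finally have "(norm (src (?F v) t - src (?F w) t))\<^sup>2 \<le> ((S * M * (sqrt (1 + T) * M) + S * M * (sqrt (1 + T) * M)) * norm ?d)\<^sup>2"
      by (rule power_mono) simp
    then show ?thesis unfolding A_def power_mult_distrib .
  qed
  note vf = volterra_fixpoint[OF A fst lip]
  from vf(1) show "\<exists>v. v = f + Q p v y + Q p z v" by metis
  assume v: "v = f + Q p v y + Q p z v"
  have fF: "norm (f - ?F f) \<le> (2 * (S * (1 + T)) * M * M) * norm f"
  proof (rule norm_traj_data_le)
    fix t
    have tf: "norm (traj f t) \<le> sqrt (1 + T) * norm f" by (rule norm_traj_le)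
    have "src (f - ?F f) t = - (tconv \<sigma> p (traj f t) (traj y t) + tconv \<sigma> p (traj z t) (traj f t))" by simp
    then have "norm (src (f - ?F f) t) \<le> norm (tconv \<sigma> p (traj f t) (traj y t)) + norm (tconv \<sigma> p (traj z t) (traj f t))"
      by (simp only: norm_minus_cancel norm_triangle_ineq)
    also have "\<dots> \<le> S * M * (sqrt (1 + T) * M) * (sqrt (1 + T) * norm f) + S * M * (sqrt (1 + T) * norm f) * (sqrt (1 + T) * M)"
      by (intro add_mono norm_tconv_le tM tf M)
    also have "\<dots> = 2 * S * (sqrt (1 + T) * sqrt (1 + T)) * M * M * norm f" by (simp add: algebra_simps)
    also have "sqrt (1 + T) * sqrt (1 + T) = 1 + T" using T_pos by simp
    finally show "norm (src (f - ?F f) t) \<le> (2 * (S * (1 + T)) * M * M) * norm f" by (simp add: mult_ac)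
  qed simp
  have K0: "0 \<le> suminf (volterra_coeff A)"
    using A T_pos by (intro suminf_nonneg summable_volterra_coeff) (auto simp: volterra_coeff_def)
  have "norm (f - v) \<le> suminf (volterra_coeff A) * norm (f - ?F f)"
    by (rule vf(2)) (rule v[symmetric])
  also have "\<dots> \<le> suminf (volterra_coeff A) * ((2 * (S * (1 + T)) * M * M) * norm f)"
    by (rule mult_left_mono[OF fF K0])
  finally show "norm v \<le> (1 + suminf (volterra_coeff A) * (2 * (S * (1 + T)) * M * M)) * norm f"
    using norm_triangle_ineq2[of v f] by (simp add: algebra_simps norm_minus_commute)
qed

lemma quadratic_fixed_point_Q: "quadratic_fixed_point Q (S * (1 + T))"
proof
  show "Q (c *\<^sub>R p + q) x y = c *\<^sub>R Q p x y + Q q x y" for c p q x y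
    by (rule traj_data_eqI) (simp_all add: tconv_lin1)
  show "Q p (c *\<^sub>R x + x') y = c *\<^sub>R Q p x y + Q p x' y" for c p x x' y
    by (rule traj_data_eqI) (simp_all add: tconv_lin2 traj_lin)
  show "Q p x (c *\<^sub>R y + y') = c *\<^sub>R Q p x y + Q p x y'" for c p x y y'
    by (rule traj_data_eqI) (simp_all add: tconv_lin3 traj_lin)
  show "norm (Q p x y) \<le> S * (1 + T) * norm p * norm x * norm y" for p x y
  proof (rule norm_traj_data_le)
    fix t
    have "norm (src (Q p x y) t) \<le> S * norm p * (sqrt (1 + T) * norm y) * (sqrt (1 + T) * norm x)"
      unfolding src_Q by (intro norm_tconv_le norm_traj_le order_refl)
    also have "\<dots> = S * (sqrt (1 + T) * sqrt (1 + T)) * norm p * norm x * norm y" by (simp add: mult_ac)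
    also have "sqrt (1 + T) * sqrt (1 + T) = 1 + T" using T_pos by simp
    finally show "norm (src (Q p x y) t) \<le> S * (1 + T) * norm p * norm x * norm y" .
  qed simp
  show "0 \<le> S * (1 + T)" using kernel_bound_nonneg T_pos by simp
  show "\<exists>v. v = f + Q p v y + Q p z v" for f p y z
    by (rule Q_resolvent(1)[of p "norm p + norm y + norm z"]) auto
  show "\<exists>C\<ge>0. \<forall>p y z f v. norm p \<le> M \<longrightarrow> norm y \<le> M \<longrightarrow> norm z \<le> M \<longrightarrow> v = f + Q p v y + Q p z v \<longrightarrow> norm v \<le> C * norm f" for M
  proof -
    let ?C = "1 + suminf (volterra_coeff ((S * M * (sqrt (1 + T) * M) + S * M * (sqrt (1 + T) * M))\<^sup>2)) * (2 * (S * (1 + T)) * M * M)"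
    have "\<forall>p y z f v. norm p \<le> M \<longrightarrow> norm y \<le> M \<longrightarrow> norm z \<le> M \<longrightarrow> v = f + Q p v y + Q p z v \<longrightarrow> norm v \<le> max 0 ?C * norm f"
    proof (intro allI impI)
      fix p y z f v
      assume "norm p \<le> M" "norm y \<le> M" "norm z \<le> M" "v = f + Q p v y + Q p z v"
      then have "norm v \<le> ?C * norm f" by (rule Q_resolvent(2))
      also have "\<dots> \<le> max 0 ?C * norm f" by (rule mult_right_mono) auto
      finally show "norm v \<le> max 0 ?C * norm f" .
    qed
    then show ?thesis by (intro exI[of _ "max 0 ?C"]) auto
  qed
qed

lemma traj_clampT: "traj x (clampT t) = traj x t"
  by (rule hl2_eqI) (simp add: coef_traj traj_coef_def clampT_id[OF clampT_in])

text \<open>Retracting both factors onto a ball makes the quadratic source globally Lipschitz, so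
  the Volterra fixed point applies.\<close>

lemma truncated_solution:
  assumes R: "0 \<le> R"
  obtains x where "fst x = u0" "\<And>t. src x t = tconv \<sigma> p (retract R (traj x t)) (retract R (traj x t))"
proof -
  let ?g = "\<lambda>x t. tconv \<sigma> p (retract R (traj x t)) (retract R (traj x t))"
  let ?F = "\<lambda>x. (u0, Bcontfun (?g x))"
  \<comment> \<open>Two factors, each bounded by \<open>R\<close> and each 2-Lipschitz through the
    retraction.\<close>
  let ?c = "4 * S * norm p * R"
  have src: "src (?F x) t = ?g x t" for x t
  proof -
    have "continuous_on UNIV (retract R \<circ> traj x)"
      by (intro continuous_on_compose traj_continuous retract_continuous R)
    then have "?g x \<in> bcontfun"
      by (intro tconv_bcontfun[where A = R and B = R] norm_retract_le R) (auto simp: comp_def)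
    then show ?thesis by (simp add: Bcontfun_inverse)
  qed
  have "\<exists>x. ?F x = x"
  proof (rule volterra_fixpoint(1)[where A = "?c\<^sup>2"])
    show "fst (?F x) = fst (?F y)" for x y by simp
    show "(norm (src (?F x) t - src (?F y) t))\<^sup>2 \<le> ?c\<^sup>2 * (norm (traj x t - traj y t))\<^sup>2" for x y t
    proof -
      let ?a = "retract R (traj x t)" and ?b = "retract R (traj y t)" and ?d = "norm (traj x t - traj y t)"
      have ab: "norm (?a - ?b) \<le> 2 * ?d" by (rule retract_lipschitz[OF R])
      have "?g x t - ?g y t = tconv \<sigma> p (?a - ?b) ?a + tconv \<sigma> p ?b (?a - ?b)"
        by (simp add: bounded_bilinear.diff_left[OF bounded_bilinear_tconv] bounded_bilinear.diff_right[OF bounded_bilinear_tconv])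
      then have "norm (?g x t - ?g y t) \<le> norm (tconv \<sigma> p (?a - ?b) ?a) + norm (tconv \<sigma> p ?b (?a - ?b))"
        by (simp only: norm_triangle_ineq)
      also have "\<dots> \<le> S * norm p * R * (2 * ?d) + S * norm p * (2 * ?d) * R"
        by (intro add_mono norm_tconv_le ab norm_retract_le R order_refl)
      finally have "norm (?g x t - ?g y t) \<le> ?c * ?d" by (simp add: algebra_simps)
      then have "(norm (?g x t - ?g y t))\<^sup>2 \<le> (?c * ?d)\<^sup>2" by (rule power_mono) simp
      then show ?thesis unfolding src power_mult_distrib .
    qed
  qed simp
  then obtain x where x: "?F x = x" ..
  show ?thesis
  proof (rule that[of x])
    show "fst x = u0" using x by (metis fst_conv)
    show "src x t = ?g x t" for t using src[of x t] unfolding x .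
  qed
qed

text \<open>Truncation at \<open>R = M + 1\<close> is inactive until the norm first reaches
  \<open>R\<close>, and at that time the a priori bound allows at most \<open>M\<close>. The
  hypothesis therefore speaks about data that solve the equation only up to
  \<open>\<tau>\<close>.\<close>

lemma global_solution:
  assumes u0: "norm u0 \<le> M" and p: "norm p \<le> P"
    and apriori: "\<And>x \<tau>. \<tau> \<in> {0..T} \<Longrightarrow> fst x = u0 \<Longrightarrow>
        (\<And>t. t \<in> {0..\<tau>} \<Longrightarrow> src x t = tconv \<sigma> p (traj x t) (traj x t)) \<Longrightarrow> norm (traj x \<tau>) \<le> M"
  obtains x where "x = (u0, 0) + Q p x x" "norm x \<le> M + S * P * M * M"
proof -
  have M0: "0 \<le> M" using norm_ge_zero u0 order_trans by blast
  define R where "R = M + 1"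
  obtain x where x: "fst x = u0" "\<And>t. src x t = tconv \<sigma> p (retract R (traj x t)) (retract R (traj x t))"
    using truncated_solution[of R u0 p] M0 unfolding R_def by fastforce
  let ?n = "\<lambda>t. norm (traj x t)"
  have nc: "continuous_on A ?n" for A by (intro continuous_intros traj_continuous)
  have init: "?n 0 \<le> M" using u0 x(1) T_pos
    by (subst hl2_eqI[of "traj x 0" u0]) (auto simp: coef_traj traj_coef_def clampT_def)
  have le: "?n t \<le> R" if t: "t \<in> {0..T}" for t
  proof (rule ccontr)
    assume "\<not> ?n t \<le> R"
    \<comment> \<open>\<open>Inf Z\<close> will be the first time at which the norm equals
      \<open>R\<close>; by the intermediate value theorem the norm is at most \<open>R\<close>
      before it.\<close>
    define Z where "Z = {s \<in> {0..t}. ?n s = R}"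
    have ivt: "\<exists>s\<in>{0..s1}. ?n s = R" if "0 \<le> s1" "?n s1 \<ge> R" for s1
      using IVT'[of ?n 0 R s1] that init nc by (auto simp: R_def)
    have "closed Z" unfolding Z_def by (rule continuous_closed_preimage_constant[OF nc]) simp
    moreover have "Z \<noteq> {}" using ivt[of t] t \<open>\<not> ?n t \<le> R\<close> by (auto simp: Z_def)
    moreover have "bdd_below Z" by (auto simp: Z_def intro!: bdd_belowI[of _ 0])
    ultimately have "Inf Z \<in> Z" by (simp add: closed_contains_Inf)
    then have \<tau>: "Inf Z \<in> {0..T}" "?n (Inf Z) = R" using t by (auto simp: Z_def)
    have "?n s \<le> R" if s: "s \<in> {0..Inf Z}" for s
    proof (rule ccontr)
      assume c: "\<not> ?n s \<le> R"
      then obtain r where r: "r \<in> {0..s}" "?n r = R" using ivt[of s] s by auto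
      then have "r < s" using c by (cases "r = s") auto
      moreover have "r \<in> Z" using r s \<open>Inf Z \<in> Z\<close> by (auto simp: Z_def)
      then have "Inf Z \<le> r" using \<open>bdd_below Z\<close> by (rule cInf_lower)
      ultimately show False using s by simp
    qed
    then have "src x s = tconv \<sigma> p (traj x s) (traj x s)" if "s \<in> {0..Inf Z}" for s
      using that x(2)[of s] by (simp add: retract_def)
    from apriori[OF \<tau>(1) x(1) this] show False using \<tau>(2) by (simp add: R_def)
  qed
  have src: "src x t = tconv \<sigma> p (traj x t) (traj x t)" for t
    using x(2)[of t] le[OF clampT_in, of t] by (simp add: retract_def traj_clampT)
  have leM: "?n t \<le> M" for t
    using apriori[OF clampT_in x(1) src, of t] by (simp add: traj_clampT)
  show ?thesis
  proof (rule that[of x])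
    show "x = (u0, 0) + Q p x x" by (rule traj_data_eqI) (simp_all add: x(1) src)
    have "norm (snd x) \<le> S * P * M * M"
      by (rule norm_bound) (unfold src, intro norm_tconv_le p leM)
    moreover have "norm x \<le> norm (fst x) + norm (snd x)"
      unfolding norm_prod_def by (rule sqrt_sum_squares_le_sum) auto
    ultimately show "norm x \<le> M + S * P * M * M" using u0 x(1) by simp
  qed
qed

end

section \<open>Fourier series on the torus\<close>

text \<open>Half-open, hence a fundamental domain: every orbit of the lattice meets it exactly once,
  while it differs from \<open>cube\<close> by a null set.\<close>

definition unit_box :: "(real^'d) set" where
  "unit_box = {x. \<forall>i. 0 \<le> x$i \<and> x$i < 1}"

lemma cube_eq_cbox: "cube = cbox (0::real^'d) (\<chi> i. 1)"
  by (auto simp: cube_def mem_box_cart)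

lemma compact_cube: "compact (cube :: (real^'d) set)" by (simp add: cube_eq_cbox)

lemma cube_lebesgue [measurable, simp]: "cube \<in> sets lebesgue"
  by (simp add: cube_eq_cbox)

lemma emeasure_cube: "emeasure lebesgue (cube :: (real^'d) set) = 1"
proof -
  have "measure lborel (cbox (0::real^'d) (\<chi> i. 1)) = 1"
    by (subst content_cbox_cart) (simp_all add: interval_ne_empty_cart)
  moreover have "emeasure lborel (cbox (0::real^'d) (\<chi> i. 1)) \<noteq> \<infinity>"
    by (simp add: emeasure_lborel_cbox_eq)
  ultimately show ?thesis
    by (simp add: cube_eq_cbox emeasure_eq_ennreal_measure)
qed

abbreviation torus :: "(real^'d) measure" where "torus \<equiv> lebesgue_on cube"

lemma emeasure_torus: "emeasure torus (space (torus :: (real^'d) measure)) = 1"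
  by (simp add: emeasure_restrict_space emeasure_cube space_restrict_space)

interpretation torus: finite_measure "torus :: (real^'d) measure"
  by (rule finite_measureI) (simp only: emeasure_torus, simp)

lemma measure_torus: "measure torus cube = 1"
  using emeasure_torus by (simp add: measure_def space_restrict_space)

lemma negligible_face: "negligible (cube - unit_box :: (real^'d) set)"
proof (rule negligible_subset)
  show "negligible (\<Union>i::'d. {x::real^'d. axis i 1 \<bullet> x = 1})"
    by (intro negligible_Union finite_imageI) (auto intro!: negligible_hyperplane)
  show "cube - unit_box \<subseteq> (\<Union>i::'d. {x::real^'d. axis i 1 \<bullet> x = 1})"
  proof
    fix x :: "real^'d" assume x: "x \<in> cube - unit_box"
    then obtain i where i: "\<not> (0 \<le> x $ i \<and> x $ i < 1)"
      by (auto simp: unit_box_def)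
    moreover have "0 \<le> x $ i \<and> x $ i \<le> 1" using x by (auto simp: cube_def)
    ultimately have "x $ i = 1" by linarith
    then have "axis i 1 \<bullet> x = 1" by (simp add: inner_axis')
    then show "x \<in> (\<Union>i::'d. {x::real^'d. axis i 1 \<bullet> x = 1})" by blast
  qed
qed

lemma unit_box_lebesgue [measurable, simp]: "(unit_box :: (real^'d) set) \<in> sets lebesgue"
proof -
  have "unit_box = cube - (cube - unit_box :: (real^'d) set)" by (auto simp: cube_def unit_box_def intro: less_imp_le)
  moreover have "cube - unit_box \<in> sets (lebesgue :: (real^'d) measure)"
    by (rule negligible_imp_sets[OF negligible_face])
  ultimately show ?thesis by (metis cube_lebesgue sets.Diff)
qed

lemma unit_box_tiling:
  fixes x :: "real^'d"
  shows "\<exists>!k. x + lattice_vec k \<in> unit_box"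
proof
  show "x + lattice_vec (\<chi> i. - \<lfloor>x $ i\<rfloor>) \<in> unit_box"
  proof -
    have "0 \<le> x $ i + real_of_int (- \<lfloor>x $ i\<rfloor>)" "x $ i + real_of_int (- \<lfloor>x $ i\<rfloor>) < 1" for i
      using of_int_floor_le[of "x $ i"] real_of_int_floor_add_one_gt[of "x $ i"] by linarith+
    then have *: "0 \<le> (x + lattice_vec (\<chi> i. - \<lfloor>x $ i\<rfloor>)) $ i \<and> (x + lattice_vec (\<chi> i. - \<lfloor>x $ i\<rfloor>)) $ i < 1" for i
      by (simp only: lattice_vec_def vector_add_component vec_lambda_beta simp_thms)
    show ?thesis unfolding unit_box_def by (rule CollectI, rule allI) (rule *)
  qed
  fix k assume k: "x + lattice_vec k \<in> unit_box"
  show "k = (\<chi> i. - \<lfloor>x $ i\<rfloor>)"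
    unfolding vec_eq_iff
  proof
    fix i
    have "0 \<le> x $ i + real_of_int (k $ i)" "x $ i + real_of_int (k $ i) < 1"
      using k by (auto simp: unit_box_def lattice_vec_def)
    then have "\<lfloor>x $ i\<rfloor> = - k $ i" by (intro floor_unique) auto
    then show "k $ i = (\<chi> i. - \<lfloor>x $ i\<rfloor>) $ i" by simp
  qed
qed

lemma nn_integral_unit_box_tiling:
  "(\<integral>\<^sup>+k. indicator unit_box (x + lattice_vec k) \<partial>count_space UNIV) = (1::ennreal)" for x :: "real^'d"
proof -
  obtain k0 where k0: "x + lattice_vec k0 \<in> unit_box" "\<And>k. x + lattice_vec k \<in> unit_box \<Longrightarrow> k = k0"
    using unit_box_tiling[of x] by blast
  have "(\<lambda>k. indicator unit_box (x + lattice_vec k) :: ennreal) = indicator {k0}"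
  proof
    show "indicator unit_box (x + lattice_vec k) = (indicator {k0} k :: ennreal)" for k
      using k0(1) k0(2)[of k] by (cases "k = k0") (auto simp: indicator_def)
  qed
  then show ?thesis by simp
qed

section \<open>Reflection invariance of integrals over the period cell\<close>

lemma lebesgue_reflect:
  fixes t :: "real^'d"
  shows "distr lebesgue lebesgue (\<lambda>x. t - x) = lebesgue" "(\<lambda>x. t - x) \<in> lebesgue \<rightarrow>\<^sub>M lebesgue"
proof -
  have eq: "(\<lambda>x. t + (\<Sum>j\<in>Basis. (- 1 * (x \<bullet> j)) *\<^sub>R j)) = (\<lambda>x. t - x)"
    by (simp add: fun_eq_iff sum_negf euclidean_representation)
  show "(\<lambda>x. t - x) \<in> lebesgue \<rightarrow>\<^sub>M lebesgue"
    using lebesgue_affine_measurable[of "\<lambda>_. - 1" t] unfolding eq by simp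
  show "distr lebesgue lebesgue (\<lambda>x. t - x) = lebesgue"
    using lebesgue_affine_euclidean[of "\<lambda>_. - 1" t] unfolding eq by (simp add: density_1)
qed

lemma lebesgue_translate:
  fixes t :: "real^'d"
  shows "distr lebesgue lebesgue (\<lambda>x. x + t) = lebesgue" "(\<lambda>x. x + t) \<in> lebesgue \<rightarrow>\<^sub>M lebesgue"
proof -
  have eq: "(\<lambda>x. t + (\<Sum>j\<in>Basis. (1 * (x \<bullet> j)) *\<^sub>R j)) = (\<lambda>x. x + t)"
    by (simp add: fun_eq_iff euclidean_representation add.commute)
  show "(\<lambda>x. x + t) \<in> lebesgue \<rightarrow>\<^sub>M lebesgue"
    using lebesgue_affine_measurable[of "\<lambda>_. 1" t] unfolding eq by simp
  show "distr lebesgue lebesgue (\<lambda>x. x + t) = lebesgue"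
    using lebesgue_affine_euclidean[of "\<lambda>_. 1" t] unfolding eq by (simp add: density_1)
qed

lemma nn_integral_torus:
  fixes g :: "real^'d \<Rightarrow> ennreal"
  shows "(\<integral>\<^sup>+x. g x \<partial>torus) = (\<integral>\<^sup>+x. g x * indicator unit_box x \<partial>lebesgue)"
proof -
  have "(\<integral>\<^sup>+x. g x \<partial>torus) = (\<integral>\<^sup>+x. g x * indicator cube x \<partial>lebesgue)"
    by (rule nn_integral_restrict_space) simp
  also have "\<dots> = (\<integral>\<^sup>+x. g x * indicator unit_box x \<partial>lebesgue)"
  proof (rule nn_integral_cong_AE)
    have "cube - unit_box \<in> null_sets (lebesgue :: (real^'d) measure)"
      using negligible_face by (simp add: negligible_iff_null_sets)
    then have "AE x in (lebesgue :: (real^'d) measure). x \<notin> cube - unit_box" by (rule AE_not_in)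
    then show "AE x in lebesgue. g x * indicator cube x = g x * indicator unit_box x"
      by eventually_elim (auto simp: indicator_def cube_def unit_box_def less_imp_le)
  qed
  finally show ?thesis .
qed

text \<open>Unfold the integral over the unit box to a sum over the lattice and fold it back.\<close>
lemma nn_integral_torus_reflect:
  fixes g :: "real^'d \<Rightarrow> ennreal"
  assumes g [measurable]: "g \<in> borel_measurable lebesgue" and per: "\<And>x k. g (x + lattice_vec k) = g x"
  shows "(\<integral>\<^sup>+y. g (t - y) \<partial>torus) = (\<integral>\<^sup>+y. g y \<partial>torus)"
proof -
  note [measurable] = lebesgue_reflect(2) lebesgue_translate(2)
  let ?B = "indicator unit_box :: real^'d \<Rightarrow> ennreal"
  have B [measurable]: "?B \<in> borel_measurable lebesgue" by simp
  have Bt [measurable]: "(\<lambda>z. ?B (t - z)) \<in> borel_measurable lebesgue"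
    using measurable_compose[OF lebesgue_reflect(2) B] .
  have Bk [measurable]: "(\<lambda>z. ?B (z + lattice_vec k)) \<in> borel_measurable lebesgue" for k
    using measurable_compose[OF lebesgue_translate(2) B] .
  have Btk [measurable]: "(\<lambda>z. ?B (t - (z - lattice_vec k))) \<in> borel_measurable lebesgue" for k
    using measurable_compose[OF lebesgue_translate(2)[of "- lattice_vec k"] Bt] by simp
  have "(\<integral>\<^sup>+y. g (t - y) \<partial>torus) = (\<integral>\<^sup>+y. g (t - y) * ?B (t - (t - y)) \<partial>lebesgue)"
    by (simp add: nn_integral_torus)
  also have "\<dots> = (\<integral>\<^sup>+z. g z * ?B (t - z) \<partial>distr lebesgue lebesgue (\<lambda>y. t - y))"
    by (subst nn_integral_distr) (auto intro: lebesgue_reflect(2))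
  also have "\<dots> = (\<integral>\<^sup>+z. g z * ?B (t - z) \<partial>lebesgue)" by (simp only: lebesgue_reflect(1))
  also have "\<dots> = (\<integral>\<^sup>+z. \<integral>\<^sup>+k. g z * ?B (t - z) * ?B (z + lattice_vec k) \<partial>count_space UNIV \<partial>lebesgue)"
    by (simp add: nn_integral_cmult nn_integral_unit_box_tiling)
  also have "\<dots> = (\<integral>\<^sup>+k. \<integral>\<^sup>+z. g z * ?B (t - z) * ?B (z + lattice_vec k) \<partial>lebesgue \<partial>count_space UNIV)"
    by (rule nn_integral_count_space_nn_integral) auto
  also have "\<dots> = (\<integral>\<^sup>+k. \<integral>\<^sup>+w. g w * ?B (t - (w - lattice_vec k)) * ?B w \<partial>lebesgue \<partial>count_space UNIV)"
  proof (rule nn_integral_cong)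
    fix k :: "int^'d"
    have "(\<integral>\<^sup>+z. g z * ?B (t - z) * ?B (z + lattice_vec k) \<partial>lebesgue)
        = (\<integral>\<^sup>+z. g (z + lattice_vec k) * ?B (t - ((z + lattice_vec k) - lattice_vec k)) * ?B (z + lattice_vec k) \<partial>lebesgue)"
      by (simp add: per)
    also have "\<dots> = (\<integral>\<^sup>+w. g w * ?B (t - (w - lattice_vec k)) * ?B w \<partial>distr lebesgue lebesgue (\<lambda>z. z + lattice_vec k))"
      by (subst nn_integral_distr) (auto intro: lebesgue_translate(2))
    finally show "(\<integral>\<^sup>+z. g z * ?B (t - z) * ?B (z + lattice_vec k) \<partial>lebesgue) = (\<integral>\<^sup>+w. g w * ?B (t - (w - lattice_vec k)) * ?B w \<partial>lebesgue)"
      by (simp only: lebesgue_translate(1))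
  qed
  also have "\<dots> = (\<integral>\<^sup>+w. \<integral>\<^sup>+k. g w * ?B w * ?B ((t - w) + lattice_vec k) \<partial>count_space UNIV \<partial>lebesgue)"
    by (subst nn_integral_count_space_nn_integral[symmetric]) (auto simp: algebra_simps)
  also have "\<dots> = (\<integral>\<^sup>+w. g w * ?B w \<partial>lebesgue)"
    by (simp add: nn_integral_cmult nn_integral_unit_box_tiling)
  finally show ?thesis by (simp add: nn_integral_torus)
qed

lemma measurable_torusI: "f \<in> borel_measurable lebesgue \<Longrightarrow> f \<in> borel_measurable torus"
  by (rule measurable_restrict_space1)

text \<open>Convolutions evaluate at \<open>t - y\<close>, so reflection and translation are
  combined. Positive and negative parts reduce the claim to nonnegative functions.\<close>

lemma torus_reflect_real:
  fixes g :: "real^'d \<Rightarrow> real"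
  assumes g: "g \<in> borel_measurable lebesgue" and per: "\<And>x k. g (x + lattice_vec k) = g x"
  shows "integrable torus (\<lambda>y. g (t - y)) \<longleftrightarrow> integrable torus g" (is ?A)
    and "(LINT y|torus. g (t - y)) = (LINT y|torus. g y)" (is ?B)
proof -
  have gt: "(\<lambda>y. g (t - y)) \<in> borel_measurable lebesgue"
    using measurable_compose[OF lebesgue_reflect(2) g] .
  note m = measurable_torusI[OF g] measurable_torusI[OF gt]
  have r: "(\<integral>\<^sup>+y. ennreal (h (g (t - y))) \<partial>torus) = (\<integral>\<^sup>+y. ennreal (h (g y)) \<partial>torus)"
    if "h \<in> borel_measurable borel" for h :: "real \<Rightarrow> real"
    by (rule nn_integral_torus_reflect[of "\<lambda>y. ennreal (h (g y))"])
      (use g that in \<open>auto simp: per intro: measurable_compose\<close>)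
  show A: ?A using m r[of "\<lambda>x. norm x"] by (simp add: integrable_iff_bounded)
  show ?B
  proof (cases "integrable torus g")
    case True
    with A have 2: "integrable torus (\<lambda>y. g (t - y))" by simp
    show ?thesis
      unfolding real_lebesgue_integral_def[OF True] real_lebesgue_integral_def[OF 2]
      using r[of "\<lambda>x. x"] r[of "\<lambda>x. - x"] by simp
  next
    case False
    with A show ?thesis by (simp add: not_integrable_integral_eq)
  qed
qed

lemma AE_torus_reflect:
  fixes P :: "real^'d \<Rightarrow> bool"
  assumes "{x. P x} \<in> sets lebesgue" "\<And>x k. P (x + lattice_vec k) = P x" "AE y in torus. P y"
  shows "AE y in torus. P (t - y)"
proof -
  let ?g = "indicator {x. \<not> P x} :: real^'d \<Rightarrow> ennreal"
  have g: "?g \<in> borel_measurable lebesgue"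
    using assms(1) sets.compl_sets[of "{x. P x}" lebesgue] by (simp add: Collect_neg_eq Compl_eq_Diff_UNIV)
  have gt: "(\<lambda>y. ?g (t - y)) \<in> borel_measurable lebesgue" using measurable_compose[OF lebesgue_reflect(2) g] .
  have "(\<integral>\<^sup>+y. ?g y \<partial>torus) = 0"
    using assms(3) measurable_torusI[OF g] by (subst nn_integral_0_iff_AE) (auto simp: indicator_def)
  then have "(\<integral>\<^sup>+y. ?g (t - y) \<partial>torus) = 0"
    using nn_integral_torus_reflect[OF g, of t] assms(2) by (simp add: indicator_def)
  then show ?thesis
    using measurable_torusI[OF gt] by (subst (asm) nn_integral_0_iff_AE) (auto simp: indicator_def elim: eventually_mono)
qed

subsection \<open>Characters\<close>

definition character :: "int^'d \<Rightarrow> real^'d \<Rightarrow> complex" where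
  "character k x = cis (2 * pi * (\<Sum>i\<in>UNIV. real_of_int (k$i) * x$i))"

lemma fcoef_character: "fcoef f k = (LINT x|torus. complex_of_real (f x) * character (- k) x)"
  by (simp add: fcoef_def character_def sum_negf)

lemma character_add_index: "character (k + m) x = character k x * character m x"
  by (simp add: character_def cis_mult algebra_simps sum.distrib)

lemma character_add: "character k (x + y) = character k x * character k y"
  by (simp add: character_def cis_mult algebra_simps sum.distrib)

lemma character_uminus: "character (- k) x = cnj (character k x)"
  by (simp add: character_def cis_cnj sum_negf)

lemma character_neg: "character k (- x) = cnj (character k x)"
  by (simp add: character_def cis_cnj sum_negf)

lemma character_diff: "character k (x - y) = character k x * cnj (character k y)"
  using character_add[of k x "- y"] by (simp add: character_neg)

lemma character_0 [simp]: "character 0 x = 1" "character k 0 = 1" by (simp_all add: character_def)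

lemma norm_character [simp]: "cmod (character k x) = 1" by (simp add: character_def)

lemma character_periodic: "character k (x + lattice_vec m) = character k x"
proof -
  have "(\<Sum>i\<in>UNIV. real_of_int (k $ i) * lattice_vec m $ i) = real_of_int (\<Sum>i\<in>UNIV. k $ i * m $ i)"
    by (simp add: lattice_vec_def)
  then have "character k (lattice_vec m) = cis (2 * pi * of_int (\<Sum>i\<in>UNIV. k $ i * m $ i))"
    unfolding character_def by (simp only:)
  also have "\<dots> = 1" by (rule cis_multiple_2pi) (rule Ints_of_int)
  finally show ?thesis by (simp add: character_add)
qed

lemma character_continuous: "continuous_on A (character k)"
  unfolding character_def by (intro continuous_intros)

lemma character_measurable [measurable]: "character k \<in> borel_measurable lebesgue"
  using character_continuous[of UNIV k] by (simp add: borel_measurable_continuous_onI measurable_completion)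

lemma bounded_integrable_torus:
  fixes f :: "real^'d \<Rightarrow> 'b::{banach,second_countable_topology}"
  assumes "f \<in> borel_measurable lebesgue" "AE x in torus. norm (f x) \<le> C"
  shows "integrable torus f"
  using assms by (intro torus.integrable_const_bound[of _ C] measurable_torusI) auto

lemma integrable_character: "integrable torus (character k)"
  by (rule bounded_integrable_torus[of _ 1]) auto

text \<open>Shifting by half a period multiplies the character by -1 and leaves the integral
  unchanged; the shift is composed of two reflections.\<close>

lemma integral_character: "(LINT x|torus. character k x) = (if k = 0 then 1 else 0)" for k :: "int^'d"
proof (cases "k = 0")
  case True
  then show ?thesis by (simp add: measure_torus space_restrict_space)
next
  case False
  then obtain i where i: "k $ i \<noteq> 0" by (auto simp: vec_eq_iff)
  let ?I = "LINT x|torus. character k x"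
  have refl: "(LINT y|torus. character k (t - y)) = ?I" for t
  proof (rule complex_eqI)
    have R: "(\<lambda>y. Re (character k y)) \<in> borel_measurable lebesgue" "(\<lambda>y. Im (character k y)) \<in> borel_measurable lebesgue"
      using character_measurable[of k] by measurable
    have c: "continuous_on UNIV (\<lambda>y. character k (t - y))" unfolding character_def by (intro continuous_intros)
    have i: "integrable torus (\<lambda>y. character k (t - y))"
      using borel_measurable_continuous_onI[OF c]
      by (intro bounded_integrable_torus[of _ 1]) (auto simp: measurable_completion)
    show "Re (LINT y|torus. character k (t - y)) = Re ?I"
      using torus_reflect_real(2)[OF R(1), of t] i integrable_character[of k] by (simp add: character_periodic)
    show "Im (LINT y|torus. character k (t - y)) = Im ?I"
      using torus_reflect_real(2)[OF R(2), of t] i integrable_character[of k] by (simp add: character_periodic)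
  qed
  \<comment> \<open>The phase of \<open>character k\<close> at this point is 1/2, so its value is
    -1.\<close>
  let ?t = "axis i (1 / (2 * real_of_int (k $ i))) :: real^'d"
  have "(\<Sum>j\<in>UNIV. real_of_int (k $ j) * ?t $ j) = (\<Sum>j\<in>UNIV. if j = i then 1 / 2 else 0)"
    using i by (intro sum.cong) (auto simp: axis_def)
  then have s: "(\<Sum>j\<in>UNIV. real_of_int (k $ j) * ?t $ j) = 1 / 2" by (simp only: sum.delta finite UNIV_I if_True)
  have t: "character k ?t = -1" unfolding character_def s by simp
  have "?I = (LINT y|torus. character k ?t * cnj (character k y))"
    using refl[of ?t] by (simp add: character_diff)
  also have "\<dots> = - (LINT y|torus. cnj (character k y))" unfolding t by simp
  also have "(LINT y|torus. cnj (character k y)) = (LINT y|torus. character k (0 - y))"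
    unfolding character_diff by simp
  also have "\<dots> = ?I" by (rule refl)
  finally show ?thesis using False by simp
qed

subsection \<open>Completeness\<close>

definition L1per :: "(real^'d \<Rightarrow> real) \<Rightarrow> bool" where
  "L1per f \<longleftrightarrow> f \<in> borel_measurable lebesgue \<and> integrable torus f"

lemma L1per_mult_bounded:
  assumes f: "L1per f" and g: "g \<in> borel_measurable lebesgue" "\<And>x. \<bar>g x\<bar> \<le> C"
  shows "L1per (\<lambda>x. f x * g x)"
proof -
  have "integrable torus (\<lambda>x. f x * g x)"
  proof (rule Bochner_Integration.integrable_bound)
    show "integrable torus (\<lambda>x. C * f x)" using f by (simp add: L1per_def)
    show "(\<lambda>x. f x * g x) \<in> borel_measurable torus"
      using f g by (intro borel_measurable_times measurable_torusI) (auto simp: L1per_def)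
    have "norm (f x * g x) \<le> norm (C * f x)" for x
      using mult_left_mono[OF g(2)[of x], of "\<bar>f x\<bar>"] g(2)[of x] by (simp add: abs_mult mult.commute)
    then show "AE x in torus. norm (f x * g x) \<le> norm (C * f x)" by simp
  qed
  with f g show ?thesis by (auto simp: L1per_def intro: borel_measurable_times)
qed

lemma integrable_mult_character:
  "L1per f \<Longrightarrow> integrable torus (\<lambda>x. complex_of_real (f x) * character k x)"
  by (rule Bochner_Integration.integrable_bound[of torus f])
    (auto simp: L1per_def norm_mult intro!: borel_measurable_times measurable_torusI)

text \<open>The torus as a product of unit circles: real and imaginary parts of characters become
  polynomials in the coordinates, within reach of the Stone-Weierstrass theorem.\<close>

definition torus_embed :: "real^'d \<Rightarrow> complex^'d" where
  "torus_embed x = (\<chi> i. cis (2 * pi * x $ i))"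

lemma torus_embed_continuous: "continuous_on A torus_embed"
  unfolding torus_embed_def by (intro continuous_intros)

text \<open>Coordinates of the embedding are real and imaginary parts of characters and merely shift
  frequencies. In the product case \<open>f\<close> times the first polynomial again has vanishing
  coefficients, which is why \<open>f\<close> varies in the induction.\<close>

lemma real_polynomial_orthogonal:
  assumes "real_polynomial_function p" "L1per f" "\<And>k. fcoef f k = 0"
  shows "L1per (\<lambda>x. f x * p (torus_embed x))" "fcoef (\<lambda>x. f x * p (torus_embed x)) k = 0"
proof -
  have bnd: "\<exists>C. \<forall>x. \<bar>p (torus_embed x)\<bar> \<le> C" if p: "real_polynomial_function p" for p :: "complex^'d \<Rightarrow> real"
  proof -
    have "compact (p ` cball 0 (real CARD('d)))"
      by (intro compact_continuous_image continuous_at_imp_continuous_on ballI continuous_real_polymonial_function p) auto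
    then obtain C where C: "\<And>z. z \<in> cball 0 (real CARD('d)) \<Longrightarrow> \<bar>p z\<bar> \<le> C"
      using compact_imp_bounded by (force simp: bounded_iff)
    have "torus_embed x \<in> cball 0 (real CARD('d))" for x :: "real^'d"
    proof -
      have "norm (torus_embed x) \<le> (\<Sum>i\<in>UNIV. norm (torus_embed x $ i))" unfolding norm_vec_def by (rule L2_set_le_sum) auto
      also have "\<dots> = real CARD('d)" by (simp add: torus_embed_def)
      finally show ?thesis by simp
    qed
    with C show ?thesis by blast
  qed
  have meas: "(\<lambda>x. p (torus_embed x)) \<in> borel_measurable lebesgue" if p: "real_polynomial_function p" for p :: "complex^'d \<Rightarrow> real"
  proof -
    have "continuous_on UNIV (p \<circ> torus_embed)"
      by (intro continuous_on_compose torus_embed_continuous continuous_at_imp_continuous_on ballI continuous_real_polymonial_function p)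
    then show ?thesis by (simp add: comp_def borel_measurable_continuous_onI measurable_completion)
  qed
  have L1: "L1per (\<lambda>x. f x * p (torus_embed x))" if "real_polynomial_function p" "L1per f" for p f
    using bnd[OF that(1)] L1per_mult_bounded[OF that(2) meas[OF that(1)]] by blast
  show "L1per (\<lambda>x. f x * p (torus_embed x))" by (rule L1[OF assms(1,2)])
  show "fcoef (\<lambda>x. f x * p (torus_embed x)) k = 0"
    using assms
  proof (induction arbitrary: f k rule: real_polynomial_function.induct)
    case (linear h)
    then interpret h: bounded_linear h by simp
    have embed: "torus_embed x = (\<Sum>i\<in>UNIV. Re (character (axis i 1) x) *\<^sub>R axis i 1 + Im (character (axis i 1) x) *\<^sub>R axis i \<i>)" for x :: "real^'d"
    proof -
      have "character (axis i 1) x = cis (2 * pi * x $ i)" for i :: 'd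
      proof -
        have "(\<Sum>j\<in>UNIV. real_of_int (axis i 1 $ j) * x $ j) = (\<Sum>j\<in>UNIV. if j = i then x $ j else 0)"
          by (intro sum.cong) (auto simp: axis_def)
        then show ?thesis by (simp add: character_def)
      qed
      then show ?thesis
        by (auto simp: vec_eq_iff torus_embed_def axis_def complex_eq_iff sum.delta' if_distrib cong: if_cong)
    qed
    have one: "complex_of_real (f x * Re (character m x)) * character (- k) x
        = (1 / 2) * (complex_of_real (f x) * character (- (k - m)) x) + (1 / 2) * (complex_of_real (f x) * character (- (k + m)) x)"
      "complex_of_real (f x * Im (character m x)) * character (- k) x
        = (- \<i> / 2) * (complex_of_real (f x) * character (- (k - m)) x) + (\<i> / 2) * (complex_of_real (f x) * character (- (k + m)) x)" for m x
    proof -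
      have a: "character (- (k - m)) x = character m x * character (- k) x"
        "character (- (k + m)) x = cnj (character m x) * character (- k) x"
        by (simp_all add: character_add_index[symmetric] character_uminus[symmetric] add.commute)
      have r: "complex_of_real (Re z) = (1 / 2) * z + (1 / 2) * cnj z" "complex_of_real (Im z) = (- \<i> / 2) * z + (\<i> / 2) * cnj z" for z
        by (simp_all add: complex_eq_iff)
      then show "complex_of_real (f x * Re (character m x)) * character (- k) x
        = (1 / 2) * (complex_of_real (f x) * character (- (k - m)) x) + (1 / 2) * (complex_of_real (f x) * character (- (k + m)) x)"
      "complex_of_real (f x * Im (character m x)) * character (- k) x
        = (- \<i> / 2) * (complex_of_real (f x) * character (- (k - m)) x) + (\<i> / 2) * (complex_of_real (f x) * character (- (k + m)) x)"
        unfolding a of_real_mult r by (simp_all only: ring_distribs mult_ac)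
    qed
    have int: "integrable torus (\<lambda>x. c * (complex_of_real (f x) * character m x))" for c m
      using integrable_mult_character[OF linear(2)] by simp
    have lin: "(LINT x|torus. c1 * (complex_of_real (f x) * character (- m1) x) + c2 * (complex_of_real (f x) * character (- m2) x)) = 0" for c1 c2 m1 m2
      unfolding Bochner_Integration.integral_add[OF int int] integral_mult_right_zero
      using linear(3) by (simp only: fcoef_character[symmetric] mult_zero_right add_0_left)
    have part: "integrable torus (\<lambda>x. complex_of_real (f x * Re (character m x)) * character (- k) x)"
        "(LINT x|torus. complex_of_real (f x * Re (character m x)) * character (- k) x) = 0"
      "integrable torus (\<lambda>x. complex_of_real (f x * Im (character m x)) * character (- k) x)"
        "(LINT x|torus. complex_of_real (f x * Im (character m x)) * character (- k) x) = 0" for m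
      unfolding one by (rule lin Bochner_Integration.integrable_add[OF int int])+
    have "complex_of_real (f x * h (torus_embed x)) * character (- k) x
      = (\<Sum>i\<in>UNIV. of_real (h (axis i 1)) * (complex_of_real (f x * Re (character (axis i 1) x)) * character (- k) x)
          + of_real (h (axis i \<i>)) * (complex_of_real (f x * Im (character (axis i 1) x)) * character (- k) x))" for x
      unfolding embed[of x] h.sum h.add h.scaleR by (simp add: sum_distrib_left sum_distrib_right algebra_simps)
    then show ?case
      unfolding fcoef_character
      by (simp only: Bochner_Integration.integral_sum Bochner_Integration.integral_add Bochner_Integration.integrable_add
          integrable_mult_right part integral_mult_right_zero mult_zero_right add_0_left sum.neutral_const)
  next
    case (const c)
    have "fcoef (\<lambda>x. f x * c) k = of_real c * fcoef f k"
      unfolding fcoef_character by (simp add: mult_ac flip: integral_mult_right_zero)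
    with const show ?case by simp
  next
    case (add p q)
    have "fcoef (\<lambda>x. f x * (p (torus_embed x) + q (torus_embed x))) k
      = fcoef (\<lambda>x. f x * p (torus_embed x)) k + fcoef (\<lambda>x. f x * q (torus_embed x)) k"
      unfolding fcoef_character
      by (simp add: ring_distribs Bochner_Integration.integral_add integrable_mult_character[OF L1[OF add(1) add(5), unfolded of_real_mult], simplified]
          integrable_mult_character[OF L1[OF add(2) add(5)], simplified])
    with add show ?case by simp
  next
    case (mult p q)
    have "fcoef (\<lambda>x. (f x * p (torus_embed x)) * q (torus_embed x)) k = 0"
      by (rule mult.IH(2)[OF L1[OF mult(1,5)] mult.IH(1)[OF mult(5,6)]])
    then show ?case by (simp add: mult.assoc)
  qed
qed

lemma torus_embed_inj:
  assumes "x \<in> box 0 (\<chi> i. 1)" "y \<in> cube" "torus_embed x = torus_embed y"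
  shows "x = y"
  unfolding vec_eq_iff
proof
  fix i
  have "cis (2 * pi * x $ i) = cis (2 * pi * y $ i)" using assms(3) by (simp add: torus_embed_def vec_eq_iff)
  then have "sin (2 * pi * y $ i) = sin (2 * pi * x $ i) \<and> cos (2 * pi * y $ i) = cos (2 * pi * x $ i)"
    by (simp add: complex_eq_iff)
  then obtain n :: int where "2 * pi * y $ i = 2 * pi * x $ i + 2 * pi * n" unfolding sin_cos_eq_iff by blast
  then have "2 * pi * y $ i = 2 * pi * (x $ i + n)" by (simp add: algebra_simps)
  then have y: "y $ i = x $ i + n" using pi_gt_zero by (simp only: mult_cancel_left) simp
  moreover have "0 < x $ i" "x $ i < 1" "0 \<le> y $ i" "y $ i \<le> 1"
    using assms by (auto simp: mem_box_cart cube_def)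
  ultimately have "real_of_int n < 1" "real_of_int n > -1" by linarith+
  then have "n = 0" by linarith
  then show "x $ i = y $ i" using y by simp
qed

text \<open>Polynomials approximate \<open>G\<close> uniformly on a ball that contains the embedded
  torus, and \<open>f\<close> is integrable.\<close>

lemma continuous_orthogonal:
  fixes G :: "complex^'d \<Rightarrow> real"
  assumes f: "L1per f" "\<And>k. fcoef f k = 0" and G: "continuous_on UNIV G"
  shows "(LINT x|torus. f x * G (torus_embed x)) = 0"
proof -
  have embed: "torus_embed x \<in> cball 0 (real CARD('d))" for x :: "real^'d"
  proof -
    have "norm (torus_embed x) \<le> (\<Sum>i\<in>UNIV. norm (torus_embed x $ i))"
      unfolding norm_vec_def by (rule L2_set_le_sum) auto
    also have "\<dots> = real CARD('d)" by (simp add: torus_embed_def)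
    finally show ?thesis by simp
  qed
  have meas: "(\<lambda>x. H (torus_embed x)) \<in> borel_measurable lebesgue" if H: "continuous_on UNIV H" for H :: "complex^'d \<Rightarrow> real"
  proof -
    have "continuous_on UNIV (H \<circ> torus_embed)"
      by (intro continuous_on_compose torus_embed_continuous continuous_on_subset[OF H]) simp
    then show ?thesis by (simp add: comp_def borel_measurable_continuous_onI measurable_completion)
  qed
  let ?n = "LINT x|torus. \<bar>f x\<bar>"
  have fi: "integrable torus f" "f \<in> borel_measurable lebesgue" using f by (auto simp: L1per_def)
  have n0: "0 \<le> ?n" by (rule integral_nonneg_AE) simp
  have "\<bar>LINT x|torus. f x * G (torus_embed x)\<bar> \<le> e * ?n" if e: "e > 0" for e
  proof -
    obtain p where p: "real_polynomial_function p" "\<And>z. z \<in> cball 0 (real CARD('d)) \<Longrightarrow> \<bar>G z - p z\<bar> < e"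
      using Stone_Weierstrass_real_polynomial_function[OF compact_cball continuous_on_subset[OF G subset_UNIV] e] by metis
    have pc: "continuous_on UNIV p" by (intro continuous_at_imp_continuous_on ballI continuous_real_polymonial_function p)
    have L: "L1per (\<lambda>x. f x * p (torus_embed x))" by (rule real_polynomial_orthogonal(1)[OF p(1) f])
    have "complex_of_real (LINT x|torus. f x * p (torus_embed x)) = fcoef (\<lambda>x. f x * p (torus_embed x)) 0"
      by (simp add: fcoef_character del: of_real_mult)
    also have "\<dots> = 0" by (rule real_polynomial_orthogonal(2)[OF p(1) f])
    finally have z: "(LINT x|torus. f x * p (torus_embed x)) = 0" by simp
    have L2: "L1per (\<lambda>x. f x * (G (torus_embed x) - p (torus_embed x)))"
      by (rule L1per_mult_bounded[OF f(1) borel_measurable_diff[OF meas[OF G] meas[OF pc]], of e])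
        (use p(2)[OF embed] in \<open>auto intro: less_imp_le\<close>)
    have "(LINT x|torus. f x * G (torus_embed x))
      = (LINT x|torus. f x * p (torus_embed x) + f x * (G (torus_embed x) - p (torus_embed x)))"
      by (simp add: algebra_simps)
    also have "\<dots> = (LINT x|torus. f x * (G (torus_embed x) - p (torus_embed x)))"
      using L L2 z by (subst Bochner_Integration.integral_add) (auto simp: L1per_def)
    finally have "\<bar>LINT x|torus. f x * G (torus_embed x)\<bar> \<le> (LINT x|torus. \<bar>f x * (G (torus_embed x) - p (torus_embed x))\<bar>)"
      by (simp only: integral_abs_bound)
    also have "\<dots> \<le> (LINT x|torus. e * \<bar>f x\<bar>)"
    proof (rule integral_mono)
      show "\<bar>f x * (G (torus_embed x) - p (torus_embed x))\<bar> \<le> e * \<bar>f x\<bar>" for x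
        using mult_left_mono[OF less_imp_le[OF p(2)[OF embed[of x]]], of "\<bar>f x\<bar>"] by (simp add: abs_mult mult.commute)
    qed (use L2 fi in \<open>auto simp: L1per_def\<close>)
    finally show ?thesis by simp
  qed
  then have "\<bar>LINT x|torus. f x * G (torus_embed x)\<bar> \<le> 0 + e" if "e > 0" for e
  proof -
    have "e / (?n + 1) > 0" using that n0 by (intro divide_pos_pos) linarith+
    then have "\<bar>LINT x|torus. f x * G (torus_embed x)\<bar> \<le> e / (?n + 1) * ?n"
      by (rule \<open>\<And>e. e > 0 \<Longrightarrow> \<bar>LINT x|torus. f x * G (torus_embed x)\<bar> \<le> e * ?n\<close>)
    also have "\<dots> \<le> e"
    proof -
      have "?n / (?n + 1) \<le> 1" by (subst pos_divide_le_eq) (use n0 in \<open>simp_all add: add_nonneg_pos\<close>)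
      from mult_left_mono[OF this, of e] show ?thesis using that by simp
    qed
    finally show ?thesis by simp
  qed
  then have "\<bar>LINT x|torus. f x * G (torus_embed x)\<bar> \<le> 0" by (rule field_le_epsilon)
  then show ?thesis by simp
qed

lemma AE_torus_box: "AE x in torus. x \<in> box (0::real^'d) (\<chi> i. 1)"
proof -
  have "cube - box (0::real^'d) (\<chi> i. 1) \<in> null_sets lebesgue"
    unfolding cube_eq_cbox using negligible_frontier_interval by (simp only: negligible_iff_null_sets)
  then have "AE x in (lebesgue :: (real^'d) measure). x \<notin> cube - box 0 (\<chi> i. 1)" by (rule AE_not_in)
  then show ?thesis by (subst AE_restrict_space_iff) auto
qed

text \<open>Tent functions of the distance to the embedded set are continuous and decrease to its
  indicator. Inside the open box the embedding identifies no points, so the limit is correct off the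
  boundary, a null set.\<close>

lemma compact_orthogonal:
  assumes f: "L1per f" "\<And>k. fcoef f k = 0" and T: "compact T" "T \<subseteq> box (0::real^'d) (\<chi> i. 1)"
  shows "(LINT x|torus. f x * indicator T x) = 0"
proof (cases "T = {}")
  case False
  let ?K = "torus_embed ` T"
  have K: "compact ?K" "?K \<noteq> {}" using T False by (auto intro: compact_continuous_image torus_embed_continuous)
  define G where "G n z = max 0 (1 - real n * infdist z ?K)" for n z
  have Gc: "continuous_on UNIV (G n)" for n unfolding G_def by (intro continuous_intros)
  have fi: "integrable torus f" "f \<in> borel_measurable lebesgue" using f by (auto simp: L1per_def)
  have meas: "(\<lambda>x. G n (torus_embed x)) \<in> borel_measurable lebesgue" for n
  proof -
    have "continuous_on UNIV (G n \<circ> torus_embed)"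
      by (intro continuous_on_compose torus_embed_continuous continuous_on_subset[OF Gc]) simp
    then show ?thesis by (simp add: comp_def borel_measurable_continuous_onI measurable_completion)
  qed
  have "(\<lambda>n. LINT x|torus. f x * G n (torus_embed x)) \<longlonglongrightarrow> (LINT x|torus. f x * indicator T x)"
  proof (rule integral_dominated_convergence)
    show "(\<lambda>x. f x * indicator T x) \<in> borel_measurable torus"
      using fi T by (intro measurable_torusI borel_measurable_times borel_measurable_indicator)
        (auto simp: lmeasurable_compact fmeasurableD)
    show "(\<lambda>x. f x * G n (torus_embed x)) \<in> borel_measurable torus" for n
      using fi meas by (intro measurable_torusI borel_measurable_times)
    show "integrable torus (\<lambda>x. \<bar>f x\<bar>)" using fi by simp
    have G1: "0 \<le> G n z \<and> G n z \<le> 1" for n z by (simp add: G_def infdist_nonneg)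
    show "AE x in torus. norm (f x * G n (torus_embed x)) \<le> \<bar>f x\<bar>" for n
      using G1 by (intro AE_I2) (simp add: abs_mult mult_left_le)
    show "AE x in torus. (\<lambda>n. f x * G n (torus_embed x)) \<longlonglongrightarrow> f x * indicator T x"
      using AE_torus_box
    proof eventually_elim
      case (elim x)
      have "(\<lambda>n. G n (torus_embed x)) \<longlonglongrightarrow> indicator T x"
      proof (cases "x \<in> T")
        case True
        then show ?thesis by (simp add: G_def)
      next
        case False
        have "torus_embed x \<notin> ?K"
        proof
          assume "torus_embed x \<in> ?K"
          then obtain y where y: "y \<in> T" "torus_embed x = torus_embed y" by blast
          have "y \<in> cube" using subsetD[OF T(2) y(1)] subsetD[OF box_subset_cbox] by (auto simp: cube_eq_cbox)
          from torus_embed_inj[OF elim this y(2)] show False using y(1) False by simp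
        qed
        then have pos: "infdist (torus_embed x) ?K > 0"
          using K by (intro infdist_pos_not_in_closed compact_imp_closed)
        then obtain N where N: "1 \<le> real N * infdist (torus_embed x) ?K"
          by (metis ex_less_of_nat_mult less_imp_le)
        have "G n (torus_embed x) = 0" if "n \<ge> N" for n
        proof -
          have "real N * infdist (torus_embed x) ?K \<le> real n * infdist (torus_embed x) ?K"
            using that pos by (intro mult_right_mono) auto
          then show ?thesis using N by (simp add: G_def)
        qed
        then have "\<forall>\<^sub>F n in sequentially. G n (torus_embed x) = 0" by (auto simp: eventually_sequentially)
        then show ?thesis using False by (simp add: tendsto_eventually)
      qed
      then show ?case by (intro tendsto_intros)
    qed
  qed
  then show ?thesis
    using continuous_orthogonal[OF f Gc] LIMSEQ_unique[OF tendsto_const[of 0]] by simp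
qed simp

lemma fcoef_scale: "fcoef (\<lambda>x. c * f x) k = of_real c * fcoef f k"
  unfolding fcoef_character by (simp add: mult.assoc)

text \<open>The set where \<open>f\<close> is positive is approximated from inside by closed sets.
  There \<open>f\<close> is positive with integral 0, so these sets are null, and what they miss has
  arbitrarily small measure.\<close>

lemma AE_nonpos_of_fcoef_zero:
  assumes f: "L1per f" "\<And>k. fcoef f k = 0"
  shows "AE x in torus. f x \<le> 0"
proof -
  let ?box = "box (0::real^'d) (\<chi> i. 1)"
  define P where "P = {x \<in> ?box. f x > 0}"
  have fi: "integrable torus f" "f \<in> borel_measurable lebesgue" using f by (auto simp: L1per_def)
  have 1: "{x \<in> space lebesgue. f x > 0} \<in> sets lebesgue"
    by (rule borel_measurable_less[OF borel_measurable_const fi(2)])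
  have 2: "?box \<in> sets lebesgue" by simp
  have "P = ?box \<inter> {x \<in> space lebesgue. f x > 0}" by (auto simp: P_def)
  then have P: "P \<in> sets lebesgue" using sets.Int[OF 2 1] by simp
  have Pc: "P \<subseteq> cube" using subsetD[OF box_subset_cbox] by (auto simp: P_def cube_eq_cbox)
  have "emeasure lebesgue P \<le> ennreal e" if e: "e > 0" for e
  proof -
    obtain T where T: "closed T" "T \<subseteq> P" "P - T \<in> lmeasurable" "emeasure lebesgue (P - T) < ennreal e"
      using sets_lebesgue_inner_closed[OF P e] by blast
    have "bounded T" using T(2) Pc bounded_subset[OF compact_imp_bounded[OF compact_cube]] by blast
    then have Tc: "compact T" using T(1) by (simp add: compact_eq_bounded_closed)
    then have Tm: "T \<in> sets lebesgue" by (simp add: lmeasurable_compact fmeasurableD)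
    have Tb: "T \<subseteq> ?box" using T(2) by (auto simp: P_def)
    have int: "integrable torus (\<lambda>x. f x * indicator T x)"
      using L1per_mult_bounded[OF f(1), of "indicator T" 1] Tm by (simp add: L1per_def)
    have "(LINT x|torus. f x * indicator T x) = 0" by (rule compact_orthogonal[OF f Tc Tb])
    moreover have "f x * indicator T x \<ge> 0" for x using T(2) by (auto simp: P_def indicator_def)
    ultimately have "AE x in torus. f x * indicator T x = 0"
      using int by (subst (asm) integral_nonneg_eq_0_iff_AE) auto
    then have "AE x in torus. x \<notin> T" by eventually_elim (use T(2) in \<open>auto simp: P_def\<close>)
    then have "AE x in lebesgue. x \<in> cube \<longrightarrow> x \<notin> T" by (subst (asm) AE_restrict_space_iff) auto
    then have "AE x in lebesgue. x \<notin> T" by eventually_elim (use T(2) Pc in auto)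
    then have "emeasure lebesgue T = 0" using Tm AE_iff_null_sets[of T lebesgue] by auto
    moreover have "emeasure lebesgue P \<le> emeasure lebesgue T + emeasure lebesgue (P - T)"
    proof -
      have "P = T \<union> (P - T)" using T(2) by auto
      then show ?thesis using emeasure_subadditive[OF Tm, of "P - T"] T(3) by (metis fmeasurableD)
    qed
    ultimately show ?thesis using T(4) by auto
  qed
  note le = this
  have "emeasure lebesgue P \<le> 0"
  proof (rule ennreal_le_epsilon)
    show "emeasure lebesgue P \<le> 0 + ennreal e" if "0 < e" for e using le[OF that] by simp
  qed
  then have "P \<in> null_sets lebesgue" using P by auto
  then have "AE x in lebesgue. x \<notin> P" by (rule AE_not_in)
  then have "AE x in torus. x \<notin> P" by (subst AE_restrict_space_iff) auto
  with AE_torus_box show ?thesis by eventually_elim (auto simp: P_def)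
qed

lemma AE_zero_of_fcoef_zero:
  assumes f: "L1per f" "\<And>k. fcoef f k = 0"
  shows "AE x in torus. f x = 0"
proof -
  have "L1per (\<lambda>x. - 1 * f x)" using f(1) by (auto simp: L1per_def)
  moreover have "fcoef (\<lambda>x. - 1 * f x) k = 0" for k using f(2) by (subst fcoef_scale) simp
  ultimately have "AE x in torus. - 1 * f x \<le> 0" by (rule AE_nonpos_of_fcoef_zero)
  with AE_nonpos_of_fcoef_zero[OF f] show ?thesis by eventually_elim simp
qed

subsection \<open>Absolutely convergent Fourier series\<close>

lemma L2per_L1per: "L2per f \<Longrightarrow> L1per f"
proof -
  assume f: "L2per f"
  have "integrable torus f"
  proof (rule Bochner_Integration.integrable_bound)
    show "integrable torus (\<lambda>x. 1 + (f x)\<^sup>2)"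
      using f by (intro Bochner_Integration.integrable_add) (auto simp: L2per_def)
    show "f \<in> borel_measurable torus" using f by (intro measurable_torusI) (auto simp: L2per_def)
    have "\<bar>y\<bar> \<le> 1 + y\<^sup>2" for y :: real
      using zero_le_power2[of "\<bar>y\<bar> - 1"] by (simp add: power2_eq_square algebra_simps)
    then show "AE x in torus. norm (f x) \<le> norm (1 + (f x)\<^sup>2)" by simp
  qed
  with f show ?thesis by (simp add: L1per_def L2per_def)
qed

lemma fcoef_uminus: "fcoef f (- k) = cnj (fcoef f k)"
  unfolding fcoef_character Bochner_Integration.integral_cnj[symmetric] by (simp add: character_uminus)

lemma fcoef_lin: "L1per f \<Longrightarrow> L1per g \<Longrightarrow> fcoef (\<lambda>x. c * f x + g x) k = of_real c * fcoef f k + fcoef g k"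
proof -
  assume f: "L1per f" and g: "L1per g"
  have "fcoef (\<lambda>x. c * f x + g x) k
    = (LINT x|torus. of_real c * (of_real (f x) * character (- k) x) + of_real (g x) * character (- k) x)"
    unfolding fcoef_character by (simp add: algebra_simps)
  also have "\<dots> = of_real c * fcoef f k + fcoef g k"
    using integrable_mult_character[OF f, of "- k"] integrable_mult_character[OF g, of "- k"]
    unfolding fcoef_character by (subst Bochner_Integration.integral_add) auto
  finally show ?thesis .
qed

lemma L1per_lin: "L1per f \<Longrightarrow> L1per g \<Longrightarrow> L1per (\<lambda>x. c * f x + g x)"
  by (auto simp: L1per_def)

lemma AE_eq_of_fcoef_eq:
  assumes "L1per f" "L1per g" "\<And>k. fcoef f k = fcoef g k"
  shows "AE x in torus. f x = g x"
proof -
  have "AE x in torus. - 1 * g x + f x = 0"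
  proof (rule AE_zero_of_fcoef_zero)
    show "L1per (\<lambda>x. - 1 * g x + f x)" by (rule L1per_lin[OF assms(2,1)])
    show "fcoef (\<lambda>x. - 1 * g x + f x) k = 0" for k by (subst fcoef_lin[OF assms(2,1)]) (simp add: assms(3))
  qed
  then show ?thesis by eventually_elim simp
qed

text \<open>Unordered sums meet dominated convergence through an enumeration of the index type: the
  finite sets \<open>F n\<close> eventually contain every finite set.\<close>

lemma integral_infsum_torus:
  fixes h :: "'k::countable \<Rightarrow> real^'d \<Rightarrow> complex"
  assumes meas: "\<And>m. h m \<in> borel_measurable torus" and w: "integrable torus w"
    and le: "\<And>m x. cmod (h m x) \<le> B m * w x" and B: "B summable_on UNIV" "\<And>m. 0 \<le> B m" and w0: "\<And>x. 0 \<le> w x"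
  shows "integrable torus (\<lambda>x. \<Sum>\<^sub>\<infinity>m. h m x)"
    and "(LINT x|torus. (\<Sum>\<^sub>\<infinity>m. h m x)) = (\<Sum>\<^sub>\<infinity>m. (LINT x|torus. h m x))"
proof -
  define F where "F n = {k :: 'k. to_nat k < n}" for n
  have F: "filterlim F (finite_subsets_at_top UNIV) sequentially"
    unfolding filterlim_finite_subsets_at_top
  proof (intro allI impI)
    fix X :: "'k set" assume X: "finite X \<and> X \<subseteq> UNIV"
    then obtain N where N: "\<And>k. k \<in> X \<Longrightarrow> to_nat k < N"
      by (metis finite_imageI finite_nat_set_iff_bounded imageI)
    have "finite (F n)" for n
      unfolding F_def by (rule finite_imageD[of to_nat]) (auto intro: finite_subset[of _ "{..<n}"] inj_on_subset[OF inj_to_nat])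
    then show "\<forall>\<^sub>F n in sequentially. finite (F n) \<and> X \<subseteq> F n \<and> F n \<subseteq> UNIV"
      using N unfolding eventually_sequentially F_def by (fastforce intro!: exI[of _ N])
  qed
  have sx: "(\<lambda>m. h m x) summable_on UNIV" for x
    by (rule abs_summable_summable, rule summable_on_comparison_test[OF summable_on_cmult_left[OF B(1), of "w x"]])
      (use le in auto)
  have hi: "integrable torus (h m)" for m
    by (rule Bochner_Integration.integrable_bound[OF integrable_mult_right[OF w, of "B m"] meas])
      (use le B w0 in \<open>auto simp: abs_mult\<close>)
  have lim: "(\<lambda>n. \<Sum>m\<in>F n. h m x) \<longlonglongrightarrow> (\<Sum>\<^sub>\<infinity>m. h m x)" for x
    using filterlim_compose[OF infsum_tendsto[OF sx] F] .
  have bd: "cmod (\<Sum>m\<in>F n. h m x) \<le> infsum B UNIV * w x" for n x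
  proof -
    have fin: "finite (F n)"
      unfolding F_def by (rule finite_imageD[of to_nat]) (auto intro: finite_subset[of _ "{..<n}"] inj_on_subset[OF inj_to_nat])
    have "cmod (\<Sum>m\<in>F n. h m x) \<le> (\<Sum>m\<in>F n. B m * w x)" by (intro sum_norm_le le)
    also have "\<dots> = sum B (F n) * w x" by (simp add: sum_distrib_right)
    also have "\<dots> \<le> infsum B UNIV * w x"
      using B w0 fin by (intro mult_right_mono finite_sum_le_infsum) auto
    finally show ?thesis .
  qed
  have m1: "(\<lambda>x. \<Sum>m\<in>F n. h m x) \<in> borel_measurable torus" for n
    using meas by (intro borel_measurable_sum)
  have m2: "(\<lambda>x. \<Sum>\<^sub>\<infinity>m. h m x) \<in> borel_measurable torus"
    by (rule borel_measurable_LIMSEQ_metric[OF m1 lim])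
  have wi: "integrable torus (\<lambda>x. infsum B UNIV * w x)" using w by simp
  show "integrable torus (\<lambda>x. \<Sum>\<^sub>\<infinity>m. h m x)"
    by (rule integrable_dominated_convergence[OF m2 m1 wi AE_I2[OF lim] AE_I2[OF bd]])
  have A: "(\<lambda>n. (LINT x|torus. (\<Sum>m\<in>F n. h m x))) \<longlonglongrightarrow> (LINT x|torus. (\<Sum>\<^sub>\<infinity>m. h m x))"
    by (rule integral_dominated_convergence[OF m2 m1 wi AE_I2[OF lim] AE_I2[OF bd]])
  have B': "(LINT x|torus. (\<Sum>m\<in>F n. h m x)) = (\<Sum>m\<in>F n. (LINT x|torus. h m x))" for n
    by (rule Bochner_Integration.integral_sum) (rule hi)
  have C: "(\<lambda>n. \<Sum>m\<in>F n. LINT x|torus. h m x) \<longlonglongrightarrow> (\<Sum>\<^sub>\<infinity>m. (LINT x|torus. h m x))"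
  proof (rule filterlim_compose[OF infsum_tendsto F], rule abs_summable_summable)
    show "(\<lambda>m. norm (LINT x|torus. h m x)) summable_on UNIV"
    proof (rule summable_on_comparison_test[OF summable_on_cmult_left[OF B(1), of "LINT x|torus. w x"]])
      show "norm (LINT x|torus. h m x) \<le> B m * (LINT x|torus. w x)" for m
      proof -
        have "norm (LINT x|torus. h m x) \<le> (LINT x|torus. cmod (h m x))" by (rule integral_norm_bound)
        also have "\<dots> \<le> (LINT x|torus. B m * w x)" using hi w le by (intro integral_mono) auto
        finally show ?thesis by simp
      qed
    qed simp
  qed
  show "(LINT x|torus. (\<Sum>\<^sub>\<infinity>m. h m x)) = (\<Sum>\<^sub>\<infinity>m. (LINT x|torus. h m x))"
    by (rule LIMSEQ_unique[OF A[unfolded B'] C])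
qed

text \<open>The real part fixes the type; for symmetric coefficients the sum is real
  already.\<close>

definition fseries :: "(int^'d \<Rightarrow> complex) \<Rightarrow> real^'d \<Rightarrow> real" where
  "fseries c x = Re (\<Sum>\<^sub>\<infinity>k. c k * character k x)"

locale fourier_coeffs =
  fixes c :: "int^'d \<Rightarrow> complex"
  assumes summable: "(\<lambda>k. cmod (c k)) summable_on UNIV" and hermitian: "c (- k) = cnj (c k)"
begin

lemma series_summable: "(\<lambda>k. c k * character k x) summable_on UNIV"
  by (rule abs_summable_summable) (simp add: norm_mult summable)

lemma of_real_fseries: "complex_of_real (fseries c x) = (\<Sum>\<^sub>\<infinity>k. c k * character k x)"
proof -
  have "(\<Sum>\<^sub>\<infinity>k. c k * character k x) = (\<Sum>\<^sub>\<infinity>k. c (- k) * character (- k) x)"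
    by (rule infsum_reindex_bij_betw[symmetric]) (auto intro!: bij_betwI[of uminus _ _ uminus])
  also have "\<dots> = cnj (\<Sum>\<^sub>\<infinity>k. c k * character k x)"
    unfolding infsum_cnj[symmetric] by (simp add: hermitian character_uminus)
  finally have "Im (\<Sum>\<^sub>\<infinity>k. c k * character k x) = 0" by (metis Im_complex_of_real Reals_cnj_iff complex_is_Real_iff)
  then show ?thesis by (simp add: fseries_def complex_eq_iff)
qed

lemma fseries_continuous: "continuous_on A (fseries c)"
proof -
  have "continuous_on A (\<lambda>x. \<Sum>\<^sub>\<infinity>k. c k * character k x)"
  proof (rule continuous_on_infsum_uniform)
    fix e :: real assume e: "e > 0"
    obtain F where F: "finite F" "\<And>G. finite G \<Longrightarrow> G \<inter> F = {} \<Longrightarrow> (\<Sum>k\<in>G. cmod (c k)) \<le> e"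
      using summable_tail[OF summable _ e] by auto
    have "norm (\<Sum>k\<in>G. c k * character k x) \<le> e" if "finite G" "G \<inter> F = {}" for G x
      by (rule order_trans[OF _ F(2)[OF that]]) (auto intro!: sum_norm_le simp: norm_mult)
    with F(1) show "\<exists>F. finite F \<and> (\<forall>s\<in>A. \<forall>G. finite G \<and> G \<inter> F = {} \<longrightarrow> norm (\<Sum>k\<in>G. c k * character k s) \<le> e)"
      by blast
  qed (auto intro!: continuous_intros character_continuous series_summable)
  then show ?thesis unfolding fseries_def by (intro continuous_intros)
qed

lemma abs_fseries_le: "\<bar>fseries c x\<bar> \<le> (\<Sum>\<^sub>\<infinity>k. cmod (c k))"
proof -
  have "\<bar>fseries c x\<bar> \<le> cmod (\<Sum>\<^sub>\<infinity>k. c k * character k x)" unfolding fseries_def by (rule abs_Re_le_cmod)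
  also have "\<dots> \<le> (\<Sum>\<^sub>\<infinity>k. cmod (c k * character k x))"
    by (rule norm_infsum_bound) (simp add: norm_mult summable)
  finally show ?thesis by (simp add: norm_mult)
qed

lemma fseries_periodic: "fseries c (x + lattice_vec k) = fseries c x"
  by (simp add: fseries_def character_periodic)

lemma fseries_measurable: "fseries c \<in> borel_measurable lebesgue"
  using fseries_continuous[of UNIV] by (simp add: borel_measurable_continuous_onI measurable_completion)

lemma fseries_L2per: "L2per (fseries c)"
proof -
  have "integrable torus (\<lambda>x. (fseries c x)\<^sup>2)"
  proof (rule bounded_integrable_torus)
    show "(\<lambda>x. (fseries c x)\<^sup>2) \<in> borel_measurable lebesgue" using fseries_measurable by measurable
    show "AE x in torus. norm ((fseries c x)\<^sup>2) \<le> (\<Sum>\<^sub>\<infinity>k. cmod (c k))\<^sup>2"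
    proof (rule AE_I2)
      show "norm ((fseries c x)\<^sup>2) \<le> (\<Sum>\<^sub>\<infinity>k. cmod (c k))\<^sup>2" for x
        using power_mono[OF abs_fseries_le[of x] abs_ge_zero, of 2] by simp
    qed
  qed
  then show ?thesis by (simp add: L2per_def periodic_def fseries_periodic fseries_measurable)
qed

text \<open>Multiplying by an absolutely convergent series convolves the coefficients. The inversion
  formula, Parseval's identity and the drift formula all rest on this.\<close>

lemma fcoef_mult_fseries:
  assumes a: "L1per a"
  shows "fcoef (\<lambda>x. a x * fseries c x) k = (\<Sum>\<^sub>\<infinity>m. c m * fcoef a (k - m))"
proof -
  let ?h = "\<lambda>m x. c m * (complex_of_real (a x) * character (- (k - m)) x)"
  have ai: "integrable torus a" "a \<in> borel_measurable lebesgue" using a by (auto simp: L1per_def)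
  have "complex_of_real (a x * fseries c x) * character (- k) x = (\<Sum>\<^sub>\<infinity>m. ?h m x)" for x
  proof -
    have "complex_of_real (a x * fseries c x) * character (- k) x
      = (complex_of_real (a x) * character (- k) x) * (\<Sum>\<^sub>\<infinity>m. c m * character m x)"
      by (simp add: of_real_fseries mult_ac)
    also have "\<dots> = (\<Sum>\<^sub>\<infinity>m. (complex_of_real (a x) * character (- k) x) * (c m * character m x))"
      by (rule infsum_cmult_right[symmetric]) (rule series_summable)
    also have "\<dots> = (\<Sum>\<^sub>\<infinity>m. ?h m x)"
    proof (rule infsum_cong)
      fix m
      have "character (- (k - m)) x = character m x * character (- k) x"
        by (simp add: character_add_index[symmetric])
      then show "(complex_of_real (a x) * character (- k) x) * (c m * character m x) = ?h m x"
        by (simp only: mult_ac)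
    qed
    finally show ?thesis .
  qed
  then have "fcoef (\<lambda>x. a x * fseries c x) k = (LINT x|torus. (\<Sum>\<^sub>\<infinity>m. ?h m x))"
    unfolding fcoef_character by (simp only:)
  also have "\<dots> = (\<Sum>\<^sub>\<infinity>m. (LINT x|torus. ?h m x))"
  proof (rule integral_infsum_torus(2)[where B = "\<lambda>m. cmod (c m)" and w = "\<lambda>x. \<bar>a x\<bar>"])
    show "?h m \<in> borel_measurable torus" for m
      using ai(2) character_measurable[of "- (k - m)"] by (intro measurable_torusI) measurable
  qed (use ai summable in \<open>auto simp: norm_mult\<close>)
  also have "\<dots> = (\<Sum>\<^sub>\<infinity>m. c m * fcoef a (k - m))" unfolding fcoef_character by simp
  finally show ?thesis .
qed

lemma fcoef_fseries: "fcoef (fseries c) k = c k"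
proof -
  have one: "fcoef (\<lambda>x. 1) m = (if m = 0 then 1 else 0)" for m :: "int^'d"
    unfolding fcoef_character by (simp add: integral_character)
  have "fcoef (fseries c) k = (\<Sum>\<^sub>\<infinity>m. c m * fcoef (\<lambda>x. 1) (k - m))"
    using fcoef_mult_fseries[of "\<lambda>x. 1" k] by (simp add: L1per_def)
  also have "\<dots> = (\<Sum>\<^sub>\<infinity>m\<in>{k}. c m)"
    by (rule infsum_cong_neutral) (auto simp: one)
  finally show ?thesis by simp
qed

end

lemma AE_eq_fseries:
  assumes f: "L1per f" and s: "(\<lambda>k. cmod (fcoef f k)) summable_on UNIV"
  shows "AE x in torus. f x = fseries (fcoef f) x"
proof -
  interpret fourier_coeffs "fcoef f" by standard (auto simp: s fcoef_uminus)
  show ?thesis by (rule AE_eq_of_fcoef_eq[OF f L2per_L1per[OF fseries_L2per]]) (simp add: fcoef_fseries)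
qed

lemma fseries_lin:
  assumes "fourier_coeffs c" "fourier_coeffs d"
  shows "fseries (\<lambda>k. of_real r * c k + d k) x = r * fseries c x + fseries d x"
proof -
  have "(\<Sum>\<^sub>\<infinity>k. (of_real r * c k + d k) * character k x) = (\<Sum>\<^sub>\<infinity>k. of_real r * (c k * character k x) + d k * character k x)"
    by (simp add: algebra_simps)
  also have "\<dots> = of_real r * (\<Sum>\<^sub>\<infinity>k. c k * character k x) + (\<Sum>\<^sub>\<infinity>k. d k * character k x)"
    using fourier_coeffs.series_summable[OF assms(1)] fourier_coeffs.series_summable[OF assms(2)]
    by (subst infsum_add) (auto intro: summable_on_cmult_right simp: infsum_cmult_right')
  finally show ?thesis by (simp add: fseries_def)
qed

text \<open>Bessel's inequality: expand the squared distance of \<open>f\<close> from its partial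
  sum over \<open>F\<close>.\<close>

lemma fcoef_l2_bound:
  fixes f :: "real^'d \<Rightarrow> real"
  assumes f: "L2per f"
  shows "l2_bound (fcoef f) (sqrt (LINT x|torus. (f x)\<^sup>2))"
proof (rule l2_boundI)
  show "0 \<le> sqrt (LINT x|torus. (f x)\<^sup>2)" by (simp add: integral_nonneg_AE)
  fix F :: "(int^'d) set" assume F: "finite F"
  let ?p = "\<lambda>x. \<Sum>k\<in>F. fcoef f k * character k x"
  let ?S = "\<Sum>k\<in>F. (cmod (fcoef f k))\<^sup>2"
  have f1: "L1per f" by (rule L2per_L1per[OF f])
  have fi: "integrable torus (\<lambda>x. (f x)\<^sup>2)" using f by (simp add: L2per_def)
  have r1: "complex_of_real (f x) * cnj (?p x) = (\<Sum>k\<in>F. cnj (fcoef f k) * (complex_of_real (f x) * character (- k) x))" for x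
    by (simp add: sum_distrib_left character_uminus mult_ac)
  have i1: "integrable torus (\<lambda>x. complex_of_real (f x) * cnj (?p x))"
    unfolding r1 by (intro Bochner_Integration.integrable_sum integrable_mult_right integrable_mult_character f1)
  have v1: "(LINT x|torus. complex_of_real (f x) * cnj (?p x)) = of_real ?S"
  proof -
    have "(LINT x|torus. complex_of_real (f x) * cnj (?p x))
      = (LINT x|torus. (\<Sum>k\<in>F. cnj (fcoef f k) * (complex_of_real (f x) * character (- k) x)))"
      by (simp only: r1)
    also have "\<dots> = (\<Sum>k\<in>F. cnj (fcoef f k) * fcoef f k)"
      using integrable_mult_character[OF f1] by (simp add: Bochner_Integration.integral_sum fcoef_character)
    also have "\<dots> = of_real ?S" by (simp add: complex_norm_square mult.commute del: of_real_power)
    finally show ?thesis .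
  qed
  have pp: "?p x * cnj (?p x) = (\<Sum>k\<in>F. \<Sum>m\<in>F. fcoef f k * cnj (fcoef f m) * character (k - m) x)" for x
    unfolding cnj_sum sum_product
    by (intro sum.cong refl) (simp add: character_add_index[of _ "- _", simplified] character_uminus mult_ac)
  have i2: "integrable torus (\<lambda>x. ?p x * cnj (?p x))"
    unfolding pp by (intro Bochner_Integration.integrable_sum integrable_mult_right integrable_character)
  have v2: "(LINT x|torus. ?p x * cnj (?p x)) = of_real ?S"
  proof -
    have "(LINT x|torus. ?p x * cnj (?p x)) = (\<Sum>k\<in>F. \<Sum>m\<in>F. fcoef f k * cnj (fcoef f m) * (if k = m then 1 else 0))"
      unfolding pp
      by (simp only: Bochner_Integration.integral_sum Bochner_Integration.integrable_sum integrable_mult_right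
          integrable_character integral_mult_right_zero integral_character right_minus_eq)
    also have "\<dots> = (\<Sum>k\<in>F. fcoef f k * cnj (fcoef f k))"
      using F by (intro sum.cong refl) (simp add: if_distrib sum.delta cong: if_cong)
    also have "\<dots> = of_real ?S" by (simp add: complex_norm_square del: of_real_power)
    finally show ?thesis .
  qed
  have sq: "(cmod (complex_of_real a - z))\<^sup>2 = a\<^sup>2 - 2 * Re (complex_of_real a * cnj z) + Re (z * cnj z)" for a z
    unfolding cmod_power2 by (simp add: power2_eq_square algebra_simps)
  have eq: "(cmod (complex_of_real (f x) - ?p x))\<^sup>2 = (f x)\<^sup>2 - 2 * Re (complex_of_real (f x) * cnj (?p x)) + Re (?p x * cnj (?p x))" for x
    by (rule sq)
  have gen: "(LINT x|torus. (f x)\<^sup>2 - 2 * Re (g1 x) + Re (g2 x)) = (LINT x|torus. (f x)\<^sup>2) - 2 * Re (integral\<^sup>L torus g1) + Re (integral\<^sup>L torus g2)"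
    if "integrable torus g1" "integrable torus g2" for g1 g2 :: "real^'d \<Rightarrow> complex"
    using fi that by simp
  have "0 \<le> (LINT x|torus. (cmod (complex_of_real (f x) - ?p x))\<^sup>2)" by (rule integral_nonneg_AE) simp
  also have "\<dots> = (LINT x|torus. (f x)\<^sup>2) - 2 * Re (of_real ?S) + Re (of_real ?S)"
    unfolding eq using gen[OF i1 i2] by (simp only: v1 v2)
  finally have "?S \<le> (LINT x|torus. (f x)\<^sup>2)" by simp
  then show "?S \<le> (sqrt (LINT x|torus. (f x)\<^sup>2))\<^sup>2" by (simp add: integral_nonneg_AE)
qed

lemma L2per_lin:
  assumes "L2per f" "L2per g" shows "L2per (\<lambda>x. c * f x + g x)"
proof -
  have "integrable torus (\<lambda>x. (c * f x + g x)\<^sup>2)"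
  proof (rule Bochner_Integration.integrable_bound)
    show "integrable torus (\<lambda>x. 2 * c\<^sup>2 * (f x)\<^sup>2 + 2 * (g x)\<^sup>2)"
      using assms by (intro Bochner_Integration.integrable_add integrable_mult_right) (auto simp: L2per_def)
    have "f \<in> borel_measurable torus" "g \<in> borel_measurable torus"
      using assms by (auto simp: L2per_def intro: measurable_torusI)
    then show "(\<lambda>x. (c * f x + g x)\<^sup>2) \<in> borel_measurable torus" by measurable
    have "(c * a + b)\<^sup>2 \<le> 2 * c\<^sup>2 * a\<^sup>2 + 2 * b\<^sup>2" for a b :: real
      using zero_le_power2[of "c * a - b"] by (simp add: power2_eq_square algebra_simps)
    then show "AE x in torus. norm ((c * f x + g x)\<^sup>2) \<le> norm (2 * c\<^sup>2 * (f x)\<^sup>2 + 2 * (g x)\<^sup>2)"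
      by simp
  qed
  then show ?thesis using assms by (auto simp: L2per_def periodic_def)
qed

text \<open>Parseval: the integral of the square is the coefficient at 0 of a product, and
  \<open>c (- m)\<close> is the conjugate of \<open>c m\<close>.\<close>

lemma (in fourier_coeffs) integral_fseries_square:
  assumes "l2_bound c C" shows "(LINT x|torus. (fseries c x)\<^sup>2) \<le> C\<^sup>2"
proof -
  have sq: "(\<lambda>m. (cmod (c m))\<^sup>2) summable_on UNIV"
    by (rule nonneg_bdd_above_summable_on) (auto intro!: bdd_aboveI2[of _ _ "C\<^sup>2"] l2_bound_sum[OF assms])
  have "complex_of_real (LINT x|torus. (fseries c x)\<^sup>2) = fcoef (\<lambda>x. fseries c x * fseries c x) 0"
    by (simp add: fcoef_character power2_eq_square flip: of_real_mult)
  also have "\<dots> = (\<Sum>\<^sub>\<infinity>m. c m * c (0 - m))"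
    by (simp only: fcoef_mult_fseries[OF L2per_L1per[OF fseries_L2per]] fcoef_fseries)
  also have "\<dots> = (\<Sum>\<^sub>\<infinity>m. complex_of_real ((cmod (c m))\<^sup>2))"
    by (simp add: hermitian complex_norm_square del: of_real_power)
  also have "\<dots> = complex_of_real (\<Sum>\<^sub>\<infinity>m. (cmod (c m))\<^sup>2)"
    using infsumI[OF has_sum_bounded_linear[OF bounded_linear_of_real has_sum_infsum[OF sq]]] by (simp add: comp_def)
  finally have "(LINT x|torus. (fseries c x)\<^sup>2) = (\<Sum>\<^sub>\<infinity>m. (cmod (c m))\<^sup>2)"
    by (simp only: of_real_eq_iff)
  also have "\<dots> \<le> C\<^sup>2"
    by (rule infsum_le_finite_sums[OF sq]) (rule l2_bound_sum[OF assms])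
  finally show ?thesis .
qed

lemma reflect_measurable: "v \<in> borel_measurable lebesgue \<Longrightarrow> (\<lambda>y. v (x - y)) \<in> borel_measurable lebesgue"
  for v :: "real^'d \<Rightarrow> 'b::topological_space"
  using measurable_compose[OF lebesgue_reflect(2)] .

lemma L2per_reflect:
  assumes v: "L2per v"
  shows "integrable torus (\<lambda>y. v (x - y))" "integrable torus (\<lambda>y. (v (x - y))\<^sup>2)"
proof -
  have m: "v \<in> borel_measurable lebesgue" and p: "\<And>x k. v (x + lattice_vec k) = v x"
    using v by (auto simp: L2per_def periodic_def)
  show "integrable torus (\<lambda>y. v (x - y))"
    using torus_reflect_real(1)[OF m p] L2per_L1per[OF v] by (simp add: L1per_def)
  have "(\<lambda>y. (v y)\<^sup>2) \<in> borel_measurable lebesgue" using m by measurable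
  from torus_reflect_real(1)[OF this] p show "integrable torus (\<lambda>y. (v (x - y))\<^sup>2)"
    using v by (simp add: L2per_def)
qed

lemma integral_reflect_character:
  assumes v: "L2per v"
  shows "(LINT y|torus. complex_of_real (v (x - y)) * character m y) = character m x * fcoef v m"
proof -
  let ?h = "\<lambda>z. complex_of_real (v z) * character m (x - z)"
  have m: "v \<in> borel_measurable lebesgue" and p: "\<And>x k. v (x + lattice_vec k) = v x"
    using v by (auto simp: L2per_def periodic_def)
  have pc: "character m (x - (z + lattice_vec k)) = character m (x - z)" for z k
    by (simp add: character_diff character_periodic)
  have cm: "(\<lambda>z. character m (x - z)) \<in> borel_measurable lebesgue"
    by (rule reflect_measurable) (rule character_measurable)
  have hm: "?h \<in> borel_measurable lebesgue" using m cm by measurable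
  have he: "?h = (\<lambda>z. character m x * (complex_of_real (v z) * character (- m) z))"
    by (simp add: fun_eq_iff character_diff character_uminus mult_ac)
  have hi: "integrable torus ?h"
    unfolding he by (rule integrable_mult_right[OF integrable_mult_character[OF L2per_L1per[OF v]]])
  have hr: "integrable torus (\<lambda>y. ?h (x - y))"
  proof (rule Bochner_Integration.integrable_bound[OF L2per_reflect(1)[OF v, of x]])
    show "(\<lambda>y. ?h (x - y)) \<in> borel_measurable torus" using reflect_measurable[OF hm] by (rule measurable_torusI)
  qed (simp add: norm_mult)
  have "(LINT y|torus. ?h (x - y)) = (LINT y|torus. ?h y)"
  proof (rule complex_eqI)
    have R: "(\<lambda>y. Re (?h y)) \<in> borel_measurable lebesgue" "(\<lambda>y. Im (?h y)) \<in> borel_measurable lebesgue"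
      using hm by measurable
    show "Re (LINT y|torus. ?h (x - y)) = Re (LINT y|torus. ?h y)"
      using torus_reflect_real(2)[OF R(1), of x] unfolding p pc
      by (simp only: integral_Re[OF hr, symmetric] integral_Re[OF hi, symmetric])
    show "Im (LINT y|torus. ?h (x - y)) = Im (LINT y|torus. ?h y)"
      using torus_reflect_real(2)[OF R(2), of x] unfolding p pc
      by (simp only: integral_Im[OF hr, symmetric] integral_Im[OF hi, symmetric])
  qed
  also have "\<dots> = (LINT y|torus. character m x * (complex_of_real (v y) * character (- m) y))"
    by (simp add: character_diff character_uminus mult_ac)
  also have "\<dots> = character m x * fcoef v m" by (simp add: fcoef_character)
  finally show ?thesis by simp
qed

lemma fourier_coeffs_mult:
  assumes "fourier_coeffs c" "L2per v"
  shows "fourier_coeffs (\<lambda>m. fcoef v m * c m)"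
proof
  interpret fourier_coeffs c by fact
  let ?C = "sqrt (LINT x|torus. (v x)\<^sup>2)"
  show "(\<lambda>m. cmod (fcoef v m * c m)) summable_on UNIV"
    by (rule summable_on_comparison_test[OF summable_on_cmult_right[OF summable, of ?C]])
      (auto simp: norm_mult intro!: mult_right_mono l2_bound_cmod[OF fcoef_l2_bound[OF assms(2)]])
  show "fcoef v (- m) * c (- m) = cnj (fcoef v m * c m)" for m by (simp add: fcoef_uminus hermitian)
qed

lemma conv_fseries:
  assumes c: "fourier_coeffs c" and v: "L2per v"
  shows "conv v (fseries c) x = fseries (\<lambda>m. fcoef v m * c m) x"
proof -
  interpret fourier_coeffs c by fact
  interpret vc: fourier_coeffs "\<lambda>m. fcoef v m * c m" by (rule fourier_coeffs_mult[OF c v])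
  let ?h = "\<lambda>m y. c m * (complex_of_real (v (x - y)) * character m y)"
  have vm: "(\<lambda>y. v (x - y)) \<in> borel_measurable lebesgue"
    using v by (intro reflect_measurable) (auto simp: L2per_def)
  have "complex_of_real (v (x - y) * fseries c y) = (\<Sum>\<^sub>\<infinity>m. ?h m y)" for y
  proof -
    have "complex_of_real (v (x - y) * fseries c y) = complex_of_real (v (x - y)) * (\<Sum>\<^sub>\<infinity>m. c m * character m y)"
      by (simp add: of_real_fseries)
    also have "\<dots> = (\<Sum>\<^sub>\<infinity>m. complex_of_real (v (x - y)) * (c m * character m y))"
      by (rule infsum_cmult_right[symmetric]) (rule series_summable)
    finally show ?thesis by (simp only: mult.left_commute)
  qed
  then have "complex_of_real (conv v (fseries c) x) = (LINT y|torus. (\<Sum>\<^sub>\<infinity>m. ?h m y))"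
    unfolding conv_def by (simp only: integral_complex_of_real[symmetric])
  also have "\<dots> = (\<Sum>\<^sub>\<infinity>m. (LINT y|torus. ?h m y))"
  proof (rule integral_infsum_torus(2)[where B = "\<lambda>m. cmod (c m)" and w = "\<lambda>y. \<bar>v (x - y)\<bar>"])
    show "?h m \<in> borel_measurable torus" for m
      using vm character_measurable[of m] by (intro measurable_torusI) measurable
  qed (use L2per_reflect(1)[OF v] summable in \<open>auto simp: norm_mult\<close>)
  also have "\<dots> = (\<Sum>\<^sub>\<infinity>m. (fcoef v m * c m) * character m x)"
    unfolding integral_mult_right_zero integral_reflect_character[OF v] by (simp only: mult_ac)
  also have "\<dots> = complex_of_real (fseries (\<lambda>m. fcoef v m * c m) x)" by (rule vc.of_real_fseries[symmetric])
  finally show ?thesis by (simp only: of_real_eq_iff)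
qed

text \<open>The convolution sees \<open>b\<close> only up to null sets, so \<open>b\<close> may be
  replaced by its Fourier series.\<close>

lemma conv_eq_fseries:
  assumes v: "L2per v" and b: "L2per b" and s: "(\<lambda>k. cmod (fcoef b k)) summable_on UNIV"
  shows "conv v b = fseries (\<lambda>m. fcoef v m * fcoef b m)" "fourier_coeffs (\<lambda>m. fcoef v m * fcoef b m)"
proof -
  have c: "fourier_coeffs (fcoef b)" by standard (auto simp: s fcoef_uminus)
  show "fourier_coeffs (\<lambda>m. fcoef v m * fcoef b m)" by (rule fourier_coeffs_mult[OF c v])
  show "conv v b = fseries (\<lambda>m. fcoef v m * fcoef b m)"
  proof
    fix x
    have vm: "(\<lambda>y. v (x - y)) \<in> borel_measurable lebesgue"
      using v by (intro reflect_measurable) (auto simp: L2per_def)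
    have bm: "b \<in> borel_measurable lebesgue" using b by (simp add: L2per_def)
    have "conv v b x = conv v (fseries (fcoef b)) x"
      unfolding conv_def
    proof (rule integral_cong_AE)
      show "(\<lambda>y. v (x - y) * b y) \<in> borel_measurable torus"
        using vm bm by (intro measurable_torusI) measurable
      show "(\<lambda>y. v (x - y) * fseries (fcoef b) y) \<in> borel_measurable torus"
        using vm fourier_coeffs.fseries_measurable[OF c] by (intro measurable_torusI) measurable
      show "AE y in torus. v (x - y) * b y = v (x - y) * fseries (fcoef b) y"
        using AE_eq_fseries[OF L2per_L1per[OF b] s] by eventually_elim simp
    qed
    then show "conv v b x = fseries (\<lambda>m. fcoef v m * fcoef b m) x" by (simp only: conv_fseries[OF c v])
  qed
qed

text \<open>Hoelder's inequality, with the essential bound carried to \<open>x - y\<close> by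
  reflection. It holds at every \<open>x\<close>, and for nonnegative \<open>u\<close> the L1 norm
  is the mass.\<close>

lemma abs_conv_le:
  assumes v: "L2per v" "AE x in torus. \<bar>v x\<bar> \<le> M" and u: "L1per u" "\<And>x. 0 \<le> u x"
  shows "\<bar>conv v u x\<bar> \<le> M * (LINT y|torus. u y)"
proof -
  have vm: "v \<in> borel_measurable lebesgue" using v by (simp add: L2per_def)
  have "{x. \<bar>v x\<bar> \<le> M} = {x \<in> space lebesgue. \<bar>v x\<bar> \<le> M}" by simp
  also have "\<dots> \<in> sets lebesgue" using vm by measurable
  finally have AE: "AE y in torus. \<bar>v (x - y)\<bar> \<le> M"
    using v by (intro AE_torus_reflect[of "\<lambda>x. \<bar>v x\<bar> \<le> M"]) (auto simp: L2per_def periodic_def)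
  have ui: "integrable torus u" "u \<in> borel_measurable lebesgue" using u by (auto simp: L1per_def)
  have le: "AE y in torus. \<bar>v (x - y) * u y\<bar> \<le> M * u y"
    using AE by eventually_elim (use u(2) in \<open>auto simp: abs_mult intro: mult_right_mono\<close>)
  have i: "integrable torus (\<lambda>y. v (x - y) * u y)"
  proof (rule Bochner_Integration.integrable_bound[OF integrable_mult_right[OF ui(1), of M]])
    show "(\<lambda>y. v (x - y) * u y) \<in> borel_measurable torus"
      using reflect_measurable[OF vm] ui(2) by (intro measurable_torusI borel_measurable_times)
    show "AE y in torus. norm (v (x - y) * u y) \<le> norm (M * u y)"
      using le by eventually_elim auto
  qed
  have "\<bar>conv v u x\<bar> \<le> (LINT y|torus. \<bar>v (x - y) * u y\<bar>)" unfolding conv_def by (rule integral_abs_bound)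
  also have "\<dots> \<le> (LINT y|torus. M * u y)" using i ui le by (intro integral_mono_AE) auto
  finally show ?thesis by simp
qed

subsection \<open>Potentials\<close>

lemma esup_finite_iff:
  assumes "f \<in> borel_measurable lebesgue"
  shows "esup f < \<infinity> \<longleftrightarrow> (\<exists>M. AE x in torus. \<bar>f x\<bar> \<le> M)"
proof
  have m: "(\<lambda>x. ereal \<bar>f x\<bar>) \<in> borel_measurable torus"
    using measurable_torusI[OF assms] by measurable
  {
    assume "esup f < \<infinity>"
    then obtain M where M: "esup f \<le> ereal M" by (cases "esup f") auto
    have "AE x in torus. ereal \<bar>f x\<bar> \<le> esup f" unfolding esup_def by (rule esssup_AE)
    then have "AE x in torus. \<bar>f x\<bar> \<le> M" by eventually_elim (use M order_trans in fastforce)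
    then show "\<exists>M. AE x in torus. \<bar>f x\<bar> \<le> M" ..
  next
    assume "\<exists>M. AE x in torus. \<bar>f x\<bar> \<le> M"
    then obtain M where "AE x in torus. \<bar>f x\<bar> \<le> M" ..
    then have "esup f \<le> ereal M" unfolding esup_def by (intro esssup_I m) (auto elim: eventually_mono)
    then show "esup f < \<infinity>" by (metis ereal_infty_less(1) ereal_less_eq(1) leD not_less ereal_infty_less_eq(1) PInfty_neq_ereal(1))
  }
qed

lemma esup_nonneg: "0 \<le> esup f" for f :: "real^'d \<Rightarrow> real"
proof -
  have "AE x in torus. ereal \<bar>f x\<bar> \<le> esup f" unfolding esup_def by (rule esssup_AE)
  then have *: "AE x in (torus :: (real^'d) measure). 0 \<le> esup f"
    by (rule eventually_mono) (metis abs_ge_zero ereal_less_eq(3) order_trans zero_ereal_def)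
  show ?thesis
  proof (rule ccontr)
    assume "\<not> 0 \<le> esup f"
    with * have "AE x in (torus :: (real^'d) measure). False" by simp
    then have "emeasure torus (space (torus :: (real^'d) measure)) = 0" by (simp add: AE_iff_measurable[OF _ refl])
    then show False unfolding emeasure_torus by simp
  qed
qed

lemma AE_abs_le_esup:
  assumes "esup f < \<infinity>"
  shows "AE x in torus. \<bar>f x\<bar> \<le> real_of_ereal (esup f)"
proof -
  have "AE x in torus. ereal \<bar>f x\<bar> \<le> esup f" unfolding esup_def by (rule esssup_AE)
  moreover have "esup f = ereal (real_of_ereal (esup f))"
    using assms esup_nonneg[of f] by (cases "esup f") auto
  ultimately show ?thesis by (metis (mono_tags, lifting) eventually_mono ereal_less_eq(3))
qed

lemma bounded_L2per:
  assumes "periodic f" "f \<in> borel_measurable lebesgue" "AE x in torus. \<bar>f x\<bar> \<le> M"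
  shows "L2per f" "(LINT x|torus. (f x)\<^sup>2) \<le> M\<^sup>2"
proof -
  have m: "(\<lambda>x. (f x)\<^sup>2) \<in> borel_measurable lebesgue" using assms by measurable
  have le: "AE x in torus. (f x)\<^sup>2 \<le> M\<^sup>2"
    using assms(3) by eventually_elim (metis abs_ge_zero power2_abs power_mono)
  then have i: "integrable torus (\<lambda>x. (f x)\<^sup>2)" by (intro bounded_integrable_torus[OF m]) auto
  then show "L2per f" using assms by (simp add: L2per_def)
  have "(LINT x|torus. (f x)\<^sup>2) \<le> (LINT x|(torus :: (real^'a) measure). M\<^sup>2)"
    using i le by (intro integral_mono_AE) auto
  then show "(LINT x|torus. (f x)\<^sup>2) \<le> M\<^sup>2" by (simp add: measure_torus space_restrict_space)
qed

lemma Wdot_L2per: assumes "Wdot W" shows "L2per W"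
proof -
  have "periodic W" "W \<in> borel_measurable lebesgue" "esup W < \<infinity>" using assms by (auto simp: Wdot_def)
  then show ?thesis using bounded_L2per(1) esup_finite_iff by blast
qed

lemma has_wpd_wpd: "Wdot W \<Longrightarrow> has_wpd W j (wpd W j)"
proof -
  assume "Wdot W"
  then have "\<exists>v. has_wpd W j v" by (auto simp: Wdot_def)
  then show ?thesis unfolding wpd_def by (rule someI_ex)
qed

text \<open>\<open>wpd\<close> is a choice; it equals the bounded derivative provided by
  \<open>Wdot\<close> almost everywhere, because the coefficients agree.\<close>

lemma esup_wpd_finite: assumes W: "Wdot W" shows "esup (wpd W j) < \<infinity>"
proof -
  obtain v where v: "has_wpd W j v" "esup v < \<infinity>" using W by (auto simp: Wdot_def)
  have w: "has_wpd W j (wpd W j)" by (rule has_wpd_wpd[OF W])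
  have L: "L2per v" "L2per (wpd W j)" using v w by (auto simp: has_wpd_def)
  obtain M where M: "AE x in torus. \<bar>v x\<bar> \<le> M" using v L(1) esup_finite_iff[of v] by (auto simp: L2per_def)
  have "AE x in torus. v x = wpd W j x"
    using v w by (intro AE_eq_of_fcoef_eq L2per_L1per L) (auto simp: has_wpd_def)
  with M have "AE x in torus. \<bar>wpd W j x\<bar> \<le> M" by eventually_elim simp
  then show ?thesis using L(2) esup_finite_iff[of "wpd W j"] by (auto simp: L2per_def)
qed

lemma Wnorm_ge: "(\<Sum>j\<in>UNIV. real_of_ereal (esup (wpd W j))) \<le> Wnorm W" "real_of_ereal (esup (wpd W j)) \<le> Wnorm W"
proof -
  have nn: "0 \<le> real_of_ereal (esup f)" for f by (simp add: esup_nonneg real_of_ereal_pos)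
  show *: "(\<Sum>j\<in>UNIV. real_of_ereal (esup (wpd W j))) \<le> Wnorm W"
    unfolding Wnorm_def by (simp add: nn sum_nonneg)
  have "real_of_ereal (esup (wpd W j)) \<le> (\<Sum>j\<in>UNIV. real_of_ereal (esup (wpd W j)))"
    by (rule member_le_sum) (auto simp: nn)
  with * show "real_of_ereal (esup (wpd W j)) \<le> Wnorm W" by simp
qed

lemma AE_wpd_le: "Wdot W \<Longrightarrow> AE x in torus. \<bar>wpd W j x\<bar> \<le> Wnorm W"
  using AE_abs_le_esup[OF esup_wpd_finite, of W j] Wnorm_ge(2)[of W j] by (auto elim: eventually_mono)

lemma has_wpd_lin:
  assumes "L2per u" "L2per u'" "has_wpd u j v" "has_wpd u' j v'"
  shows "has_wpd (\<lambda>x. c * u x + u' x) j (\<lambda>x. c * v x + v' x)"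
  using assms L2per_lin[of v v' c]
  by (auto simp: has_wpd_def fcoef_lin L2per_L1per distrib_left mult.assoc mult.left_commute)

lemma esup_lin:
  assumes "f \<in> borel_measurable lebesgue" "g \<in> borel_measurable lebesgue" "esup f < \<infinity>" "esup g < \<infinity>"
  shows "esup (\<lambda>x. c * f x + g x) < \<infinity>"
proof -
  obtain M N where "AE x in torus. \<bar>f x\<bar> \<le> M" "AE x in torus. \<bar>g x\<bar> \<le> N"
    using assms esup_finite_iff by metis
  then have "AE x in torus. \<bar>c * f x + g x\<bar> \<le> \<bar>c\<bar> * M + N"
  proof eventually_elim
    case (elim x)
    have "\<bar>c * f x + g x\<bar> \<le> \<bar>c\<bar> * \<bar>f x\<bar> + \<bar>g x\<bar>" by (metis abs_mult abs_triangle_ineq)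
    also have "\<dots> \<le> \<bar>c\<bar> * M + N" using elim by (intro add_mono mult_left_mono) auto
    finally show ?case .
  qed
  moreover have "(\<lambda>x. c * f x + g x) \<in> borel_measurable lebesgue" using assms by measurable
  ultimately show ?thesis using esup_finite_iff by blast
qed

lemma Wdot_comb:
  assumes H: "Wdot H" and H': "Wdot H'"
  shows "Wdot (Wcomb c H H')"
  unfolding Wdot_def
proof (intro conjI allI)
  have m: "H \<in> borel_measurable lebesgue" "H' \<in> borel_measurable lebesgue" using H H' by (auto simp: Wdot_def)
  show "periodic (Wcomb c H H')" using H H' by (simp add: Wdot_def periodic_def Wcomb_def)
  show "Wcomb c H H' \<in> borel_measurable lebesgue" unfolding Wcomb_def using m by measurable
  show "esup (Wcomb c H H') < \<infinity>" unfolding Wcomb_def using H H' by (intro esup_lin) (auto simp: Wdot_def)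
  show "fcoef (Wcomb c H H') 0 = 0"
    unfolding Wcomb_def using H H' by (simp add: fcoef_lin L2per_L1per Wdot_L2per Wdot_def)
  fix j
  obtain v v' where v: "has_wpd H j v" "esup v < \<infinity>" "\<And>i. \<exists>w. has_wpd v i w \<and> esup w < \<infinity>"
    and v': "has_wpd H' j v'" "esup v' < \<infinity>" "\<And>i. \<exists>w. has_wpd v' i w \<and> esup w < \<infinity>"
    using H H' unfolding Wdot_def by metis
  have L: "L2per v" "L2per v'" using v v' by (auto simp: has_wpd_def)
  show "\<exists>v. has_wpd (Wcomb c H H') j v \<and> esup v < \<infinity> \<and> (\<forall>i. \<exists>w. has_wpd v i w \<and> esup w < \<infinity>)"
  proof (rule exI[of _ "\<lambda>x. c * v x + v' x"], intro conjI allI)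
    show "has_wpd (Wcomb c H H') j (\<lambda>x. c * v x + v' x)"
      unfolding Wcomb_def by (rule has_wpd_lin[OF Wdot_L2per[OF H] Wdot_L2per[OF H'] v(1) v'(1)])
    show "esup (\<lambda>x. c * v x + v' x) < \<infinity>" using L v v' by (intro esup_lin) (auto simp: L2per_def)
    fix i
    obtain w w' where w: "has_wpd v i w" "esup w < \<infinity>" "has_wpd v' i w'" "esup w' < \<infinity>"
      using v(3)[of i] v'(3)[of i] by blast
    have "has_wpd (\<lambda>x. c * v x + v' x) i (\<lambda>x. c * w x + w' x)" by (rule has_wpd_lin[OF L w(1,3)])
    moreover have "esup (\<lambda>x. c * w x + w' x) < \<infinity>"
      using w by (intro esup_lin) (auto simp: has_wpd_def L2per_def)
    ultimately show "\<exists>w. has_wpd (\<lambda>x. c * v x + v' x) i w \<and> esup w < \<infinity>" by blast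
  qed
qed

subsection \<open>The interaction term in Fourier variables\<close>

definition freq :: "int^'d \<Rightarrow> real" where "freq k = norm (lattice_vec k)"

text \<open>The symbol of the negative Laplacian on characters of period 1.\<close>

definition decay :: "int^'d \<Rightarrow> real" where "decay k = 4 * pi\<^sup>2 * knorm2 k"

definition japanese :: "int^'d \<Rightarrow> real" where "japanese k = sqrt (1 + knorm2 k)"

text \<open>With \<open>p\<^sub>m = |m| \<hat>W\<^sub>m\<close>, the \<open>k\<close>-th coefficient of \<open>\<nabla>\<cdot>(a \<nabla>W*b)\<close> is \<open>|k|\<close> times
  the twisted convolution with this bounded kernel.\<close>
definition drift_kernel :: "int^'d \<Rightarrow> int^'d \<Rightarrow> real" where
  "drift_kernel k m = - 4 * pi\<^sup>2 * (lattice_vec k \<bullet> lattice_vec m) / (freq k * freq m)"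

text \<open>The same kernel acting on coefficients that carry the weight \<open>(1 + |k|\<^sup>2)\<^bsup>b/2\<^esup>\<close>.\<close>
definition kernelw :: "nat \<Rightarrow> int^'d \<Rightarrow> int^'d \<Rightarrow> real" where
  "kernelw b k m = drift_kernel k m * japanese k ^ b / (japanese m ^ b * japanese (k - m) ^ b)"

text \<open>Up to the factor 2 pi, the size of the gradient on each mode. In this form the parameter
  lies in l2 with norm at most \<open>Wnorm W\<close> and depends linearly on \<open>W\<close>; the
  |k| of the divergence is left to the parabolic part.\<close>

definition potential :: "(real^'d \<Rightarrow> real) \<Rightarrow> (int^'d) hl2" where
  "potential W = Hl2 (\<lambda>m. of_real (freq m) * fcoef W m)"

lemma lattice_vec_uminus: "lattice_vec (- k) = - lattice_vec k"
  by (simp add: lattice_vec_def vec_eq_iff)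

lemma lattice_vec_diff: "lattice_vec (k - m) = lattice_vec k - lattice_vec m"
  by (simp add: lattice_vec_def vec_eq_iff)

lemma freq_square: "(freq k)\<^sup>2 = knorm2 k"
  unfolding freq_def knorm2_def power2_norm_eq_inner inner_vec_def by (simp add: lattice_vec_def power2_eq_square)

lemma knorm2_nonneg: "0 \<le> knorm2 k" by (simp add: knorm2_def sum_nonneg)

lemma freq_nonneg: "0 \<le> freq k" by (simp add: freq_def)

lemma japanese_ge_1: "1 \<le> japanese k" by (simp add: japanese_def knorm2_nonneg)

lemma japanese_simps [simp]: "0 < japanese k" "0 \<le> japanese k" "japanese k \<noteq> 0"
  using japanese_ge_1[of k] by linarith+

text \<open>The triangle inequality in the plane for \<open>(1, freq m)\<close> and
  \<open>(1, freq (k - m))\<close>, whose sum has length at least \<open>japanese k\<close>.\<close>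

lemma japanese_triangle: "japanese k \<le> japanese m + japanese (k - m)"
proof -
  have "freq k \<le> freq m + freq (k - m)"
    unfolding freq_def lattice_vec_diff using norm_triangle_ineq[of "lattice_vec m" "lattice_vec k - lattice_vec m"] by simp
  then have "(freq k)\<^sup>2 \<le> (freq m + freq (k - m))\<^sup>2" by (intro power_mono freq_nonneg)
  then have "japanese k \<le> sqrt ((1 + 1)\<^sup>2 + (freq m + freq (k - m))\<^sup>2)"
    unfolding japanese_def freq_square[symmetric] by (intro real_sqrt_le_mono) simp
  also have "\<dots> \<le> sqrt (1\<^sup>2 + (freq m)\<^sup>2) + sqrt (1\<^sup>2 + (freq (k - m))\<^sup>2)"
    by (rule real_sqrt_sum_squares_triangle_ineq)
  finally show ?thesis by (simp add: japanese_def freq_square)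
qed

lemma kernel_bound_abs: "\<bar>drift_kernel k m\<bar> \<le> 4 * pi\<^sup>2"
proof (cases "freq k * freq m = 0")
  case False
  then have pos: "freq k * freq m > 0" using freq_nonneg[of k] freq_nonneg[of m] by (simp add: less_le)
  have "\<bar>lattice_vec k \<bullet> lattice_vec m\<bar> \<le> freq k * freq m"
    unfolding freq_def by (rule Cauchy_Schwarz_ineq2)
  then have "\<bar>lattice_vec k \<bullet> lattice_vec m\<bar> / (freq k * freq m) \<le> 1" using pos by simp
  from mult_left_mono[OF this, of "4 * pi\<^sup>2"] show ?thesis
    using pos freq_nonneg[of k] freq_nonneg[of m] by (simp add: drift_kernel_def abs_mult)
next
  case True
  show ?thesis unfolding drift_kernel_def True by simp
qed

lemma kernel_uminus: "drift_kernel (- k) (- m) = drift_kernel k m"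
  by (simp add: drift_kernel_def freq_def lattice_vec_uminus)

lemma japanese_uminus: "japanese (- k) = japanese k" by (simp add: japanese_def knorm2_def)

lemma twist_kernel_drift_kernel: "twist_kernel drift_kernel (4 * pi\<^sup>2)"
  by standard (rule kernel_bound_abs kernel_uminus)+

text \<open>The sum of two numbers that are at least 1 is at most twice their product; hence the
  weights are submultiplicative up to \<open>2 ^ b\<close>.\<close>

lemma japanese_power_le: "japanese k ^ b \<le> 2 ^ b * (japanese m ^ b * japanese (k - m) ^ b)"
proof -
  have "japanese m + japanese (k - m) \<le> 2 * (japanese m * japanese (k - m))"
    using mult_right_mono[OF japanese_ge_1[of m], of "japanese (k - m)"]
      mult_left_mono[OF japanese_ge_1[of "k - m"], of "japanese m"] japanese_ge_1[of m] japanese_ge_1[of "k - m"]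
    by linarith
  then have "japanese k \<le> 2 * (japanese m * japanese (k - m))" using japanese_triangle[of k m] by linarith
  then have "japanese k ^ b \<le> (2 * (japanese m * japanese (k - m))) ^ b"
    using japanese_ge_1[of k] by (intro power_mono) auto
  then show ?thesis by (simp add: power_mult_distrib)
qed

lemma kernelw_bound_abs: "\<bar>kernelw b k m\<bar> \<le> 4 * pi\<^sup>2 * 2 ^ b"
proof -
  have j: "japanese n ^ b > 0" for n :: "int^'a" using japanese_ge_1[of n] by (intro zero_less_power) linarith
  have "\<bar>kernelw b k m\<bar> = \<bar>drift_kernel k m\<bar> * (japanese k ^ b / (japanese m ^ b * japanese (k - m) ^ b))"
    using j[of k] j[of m] j[of "k - m"] by (simp add: kernelw_def abs_mult)
  also have "\<dots> \<le> (4 * pi\<^sup>2) * 2 ^ b"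
    using japanese_power_le[of k b m] j[of k] j[of m] j[of "k - m"]
    by (intro mult_mono kernel_bound_abs) (auto simp: pos_divide_le_eq)
  finally show ?thesis .
qed

lemma kernelw_uminus: "kernelw b (- k) (- m) = kernelw b k m"
  using japanese_uminus[of "k - m"] by (simp add: kernelw_def kernel_uminus japanese_uminus)

lemma parabolic_quadratic_torus:
  "T > 0 \<Longrightarrow> parabolic_quadratic decay freq T (kernelw b) (4 * pi\<^sup>2 * 2 ^ b)"
proof
  fix k :: "int^'a"
  have "1 * knorm2 k \<le> 4 * pi\<^sup>2 * knorm2 k"
    using pi_ge_two power_mono[of 2 pi 2] by (intro mult_right_mono knorm2_nonneg) simp
  then show "(freq k)\<^sup>2 \<le> decay k" by (simp add: freq_square decay_def)
  show "decay (- k) = decay k" by (simp add: decay_def knorm2_def)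
  show "freq (- k) = freq k" by (simp add: freq_def lattice_vec_uminus)
qed (rule kernelw_bound_abs kernelw_uminus | assumption)+

text \<open>Bessel's inequality for each partial derivative. Summed over \<open>j\<close>, the
  squared coefficients carry the factor \<open>(2 * pi)\<^sup>2\<close>, which is at least
  1.\<close>

lemma freq_fcoef_l2_bound:
  assumes W: "Wdot W"
  shows "l2_bound (\<lambda>m. of_real (freq m) * fcoef W m) (Wnorm W)"
proof (rule l2_boundI)
  let ?e = "\<lambda>j. real_of_ereal (esup (wpd W j))"
  have e0: "0 \<le> ?e j" for j by (simp add: esup_nonneg real_of_ereal_pos)
  show "0 \<le> Wnorm W" using order_trans[OF sum_nonneg Wnorm_ge(1)] e0 by blast
  fix F :: "(int^'a) set" assume F: "finite F"
  have w: "has_wpd W j (wpd W j)" for j by (rule has_wpd_wpd[OF W])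
  then have wf: "fcoef (wpd W j) m = 2 * pi * \<i> * of_int (m $ j) * fcoef W m" and wL: "L2per (wpd W j)" for j m
    by (auto simp: has_wpd_def)
  have le: "(\<Sum>m\<in>F. (cmod (fcoef (wpd W j) m))\<^sup>2) \<le> (?e j)\<^sup>2" for j
  proof -
    have "(\<Sum>m\<in>F. (cmod (fcoef (wpd W j) m))\<^sup>2) \<le> (sqrt (LINT x|torus. (wpd W j x)\<^sup>2))\<^sup>2"
      by (rule l2_bound_sum[OF fcoef_l2_bound[OF wL] F])
    also have "\<dots> = (LINT x|torus. (wpd W j x)\<^sup>2)" by (simp add: integral_nonneg_AE)
    also have "\<dots> \<le> (?e j)\<^sup>2"
      using wL AE_abs_le_esup[OF esup_wpd_finite[OF W]] by (intro bounded_L2per(2)) (auto simp: L2per_def)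
    finally show ?thesis .
  qed
  have one: "(cmod (of_real (freq m) * fcoef W m))\<^sup>2 \<le> (\<Sum>j\<in>UNIV. (cmod (fcoef (wpd W j) m))\<^sup>2)" for m
  proof -
    have "(\<Sum>j\<in>UNIV. (cmod (fcoef (wpd W j) m))\<^sup>2) = (2 * pi)\<^sup>2 * (knorm2 m * (cmod (fcoef W m))\<^sup>2)"
      unfolding wf knorm2_def sum_distrib_left sum_distrib_right
      by (intro sum.cong refl) (simp add: norm_mult power_mult_distrib)
    moreover have "1 * (knorm2 m * (cmod (fcoef W m))\<^sup>2) \<le> (2 * pi)\<^sup>2 * (knorm2 m * (cmod (fcoef W m))\<^sup>2)"
      using pi_ge_two power_mono[of 2 pi 2] knorm2_nonneg[of m] by (intro mult_right_mono) (auto simp: power_mult_distrib)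
    ultimately show ?thesis by (simp add: norm_mult power_mult_distrib freq_square)
  qed
  have "(\<Sum>m\<in>F. (cmod (of_real (freq m) * fcoef W m))\<^sup>2) \<le> (\<Sum>m\<in>F. \<Sum>j\<in>UNIV. (cmod (fcoef (wpd W j) m))\<^sup>2)"
    by (intro sum_mono one)
  also have "\<dots> = (\<Sum>j\<in>UNIV. \<Sum>m\<in>F. (cmod (fcoef (wpd W j) m))\<^sup>2)" by (rule sum.swap)
  also have "\<dots> \<le> (\<Sum>j\<in>UNIV. (?e j)\<^sup>2)" by (intro sum_mono le)
  also have "\<dots> = (L2_set ?e UNIV)\<^sup>2" by (simp add: L2_set_def sum_nonneg)
  also have "\<dots> \<le> (\<Sum>j\<in>UNIV. ?e j)\<^sup>2" by (intro power_mono L2_set_le_sum e0 L2_set_nonneg)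
  also have "\<dots> \<le> (Wnorm W)\<^sup>2" by (intro power_mono Wnorm_ge sum_nonneg e0)
  finally show "(\<Sum>m\<in>F. (cmod (of_real (freq m) * fcoef W m))\<^sup>2) \<le> (Wnorm W)\<^sup>2" .
qed

lemma coef_potential: "Wdot W \<Longrightarrow> coef (potential W) m = of_real (freq m) * fcoef W m"
  unfolding potential_def
  by (subst coef_Hl2[OF _ freq_fcoef_l2_bound]) (auto simp: fcoef_uminus freq_def lattice_vec_uminus)

lemma norm_potential_le: "Wdot W \<Longrightarrow> norm (potential W) \<le> Wnorm W"
  by (rule norm_hl2_le) (use freq_fcoef_l2_bound in \<open>simp add: l2_bound_def coef_potential\<close>)

lemma potential_comb: "Wdot H \<Longrightarrow> Wdot H' \<Longrightarrow> potential (Wcomb c H H') = c *\<^sub>R potential H + potential H'"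
  by (rule hl2_eqI)
    (simp add: coef_potential Wdot_comb, simp add: Wcomb_def fcoef_lin Wdot_L2per L2per_L1per distrib_left mult.left_commute)

lemma infsum_finite_sum:
  fixes f :: "'j \<Rightarrow> 'k \<Rightarrow> 'b::{topological_comm_monoid_add,t2_space}"
  assumes "finite J" "\<And>j. j \<in> J \<Longrightarrow> f j summable_on A"
  shows "infsum (\<lambda>m. \<Sum>j\<in>J. f j m) A = (\<Sum>j\<in>J. infsum (f j) A)"
proof -
  have "(\<lambda>m. \<Sum>j\<in>J. f j m) summable_on A \<and> infsum (\<lambda>m. \<Sum>j\<in>J. f j m) A = (\<Sum>j\<in>J. infsum (f j) A)"
    using assms by (induction J) (auto simp: infsum_add intro: summable_on_add)
  then show ?thesis ..
qed

text \<open>Summable coefficients of \<open>b\<close> make the convolution with each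
  \<open>wpd W j\<close> an absolutely convergent series, so its product with \<open>a\<close> has
  convolved coefficients. Summing over \<open>j\<close> turns the derivative factors into the inner
  product of \<open>k\<close> and \<open>m\<close>.\<close>

lemma driftc_eq:
  assumes W: "Wdot W" and a: "L2per a" and b: "L2per b" and s: "(\<lambda>k. cmod (fcoef b k)) summable_on UNIV"
  shows "driftc a W b k = of_real (freq k) * twist_conv drift_kernel (coef (potential W)) (fcoef a) (fcoef b) k"
proof -
  have w: "has_wpd W j (wpd W j)" for j by (rule has_wpd_wpd[OF W])
  then have wf: "fcoef (wpd W j) m = 2 * pi * \<i> * of_int (m $ j) * fcoef W m" and wL: "L2per (wpd W j)" for j m
    by (auto simp: has_wpd_def)
  let ?t = "\<lambda>j m. fcoef (wpd W j) m * fcoef b m * fcoef a (k - m)"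
  have fc: "fourier_coeffs (\<lambda>m. fcoef (wpd W j) m * fcoef b m)" for j by (rule conv_eq_fseries(2)[OF wL b s])
  have sj: "?t j summable_on UNIV" for j
  proof (rule abs_summable_summable, rule summable_on_comparison_test)
    show "(\<lambda>m. sqrt (LINT x|torus. (a x)\<^sup>2) * cmod (fcoef (wpd W j) m * fcoef b m)) summable_on UNIV"
      by (rule summable_on_cmult_right[OF fourier_coeffs.summable[OF fc]])
    show "norm (?t j m) \<le> sqrt (LINT x|torus. (a x)\<^sup>2) * cmod (fcoef (wpd W j) m * fcoef b m)" for m
      using mult_left_mono[OF l2_bound_cmod[OF fcoef_l2_bound[OF a], of "k - m"], of "cmod (fcoef (wpd W j) m * fcoef b m)"]
      by (simp add: norm_mult mult_ac)
  qed auto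
  have "driftc a W b k = (\<Sum>j\<in>UNIV. 2 * pi * \<i> * of_int (k $ j) * (\<Sum>\<^sub>\<infinity>m. ?t j m))"
    unfolding driftc_def conv_eq_fseries(1)[OF wL b s] fourier_coeffs.fcoef_mult_fseries[OF fc L2per_L1per[OF a]] ..
  also have "\<dots> = (\<Sum>j\<in>UNIV. (\<Sum>\<^sub>\<infinity>m. 2 * pi * \<i> * of_int (k $ j) * ?t j m))"
    by (intro sum.cong refl infsum_cmult_right[symmetric] sj)
  also have "\<dots> = (\<Sum>\<^sub>\<infinity>m. \<Sum>j\<in>UNIV. 2 * pi * \<i> * of_int (k $ j) * ?t j m)"
    by (rule infsum_finite_sum[symmetric]) (intro finite summable_on_cmult_right sj)+
  also have "\<dots> = (\<Sum>\<^sub>\<infinity>m. of_real (freq k) * (of_real (drift_kernel k m) * (coef (potential W) m * fcoef b m) * fcoef a (k - m)))"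
  proof (rule infsum_cong)
    fix m
    have "(\<Sum>j\<in>UNIV. 2 * pi * \<i> * of_int (k $ j) * ?t j m)
      = of_real (- 4 * pi\<^sup>2 * (lattice_vec k \<bullet> lattice_vec m)) * (fcoef W m * fcoef b m * fcoef a (k - m))"
      unfolding wf inner_vec_def lattice_vec_def of_real_mult of_real_sum sum_distrib_left sum_distrib_right
      by (intro sum.cong refl) (simp add: power2_eq_square algebra_simps)
    \<comment> \<open>If one frequency is 0, its lattice vector vanishes and both sides are 0;
      otherwise the denominators cancel.\<close>
    also have "- 4 * pi\<^sup>2 * (lattice_vec k \<bullet> lattice_vec m) = freq k * drift_kernel k m * freq m"
    proof (cases "freq k = 0 \<or> freq m = 0")
      case True
      then show ?thesis by (auto simp: freq_def)
    next
      case False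
      then show ?thesis by (simp add: drift_kernel_def)
    qed
    finally show "(\<Sum>j\<in>UNIV. 2 * pi * \<i> * of_int (k $ j) * ?t j m)
      = of_real (freq k) * (of_real (drift_kernel k m) * (coef (potential W) m * fcoef b m) * fcoef a (k - m))"
      by (simp add: coef_potential[OF W] mult_ac)
  qed
  also have "\<dots> = of_real (freq k) * twist_conv drift_kernel (coef (potential W)) (fcoef a) (fcoef b) k"
    unfolding twist_conv_def by (rule infsum_cmult_right')
  finally show ?thesis .
qed

section \<open>A priori bounds\<close>

text \<open>The correction \<open>4 / (real N + 1)\<close> makes the induction telescope; both sides
  are 1 at \<open>N = 0\<close>.\<close>

lemma sum_inverse_one_plus_square:
  "(\<Sum>n\<in>{- int N..int N}. 1 / (1 + (real_of_int n)\<^sup>2)) \<le> 5 - 4 / (real N + 1)"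
proof (induction N)
  case (Suc N)
  have "{- int (Suc N)..int (Suc N)} = insert (- int (Suc N)) (insert (int (Suc N)) {- int N..int N})" by auto
  then have "(\<Sum>n\<in>{- int (Suc N)..int (Suc N)}. 1 / (1 + (real_of_int n)\<^sup>2))
     = 2 / (1 + (real N + 1)\<^sup>2) + (\<Sum>n\<in>{- int N..int N}. 1 / (1 + (real_of_int n)\<^sup>2))"
    by (simp add: power2_eq_square algebra_simps)
  moreover have "2 / (1 + (real N + 1)\<^sup>2) \<le> 4 / (real N + 1) - 4 / (real N + 2)"
  proof -
    have "4 / (real N + 1) - 4 / (real N + 2) = 4 / ((real N + 1) * (real N + 2))"
      by (simp add: field_simps)
    moreover have "2 / (1 + (real N + 1)\<^sup>2) \<le> 4 / ((real N + 1) * (real N + 2))"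
      by (rule frac_le[of 4 4 "(real N + 1) * (real N + 2)" "2 * (1 + (real N + 1)\<^sup>2)", simplified mult.commute, THEN order_trans[rotated]])
        (auto simp: power2_eq_square algebra_simps add_pos_nonneg divide_simps)
    ultimately show ?thesis by simp
  qed
  ultimately show ?case using Suc by (simp add: algebra_simps)
qed simp

text \<open>\<open>japanese k ^ (2 * CARD('d))\<close> dominates the product of the factors
  \<open>1 + (k $ i)\<^sup>2\<close>, so every finite sum is at most a product of one-dimensional
  sums, each at most 5.\<close>

lemma japanese_power_summable:
  assumes "2 * CARD('d) \<le> n"
  shows "(\<lambda>k :: int^'d. 1 / japanese k ^ n) summable_on UNIV"
proof (rule nonneg_bdd_above_summable_on)
  show "bdd_above (sum (\<lambda>k :: int^'d. 1 / japanese k ^ n) ` {F. F \<subseteq> UNIV \<and> finite F})"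
  proof (rule bdd_aboveI2)
    fix F :: "(int^'d) set" assume "F \<in> {F. F \<subseteq> UNIV \<and> finite F}"
    then have F: "finite F" by simp
    let ?g = "\<lambda>n::int. 1 / (1 + (real_of_int n)\<^sup>2)"
    have "finite (\<Union>i. (\<lambda>k. \<bar>k $ i\<bar>) ` F)" using F by auto
    then obtain N0 where N0: "\<And>z. z \<in> (\<Union>i. (\<lambda>k. \<bar>k $ i\<bar>) ` F) \<Longrightarrow> z \<le> N0"
      by (metis Max_ge)
    define N where "N = nat N0"
    define A where "A = {- int N..int N}"
    have FA: "k $ i \<in> A" if "k \<in> F" for k i
    proof -
      have "\<bar>k $ i\<bar> \<le> N0" using that by (intro N0) blast
      then show ?thesis unfolding A_def N_def by auto
    qed
    have le: "1 / japanese k ^ n \<le> (\<Prod>i\<in>UNIV. ?g (k $ i))" for k :: "int^'d"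
    proof -
      have j1: "1 \<le> japanese k" by (rule japanese_ge_1)
      have "(\<Prod>i\<in>(UNIV::'d set). 1 + (real_of_int (k $ i))\<^sup>2) \<le> (\<Prod>i\<in>(UNIV::'d set). 1 + knorm2 k)"
      proof (rule prod_mono)
        show "0 \<le> 1 + (real_of_int (k $ i))\<^sup>2 \<and> 1 + (real_of_int (k $ i))\<^sup>2 \<le> 1 + knorm2 k" for i
          unfolding knorm2_def using member_le_sum[of i UNIV "\<lambda>i. (real_of_int (k $ i))\<^sup>2"] by auto
      qed
      also have "\<dots> = japanese k ^ (2 * CARD('d))"
        by (simp add: japanese_def power_mult knorm2_nonneg)
      also have "\<dots> \<le> japanese k ^ n" by (rule power_increasing[OF assms j1])
      finally have "1 / japanese k ^ n \<le> 1 / (\<Prod>i\<in>(UNIV::'d set). 1 + (real_of_int (k $ i))\<^sup>2)"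
        by (intro divide_left_mono mult_pos_pos prod_pos zero_less_power)
          (use j1 in \<open>auto simp: add_pos_nonneg\<close>)
      then show ?thesis by (simp add: prod_dividef)
    qed
    have "(\<Sum>k\<in>F. 1 / japanese k ^ n) \<le> (\<Sum>k\<in>F. \<Prod>i\<in>UNIV. ?g (k $ i))" by (intro sum_mono le)
    also have "\<dots> = (\<Sum>h\<in>(\<lambda>k. vec_nth k) ` F. \<Prod>i\<in>UNIV. ?g (h i))"
      by (subst sum.reindex) (auto simp: inj_on_def vec_nth_inject)
    also have "\<dots> \<le> (\<Sum>h\<in>PiE (UNIV::'d set) (\<lambda>_. A). \<Prod>i\<in>UNIV. ?g (h i))"
    proof (rule sum_mono2)
      show "finite (PiE (UNIV :: 'd set) (\<lambda>_. A))" by (intro finite_PiE) (auto simp: A_def)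
      show "(\<lambda>k. vec_nth k) ` F \<subseteq> PiE UNIV (\<lambda>_. A)" using FA by auto
      show "0 \<le> (\<Prod>i\<in>(UNIV :: 'd set). ?g (h i))" for h by (intro prod_nonneg) auto
    qed
    also have "\<dots> = (\<Prod>i\<in>(UNIV::'d set). \<Sum>n\<in>A. ?g n)"
      by (rule prod_sum_PiE[symmetric]) (auto simp: A_def)
    also have "\<dots> \<le> (\<Prod>i\<in>(UNIV::'d set). 5)"
    proof (rule prod_mono)
      have "(\<Sum>n\<in>A. ?g n) \<le> 5 - 4 / (real N + 1)" unfolding A_def by (rule sum_inverse_one_plus_square)
      also have "\<dots> \<le> 5" by simp
      finally show "0 \<le> (\<Sum>n\<in>A. ?g n) \<and> (\<Sum>n\<in>A. ?g n) \<le> 5" by (auto intro: sum_nonneg)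
    qed
    finally show "(\<Sum>k\<in>F. 1 / japanese k ^ n) \<le> (\<Prod>i\<in>(UNIV::'d set). 5)" .
  qed
qed (use japanese_ge_1 in \<open>auto intro!: divide_nonneg_nonneg zero_le_power intro: order_trans[of 0 1]\<close>)

text \<open>The Bessel potential of order \<open>b\<close>: trajectories store coefficients
  multiplied by \<open>japanese k ^ b\<close>, and this recovers those of the function.\<close>

definition smooth :: "nat \<Rightarrow> (int^'d) hl2 \<Rightarrow> (int^'d) hl2" where
  "smooth b f = Hl2 (\<lambda>k. coef f k / of_real (japanese k ^ b))"

lemma japanese_pos: "0 < japanese k ^ n" using japanese_ge_1[of k] by (intro zero_less_power) linarith

lemma japanese_power_ge_1: "1 \<le> japanese k ^ n" using japanese_ge_1 by (rule one_le_power)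

lemma smooth_le: "cmod (coef f k / of_real (japanese k ^ b)) \<le> cmod (coef f k)"
  using japanese_power_ge_1[of k b] by (simp add: norm_divide divide_le_eq mult_le_cancel_left1 del: of_real_power)

lemma coef_smooth: "coef (smooth b f) k = coef f k / of_real (japanese k ^ b)"
  unfolding smooth_def
  by (subst coef_Hl2[OF _ l2_bound_comparison[OF l2_bound_norm[of f] smooth_le]])
    (auto simp: coef_uminus japanese_uminus)

lemma bounded_linear_smooth: "bounded_linear (smooth b)"
proof (rule bounded_linear_intro[where K = 1])
  show "norm (smooth b f) \<le> norm f * 1" for f
    by (rule norm_hl2_le) (simp add: coef_smooth l2_bound_comparison[OF l2_bound_norm[of f] smooth_le] del: of_real_power,
        use l2_bound_comparison[OF l2_bound_norm[of f] smooth_le[of f _ b]] in \<open>simp add: l2_bound_def coef_smooth\<close>)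
qed (auto intro!: hl2_eqI simp: coef_smooth add_divide_distrib scaleR_conv_of_real)

text \<open>\<open>kernelw\<close> is \<open>drift_kernel\<close> conjugated with the weights:
  removing the weight of the output puts inverse weights on both inputs.\<close>

lemma twist_conv_kernelw:
  "coef (tconv (kernelw b) p f g) k / of_real (japanese k ^ b) = twist_conv drift_kernel (coef p) (coef (smooth b f)) (coef (smooth b g)) k"
proof -
  interpret kw: twist_kernel "kernelw b" "4 * pi\<^sup>2 * 2 ^ b" by standard (rule kernelw_bound_abs kernelw_uminus)+
  have "coef (tconv (kernelw b) p f g) k / of_real (japanese k ^ b)
     = (\<Sum>\<^sub>\<infinity>m. of_real (kernelw b k m) * (coef p m * coef g m) * coef f (k - m) * (1 / of_real (japanese k ^ b)))"
    unfolding kw.coef_tconv by (subst infsum_cmult_left') simp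
  also have "\<dots> = twist_conv drift_kernel (coef p) (coef (smooth b f)) (coef (smooth b g)) k"
    unfolding twist_conv_def coef_smooth
  proof (rule infsum_cong)
    fix m
    have "complex_of_real (kernelw b k m) = of_real (drift_kernel k m) * of_real (japanese k ^ b) / (of_real (japanese m ^ b) * of_real (japanese (k - m) ^ b))"
      by (simp add: kernelw_def del: of_real_power)
    moreover have "complex_of_real (japanese k ^ b) \<noteq> 0" using japanese_pos[of k b] by (metis less_irrefl of_real_eq_0_iff)
    ultimately show "of_real (kernelw b k m) * (coef p m * coef g m) * coef f (k - m) * (1 / of_real (japanese k ^ b))
       = of_real (drift_kernel k m) * (coef p m * (coef g m / of_real (japanese m ^ b))) * (coef f (k - m) / of_real (japanese (k - m) ^ b))"
      by (simp del: of_real_power add: mult_ac)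
  qed
  finally show ?thesis .
qed

text \<open>Whichever of \<open>m\<close> and \<open>k - m\<close> is larger absorbs the weight of \<open>k\<close>, so that only one factor
  is measured in the strong norm.\<close>
lemma norm_tconv_kernelw_tame:
  "norm (tconv (kernelw b) p f f) \<le> 8 * pi\<^sup>2 * 2 ^ b * norm p * norm (smooth b f) * norm f"
proof -
  let ?S = "4 * pi\<^sup>2 * 2 ^ b"
  define s1 where "s1 k m = (if japanese (k - m) \<le> japanese m then drift_kernel k m * (japanese k ^ b / japanese m ^ b) else 0)" for k m :: "int^'a"
  define s2 where "s2 k m = (if japanese (k - m) \<le> japanese m then 0 else drift_kernel k m * (japanese k ^ b / japanese (k - m) ^ b))" for k m :: "int^'a"
  have dom: "\<bar>drift_kernel k m * (japanese k ^ b / japanese n ^ b)\<bar> \<le> ?S" if "japanese k \<le> 2 * japanese n" for k m n :: "int^'a"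
  proof -
    have "japanese k ^ b \<le> (2 * japanese n) ^ b" using that japanese_ge_1[of k] by (intro power_mono) auto
    then have "japanese k ^ b / japanese n ^ b \<le> 2 ^ b"
      using japanese_pos[of n b] by (simp add: power_mult_distrib pos_divide_le_eq)
    then show ?thesis
      using japanese_pos[of k b] japanese_pos[of n b] unfolding abs_mult
      by (intro mult_mono kernel_bound_abs) auto
  qed
  interpret kw: twist_kernel "kernelw b" ?S by standard (rule kernelw_bound_abs kernelw_uminus)+
  have ev: "japanese (- k - (- m)) = japanese (k - m)" for k m :: "int^'a" using japanese_uminus[of "k - m"] by simp
  interpret k1: twist_kernel s1 ?S
  proof
    show "\<bar>s1 k m\<bar> \<le> ?S" for k m
    proof (cases "japanese (k - m) \<le> japanese m")
      case True
      then have "japanese k \<le> 2 * japanese m" using japanese_triangle[of k m] by linarith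
      from dom[OF this, of m] show ?thesis using True by (simp only: s1_def if_True)
    qed (simp add: s1_def)
    show "s1 (- k) (- m) = s1 k m" for k m unfolding s1_def ev by (simp add: japanese_uminus kernel_uminus)
  qed
  interpret k2: twist_kernel s2 ?S
  proof
    show "\<bar>s2 k m\<bar> \<le> ?S" for k m
    proof (cases "japanese (k - m) \<le> japanese m")
      case False
      then have "japanese k \<le> 2 * japanese (k - m)" using japanese_triangle[of k m] by linarith
      from dom[OF this, of m] show ?thesis using False by (simp only: s2_def if_False)
    qed (simp add: s2_def)
    show "s2 (- k) (- m) = s2 k m" for k m unfolding s2_def ev by (simp add: japanese_uminus kernel_uminus)
  qed
  have "tconv (kernelw b) p f f = tconv s1 p (smooth b f) f + tconv s2 p f (smooth b f)"
  proof (rule hl2_eqI)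
    fix k
    have "of_real (kernelw b k m) * (coef p m * coef f m) * coef f (k - m)
       = of_real (s1 k m) * (coef p m * coef f m) * coef (smooth b f) (k - m)
         + of_real (s2 k m) * (coef p m * coef (smooth b f) m) * coef f (k - m)" for m
    proof -
      have kw: "complex_of_real (kernelw b k m) = of_real (drift_kernel k m) * of_real (japanese k ^ b) / (of_real (japanese m ^ b) * of_real (japanese (k - m) ^ b))"
        by (simp add: kernelw_def del: of_real_power)
      show ?thesis unfolding kw coef_smooth s1_def s2_def by (simp del: of_real_power add: mult_ac)
    qed
    then show "coef (tconv (kernelw b) p f f) k = coef (tconv s1 p (smooth b f) f + tconv s2 p f (smooth b f)) k"
      unfolding coef_add kw.coef_tconv k1.coef_tconv k2.coef_tconv
      by (simp only: infsum_add[OF k1.tconv_summable k2.tconv_summable])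
  qed
  then have "norm (tconv (kernelw b) p f f) \<le> norm (tconv s1 p (smooth b f) f) + norm (tconv s2 p f (smooth b f))"
    by (simp add: norm_triangle_ineq)
  also have "\<dots> \<le> ?S * norm p * norm f * norm (smooth b f) + ?S * norm p * norm (smooth b f) * norm f"
    by (intro add_mono k1.norm_tconv k2.norm_tconv)
  finally show ?thesis by (simp add: algebra_simps)
qed

section \<open>The function belonging to a trajectory\<close>

locale torus_problem =
  fixes T :: real and b :: nat and \<phi> :: "real^'d \<Rightarrow> real"
  assumes T_gt_0: "T > 0" and A1: "A1 b \<phi>"
begin

sublocale parabolic_quadratic "decay :: int^'d \<Rightarrow> real" freq T "kernelw b" "4 * pi\<^sup>2 * 2 ^ b"
  by (rule parabolic_quadratic_torus[OF T_gt_0])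

lemma b_ge: "b \<ge> 3 + CARD('d)" and phi_L2per: "L2per \<phi>" and phi_nonneg: "0 \<le> \<phi> y"
  and phi_mass: "(LINT x|torus. \<phi> x) = 1"
  using A1 by (auto simp: A1_def Hs_def)

definition ucoef :: "(int^'d) traj_data \<Rightarrow> real \<Rightarrow> int^'d \<Rightarrow> complex" where
  "ucoef x t = coef (smooth b (traj x t))"

definition state :: "(int^'d) traj_data \<Rightarrow> real \<Rightarrow> real^'d \<Rightarrow> real" where
  "state x t = fseries (ucoef x t)"

lemma ucoef_eq: "ucoef x t k = traj_coef x t k / of_real (japanese k ^ b)"
  by (simp add: ucoef_def coef_smooth coef_traj)

text \<open>Twice \<open>b - 2\<close> is at least \<open>2 * CARD('d)\<close> by the lower bound on
  \<open>b\<close> in \<open>A1\<close>. The two powers held back pay for two derivatives in space,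
  or one in time, inside absolutely convergent series.\<close>

lemma weight_summable: "(\<lambda>k :: int^'d. (1 / japanese k ^ (b - 2))\<^sup>2) summable_on UNIV"
  using japanese_power_summable[where 'd = 'd, of "(b - 2) * 2"] b_ge by (simp add: power_divide flip: power_mult)

text \<open>Cauchy-Schwarz against fixed weights: the finite set depends on \<open>e\<close> and
  serves all \<open>f\<close> at once.\<close>

lemma weighted_tail:
  assumes "e > 0"
  obtains F :: "(int^'d) set" where "finite F"
    "\<And>G f. finite G \<Longrightarrow> G \<inter> F = {} \<Longrightarrow> (\<Sum>k\<in>G. cmod (coef f k) / japanese k ^ (b - 2)) \<le> e * norm f"
proof -
  obtain F :: "(int^'d) set" where F: "finite F" "\<And>G. finite G \<Longrightarrow> G \<inter> F = {} \<Longrightarrow> (\<Sum>k\<in>G. (1 / japanese k ^ (b - 2))\<^sup>2) \<le> e\<^sup>2"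
    using summable_tail[OF weight_summable, of "e\<^sup>2"] assms by auto
  show ?thesis
  proof (rule that[OF F(1)])
    fix G :: "(int^'d) set" and f :: "(int^'d) hl2" assume G: "finite G" "G \<inter> F = {}"
    have "(\<Sum>k\<in>G. cmod (coef f k) / japanese k ^ (b - 2)) = (\<Sum>k\<in>G. \<bar>1 / japanese k ^ (b - 2)\<bar> * \<bar>cmod (coef f k)\<bar>)"
      by (intro sum.cong refl) simp
    also have "\<dots> \<le> L2_set (\<lambda>k. 1 / japanese k ^ (b - 2)) G * L2_set (\<lambda>k. cmod (coef f k)) G"
      by (rule L2_set_mult_ineq)
    also have "\<dots> \<le> e * norm f"
      using F(2)[OF G] l2_bound_norm[of f] G assms
      by (intro mult_mono) (auto simp: L2_set_def[of "\<lambda>k. 1 / _ k"] l2_bound_def intro!: real_le_lsqrt sum_nonneg)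
    finally show "(\<Sum>k\<in>G. cmod (coef f k) / japanese k ^ (b - 2)) \<le> e * norm f" .
  qed
qed

lemma weighted_coef_summable: "(\<lambda>k. cmod (coef f k) / japanese k ^ (b - 2)) summable_on UNIV" for f :: "(int^'d) hl2"
proof (rule summable_on_comparison_test)
  show "(\<lambda>k. (cmod (coef f k))\<^sup>2 + (1 / japanese k ^ (b - 2))\<^sup>2) summable_on UNIV"
  proof (rule summable_on_add[OF _ weight_summable])
    show "(\<lambda>k. (cmod (coef f k))\<^sup>2) summable_on UNIV"
      by (rule nonneg_bdd_above_summable_on) (auto intro!: bdd_aboveI2[of _ _ "(norm f)\<^sup>2"] sum_coef_le)
  qed
  show "cmod (coef f k) / japanese k ^ (b - 2) \<le> (cmod (coef f k))\<^sup>2 + (1 / japanese k ^ (b - 2))\<^sup>2" for k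
  proof -
    have "x * y \<le> x\<^sup>2 + y\<^sup>2" if "0 \<le> x" "0 \<le> y" for x y :: real
      using zero_le_power2[of "x - y"] mult_nonneg_nonneg[OF that] by (simp add: power2_eq_square algebra_simps)
    from this[of "cmod (coef f k)" "1 / japanese k ^ (b - 2)"] show ?thesis
      using japanese_pos[of k "b - 2"] by simp
  qed
qed auto

lemma japanese_split: "japanese k ^ b = japanese k ^ (b - 2) * (japanese k)\<^sup>2"
proof -
  have "b - 2 + 2 = b" using b_ge by simp
  then show ?thesis by (metis power_add)
qed

lemma cmod_ucoef: "(japanese k)\<^sup>2 * cmod (ucoef x t k) = cmod (coef (traj x t) k) / japanese k ^ (b - 2)"
  by (simp add: ucoef_def coef_smooth norm_divide japanese_split norm_mult norm_power)

lemma ucoef_summable2: "(\<lambda>k. (japanese k)\<^sup>2 * cmod (ucoef x t k)) summable_on UNIV"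
  unfolding cmod_ucoef by (rule weighted_coef_summable)

lemma ucoef_summable1: "(\<lambda>k. japanese k * cmod (ucoef x t k)) summable_on UNIV"
proof (rule summable_on_comparison_test[OF ucoef_summable2[of x t]])
  show "japanese k * cmod (ucoef x t k) \<le> (japanese k)\<^sup>2 * cmod (ucoef x t k)" for k
    using mult_right_mono[OF japanese_ge_1[of k], of "japanese k * cmod (ucoef x t k)"]
    by (simp add: power2_eq_square mult.assoc)
qed simp

lemma ucoef_summable: "(\<lambda>k. cmod (ucoef x t k)) summable_on UNIV"
proof (rule summable_on_comparison_test[OF ucoef_summable1[of x t]])
  show "cmod (ucoef x t k) \<le> japanese k * cmod (ucoef x t k)" for k
    using mult_right_mono[OF japanese_ge_1[of k], of "cmod (ucoef x t k)"] by simp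
qed simp

lemma fourier_coeffs_ucoef: "fourier_coeffs (ucoef x t)"
  by standard (rule ucoef_summable, simp add: ucoef_def coef_uminus)

lemma fcoef_state: "fcoef (state x t) k = ucoef x t k"
  unfolding state_def by (rule fourier_coeffs.fcoef_fseries[OF fourier_coeffs_ucoef])

lemma state_L2per: "L2per (state x t)"
  unfolding state_def by (rule fourier_coeffs.fseries_L2per[OF fourier_coeffs_ucoef])

lemma driftc_state:
  assumes "Wdot W"
  shows "driftc (state x s) W (state y t) k
    = of_real (freq k) * (coef (tconv (kernelw b) (potential W) (traj x s) (traj y t)) k / of_real (japanese k ^ b))"
proof -
  have "fcoef (state x s) = coef (smooth b (traj x s))" for x s by (rule ext) (simp add: fcoef_state ucoef_def)
  then show ?thesis
    unfolding twist_conv_kernelw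
    by (subst driftc_eq[OF assms state_L2per state_L2per]) (simp_all add: fcoef_state ucoef_summable ucoef_def[symmetric])
qed

end

subsection \<open>Positivity\<close>

lemma cmod_cis_minus_1_sq: "(cmod (cis a - 1))\<^sup>2 = 2 - 2 * cos a"
proof -
  have "(cmod (cis a - 1))\<^sup>2 = (cos a - 1)\<^sup>2 + (sin a)\<^sup>2" by (simp add: cmod_power2)
  also have "\<dots> = (sin a)\<^sup>2 + (cos a)\<^sup>2 + 1 - 2 * cos a" by (simp add: power2_eq_square algebra_simps)
  finally show ?thesis by simp
qed

lemma two_minus_two_cos: "2 - 2 * cos a = 4 * (sin (a / 2))\<^sup>2" for a :: real
  using cos_double_sin[of "a / 2"] by simp

lemma two_minus_two_cos_le: "2 - 2 * cos a \<le> a\<^sup>2" for a :: real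
proof -
  have "\<bar>sin (a / 2)\<bar>\<^sup>2 \<le> \<bar>a / 2\<bar>\<^sup>2" by (intro power_mono abs_sin_x_le_abs_x) simp
  then show ?thesis unfolding two_minus_two_cos by (simp add: power_divide)
qed

lemma cmod_cis_minus_1_le: "cmod (cis a - 1) \<le> \<bar>a\<bar>"
proof -
  have "(cmod (cis a - 1))\<^sup>2 \<le> \<bar>a\<bar>\<^sup>2" using two_minus_two_cos_le[of a] by (simp add: cmod_cis_minus_1_sq)
  then show ?thesis by (rule power2_le_imp_le) simp
qed

lemma sin_quotient_limit: "((\<lambda>s. sin (a * s) / s) \<longlongrightarrow> a) (at 0)" for a :: real
proof -
  have "((\<lambda>s. sin (a * s)) has_real_derivative a) (at 0)" by (auto intro!: derivative_eq_intros)
  then show ?thesis by (simp add: DERIV_def)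
qed

lemma cis_quotient_limit: "((\<lambda>s. (cis (a * s) - 1) / of_real s) \<longlongrightarrow> \<i> * of_real a) (at 0)"
proof -
  have "((\<lambda>s. cos (a * s)) has_real_derivative 0) (at 0)" by (auto intro!: derivative_eq_intros)
  then have c: "((\<lambda>s. (cos (a * s) - 1) / s) \<longlongrightarrow> 0) (at 0)" by (simp add: DERIV_def)
  have "((\<lambda>s. Complex ((cos (a * s) - 1) / s) (sin (a * s) / s)) \<longlongrightarrow> Complex 0 a) (at 0)"
    by (intro tendsto_Complex c sin_quotient_limit)
  moreover have "(cis (a * s) - 1) / of_real s = Complex ((cos (a * s) - 1) / s) (sin (a * s) / s)" for s
    by (simp add: complex_eq_iff)
  moreover have "Complex 0 a = \<i> * of_real a" by (simp add: complex_eq_iff)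
  ultimately show ?thesis by simp
qed

lemma cos_quotient_limit: "((\<lambda>s. (2 * cos (a * s) - 2) / s\<^sup>2) \<longlongrightarrow> - a\<^sup>2) (at 0)" for a :: real
proof -
  have "((\<lambda>s. - 4 * (sin (a / 2 * s) / s)\<^sup>2) \<longlongrightarrow> - 4 * (a / 2)\<^sup>2) (at 0)"
    by (intro tendsto_intros sin_quotient_limit)
  moreover have "(2 * cos (a * s) - 2) / s\<^sup>2 = - 4 * (sin (a / 2 * s) / s)\<^sup>2" for s
  proof -
    have "2 * cos (a * s) - 2 = - (4 * (sin (a * s / 2))\<^sup>2)" using two_minus_two_cos[of "a * s"] by linarith
    then show ?thesis by (simp add: power_divide)
  qed
  moreover have "- 4 * (a / 2)\<^sup>2 = - a\<^sup>2" by (simp add: power_divide)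
  ultimately show ?thesis by simp
qed

lemma character_axis: "character k (axis j s) = cis (2 * pi * real_of_int (k $ j) * s)"
proof -
  have "(\<Sum>i\<in>UNIV. real_of_int (k $ i) * axis j s $ i) = (\<Sum>i\<in>UNIV. if i = j then real_of_int (k $ j) * s else 0)"
    by (intro sum.cong) (auto simp: axis_def)
  then show ?thesis by (simp add: character_def mult_ac)
qed

lemma abs_component_le: "\<bar>real_of_int (k $ j)\<bar> \<le> japanese k"
proof -
  have "(real_of_int (k $ j))\<^sup>2 \<le> knorm2 k"
    unfolding knorm2_def by (rule member_le_sum) auto
  then have "sqrt ((real_of_int (k $ j))\<^sup>2) \<le> japanese k" unfolding japanese_def by (intro real_sqrt_le_mono) simp
  then show ?thesis by simp
qed

lemma summable_on_finite_sum:
  fixes f :: "'i \<Rightarrow> 'a \<Rightarrow> 'b::topological_ab_group_add"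
  assumes "finite I" and "\<And>i. i \<in> I \<Longrightarrow> f i summable_on A"
  shows "(\<lambda>x. \<Sum>i\<in>I. f i x) summable_on A"
  using assms by (induction rule: finite_induct) (auto intro: summable_on_add)

text \<open>Series that may be differentiated twice term by term.\<close>

locale fourier_C2 = fourier_coeffs +
  assumes summable2: "(\<lambda>k. (japanese k)\<^sup>2 * cmod (c k)) summable_on UNIV"
begin

lemma summable1: "(\<lambda>k. japanese k * cmod (c k)) summable_on UNIV"
proof (rule summable_on_comparison_test[OF summable2])
  show "japanese k * cmod (c k) \<le> (japanese k)\<^sup>2 * cmod (c k)" for k
    using mult_right_mono[OF japanese_ge_1[of k], of "japanese k * cmod (c k)"]
    by (simp add: power2_eq_square mult.assoc)
qed simp

lemma gradient_summable: "(\<lambda>k. of_int (k $ j) * (c k * character k y)) summable_on UNIV"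
proof (rule abs_summable_summable, rule summable_on_comparison_test[OF summable1])
  show "cmod (of_int (k $ j) * (c k * character k y)) \<le> japanese k * cmod (c k)" for k
    using abs_component_le[of k j] by (auto simp: norm_mult intro: mult_right_mono)
qed simp

text \<open>Difference quotients along an axis converge by dominated convergence. Their limit is
  real, and it vanishes because the restriction to the axis has a minimum.\<close>

lemma minimum_gradient:
  assumes min: "\<And>y. fseries c y0 \<le> fseries c y"
  shows "(\<Sum>\<^sub>\<infinity>k. of_int (k $ j) * (c k * character k y0)) = 0"
proof -
  let ?a = "\<lambda>k :: int^'a. 2 * pi * real_of_int (k $ j)"
  let ?L = "\<Sum>\<^sub>\<infinity>k. c k * character k y0 * (\<i> * of_real (?a k))"
  let ?q = "\<lambda>s. (fseries c (y0 + axis j s) - fseries c y0) / s"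
  have q: "complex_of_real (?q s) = (\<Sum>\<^sub>\<infinity>k. c k * character k y0 * ((cis (?a k * s) - 1) / of_real s))" for s
  proof -
    have "complex_of_real (fseries c (y0 + axis j s) - fseries c y0)
      = (\<Sum>\<^sub>\<infinity>k. c k * character k (y0 + axis j s) - c k * character k y0)"
      using infsum_add[OF series_summable summable_on_uminus[THEN iffD2, OF series_summable], of "y0 + axis j s" y0]
      by (simp add: of_real_fseries infsum_uminus)
    also have "\<dots> = (\<Sum>\<^sub>\<infinity>k. c k * character k y0 * (cis (?a k * s) - 1))"
      by (simp add: character_add character_axis algebra_simps)
    finally have "complex_of_real (?q s) = (\<Sum>\<^sub>\<infinity>k. c k * character k y0 * (cis (?a k * s) - 1)) * (1 / of_real s)" by simp
    then show ?thesis by (simp only: infsum_cmult_left'[symmetric]) simp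
  qed
  have "((\<lambda>s. complex_of_real (?q s)) \<longlongrightarrow> ?L) (at 0)"
    unfolding q
  proof (rule tendsto_infsum_dominated(1)[where M = "\<lambda>k. 2 * pi * (japanese k * cmod (c k))"])
    show "((\<lambda>s. c k * character k y0 * ((cis (?a k * s) - 1) / of_real s)) \<longlongrightarrow> c k * character k y0 * (\<i> * of_real (?a k))) (at 0)" for k
      by (intro tendsto_intros cis_quotient_limit)
    show "(\<lambda>k. 2 * pi * (japanese k * cmod (c k))) summable_on UNIV"
      by (rule summable_on_cmult_right[OF summable1])
    show "\<forall>\<^sub>F s in at 0. \<forall>k. norm (c k * character k y0 * ((cis (?a k * s) - 1) / of_real s)) \<le> 2 * pi * (japanese k * cmod (c k))"
    proof (intro always_eventually allI)
      fix s :: real and k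
      have "cmod (cis (?a k * s) - 1) / \<bar>s\<bar> \<le> 2 * pi * japanese k"
      proof (cases "s = 0")
        case False
        have "cmod (cis (?a k * s) - 1) \<le> \<bar>?a k * s\<bar>" by (rule cmod_cis_minus_1_le)
        also have "\<dots> = 2 * pi * \<bar>real_of_int (k $ j)\<bar> * \<bar>s\<bar>" by (simp add: abs_mult)
        also have "\<dots> \<le> 2 * pi * japanese k * \<bar>s\<bar>" by (intro mult_right_mono mult_left_mono abs_component_le) auto
        finally show ?thesis using False by (simp add: pos_divide_le_eq)
      qed simp
      from mult_left_mono[OF this, of "cmod (c k)"]
      show "norm (c k * character k y0 * ((cis (?a k * s) - 1) / of_real s)) \<le> 2 * pi * (japanese k * cmod (c k))"
        by (simp add: norm_mult norm_divide mult_ac)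
    qed
  qed simp
  then have re: "(?q \<longlongrightarrow> Re ?L) (at 0)" and im: "((\<lambda>s. 0) \<longlongrightarrow> Im ?L) (at (0::real))"
    using tendsto_Re tendsto_Im by fastforce+
  have "Im ?L = 0" using tendsto_unique[OF _ im tendsto_const] by simp
  moreover have "Re ?L = 0"
  proof (rule DERIV_local_min[where f = "\<lambda>s. fseries c (y0 + axis j s)" and x = 0 and d = 1])
    have z: "axis j 0 = (0 :: real^'a)" by (simp add: axis_def vec_eq_iff)
    show "((\<lambda>s. fseries c (y0 + axis j s)) has_real_derivative Re ?L) (at 0)"
      using re by (simp add: DERIV_def z)
    show "\<forall>s. \<bar>0 - s\<bar> < 1 \<longrightarrow> fseries c (y0 + axis j 0) \<le> fseries c (y0 + axis j s)" using min by (simp add: z)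
  qed simp
  ultimately have "?L = 0" by (simp add: complex_eq_iff)
  moreover have "?L = (\<Sum>\<^sub>\<infinity>k. (\<i> * of_real (2 * pi)) * (of_int (k $ j) * (c k * character k y0)))"
    by (simp add: mult_ac)
  ultimately show ?thesis by (simp only: infsum_cmult_right') simp
qed

lemma laplacian_summable: "(\<lambda>k. of_real (- decay k) * (c k * character k y)) summable_on UNIV"
proof (rule abs_summable_summable, rule summable_on_comparison_test)
  show "(\<lambda>k. 4 * pi\<^sup>2 * ((japanese k)\<^sup>2 * cmod (c k))) summable_on UNIV" by (rule summable_on_cmult_right[OF summable2])
  show "cmod (of_real (- decay k) * (c k * character k y)) \<le> 4 * pi\<^sup>2 * ((japanese k)\<^sup>2 * cmod (c k))" for k
    using mult_right_mono[of "knorm2 k" "(japanese k)\<^sup>2" "cmod (c k)"]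
    by (simp add: norm_mult norm_power decay_def japanese_def knorm2_nonneg abs_mult)
qed simp

text \<open>Symmetric second differences are nonnegative at a minimum and converge to second
  derivatives of the series; summing over the axes gives the Laplacian.\<close>

lemma minimum_laplacian:
  assumes min: "\<And>y. fseries c y0 \<le> fseries c y"
  shows "0 \<le> Re (\<Sum>\<^sub>\<infinity>k. of_real (- decay k) * (c k * character k y0))"
proof -
  let ?a = "\<lambda>j (k :: int^'a). 2 * pi * real_of_int (k $ j)"
  let ?f = "\<lambda>j k. of_real (- (?a j k)\<^sup>2) * (c k * character k y0)"
  have one: "0 \<le> Re (infsum (?f j) UNIV) \<and> ?f j summable_on UNIV" for j
  proof -
    let ?q = "\<lambda>s. (fseries c (y0 + axis j s) + fseries c (y0 + axis j (- s)) - 2 * fseries c y0) / s\<^sup>2"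
    have q: "complex_of_real (?q s) = (\<Sum>\<^sub>\<infinity>k. of_real ((2 * cos (?a j k * s) - 2) / s\<^sup>2) * (c k * character k y0))" for s
    proof -
      have cs: "cis (x * s) + cis (x * (- s)) = of_real (2 * cos (x * s))" for x by (simp add: complex_eq_iff)
      have "complex_of_real (fseries c (y0 + axis j s) + fseries c (y0 + axis j (- s)) - 2 * fseries c y0)
        = (\<Sum>\<^sub>\<infinity>k. c k * character k (y0 + axis j s) + c k * character k (y0 + axis j (- s)) + (- 2) * (c k * character k y0))"
        by (subst infsum_add infsum_add, intro summable_on_add series_summable, intro summable_on_cmult_right series_summable,
            subst infsum_add, intro series_summable, rule series_summable)
          (simp add: infsum_cmult_right' infsum_uminus of_real_fseries)
      also have "\<dots> = (\<Sum>\<^sub>\<infinity>k. of_real (2 * cos (?a j k * s) - 2) * (c k * character k y0))"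
      proof (rule infsum_cong)
        fix k
        have "c k * character k (y0 + axis j s) + c k * character k (y0 + axis j (- s)) + (- 2) * (c k * character k y0)
           = (cis (?a j k * s) + cis (?a j k * (- s)) - 2) * (c k * character k y0)"
          unfolding character_add character_axis by (simp only: ring_distribs) (simp add: mult_ac)
        then show "c k * character k (y0 + axis j s) + c k * character k (y0 + axis j (- s)) + (- 2) * (c k * character k y0)
           = of_real (2 * cos (?a j k * s) - 2) * (c k * character k y0)" unfolding cs by simp
      qed
      finally have "complex_of_real (?q s) = (1 / of_real (s\<^sup>2)) * (\<Sum>\<^sub>\<infinity>k. of_real (2 * cos (?a j k * s) - 2) * (c k * character k y0))" by simp
      then show ?thesis by (simp only: infsum_cmult_right'[symmetric]) (simp add: mult.assoc[symmetric])
    qed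
    have lim: "((\<lambda>s. complex_of_real (?q s)) \<longlongrightarrow> infsum (?f j) UNIV) (at 0)" "?f j summable_on UNIV"
      unfolding q
    proof (rule tendsto_infsum_dominated(1)[where M = "\<lambda>k. (2 * pi)\<^sup>2 * ((japanese k)\<^sup>2 * cmod (c k))"])
      show l: "((\<lambda>s. of_real ((2 * cos (?a j k * s) - 2) / s\<^sup>2) * (c k * character k y0)) \<longlongrightarrow> ?f j k) (at 0)" for k
        by (intro tendsto_intros cos_quotient_limit)
      show m: "(\<lambda>k. (2 * pi)\<^sup>2 * ((japanese k)\<^sup>2 * cmod (c k))) summable_on UNIV" by (rule summable_on_cmult_right[OF summable2])
      show b: "\<forall>\<^sub>F s in at 0. \<forall>k. norm (of_real ((2 * cos (?a j k * s) - 2) / s\<^sup>2) * (c k * character k y0)) \<le> (2 * pi)\<^sup>2 * ((japanese k)\<^sup>2 * cmod (c k))"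
      proof (intro always_eventually allI)
        fix s :: real and k
        have "\<bar>2 * cos (?a j k * s) - 2\<bar> / s\<^sup>2 \<le> (2 * pi)\<^sup>2 * (japanese k)\<^sup>2"
        proof (cases "s = 0")
          case False
          have "\<bar>2 * cos (?a j k * s) - 2\<bar> \<le> (?a j k * s)\<^sup>2"
            using two_minus_two_cos_le[of "?a j k * s"] cos_le_one[of "?a j k * s"] by linarith
          also have "\<dots> = (2 * pi)\<^sup>2 * \<bar>real_of_int (k $ j)\<bar>\<^sup>2 * s\<^sup>2" by (simp add: power_mult_distrib)
          also have "\<dots> \<le> (2 * pi)\<^sup>2 * (japanese k)\<^sup>2 * s\<^sup>2"
            by (intro mult_right_mono mult_left_mono power_mono abs_component_le) auto
          finally show ?thesis using False by (simp add: pos_divide_le_eq)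
        qed simp
        from mult_right_mono[OF this, of "cmod (c k)"]
        show "norm (of_real ((2 * cos (?a j k * s) - 2) / s\<^sup>2) * (c k * character k y0)) \<le> (2 * pi)\<^sup>2 * ((japanese k)\<^sup>2 * cmod (c k))"
          by (simp add: norm_mult norm_divide mult_ac del: of_real_diff of_real_divide of_real_mult)
      qed
      show "?f j summable_on UNIV" by (rule tendsto_infsum_dominated(2)[OF l m b]) simp
    qed simp
    have "(?q \<longlongrightarrow> Re (infsum (?f j) UNIV)) (at 0)" using tendsto_Re[OF lim(1)] by simp
    moreover have "0 \<le> ?q s" for s using min[of "y0 + axis j s"] min[of "y0 + axis j (- s)"] by simp
    ultimately have "0 \<le> Re (infsum (?f j) UNIV)" by (intro tendsto_lowerbound) auto
    with lim(2) show ?thesis by blast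
  qed
  have "of_real (- decay k) * (c k * character k y0) = (\<Sum>j\<in>UNIV. ?f j k)" for k
    unfolding sum_distrib_right[symmetric] decay_def knorm2_def
    by (simp add: power_mult_distrib sum_distrib_left sum_negf mult.assoc)
  then have "(\<Sum>\<^sub>\<infinity>k. of_real (- decay k) * (c k * character k y0)) = (\<Sum>j\<in>UNIV. infsum (?f j) UNIV)"
    using infsum_finite_sum[of UNIV ?f UNIV] one by simp
  then show ?thesis using one by (simp add: sum_nonneg)
qed

text \<open>The product rule for the drift done on coefficients. With
  \<open>k = (k - m) + m\<close>, the first part of the inner product with \<open>m\<close> yields
  the gradient of \<open>u\<close>, zero at the minimum, and the second yields \<open>u\<close>
  times \<open>\<Delta>W*u\<close>, whose value is \<open>D\<close>. One of the two derivatives in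
  \<open>D\<close> is charged to \<open>u\<close>, so the gradient bound on \<open>W\<close>
  suffices.\<close>

lemma minimum_drift:
  assumes min: "\<And>y. fseries c y0 \<le> fseries c y" and W: "Wdot W"
  defines "L \<equiv> 4 * pi\<^sup>2 * Wnorm W * (\<Sum>\<^sub>\<infinity>k. japanese k * cmod (c k))"
  obtains D where "\<bar>D\<bar> \<le> L"
    "Re (\<Sum>\<^sub>\<infinity>k. of_real (freq k) * twist_conv drift_kernel (coef (potential W)) c c k * character k y0) = fseries c y0 * D"
proof -
  let ?w = "\<lambda>m. fcoef W m * (c m * character m y0)"
  let ?A = "\<lambda>l. c l * character l y0"
  let ?dot = "\<lambda>k m :: int^'a. lattice_vec k \<bullet> (lattice_vec m :: real^'a)"
  let ?F = "\<lambda>k m. of_real (- 4 * pi\<^sup>2 * ?dot k m) * ?w m * ?A (k - m)"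
  let ?G = "\<lambda>m l. of_real (- 4 * pi\<^sup>2 * ?dot (l + m) m) * ?w m * ?A l"
  have P: "freq m * cmod (fcoef W m) \<le> Wnorm W" for m
    using l2_bound_cmod[OF freq_fcoef_l2_bound[OF W], of m] by (simp add: norm_mult freq_nonneg)
  have P0: "0 \<le> Wnorm W" using order_trans[OF mult_nonneg_nonneg[OF freq_nonneg norm_ge_zero] P] .
  have fj: "freq k \<le> japanese k" for k :: "int^'a"
    using real_sqrt_le_mono[of "knorm2 k" "1 + knorm2 k"] freq_nonneg[of k] by (simp add: japanese_def freq_square[symmetric])
  have G: "cmod (?G m l) \<le> (8 * pi\<^sup>2 * Wnorm W) * ((japanese m * cmod (c m)) * (japanese l * cmod (c l)))" for m l
  proof -
    have "freq (l + m) \<le> freq l + freq m"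
      unfolding freq_def by (metis norm_triangle_ineq lattice_vec_diff diff_minus_eq_add lattice_vec_uminus minus_minus)
    also have "\<dots> \<le> japanese l + japanese m" by (intro add_mono fj)
    also have "\<dots> \<le> 2 * (japanese l * japanese m)"
    proof -
      have "japanese m \<le> japanese l * japanese m" using mult_right_mono[OF japanese_ge_1[of l], of "japanese m"] by simp
      moreover have "japanese l \<le> japanese l * japanese m" using mult_left_mono[OF japanese_ge_1[of m], of "japanese l"] by simp
      ultimately show ?thesis by linarith
    qed
    finally have f: "freq (l + m) \<le> 2 * (japanese l * japanese m)" .
    have "\<bar>?dot (l + m) m\<bar> * cmod (fcoef W m) \<le> (freq (l + m) * freq m) * cmod (fcoef W m)"
      unfolding freq_def by (intro mult_right_mono Cauchy_Schwarz_ineq2) auto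
    also have "\<dots> = freq (l + m) * (freq m * cmod (fcoef W m))" by simp
    also have "\<dots> \<le> (2 * (japanese l * japanese m)) * Wnorm W"
      using f P P0 freq_nonneg[of "l + m"] freq_nonneg[of m] by (intro mult_mono) auto
    finally have "4 * pi\<^sup>2 * (\<bar>?dot (l + m) m\<bar> * cmod (fcoef W m)) * (cmod (c m) * cmod (c l))
       \<le> 4 * pi\<^sup>2 * ((2 * (japanese l * japanese m)) * Wnorm W) * (cmod (c m) * cmod (c l))"
      by (intro mult_right_mono mult_left_mono) auto
    then show ?thesis by (simp add: norm_mult norm_power abs_mult mult_ac)
  qed
  \<comment> \<open>Absolute summability over both indices, for exchanging the sums. It is proved
    after the substitution \<open>l = k - m\<close>, where the bound separates into a
    product.\<close>
  have Gs: "(\<lambda>z. norm (case z of (m, l) \<Rightarrow> ?G m l)) summable_on UNIV \<times> UNIV"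
  proof (rule summable_on_comparison_test)
    show "(\<lambda>(m, l). (8 * pi\<^sup>2 * Wnorm W) * ((japanese m * cmod (c m)) * (japanese l * cmod (c l)))) summable_on UNIV \<times> UNIV"
    proof -
      have "(\<lambda>z. norm (case z of (m, l) \<Rightarrow> (japanese m * cmod (c m)) * (japanese l * cmod (c l)))) summable_on UNIV \<times> UNIV"
        unfolding Infinite_Sum.abs_summable_on_Sigma_iff
        by (auto simp: abs_mult infsum_cmult_right' intro!: summable_on_cmult_right summable_on_cmult_left summable1)
      then have "(\<lambda>(m, l). (japanese m * cmod (c m)) * (japanese l * cmod (c l))) summable_on UNIV \<times> UNIV"
        by (rule abs_summable_summable)
      from summable_on_cmult_right[OF this, of "8 * pi\<^sup>2 * Wnorm W"] show ?thesis by (simp add: case_prod_unfold)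
    qed
    show "norm (case z of (m, l) \<Rightarrow> ?G m l) \<le> (case z of (m, l) \<Rightarrow> (8 * pi\<^sup>2 * Wnorm W) * ((japanese m * cmod (c m)) * (japanese l * cmod (c l))))" for z
      using G by (cases z) simp
  qed auto
  have Fs: "(\<lambda>(k, m). ?F k m) summable_on UNIV \<times> UNIV"
  proof -
    have bij: "bij_betw (\<lambda>(k, m :: int^'a). (m, k - m)) (UNIV \<times> UNIV) (UNIV \<times> UNIV)"
      by (rule bij_betwI[of _ _ _ "\<lambda>(m, l). (l + m, m)"]) auto
    have "(\<lambda>x. (\<lambda>(m, l). ?G m l) ((\<lambda>(k, m). (m, k - m)) x)) summable_on UNIV \<times> UNIV"
      using abs_summable_summable[OF Gs] unfolding summable_on_reindex_bij_betw[OF bij] .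
    then show ?thesis by (simp add: case_prod_unfold)
  qed
  let ?D = "\<Sum>\<^sub>\<infinity>m. of_real (- 4 * pi\<^sup>2 * knorm2 m) * ?w m"
  have "of_real (freq k) * twist_conv drift_kernel (coef (potential W)) c c k * character k y0 = (\<Sum>\<^sub>\<infinity>m. ?F k m)" for k
  proof -
    have "of_real (freq k) * twist_conv drift_kernel (coef (potential W)) c c k * character k y0
       = (of_real (freq k) * character k y0) * twist_conv drift_kernel (coef (potential W)) c c k" by simp
    also have "\<dots> = (\<Sum>\<^sub>\<infinity>m. (of_real (freq k) * character k y0) * (of_real (drift_kernel k m) * (coef (potential W) m * c m) * c (k - m)))"
      unfolding twist_conv_def by (simp only: infsum_cmult_right')
    also have "\<dots> = (\<Sum>\<^sub>\<infinity>m. ?F k m)"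
    proof (rule infsum_cong)
      fix m
      have "freq k * drift_kernel k m * freq m = - 4 * pi\<^sup>2 * ?dot k m"
        by (cases "freq k = 0 \<or> freq m = 0") (auto simp: freq_def drift_kernel_def)
      then have e: "complex_of_real (freq k) * (of_real (drift_kernel k m) * of_real (freq m)) = of_real (- 4 * pi\<^sup>2 * ?dot k m)"
        by (metis of_real_mult mult.assoc)
      have ch: "character k y0 = character m y0 * character (k - m) y0" by (simp add: character_add_index[symmetric])
      have "(of_real (freq k) * character k y0) * (of_real (drift_kernel k m) * (coef (potential W) m * c m) * c (k - m))
        = (complex_of_real (freq k) * (of_real (drift_kernel k m) * of_real (freq m))) * ?w m * ?A (k - m)"
        unfolding coef_potential[OF W] ch by (simp only: mult_ac)
      then show "(of_real (freq k) * character k y0) * (of_real (drift_kernel k m) * (coef (potential W) m * c m) * c (k - m)) = ?F k m"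
        unfolding e .
    qed
    finally show ?thesis .
  qed
  then have "(\<Sum>\<^sub>\<infinity>k. of_real (freq k) * twist_conv drift_kernel (coef (potential W)) c c k * character k y0) = (\<Sum>\<^sub>\<infinity>k. \<Sum>\<^sub>\<infinity>m. ?F k m)"
    by simp
  also have "\<dots> = (\<Sum>\<^sub>\<infinity>m. \<Sum>\<^sub>\<infinity>k. ?F k m)" by (rule infsum_swap_banach[OF Fs])
  also have "\<dots> = (\<Sum>\<^sub>\<infinity>m. of_real (- 4 * pi\<^sup>2 * knorm2 m) * ?w m * of_real (fseries c y0))"
  proof (rule infsum_cong)
    fix m
    have dot: "of_real (?dot l m) * ?A l = (\<Sum>j\<in>UNIV. of_int (m $ j) * (of_int (l $ j) * ?A l))" for l
      unfolding inner_vec_def by (simp add: lattice_vec_def sum_distrib_left mult_ac)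
    have grad: "(\<Sum>\<^sub>\<infinity>l. of_real (?dot l m) * ?A l) = 0"
    proof -
      have "(\<Sum>\<^sub>\<infinity>l. of_real (?dot l m) * ?A l) = (\<Sum>j\<in>UNIV. \<Sum>\<^sub>\<infinity>l. of_int (m $ j) * (of_int (l $ j) * ?A l))"
        using infsum_finite_sum[of UNIV "\<lambda>j l. of_int (m $ j) * (of_int (l $ j) * ?A l)" UNIV]
          summable_on_cmult_right[OF gradient_summable] dot by simp
      then show ?thesis by (simp add: infsum_cmult_right' minimum_gradient[OF min])
    qed
    have dots: "(\<lambda>l. of_real (?dot l m) * ?A l) summable_on UNIV"
    proof -
      have "(\<lambda>l. \<Sum>j\<in>UNIV. of_int (m $ j) * (of_int (l $ j) * ?A l)) summable_on UNIV"
        by (rule summable_on_finite_sum[OF finite]) (intro summable_on_cmult_right gradient_summable)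
      then show ?thesis unfolding dot .
    qed
    have "(\<Sum>\<^sub>\<infinity>k. ?F k m) = (\<Sum>\<^sub>\<infinity>l. ?F (l + m) m)"
      by (rule infsum_reindex_bij_betw[symmetric]) (rule bij_betwI[of _ _ _ "\<lambda>k. k - m"], auto)
    also have "\<dots> = (\<Sum>\<^sub>\<infinity>l. (of_real (- 4 * pi\<^sup>2) * ?w m) * (of_real (?dot l m) * ?A l + of_real (knorm2 m) * ?A l))"
    proof (rule infsum_cong)
      fix l
      have "?dot (l + m) m = ?dot l m + knorm2 m"
        using freq_square[of m] unfolding freq_def power2_norm_eq_inner
        by (metis (no_types, lifting) add_uminus_conv_diff diff_minus_eq_add inner_add_left lattice_vec_diff lattice_vec_uminus minus_minus)
      then show "?F (l + m) m = (of_real (- 4 * pi\<^sup>2) * ?w m) * (of_real (?dot l m) * ?A l + of_real (knorm2 m) * ?A l)"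
        by (simp add: algebra_simps)
    qed
    also have "\<dots> = (of_real (- 4 * pi\<^sup>2) * ?w m) * (0 + of_real (knorm2 m) * of_real (fseries c y0))"
      by (simp only: infsum_cmult_right' infsum_add[OF dots summable_on_cmult_right[OF series_summable]] grad of_real_fseries)
    finally show "(\<Sum>\<^sub>\<infinity>k. ?F k m) = of_real (- 4 * pi\<^sup>2 * knorm2 m) * ?w m * of_real (fseries c y0)" by simp
  qed
  also have "\<dots> = ?D * of_real (fseries c y0)" by (rule infsum_cmult_left')
  finally have eq: "(\<Sum>\<^sub>\<infinity>k. of_real (freq k) * twist_conv drift_kernel (coef (potential W)) c c k * character k y0)
     = ?D * of_real (fseries c y0)" .
  have Ds: "cmod (of_real (- 4 * pi\<^sup>2 * knorm2 m) * ?w m) \<le> 4 * pi\<^sup>2 * Wnorm W * (japanese m * cmod (c m))" for m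
  proof -
    have "knorm2 m * cmod (fcoef W m) = freq m * (freq m * cmod (fcoef W m))"
      by (simp add: freq_square[symmetric] power2_eq_square)
    also have "\<dots> \<le> japanese m * Wnorm W" using fj[of m] P[of m] freq_nonneg[of m] by (intro mult_mono) auto
    finally have "4 * pi\<^sup>2 * (knorm2 m * cmod (fcoef W m)) * cmod (c m) \<le> 4 * pi\<^sup>2 * (japanese m * Wnorm W) * cmod (c m)"
      by (intro mult_right_mono mult_left_mono) auto
    then show ?thesis by (simp add: norm_mult norm_power abs_mult knorm2_nonneg mult_ac)
  qed
  have "\<bar>Re ?D\<bar> \<le> cmod ?D" by (rule abs_Re_le_cmod)
  also have "\<dots> \<le> (\<Sum>\<^sub>\<infinity>m. cmod (of_real (- 4 * pi\<^sup>2 * knorm2 m) * ?w m))"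
    by (rule norm_infsum_bound, rule summable_on_comparison_test[OF summable_on_cmult_right[OF summable1]], rule Ds) simp
  also have "\<dots> \<le> (\<Sum>\<^sub>\<infinity>m. 4 * pi\<^sup>2 * Wnorm W * (japanese m * cmod (c m)))"
    by (rule infsum_mono[OF _ summable_on_cmult_right[OF summable1] Ds], rule summable_on_comparison_test[OF summable_on_cmult_right[OF summable1]], rule Ds) simp
  also have "\<dots> = L" unfolding L_def by (rule infsum_cmult_right')
  finally show ?thesis using eq by (intro that[of "Re ?D"]) simp_all
qed

end

section \<open>Differentiability in time and the minimum principle\<close>

context torus_problem
begin

definition rate :: "(int^'d) traj_data \<Rightarrow> real \<Rightarrow> int^'d \<Rightarrow> complex" where
  "rate x t k = (- decay k) *\<^sub>R ucoef x t k + freq k *\<^sub>R (coef (src x t) k / of_real (japanese k ^ b))"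

lemma ucoef_deriv:
  assumes "t \<in> {0..T}"
  shows "((\<lambda>t. ucoef x t k) has_vector_derivative rate x t k) (at t within {0..T})"
proof -
  have "((\<lambda>t. traj_coef x t k / of_real (japanese k ^ b)) has_vector_derivative
     ((- decay k) *\<^sub>R traj_coef x t k + freq k *\<^sub>R coef (src x t) k) / of_real (japanese k ^ b)) (at t within {0..T})"
    by (rule has_vector_derivative_divide[OF traj_coef_deriv[OF assms]])
  then show ?thesis
    by (simp add: ucoef_eq[abs_def] rate_def add_divide_distrib diff_divide_distrib scaleR_conv_of_real del: of_real_power)
qed

lemma ucoef_continuous: "continuous_on A (\<lambda>t. ucoef x t k)"
proof -
  have "continuous_on UNIV (\<lambda>t. ucoef x t k)"
    unfolding ucoef_eq by (intro continuous_intros traj_coef_continuous) (simp del: of_real_power)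
  then show ?thesis by (rule continuous_on_subset) simp
qed

lemma freq_le_japanese: "freq k \<le> japanese k" for k :: "int^'d"
  using real_sqrt_le_mono[of "knorm2 k" "1 + knorm2 k"] freq_nonneg[of k]
  by (simp add: japanese_def freq_square[symmetric])

text \<open>Two derivatives on the trajectory, or one on the source, still leave a weight of order
  \<open>b - 2\<close>.\<close>

lemma cmod_rate_le:
  "cmod (rate x t k) \<le> 4 * pi\<^sup>2 * (cmod (coef (traj x t) k) / japanese k ^ (b - 2)) + cmod (coef (src x t) k) / japanese k ^ (b - 2)"
proof -
  have "cmod (rate x t k) \<le> cmod ((- decay k) *\<^sub>R ucoef x t k) + cmod (freq k *\<^sub>R (coef (src x t) k / of_real (japanese k ^ b)))"
    unfolding rate_def by (rule norm_triangle_ineq)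
  moreover have "cmod ((- decay k) *\<^sub>R ucoef x t k) \<le> 4 * pi\<^sup>2 * ((japanese k)\<^sup>2 * cmod (ucoef x t k))"
    using mult_right_mono[of "knorm2 k" "(japanese k)\<^sup>2" "cmod (ucoef x t k)"]
    by (simp add: decay_def japanese_def knorm2_nonneg abs_mult mult.assoc)
  moreover have "cmod (freq k *\<^sub>R (coef (src x t) k / of_real (japanese k ^ b))) \<le> cmod (coef (src x t) k) / japanese k ^ (b - 2)"
  proof -
    have "freq k \<le> (japanese k)\<^sup>2"
      using freq_le_japanese[of k] self_le_power[OF japanese_ge_1[of k], of 2] by simp
    then have "freq k * (cmod (coef (src x t) k) / japanese k ^ b) \<le> (japanese k)\<^sup>2 * (cmod (coef (src x t) k) / japanese k ^ b)"
      by (rule mult_right_mono) simp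
    then show ?thesis by (simp add: freq_nonneg norm_divide norm_mult norm_power japanese_split)
  qed
  ultimately show ?thesis unfolding cmod_ucoef by linarith
qed

text \<open>The weights are fixed and the norms of trajectory and source are bounded by
  \<open>x\<close>, so one finite set serves all times.\<close>

lemma rate_tail:
  assumes "e > 0"
  shows "\<exists>F. finite F \<and> (\<forall>G t. finite G \<longrightarrow> G \<inter> F = {} \<longrightarrow>
    (\<Sum>k\<in>G. cmod (rate x t k)) \<le> e \<and> (\<Sum>k\<in>G. cmod (ucoef x t k)) \<le> e)"
proof -
  define C where "C = 4 * pi\<^sup>2 * (sqrt (1 + T) * norm x) + sqrt (1 + T) * norm x + norm x + 1"
  have sn: "0 \<le> sqrt (1 + T) * norm x" using T_gt_0 by simp
  have C: "C > 0" unfolding C_def using T_gt_0 by (intro add_nonneg_pos add_nonneg_nonneg) auto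
  have "e / C > 0" using assms C by simp
  have le: "e / C * c \<le> e" if "c \<le> C" for c
    using mult_left_mono[OF that, of "e / C"] assms C by simp
  show ?thesis
  proof (rule weighted_tail[OF \<open>e / C > 0\<close>], intro exI conjI allI impI)
    fix F G :: "(int^'d) set" and t
    assume F: "finite F" "\<And>G f. finite G \<Longrightarrow> G \<inter> F = {} \<Longrightarrow> (\<Sum>k\<in>G. cmod (coef f k) / japanese k ^ (b - 2)) \<le> e / C * norm f"
    show "finite F" by fact
    assume G: "finite G" "G \<inter> F = {}"
    have "(\<Sum>k\<in>G. cmod (rate x t k)) \<le> (\<Sum>k\<in>G. 4 * pi\<^sup>2 * (cmod (coef (traj x t) k) / japanese k ^ (b - 2)) + cmod (coef (src x t) k) / japanese k ^ (b - 2))"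
      by (intro sum_mono cmod_rate_le)
    also have "\<dots> = 4 * pi\<^sup>2 * (\<Sum>k\<in>G. cmod (coef (traj x t) k) / japanese k ^ (b - 2)) + (\<Sum>k\<in>G. cmod (coef (src x t) k) / japanese k ^ (b - 2))"
      by (simp only: sum.distrib sum_distrib_left)
    also have "\<dots> \<le> 4 * pi\<^sup>2 * (e / C * norm (traj x t)) + e / C * norm (src x t)"
      using F(2)[OF G] by (intro add_mono mult_left_mono) auto
    also have "\<dots> = e / C * (4 * pi\<^sup>2 * norm (traj x t) + norm (src x t))" by (simp only: distrib_left mult_ac)
    also have "\<dots> \<le> e"
    proof (rule le)
      have "4 * pi\<^sup>2 * norm (traj x t) + norm (src x t) \<le> 4 * pi\<^sup>2 * (sqrt (1 + T) * norm x) + norm x"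
        by (intro add_mono mult_left_mono norm_traj_le norm_src_le) auto
      then show "4 * pi\<^sup>2 * norm (traj x t) + norm (src x t) \<le> C"
        unfolding C_def using sn by linarith
    qed
    finally show "(\<Sum>k\<in>G. cmod (rate x t k)) \<le> e" .
    have "(\<Sum>k\<in>G. cmod (ucoef x t k)) \<le> (\<Sum>k\<in>G. cmod (coef (traj x t) k) / japanese k ^ (b - 2))"
    proof (rule sum_mono)
      fix k
      have "1 * cmod (ucoef x t k) \<le> (japanese k)\<^sup>2 * cmod (ucoef x t k)"
        by (intro mult_right_mono japanese_power_ge_1) auto
      then show "cmod (ucoef x t k) \<le> cmod (coef (traj x t) k) / japanese k ^ (b - 2)" unfolding cmod_ucoef by simp
    qed
    also have "\<dots> \<le> e / C * norm (traj x t)" by (rule F(2)[OF G])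
    also have "\<dots> \<le> e"
    proof (rule le)
      show "norm (traj x t) \<le> C"
        using norm_traj_le[of x t] T_gt_0 unfolding C_def
        by (intro order_trans[OF norm_traj_le]) (simp add: add_increasing)
    qed
    finally show "(\<Sum>k\<in>G. cmod (ucoef x t k)) \<le> e" .
  qed
qed

lemma rate_summable: "(\<lambda>k. rate x t k * character k y) summable_on UNIV"
proof (rule abs_summable_summable, rule summable_on_comparison_test)
  show "(\<lambda>k. 4 * pi\<^sup>2 * (cmod (coef (traj x t) k) / japanese k ^ (b - 2)) + cmod (coef (src x t) k) / japanese k ^ (b - 2)) summable_on UNIV"
    by (intro summable_on_add summable_on_cmult_right weighted_coef_summable)
  show "cmod (rate x t k * character k y) \<le> 4 * pi\<^sup>2 * (cmod (coef (traj x t) k) / japanese k ^ (b - 2)) + cmod (coef (src x t) k) / japanese k ^ (b - 2)" for k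
    using cmod_rate_le[of x t k] by (simp add: norm_mult)
qed simp

lemma state_continuous: "continuous_on A (\<lambda>z. state x (fst z) (snd z))"
proof -
  have "continuous_on A (\<lambda>z. \<Sum>\<^sub>\<infinity>k. ucoef x (fst z) k * character k (snd z))"
  proof (rule continuous_on_infsum_uniform)
    show "continuous_on A (\<lambda>z. ucoef x (fst z) k * character k (snd z))" for k
      by (intro continuous_intros continuous_on_compose2[OF ucoef_continuous[of UNIV]]
          continuous_on_compose2[OF character_continuous[of UNIV]]) auto
    fix e :: real assume e: "e > 0"
    obtain F :: "(int^'d) set" where F: "finite F" and F': "\<forall>G t. finite G \<longrightarrow> G \<inter> F = {} \<longrightarrow>
      (\<Sum>k\<in>G. cmod (rate x t k)) \<le> e \<and> (\<Sum>k\<in>G. cmod (ucoef x t k)) \<le> e"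
      using rate_tail[OF e, of x] by (elim exE conjE)
    have F2: "(\<Sum>k\<in>G. cmod (ucoef x t k)) \<le> e" if "finite G" "G \<inter> F = {}" for G t using F' that by simp
    have "norm (\<Sum>k\<in>G. ucoef x (fst z) k * character k (snd z)) \<le> e" if "finite G" "G \<inter> F = {}" for G z
      by (rule order_trans[OF _ F2[OF that, of "fst z"]]) (auto intro!: sum_norm_le simp: norm_mult)
    with F show "\<exists>F. finite F \<and> (\<forall>z\<in>A. \<forall>G. finite G \<and> G \<inter> F = {} \<longrightarrow> norm (\<Sum>k\<in>G. ucoef x (fst z) k * character k (snd z)) \<le> e)"
      by blast
  qed (rule fourier_coeffs.series_summable[OF fourier_coeffs_ucoef])
  then show ?thesis unfolding state_def fseries_def by (intro continuous_intros)
qed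

text \<open>Quotients are taken from the left, since the minimum may be attained at the final time,
  where only earlier times are available.\<close>

lemma difference_quotient_limit:
  assumes t0: "0 < t0" "t0 \<le> T"
  shows "((\<lambda>h. (ucoef x t0 k - ucoef x (t0 - h) k) / of_real h) \<longlongrightarrow> rate x t0 k) (at_right 0)"
proof -
  let ?D = "rate x t0 k" let ?u = "\<lambda>t. ucoef x t k"
  have "((\<lambda>t. (1 / norm (t - t0)) *\<^sub>R (?u t - (?u t0 + (t - t0) *\<^sub>R ?D))) \<longlongrightarrow> 0) (at t0 within {0..T})"
    using ucoef_deriv[of t0 x k] t0 by (simp add: has_vector_derivative_def has_derivative_within)
  moreover have "filterlim (\<lambda>h. t0 - h) (at t0 within {0..T}) (at_right 0)"
  proof -
    have "((\<lambda>h. t0 - h) \<longlongrightarrow> t0 - 0) (at_right 0)" by (intro tendsto_intros)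
    moreover have "\<forall>\<^sub>F h in at_right 0. t0 - h \<in> {0..T} \<and> t0 - h \<noteq> t0"
      using eventually_at_right_less[of 0] eventually_at_right_field[of "\<lambda>h. h < t0" 0] t0
      by (auto elim!: eventually_elim2 intro: exI[of _ t0])
    ultimately show ?thesis unfolding filterlim_at by simp
  qed
  ultimately have "((\<lambda>h. (1 / norm ((t0 - h) - t0)) *\<^sub>R (?u (t0 - h) - (?u t0 + ((t0 - h) - t0) *\<^sub>R ?D))) \<longlongrightarrow> 0) (at_right 0)"
    by (rule filterlim_compose)
  then have "((\<lambda>h. ?D - (1 / norm ((t0 - h) - t0)) *\<^sub>R (?u (t0 - h) - (?u t0 + ((t0 - h) - t0) *\<^sub>R ?D))) \<longlongrightarrow> ?D - 0) (at_right 0)"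
    by (intro tendsto_intros)
  moreover have "\<forall>\<^sub>F h in at_right 0. ?D - (1 / norm ((t0 - h) - t0)) *\<^sub>R (?u (t0 - h) - (?u t0 + ((t0 - h) - t0) *\<^sub>R ?D))
       = (?u t0 - ?u (t0 - h)) / of_real h"
    using eventually_at_right_less[of "0::real"]
    by eventually_elim (simp add: scaleR_conv_of_real field_simps)
  ultimately show ?thesis unfolding diff_0_right by (rule Lim_transform_eventually)
qed

text \<open>Limit and sum are exchanged through uniform tails: a finite tail of the difference
  quotient is a time average of tails of \<open>rate\<close>, which \<open>rate_tail\<close> makes
  small.\<close>

lemma state_time_derivative:
  assumes t0: "0 < t0" "t0 \<le> T"
  shows "((\<lambda>h. (state x t0 y - state x (t0 - h) y) / h) \<longlongrightarrow> Re (\<Sum>\<^sub>\<infinity>k. rate x t0 k * character k y)) (at_right 0)"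
proof -
  let ?q = "\<lambda>h k. (ucoef x t0 k - ucoef x (t0 - h) k) / of_real h * character k y"
  note ss = fourier_coeffs.series_summable[OF fourier_coeffs_ucoef]
  have q: "complex_of_real ((state x t0 y - state x (t0 - h) y) / h) = infsum (?q h) UNIV \<and> ?q h summable_on UNIV" for h
  proof -
    have e: "?q h k = (1 / of_real h) * (ucoef x t0 k * character k y + - (ucoef x (t0 - h) k * character k y))" for k
      by (simp add: algebra_simps diff_divide_distrib)
    have s: "(\<lambda>k. ucoef x t0 k * character k y + - (ucoef x (t0 - h) k * character k y)) summable_on UNIV"
      by (intro summable_on_add summable_on_uminus[THEN iffD2] ss)
    have "infsum (?q h) UNIV = (1 / of_real h) * ((\<Sum>\<^sub>\<infinity>k. ucoef x t0 k * character k y) + - (\<Sum>\<^sub>\<infinity>k. ucoef x (t0 - h) k * character k y))"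
      unfolding e infsum_cmult_right' infsum_add[OF ss summable_on_uminus[THEN iffD2, OF ss]] infsum_uminus ..
    then have "infsum (?q h) UNIV = complex_of_real ((state x t0 y - state x (t0 - h) y) / h)"
      unfolding state_def by (simp add: fourier_coeffs.of_real_fseries[OF fourier_coeffs_ucoef, symmetric])
    then show ?thesis using summable_on_cmult_right[OF s, of "1 / of_real h"] unfolding e by simp
  qed
  have "((\<lambda>h. infsum (?q h) UNIV) \<longlongrightarrow> (\<Sum>\<^sub>\<infinity>k. rate x t0 k * character k y)) (at_right 0)"
  proof (rule tendsto_infsum_uniform)
    show "((\<lambda>h. ?q h k) \<longlongrightarrow> rate x t0 k * character k y) (at_right 0)" for k
      by (intro tendsto_intros difference_quotient_limit t0)
    show "\<forall>\<^sub>F h in at_right 0. ?q h summable_on UNIV" using q by (intro always_eventually) auto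
    show "(\<lambda>k. rate x t0 k * character k y) summable_on UNIV" by (rule rate_summable)
    fix e :: real assume e: "e > 0"
    obtain F :: "(int^'d) set" where F: "finite F" and F': "\<forall>G t. finite G \<longrightarrow> G \<inter> F = {} \<longrightarrow>
      (\<Sum>k\<in>G. cmod (rate x t k)) \<le> e \<and> (\<Sum>k\<in>G. cmod (ucoef x t k)) \<le> e"
      using rate_tail[OF e, of x] by (elim exE conjE)
    have F2: "(\<Sum>k\<in>G. cmod (rate x t k)) \<le> e" if "finite G" "G \<inter> F = {}" for G t using F' that by simp
    have "norm (sum (?q h) G) \<le> e" if h: "0 < h" "h < t0" and G: "finite G" "G \<inter> F = {}" for h G
    proof -
      let ?Z = "\<lambda>t. \<Sum>k\<in>G. ucoef x t k * character k y" and ?Z' = "\<lambda>t. \<Sum>k\<in>G. rate x t k * character k y"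
      have "(?Z' has_integral (?Z t0 - ?Z (t0 - h))) {t0 - h..t0}"
      proof (rule fundamental_theorem_of_calculus)
        fix s assume s: "s \<in> {t0 - h..t0}"
        then have "s \<in> {0..T}" "{t0 - h..t0} \<subseteq> {0..T}" using h t0 by auto
        then have "((\<lambda>t. ucoef x t k) has_vector_derivative rate x s k) (at s within {t0 - h..t0})" for k
          using ucoef_deriv has_vector_derivative_within_subset by blast
        then show "(?Z has_vector_derivative ?Z' s) (at s within {t0 - h..t0})"
          by (intro has_vector_derivative_sum has_vector_derivative_mult_left)
      qed (use h in simp)
      then have "norm (?Z t0 - ?Z (t0 - h)) \<le> e * measure lborel (cbox (t0 - h) t0)"
      proof (intro has_integral_bound)
        fix s assume "s \<in> cbox (t0 - h) t0"
        show "norm (?Z' s) \<le> e"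
          by (rule order_trans[OF _ F2[OF G, of s]]) (auto intro!: sum_norm_le simp: norm_mult)
      qed (use e in auto)
      then have "norm (?Z t0 - ?Z (t0 - h)) \<le> e * h" using h by simp
      moreover have "sum (?q h) G = (?Z t0 - ?Z (t0 - h)) / of_real h"
        by (simp add: sum_subtractf[symmetric] sum_divide_distrib algebra_simps)
      ultimately show ?thesis using h by (simp add: norm_divide pos_divide_le_eq)
    qed
    moreover have "\<forall>\<^sub>F h in at_right 0. 0 < h \<and> h < t0"
      using eventually_at_right_real[OF t0(1)] by (auto elim: eventually_mono)
    ultimately have "\<forall>\<^sub>F h in at_right 0. \<forall>G. finite G \<and> G \<inter> F = {} \<longrightarrow> norm (sum (?q h) G) \<le> e"
      by (auto elim!: eventually_mono)
    with F show "\<exists>F. finite F \<and> (\<forall>\<^sub>F h in at_right 0. \<forall>G. finite G \<and> G \<inter> F = {} \<longrightarrow> norm (sum (?q h) G) \<le> e)" by blast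
  qed
  then have "((\<lambda>h. complex_of_real ((state x t0 y - state x (t0 - h) y) / h)) \<longlongrightarrow> (\<Sum>\<^sub>\<infinity>k. rate x t0 k * character k y)) (at_right 0)"
    using q by simp
  from tendsto_Re[OF this] show ?thesis by simp
qed

lemma fourier_C2_ucoef: "fourier_C2 (ucoef x t)"
  using fourier_coeffs_ucoef by (simp add: fourier_C2_def fourier_C2_axioms_def ucoef_summable2)

text \<open>At a negative space-time minimum of \<open>e\<^bsup>-\<lambda>t\<^esup> u\<close> the gradient vanishes, the Laplacian is nonnegative,
  and the zeroth-order term \<open>u \<Delta>W*u\<close> is beaten by \<open>\<lambda>\<close>.\<close>
lemma state_nonneg:
  assumes W: "Wdot W" and init: "\<And>y. 0 \<le> state x 0 y" and \<tau>: "\<tau> \<in> {0..T}"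
    and src: "\<And>t. t \<in> {0..\<tau>} \<Longrightarrow> src x t = tconv (kernelw b) (potential W) (traj x t) (traj x t)"
    and t: "t \<in> {0..\<tau>}"
  shows "0 \<le> state x t y"
proof (rule ccontr)
  assume neg: "\<not> 0 \<le> state x t y"
  define S where "S = (\<Sum>\<^sub>\<infinity>k :: int^'d. 1 / (japanese k ^ (b - 2))\<^sup>2)"
  \<comment> \<open>Exceeds the bound of \<open>minimum_drift\<close> at every time, because
    \<open>sumle\<close> is uniform in time; the added 1 makes it strict.\<close>
  define l where "l = 4 * pi\<^sup>2 * Wnorm W * ((norm x * sqrt (1 + T))\<^sup>2 + S) + 1"
  have P0: "0 \<le> Wnorm W" using order_trans[OF norm_ge_zero norm_potential_le[OF W]] .
  have sumle: "(\<Sum>\<^sub>\<infinity>k. japanese k * cmod (ucoef x s k)) \<le> (norm x * sqrt (1 + T))\<^sup>2 + S" for s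
  proof -
    have am: "a * c \<le> a\<^sup>2 + c\<^sup>2" if "0 \<le> a" "0 \<le> c" for a c :: real
      using sum_squares_bound[of a c] mult_nonneg_nonneg[OF that] by linarith
    have S0: "(\<lambda>k :: int^'d. 1 / (japanese k ^ (b - 2))\<^sup>2) summable_on UNIV"
      using weight_summable by (simp add: power_divide)
    have c2: "(\<lambda>k. (cmod (coef (traj x s) k))\<^sup>2) summable_on UNIV"
      by (rule nonneg_bdd_above_summable_on) (auto intro!: bdd_aboveI2[of _ _ "(norm (traj x s))\<^sup>2"] sum_coef_le)
    have "(\<Sum>\<^sub>\<infinity>k. japanese k * cmod (ucoef x s k)) \<le> (\<Sum>\<^sub>\<infinity>k. (cmod (coef (traj x s) k))\<^sup>2 + 1 / (japanese k ^ (b - 2))\<^sup>2)"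
    proof (rule infsum_mono[OF ucoef_summable1 summable_on_add[OF c2 S0]])
      fix k
      have "japanese k * cmod (ucoef x s k) \<le> (japanese k)\<^sup>2 * cmod (ucoef x s k)"
        using mult_right_mono[OF japanese_ge_1[of k], of "japanese k * cmod (ucoef x s k)"] by (simp add: power2_eq_square mult.assoc)
      also have "\<dots> = cmod (coef (traj x s) k) * (1 / japanese k ^ (b - 2))" by (simp add: cmod_ucoef)
      also have "\<dots> \<le> (cmod (coef (traj x s) k))\<^sup>2 + (1 / japanese k ^ (b - 2))\<^sup>2"
        using less_imp_le[OF japanese_pos[of k "b - 2"]] by (intro am) auto
      finally show "japanese k * cmod (ucoef x s k) \<le> (cmod (coef (traj x s) k))\<^sup>2 + 1 / (japanese k ^ (b - 2))\<^sup>2"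
        by (simp add: power_divide)
    qed
    also have "\<dots> = (\<Sum>\<^sub>\<infinity>k. (cmod (coef (traj x s) k))\<^sup>2) + S" unfolding S_def by (rule infsum_add[OF c2 S0])
    also have "(\<Sum>\<^sub>\<infinity>k. (cmod (coef (traj x s) k))\<^sup>2) \<le> (norm (traj x s))\<^sup>2"
      by (rule infsum_le_finite_sums[OF c2]) (rule sum_coef_le)
    also have "(norm (traj x s))\<^sup>2 \<le> (norm x * sqrt (1 + T))\<^sup>2"
      using norm_traj_le[of x s] by (intro power_mono) (auto simp: mult.commute)
    finally show ?thesis by simp
  qed
  let ?w = "\<lambda>z. exp (- l * fst z) * state x (fst z) (snd z)"
  let ?K = "{0..\<tau>} \<times> (cube :: (real^'d) set)"
  have "compact ?K" by (intro compact_Times compact_cube) auto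
  moreover have "?K \<noteq> {}" using t by (auto simp: cube_def intro!: exI[of _ 0])
  moreover have "continuous_on ?K ?w" by (intro continuous_intros state_continuous)
  ultimately obtain z where z: "z \<in> ?K" "\<And>z'. z' \<in> ?K \<Longrightarrow> ?w z \<le> ?w z'"
    using continuous_attains_inf[of ?K ?w] by blast
  obtain t0 y0 where z_eq: "z = (t0, y0)" by (cases z)
  have t0: "t0 \<in> {0..\<tau>}" using z(1) z_eq by auto
  \<comment> \<open>Periodicity extends minimality from the cell to all of space, so the conditions
    at a minimum apply even if \<open>y0\<close> lies on the boundary of the cell.\<close>
  have minw: "exp (- l * t0) * state x t0 y0 \<le> exp (- l * s) * state x s y'" if "s \<in> {0..\<tau>}" for s y'
  proof -
    obtain k where "y' + lattice_vec k \<in> unit_box" using unit_box_tiling[of y'] by blast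
    then have "(s, y' + lattice_vec k) \<in> ?K" using that by (auto simp: unit_box_def cube_def less_imp_le)
    from z(2)[OF this] show ?thesis
      by (simp add: z_eq state_def fourier_coeffs.fseries_periodic[OF fourier_coeffs_ucoef])
  qed
  have "exp (- l * t0) * state x t0 y0 < 0"
    using minw[OF t, of y] neg by (intro le_less_trans[OF minw[OF t, of y]] mult_pos_neg) auto
  then have neg0: "state x t0 y0 < 0" by (simp add: mult_less_0_iff)
  have "t0 \<noteq> 0" using init[of y0] neg0 by auto
  then have t0': "0 < t0" "t0 \<le> T" using t0 \<tau> by auto
  have min: "fseries (ucoef x t0) y0 \<le> fseries (ucoef x t0) y'" for y'
    using minw[OF t0, of y'] by (simp add: state_def)
  interpret C: fourier_C2 "ucoef x t0" by (rule fourier_C2_ucoef)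
  obtain D where D: "\<bar>D\<bar> \<le> 4 * pi\<^sup>2 * Wnorm W * (\<Sum>\<^sub>\<infinity>k. japanese k * cmod (ucoef x t0 k))"
    "Re (\<Sum>\<^sub>\<infinity>k. of_real (freq k) * twist_conv drift_kernel (coef (potential W)) (ucoef x t0) (ucoef x t0) k * character k y0) = fseries (ucoef x t0) y0 * D"
    using C.minimum_drift[OF min W] by blast
  let ?rate = "\<Sum>\<^sub>\<infinity>k. rate x t0 k * character k y0"
  have rate: "rate x t0 k * character k y0 = of_real (- decay k) * (ucoef x t0 k * character k y0)
     + of_real (freq k) * twist_conv drift_kernel (coef (potential W)) (ucoef x t0) (ucoef x t0) k * character k y0" for k
    unfolding rate_def src[OF t0] twist_conv_kernelw ucoef_def by (simp add: scaleR_conv_of_real algebra_simps)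
  have ds: "(\<lambda>k. of_real (freq k) * twist_conv drift_kernel (coef (potential W)) (ucoef x t0) (ucoef x t0) k * character k y0) summable_on UNIV"
    using summable_on_add[OF rate_summable[of x t0 y0] summable_on_uminus[THEN iffD2, OF C.laplacian_summable[of y0]]]
    unfolding rate by simp
  have "Re ?rate = Re (\<Sum>\<^sub>\<infinity>k. of_real (- decay k) * (ucoef x t0 k * character k y0)) + fseries (ucoef x t0) y0 * D"
    unfolding rate infsum_add[OF C.laplacian_summable ds] by (simp only: plus_complex.simps D(2))
  then have ge: "state x t0 y0 * D \<le> Re ?rate" using C.minimum_laplacian[OF min] by (simp add: state_def)
  \<comment> \<open>Minimality against the earlier times \<open>t0 - h\<close> bounds the left
    difference quotient from above. Together with the lower bound \<open>state x t0 y0 * D\<close>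
    from the equation this contradicts \<open>D < l\<close>.\<close>
  have "Re ?rate \<le> l * state x t0 y0"
  proof (rule tendsto_le[OF _ _ state_time_derivative[OF t0']])
    have "((\<lambda>h. exp (- l * h)) has_real_derivative - l) (at 0)" by (auto intro!: derivative_eq_intros)
    then have "((\<lambda>h. (exp (- l * h) - 1) / h) \<longlongrightarrow> - l) (at 0)" by (simp add: DERIV_def)
    then have "((\<lambda>h. (exp (- l * h) - 1) / h) \<longlongrightarrow> - l) (at_right 0)" by (rule tendsto_within_subset) simp
    then have "((\<lambda>h. - ((exp (- l * h) - 1) / h) * state x t0 y0) \<longlongrightarrow> - (- l) * state x t0 y0) (at_right 0)"
      by (intro tendsto_intros)
    then show "((\<lambda>h. - ((exp (- l * h) - 1) / h) * state x t0 y0) \<longlongrightarrow> l * state x t0 y0) (at_right 0)" by simp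
    have "\<forall>\<^sub>F h in at_right 0. 0 < h \<and> h < t0"
      using eventually_at_right_real[OF t0'(1)] by (auto elim: eventually_mono)
    then show "\<forall>\<^sub>F h in at_right 0. (state x t0 y0 - state x (t0 - h) y0) / h \<le> - ((exp (- l * h) - 1) / h) * state x t0 y0"
    proof eventually_elim
      case (elim h)
      have e1: "exp (l * (t0 - h)) * exp (- l * t0) = exp (- l * h)" by (simp add: mult_exp_exp algebra_simps)
      have e2: "exp (l * (t0 - h)) * exp (- l * (t0 - h)) = 1" by (simp add: mult_exp_exp)
      have "exp (l * (t0 - h)) * (exp (- l * t0) * state x t0 y0) \<le> exp (l * (t0 - h)) * (exp (- l * (t0 - h)) * state x (t0 - h) y0)"
        using elim t0 by (intro mult_left_mono minw) auto
      then have "exp (- l * h) * state x t0 y0 \<le> state x (t0 - h) y0"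
        by (simp only: mult.assoc[symmetric] e1 e2 mult_1_left)
      then have "state x t0 y0 - state x (t0 - h) y0 \<le> - (exp (- l * h) - 1) * state x t0 y0" by (simp add: algebra_simps)
      then have "(state x t0 y0 - state x (t0 - h) y0) / h \<le> - (exp (- l * h) - 1) * state x t0 y0 / h"
        using elim by (intro divide_right_mono) auto
      then show ?case by (simp only: times_divide_eq_left minus_divide_left mult_minus_left)
    qed
  qed simp
  with ge have "state x t0 y0 * D \<le> l * state x t0 y0" by linarith
  then have "0 \<le> state x t0 y0 * (l - D)" by (simp add: algebra_simps)
  moreover have "D < l"
  proof -
    have A0: "0 \<le> 4 * pi\<^sup>2 * Wnorm W" using P0 by simp
    have "D \<le> 4 * pi\<^sup>2 * Wnorm W * ((norm x * sqrt (1 + T))\<^sup>2 + S)"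
      using abs_ge_self[of D] D(1) mult_left_mono[OF sumle[of t0] A0] by linarith
    then show ?thesis unfolding l_def by linarith
  qed
  ultimately show False using neg0 by (simp add: zero_le_mult_iff)
qed

end

text \<open>Sobolev norms are extended integrals over a counting measure while the estimates live on
  finite sums; an enumeration turns the former into a supremum of the latter.\<close>

lemma nn_integral_count_space_SUP:
  fixes h :: "'k::countable \<Rightarrow> ennreal"
  shows "(\<integral>\<^sup>+k. h k \<partial>count_space UNIV) = (SUP n. \<Sum>k\<in>{k. to_nat k < n}. h k)"
    and "incseq (\<lambda>n. \<Sum>k\<in>{k :: 'k. to_nat k < n}. h k)"
    and "finite {k :: 'k. to_nat k < n}"
proof -
  let ?F = "\<lambda>n. {k :: 'k. to_nat k < n}"
  have fin: "finite (?F n)" for n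
    using finite_vimageI[of "{..<n}" "to_nat :: 'k \<Rightarrow> nat"] by (simp add: vimage_def)
  then show "finite {k :: 'k. to_nat k < n}" .
  show "incseq (\<lambda>n. \<Sum>k\<in>?F n. h k)" by (intro incseq_SucI sum_mono2 fin) auto
  have "h k = (SUP n. h k * indicator (?F n) k)" for k
  proof (rule antisym)
    show "h k \<le> (SUP n. h k * indicator (?F n) k)" by (rule SUP_upper2[of "Suc (to_nat k)"]) auto
    show "(SUP n. h k * indicator (?F n) k) \<le> h k" by (intro SUP_least) (auto simp: indicator_def)
  qed
  then have "(\<integral>\<^sup>+k. h k \<partial>count_space UNIV) = (\<integral>\<^sup>+k. (SUP n. h k * indicator (?F n) k) \<partial>count_space UNIV)"
    by (intro nn_integral_cong) simp
  also have "\<dots> = (SUP n. \<integral>\<^sup>+k. h k * indicator (?F n) k \<partial>count_space UNIV)"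
    by (intro nn_integral_monotone_convergence_SUP) (auto intro!: incseq_SucI le_funI simp: indicator_def)
  also have "\<dots> = (SUP n. \<Sum>k\<in>?F n. h k)"
    by (subst nn_integral_count_space_indicator[symmetric]) (simp_all add: NO_MATCH_def nn_integral_count_space_finite[OF fin])
  finally show "(\<integral>\<^sup>+k. h k \<partial>count_space UNIV) = (SUP n. \<Sum>k\<in>?F n. h k)" .
qed

lemma sum_le_nn_integral_count_space:
  fixes h :: "'k::countable \<Rightarrow> ennreal"
  assumes "finite F"
  shows "sum h F \<le> (\<integral>\<^sup>+k. h k \<partial>count_space UNIV)"
proof -
  have "F \<subseteq> {k. to_nat k < Suc (Max (to_nat ` F))}" using assms by (auto intro!: le_imp_less_Suc Max_ge)
  then show ?thesis unfolding nn_integral_count_space_SUP(1)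
    by (intro SUP_upper2[OF UNIV_I] sum_mono2) (auto intro: nn_integral_count_space_SUP(3))
qed

lemma sobolev_weight: "(1 + knorm2 k) powr real n = (japanese k ^ n)\<^sup>2"
  using knorm2_nonneg[of k] by (simp add: powr_realpow add_pos_nonneg japanese_def power_mult[symmetric] mult.commute[of n 2] power_mult)

lemma sobolev_l2_bound:
  assumes "sobn2 (real n) f < \<infinity>"
  shows "l2_bound (\<lambda>k. of_real (japanese k ^ n) * fcoef f k) (sqrt (enn2real (sobn2 (real n) f)))"
proof (rule l2_boundI)
  fix F :: "(int^'a) set" assume F: "finite F"
  have "ennreal (\<Sum>k\<in>F. (1 + knorm2 k) powr real n * (cmod (fcoef f k))\<^sup>2)
     = (\<Sum>k\<in>F. ennreal ((1 + knorm2 k) powr real n * (cmod (fcoef f k))\<^sup>2))" by (rule sum_ennreal[symmetric]) simp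
  also have "\<dots> \<le> sobn2 (real n) f" unfolding sobn2_def by (rule sum_le_nn_integral_count_space[OF F])
  finally have "(\<Sum>k\<in>F. (1 + knorm2 k) powr real n * (cmod (fcoef f k))\<^sup>2) \<le> enn2real (sobn2 (real n) f)"
    using enn2real_mono[OF _ assms[unfolded infinity_ennreal_def]] by (fastforce simp: sum_nonneg)
  then show "(\<Sum>k\<in>F. (cmod (of_real (japanese k ^ n) * fcoef f k))\<^sup>2) \<le> (sqrt (enn2real (sobn2 (real n) f)))\<^sup>2"
    by (simp add: norm_mult norm_power power_mult_distrib sobolev_weight)
qed simp

lemma l2_bound_finite_sum:
  assumes "finite J" "\<And>j. j \<in> J \<Longrightarrow> l2_bound (c j) C"
  shows "l2_bound (\<lambda>k. \<Sum>j\<in>J. of_real (cmod (c j k))) (real (card J) * C)"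
  using assms
proof (induction rule: finite_induct)
  case empty
  then show ?case by (simp add: l2_bound_def L2_set_def)
next
  case (insert j J)
  have "l2_bound (\<lambda>k. complex_of_real (cmod (c j k))) C"
    by (rule l2_bound_comparison[of "c j"]) (use insert in auto)
  from l2_bound_add[OF this insert.IH] insert show ?case by (simp add: algebra_simps)
qed

text \<open>The set where \<open>f\<close> is negative is open, so it is empty once it is null.
  Reflection first moves \<open>y\<close> to the centre of the cell, away from the boundary.\<close>

lemma continuous_periodic_nonneg:
  fixes f :: "real^'d \<Rightarrow> real"
  assumes cont: "continuous_on UNIV f" and per: "\<And>x k. f (x + lattice_vec k) = f x" and ae: "AE x in torus. 0 \<le> f x"
  shows "0 \<le> f y"
proof (rule ccontr)
  assume neg: "\<not> 0 \<le> f y"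
  define c :: "real^'d" where "c = (\<chi> i. 1 / 2)"
  let ?V = "{z. f (y + c - z) < 0} \<inter> box (0::real^'d) (\<chi> i. 1)"
  have "{x. 0 \<le> f x} \<in> sets lebesgue"
    using closed_Collect_le[OF continuous_on_const cont, of 0] by (metis borel_closed sets_completionI_sets sets_lborel)
  then have "AE z in torus. 0 \<le> f (y + c - z)"
    by (rule AE_torus_reflect) (use per ae in auto)
  then have "AE z in lebesgue. z \<in> cube \<longrightarrow> 0 \<le> f (y + c - z)"
    by (subst (asm) AE_restrict_space_iff) auto
  moreover have V: "open ?V"
    by (intro open_Int open_box open_Collect_less continuous_on_const continuous_on_compose2[OF cont]) (auto intro!: continuous_intros)
  ultimately have "AE z in lebesgue. z \<notin> ?V"
    by (rule_tac eventually_mono) (auto simp: cube_eq_cbox dest: subsetD[OF box_subset_cbox])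
  then have "?V \<in> null_sets lebesgue" using V by (subst AE_iff_null_sets) (metis borel_open sets_completionI_sets sets_lborel)
  then have "negligible ?V" by (simp add: negligible_iff_null_sets)
  moreover have "c \<in> ?V" using neg by (auto simp: c_def mem_box_cart)
  ultimately show False using open_not_negligible[OF V] by blast
qed

section \<open>Mass, energy and the a priori bound\<close>

context torus_problem
begin

definition phi0 :: "(int^'d) hl2" where
  "phi0 = Hl2 (\<lambda>k. of_real (japanese k ^ b) * fcoef \<phi> k)"

lemma coef_phi0: "coef phi0 k = of_real (japanese k ^ b) * fcoef \<phi> k"
proof -
  have "sobn2 (real b) \<phi> < \<infinity>" using A1 by (simp add: A1_def Hs_def)
  then show ?thesis unfolding phi0_def
    by (subst coef_Hl2[OF _ sobolev_l2_bound]) (simp_all add: japanese_uminus fcoef_uminus)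
qed

lemma traj_coef_0: "traj_coef x 0 k = coef (fst x) k"
  using T_gt_0 by (simp add: traj_coef_def clampT_def)

lemma traj_0: "traj x 0 = fst x"
  by (rule hl2_eqI) (simp add: coef_traj traj_coef_0)

lemma ucoef_0: "ucoef x 0 k = coef (fst x) k / of_real (japanese k ^ b)"
  by (simp add: ucoef_eq traj_coef_0)

lemma ucoef_init: "fst x = phi0 \<Longrightarrow> ucoef x 0 k = fcoef \<phi> k"
  by (simp add: ucoef_0 coef_phi0)

lemma state_init_nonneg:
  assumes x: "fst x = phi0" shows "0 \<le> state x 0 y"
proof -
  interpret C: fourier_coeffs "ucoef x 0" by (rule fourier_coeffs_ucoef)
  have eq: "fcoef \<phi> = ucoef x 0" using ucoef_init[OF x] by auto
  have "AE y in torus. \<phi> y = fseries (fcoef \<phi>) y"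
    by (rule AE_eq_fseries[OF L2per_L1per[OF phi_L2per]]) (simp add: eq C.summable)
  then have "AE y in torus. 0 \<le> state x 0 y"
    unfolding eq state_def by (rule eventually_mono) (use phi_nonneg in metis)
  then show ?thesis unfolding state_def
    by (intro continuous_periodic_nonneg C.fseries_continuous C.fseries_periodic)
qed

text \<open>The mode 0 neither decays nor receives forcing, and the integral is its
  coefficient.\<close>

lemma state_mass:
  assumes x: "fst x = phi0" shows "(LINT y|torus. state x t y) = 1"
proof -
  have z: "decay (0 :: int^'d) = 0" "freq (0 :: int^'d) = 0"
    by (simp_all add: decay_def freq_def knorm2_def lattice_vec_def vec_eq_iff)
  have "ucoef x t 0 = ucoef x 0 0"
    by (simp add: ucoef_eq traj_coef_def mode_def z)
  also have "\<dots> = fcoef \<phi> 0" by (rule ucoef_init[OF x])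
  finally have "fcoef (state x t) 0 = fcoef \<phi> 0" by (simp add: fcoef_state)
  then have "complex_of_real (LINT y|torus. state x t y) = complex_of_real (LINT y|torus. \<phi> y)"
    by (simp add: fcoef_character)
  then show ?thesis by (simp only: of_real_eq_iff phi_mass)
qed

text \<open>\<open>\<nabla>W*u\<close> is bounded by \<open>\<parallel>\<nabla>W\<parallel>\<^sub>\<infinity>\<close> since \<open>u\<close> stays a probability density.\<close>
lemma source_l2_bound:
  assumes W: "Wdot W" and K: "\<And>j. AE y in torus. \<bar>wpd W j y\<bar> \<le> K"
    and x: "fst x = phi0" and nonneg: "\<And>y. 0 \<le> state x t y"
    and src: "src x t = tconv (kernelw b) (potential W) (traj x t) (traj x t)"
  shows "l2_bound (\<lambda>k. coef (src x t) k / of_real (japanese k ^ b)) (2 * pi * real CARD('d) * K * norm (smooth b (traj x t)))"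
proof -
  let ?N = "norm (smooth b (traj x t))"
  let ?c = "\<lambda>j. fcoef (\<lambda>y. state x t y * conv (wpd W j) (state x t) y)"
  interpret C: fourier_coeffs "ucoef x t" by (rule fourier_coeffs_ucoef)
  have wL: "L2per (wpd W j)" for j using has_wpd_wpd[OF W, of j] by (simp add: has_wpd_def)
  have le: "\<bar>conv (wpd W j) (state x t) y\<bar> \<le> K" for j y
    using abs_conv_le[OF wL K L2per_L1per[OF state_L2per] nonneg] state_mass[OF x] by simp
  have K0: "0 \<le> K" using le[of undefined undefined] by linarith
  have cl: "l2_bound (?c j) (K * ?N)" for j
  proof -
    have cv: "conv (wpd W j) (state x t) = fseries (\<lambda>m. fcoef (wpd W j) m * fcoef (state x t) m)"
      and fc: "fourier_coeffs (\<lambda>m. fcoef (wpd W j) m * fcoef (state x t) m)"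
      using conv_eq_fseries[OF wL state_L2per] C.summable by (simp_all add: fcoef_state)
    interpret D: fourier_coeffs "\<lambda>m. fcoef (wpd W j) m * fcoef (state x t) m" by (rule fc)
    let ?p = "\<lambda>y. state x t y * conv (wpd W j) (state x t) y"
    have pt: "\<bar>?p y\<bar> \<le> K * \<bar>state x t y\<bar>" for y
      using mult_left_mono[OF le[of j y], of "\<bar>state x t y\<bar>"] by (simp add: abs_mult mult.commute)
    have L2: "L2per ?p"
    proof (rule bounded_L2per(1))
      show "periodic ?p" using D.fseries_periodic C.fseries_periodic[folded state_def] by (simp add: periodic_def cv)
      show "?p \<in> borel_measurable lebesgue"
        using C.fseries_measurable[folded state_def] D.fseries_measurable unfolding cv by (rule borel_measurable_times)
      have "\<bar>?p y\<bar> \<le> K * (\<Sum>\<^sub>\<infinity>k. cmod (ucoef x t k))" for y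
        by (rule order_trans[OF pt mult_left_mono[OF C.abs_fseries_le[folded state_def] K0]])
      then show "AE y in torus. \<bar>?p y\<bar> \<le> K * (\<Sum>\<^sub>\<infinity>k. cmod (ucoef x t k))" by simp
    qed
    have "(LINT y|torus. (?p y)\<^sup>2) \<le> (LINT y|torus. K\<^sup>2 * (state x t y)\<^sup>2)"
    proof (rule integral_mono)
      show "integrable torus (\<lambda>y. (?p y)\<^sup>2)" using L2 by (simp add: L2per_def)
      show "integrable torus (\<lambda>y. K\<^sup>2 * (state x t y)\<^sup>2)" using state_L2per[of x t] by (simp add: L2per_def)
      show "(?p y)\<^sup>2 \<le> K\<^sup>2 * (state x t y)\<^sup>2" for y
        using power_mono[OF pt[of y], of 2] by (simp add: power_mult_distrib)
    qed
    also have "\<dots> \<le> K\<^sup>2 * ?N\<^sup>2"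
      using C.integral_fseries_square[of ?N] l2_bound_norm[of "smooth b (traj x t)"]
      by (simp add: state_def ucoef_def mult_left_mono)
    finally have "sqrt (LINT y|torus. (?p y)\<^sup>2) \<le> sqrt ((K * ?N)\<^sup>2)" by (simp add: power_mult_distrib)
    then have "sqrt (LINT y|torus. (?p y)\<^sup>2) \<le> K * ?N" using K0 by simp
    with fcoef_l2_bound[OF L2] show ?thesis by (rule l2_bound_mono)
  qed
  have "l2_bound (\<lambda>k. of_real (2 * pi) * (\<Sum>j\<in>UNIV. complex_of_real (cmod (?c j k)))) (cmod (of_real (2 * pi)) * (real CARD('d) * (K * ?N)))"
    by (intro l2_bound_scale l2_bound_finite_sum cl) auto
  then have "l2_bound (\<lambda>k. coef (src x t) k / of_real (japanese k ^ b)) (cmod (of_real (2 * pi)) * (real CARD('d) * (K * ?N)))"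
  proof (rule l2_bound_comparison)
    fix k :: "int^'d"
    let ?g = "coef (src x t) k / of_real (japanese k ^ b)"
    show "cmod ?g \<le> cmod (of_real (2 * pi) * (\<Sum>j\<in>UNIV. complex_of_real (cmod (?c j k))))"
    \<comment> \<open>At frequency 0 the kernel divides by 0, which yields 0, so the source vanishes
      there. Elsewhere the factor \<open>freq k\<close> of the divergence can be divided
      out.\<close>
    proof (cases "freq k = 0")
      case True
      have "?g = 0" unfolding src twist_conv_kernelw twist_conv_def by (simp add: drift_kernel_def True)
      then show ?thesis by simp
    next
      case False
      then have f: "freq k > 0" using freq_nonneg[of k] by simp
      have "of_real (freq k) * ?g = driftc (state x t) W (state x t) k"
        unfolding driftc_state[OF W] src ..
      then have "freq k * cmod ?g = cmod (driftc (state x t) W (state x t) k)"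
        using f by (metis norm_mult norm_of_real abs_of_pos)
      also have "\<dots> \<le> (\<Sum>j\<in>UNIV. cmod (2 * pi * \<i> * of_int (k $ j) * ?c j k))"
        unfolding driftc_def by (rule norm_sum)
      also have "\<dots> \<le> (\<Sum>j\<in>UNIV. freq k * (2 * pi * cmod (?c j k)))"
      proof (rule sum_mono)
        fix j
        have "\<bar>lattice_vec k $ j\<bar> \<le> freq k" unfolding freq_def by (rule component_le_norm_cart)
        then have "\<bar>real_of_int (k $ j)\<bar> * (2 * pi * cmod (?c j k)) \<le> freq k * (2 * pi * cmod (?c j k))"
          by (intro mult_right_mono) (auto simp: lattice_vec_def)
        then show "cmod (2 * pi * \<i> * of_int (k $ j) * ?c j k) \<le> freq k * (2 * pi * cmod (?c j k))"
          by (simp add: norm_mult mult_ac)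
      qed
      also have "\<dots> = freq k * (2 * pi * (\<Sum>j\<in>UNIV. cmod (?c j k)))" by (simp only: sum_distrib_left)
      finally have "cmod ?g \<le> 2 * pi * (\<Sum>j\<in>UNIV. cmod (?c j k))" using f by simp
      moreover have "cmod (of_real (2 * pi) * (\<Sum>j\<in>UNIV. complex_of_real (cmod (?c j k)))) = 2 * pi * (\<Sum>j\<in>UNIV. cmod (?c j k))"
        unfolding of_real_sum[symmetric] norm_mult norm_of_real by (simp add: sum_nonneg)
      ultimately show ?thesis by simp
    qed
  qed
  then show ?thesis by (simp add: mult_ac)
qed

text \<open>The constants delivered by Gronwall's inequality: here for the l2 norm, with the rate of
  \<open>source_l2_bound\<close>; in \<open>apriori_bound\<close> for the weighted norm, with the
  rate of the tame estimate once the l2 norm is bounded.\<close>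

definition energy_bound :: "real \<Rightarrow> real" where
  "energy_bound K = (norm phi0)\<^sup>2 * exp ((2 * pi * real CARD('d) * K)\<^sup>2 * T)"

definition apriori_bound :: "real \<Rightarrow> real" where
  "apriori_bound K = sqrt ((norm phi0)\<^sup>2 * exp ((8 * pi\<^sup>2 * 2 ^ b * K)\<^sup>2 * energy_bound K * T))"

lemma norm_smooth_le: "norm (smooth b f) \<le> norm f"
  by (rule norm_hl2_le[OF l2_bound_comparison[OF l2_bound_norm]]) (simp add: coef_smooth smooth_le del: of_real_power)

context
  fixes W K x \<tau>
  assumes W: "Wdot W" and K: "\<And>j. AE y in torus. \<bar>wpd W j y\<bar> \<le> K" and P: "norm (potential W) \<le> K"
    and \<tau>: "\<tau> \<in> {0..T}" and x: "fst x = phi0"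
    and src: "\<And>t. t \<in> {0..\<tau>} \<Longrightarrow> src x t = tconv (kernelw b) (potential W) (traj x t) (traj x t)"
begin

text \<open>Energy inequality for the coefficients without weight. By \<open>source_l2_bound\<close>
  the source is bounded linearly in the norm, although it is quadratic, so Gronwall's inequality
  gives a bound for all times.\<close>

lemma smooth_energy:
  assumes t: "t \<in> {0..\<tau>}"
  shows "(norm (smooth b (traj x t)))\<^sup>2 \<le> energy_bound K"
proof -
  let ?f = "\<lambda>t. (norm (smooth b (traj x t)))\<^sup>2" and ?c = "(2 * pi * real CARD('d) * K)\<^sup>2"
  let ?g = "\<lambda>s k. coef (src x s) k / of_real (japanese k ^ b)"
  have cf: "continuous_on A ?f" for A
    by (intro continuous_intros bounded_linear.continuous_on[OF bounded_linear_smooth] traj_continuous)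
  have cg: "continuous_on A (\<lambda>s. ?g s k)" for A k
    by (intro continuous_intros coef_snd_continuous) (simp del: of_real_power)
  have "?f t \<le> (norm phi0)\<^sup>2 * exp (?c * t)"
  proof (rule gronwall_integral[OF cf _ _ t])
    fix t assume t: "t \<in> {0..\<tau>}"
    show "?f t \<le> (norm phi0)\<^sup>2 + ?c * integral {0..t} ?f"
    proof (rule norm_sq_hl2_le)
      fix F :: "(int^'d) set" assume F: "finite F"
      have "(cmod (ucoef x t k))\<^sup>2 \<le> (cmod (ucoef x 0 k))\<^sup>2 + integral {0..t} (\<lambda>s. (cmod (?g s k))\<^sup>2)" for k
      proof -
        have "(cmod (ucoef x t k))\<^sup>2 + decay k * integral {0..t} (\<lambda>s. (cmod (ucoef x s k))\<^sup>2)
            \<le> (cmod (ucoef x 0 k))\<^sup>2 + integral {0..t} (\<lambda>s. (cmod (?g s k))\<^sup>2)"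
        proof (rule parabolic_energy[OF _ cg kappa_le])
          show "t \<in> {0..T}" using t \<tau> by auto
          show "((\<lambda>a. ucoef x a k) has_vector_derivative (- decay k) *\<^sub>R ucoef x s k + freq k *\<^sub>R ?g s k) (at s within {0..T})"
            if "s \<in> {0..T}" for s using ucoef_deriv[OF that, of x k] by (simp only: rate_def)
        qed
        moreover have "0 \<le> decay k * integral {0..t} (\<lambda>s. (cmod (ucoef x s k))\<^sup>2)"
          by (intro mult_nonneg_nonneg nu_nonneg integral_nonneg integrable_continuous_interval continuous_intros ucoef_continuous) auto
        ultimately show ?thesis by linarith
      qed
      then have "(\<Sum>k\<in>F. (cmod (ucoef x t k))\<^sup>2) \<le> (\<Sum>k\<in>F. (cmod (ucoef x 0 k))\<^sup>2 + integral {0..t} (\<lambda>s. (cmod (?g s k))\<^sup>2))"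
        by (rule sum_mono)
      also have "\<dots> = (\<Sum>k\<in>F. (cmod (ucoef x 0 k))\<^sup>2) + integral {0..t} (\<lambda>s. \<Sum>k\<in>F. (cmod (?g s k))\<^sup>2)"
        unfolding sum.distrib integral_sum[OF F, OF integrable_continuous_interval[OF continuous_on_power[OF continuous_on_norm[OF cg]]]] ..
      also have "\<dots> \<le> (norm phi0)\<^sup>2 + integral {0..t} (\<lambda>s. ?c * ?f s)"
      proof (rule add_mono)
        show "(\<Sum>k\<in>F. (cmod (ucoef x 0 k))\<^sup>2) \<le> (norm phi0)\<^sup>2"
          using order_trans[OF sum_coef_le[OF F, of "smooth b (traj x 0)"] power_mono[OF norm_smooth_le norm_ge_zero]]
          by (simp add: ucoef_def traj_0 x)
        show "integral {0..t} (\<lambda>s. \<Sum>k\<in>F. (cmod (?g s k))\<^sup>2) \<le> integral {0..t} (\<lambda>s. ?c * ?f s)"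
        proof (rule integral_le)
          show "(\<lambda>s. \<Sum>k\<in>F. (cmod (?g s k))\<^sup>2) integrable_on {0..t}"
            by (intro integrable_continuous_interval continuous_on_sum continuous_on_power continuous_on_norm cg)
          show "(\<lambda>s. ?c * ?f s) integrable_on {0..t}"
            by (intro integrable_continuous_interval continuous_on_mult continuous_on_const cf)
          fix s assume s: "s \<in> {0..t}"
          then have s': "s \<in> {0..\<tau>}" using t by auto
          \<comment> \<open>Positivity is available here because the equation holds on all of
            \<open>{0..\<tau>}\<close>; it is an assumption of
            \<open>source_l2_bound\<close>.\<close>
          have "0 \<le> state x s y" for y by (rule state_nonneg[OF W state_init_nonneg[OF x] \<tau> src s'])
          from l2_bound_sum[OF source_l2_bound[OF W K x this src[OF s']] F]
          show "(\<Sum>k\<in>F. (cmod (?g s k))\<^sup>2) \<le> ?c * ?f s" by (simp add: power_mult_distrib)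
        qed
      qed
      also have "integral {0..t} (\<lambda>s. ?c * ?f s) = ?c * integral {0..t} ?f" by simp
      finally show "(\<Sum>k\<in>F. (cmod (coef (smooth b (traj x t)) k))\<^sup>2) \<le> (norm phi0)\<^sup>2 + ?c * integral {0..t} ?f"
        by (simp only: ucoef_def)
    qed
  qed simp
  also have "\<dots> \<le> (norm phi0)\<^sup>2 * exp (?c * T)"
    using t \<tau> by (intro mult_left_mono) (auto intro!: mult_left_mono)
  finally show ?thesis unfolding energy_bound_def .
qed

text \<open>The tame estimate multiplies one weak and one strong norm. The weak one is bounded by
  \<open>smooth_energy\<close>, so the source is linear in the strong one.\<close>

lemma traj_apriori: "norm (traj x \<tau>) \<le> apriori_bound K"
proof -
  let ?f = "\<lambda>t. (norm (traj x t))\<^sup>2" and ?c = "(8 * pi\<^sup>2 * 2 ^ b * K)\<^sup>2 * energy_bound K"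
  have K0: "0 \<le> K" using norm_ge_zero P by (rule order_trans)
  have E0: "0 \<le> energy_bound K" by (simp add: energy_bound_def)
  have cf: "continuous_on A ?f" for A by (intro continuous_intros traj_continuous)
  have "?f \<tau> \<le> (norm phi0)\<^sup>2 * exp (?c * \<tau>)"
  proof (rule gronwall_integral[OF cf])
    show "\<tau> \<in> {0..\<tau>}" using \<tau> by simp
    show "0 \<le> ?c" using E0 by simp
    fix t assume t: "t \<in> {0..\<tau>}"
    have tT: "t \<in> {0..T}" using t \<tau> by auto
    have "?f t \<le> (norm phi0)\<^sup>2 + integral {0..t} (\<lambda>s. (norm (src x s))\<^sup>2)"
      using traj_energy[of x t] by (simp add: clampT_id[OF tT] x)
    also have "integral {0..t} (\<lambda>s. (norm (src x s))\<^sup>2) \<le> integral {0..t} (\<lambda>s. ?c * ?f s)"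
    proof (rule integral_le)
      show "(\<lambda>s. (norm (src x s))\<^sup>2) integrable_on {0..t}" by (intro integrable_continuous_interval norm_snd_continuous)
      show "(\<lambda>s. ?c * ?f s) integrable_on {0..t}"
        by (intro integrable_continuous_interval continuous_on_mult continuous_on_const cf)
      fix s assume "s \<in> {0..t}"
      then have s: "s \<in> {0..\<tau>}" using t by auto
      have "norm (src x s) \<le> 8 * pi\<^sup>2 * 2 ^ b * norm (potential W) * norm (smooth b (traj x s)) * norm (traj x s)"
        unfolding src[OF s] by (rule norm_tconv_kernelw_tame)
      also have "\<dots> \<le> 8 * pi\<^sup>2 * 2 ^ b * K * norm (smooth b (traj x s)) * norm (traj x s)"
        using P by (intro mult_right_mono mult_left_mono) auto
      finally have "(norm (src x s))\<^sup>2 \<le> (8 * pi\<^sup>2 * 2 ^ b * K * norm (smooth b (traj x s)) * norm (traj x s))\<^sup>2"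
        by (rule power_mono) simp
      also have "\<dots> = (8 * pi\<^sup>2 * 2 ^ b * K)\<^sup>2 * (norm (smooth b (traj x s)))\<^sup>2 * ?f s" by (simp only: power_mult_distrib)
      also have "\<dots> \<le> ?c * ?f s" using smooth_energy[OF s] by (intro mult_right_mono mult_left_mono) auto
      finally show "(norm (src x s))\<^sup>2 \<le> ?c * ?f s" .
    qed
    also have "integral {0..t} (\<lambda>s. ?c * ?f s) = ?c * integral {0..t} ?f" by simp
    finally show "?f t \<le> (norm phi0)\<^sup>2 + ?c * integral {0..t} ?f" by simp
  qed
  also have "\<dots> \<le> (norm phi0)\<^sup>2 * exp (?c * T)"
    using \<tau> E0 by (intro mult_left_mono) (auto intro!: mult_left_mono)
  finally show ?thesis unfolding apriori_bound_def by (simp add: real_le_rsqrt mult.assoc)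
qed

end

section \<open>Potentials as parameters of the abstract problem\<close>

sublocale quadratic_fixed_point Q "(phi0, 0)" "4 * pi\<^sup>2 * 2 ^ b * (1 + T)"
  by (rule quadratic_fixed_point_Q)

text \<open>\<open>K\<close> bounds the gradient twice, in sup norm for the energy estimate and in
  l2 for the tame one. The resulting control depends on \<open>W\<close> through \<open>K\<close>
  alone.\<close>

lemma controlled_potential:
  assumes W: "Wdot W" and K: "\<And>j. AE y in torus. \<bar>wpd W j y\<bar> \<le> K" and P: "norm (potential W) \<le> K"
  shows "controlled (K + (norm phi0 + apriori_bound K) + 4 * pi\<^sup>2 * 2 ^ b * K * (norm phi0 + apriori_bound K) * (norm phi0 + apriori_bound K)) (potential W)"
proof -
  let ?M = "norm phi0 + apriori_bound K"
  have A0: "0 \<le> apriori_bound K" by (simp add: apriori_bound_def energy_bound_def)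
  have K0: "0 \<le> K" using norm_ge_zero P by (rule order_trans)
  obtain x where x: "x = (phi0, 0) + Q (potential W) x x" "norm x \<le> ?M + 4 * pi\<^sup>2 * 2 ^ b * K * ?M * ?M"
  proof (rule global_solution[OF _ P])
    show "norm phi0 \<le> ?M" using A0 by simp
    show "norm (traj x \<tau>) \<le> ?M" if "\<tau> \<in> {0..T}" "fst x = phi0"
      "\<And>t. t \<in> {0..\<tau>} \<Longrightarrow> src x t = tconv (kernelw b) (potential W) (traj x t) (traj x t)" for x \<tau>
      using traj_apriori[OF W K P that] norm_ge_zero[of phi0] by linarith
  qed
  then have s: "solution (potential W) x" by (simp only: solution_def)
  have "0 \<le> 4 * pi\<^sup>2 * 2 ^ b * K * ?M * ?M" using K0 A0 by (intro mult_nonneg_nonneg add_nonneg_nonneg) auto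
  then have "norm (potential W) \<le> K + ?M + 4 * pi\<^sup>2 * 2 ^ b * K * ?M * ?M" "norm x \<le> K + ?M + 4 * pi\<^sup>2 * 2 ^ b * K * ?M * ?M"
    using x(2) P A0 K0 norm_ge_zero[of phi0] by linarith+
  then show ?thesis unfolding controlled_def solution_sol[OF s] solvable_def using s by blast
qed

end

section \<open>Parabolic regularity in the space \<open>F\<^sub>\<beta>\<close>\<close>

text \<open>Monotone convergence along an enumeration of the frequencies reduces the Bochner norm to
  finite blocks.\<close>

lemma L2H_le:
  fixes u :: "real \<Rightarrow> real^'d \<Rightarrow> real"
  assumes cont: "\<And>k. continuous_on {0..T} (\<lambda>t. fcoef (u t) k)"
  shows "(\<And>F. finite F \<Longrightarrow> integral {0..T} (\<lambda>t. \<Sum>k\<in>F. (japanese k ^ n)\<^sup>2 * (cmod (fcoef (u t) k))\<^sup>2) \<le> C)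
      \<Longrightarrow> L2H T (real n) u \<le> ennreal C"
    and "(\<lambda>t. sobn2 (real n) (u t) * indicator {0..T} t) \<in> borel_measurable lborel"
proof -
  let ?F = "\<lambda>m. {k :: int^'d. to_nat k < m}"
  let ?s = "\<lambda>m t. \<Sum>k\<in>?F m. (japanese k ^ n)\<^sup>2 * (cmod (fcoef (u t) k))\<^sup>2"
  have cs: "continuous_on {0..T} (?s m)" for m by (intro continuous_intros cont)
  have s0: "0 \<le> ?s m t" for m t by (intro sum_nonneg) simp
  have e: "(\<Sum>k\<in>?F m. ennreal ((1 + knorm2 k) powr real n * (cmod (fcoef (u t) k))\<^sup>2)) = ennreal (?s m t)" for m t
    unfolding sobolev_weight by (rule sum_ennreal) simp
  have eq: "sobn2 (real n) (u t) * indicator {0..T} t = (SUP m. ennreal (?s m t) * indicator {0..T} t)" for t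
    unfolding sobn2_def nn_integral_count_space_SUP(1) e by (simp add: indicator_def)
  have m: "(\<lambda>t. ennreal (?s m t) * indicator {0..T} t) \<in> borel_measurable lborel" for m
  proof -
    have "(\<lambda>t. ennreal (indicator {0..T} t *\<^sub>R ?s m t)) \<in> borel_measurable lborel"
      using borel_measurable_continuous_on_indicator[OF _ cs[of m]] by simp
    then show ?thesis by (rule measurable_cong[THEN iffD1, rotated]) (simp add: indicator_def)
  qed
  have inc: "incseq (\<lambda>m t. ennreal (?s m t) * indicator {0..T} t)"
    using nn_integral_count_space_SUP(2)[where h = "\<lambda>k. ennreal ((1 + knorm2 k) powr real n * (cmod (fcoef (u _) k))\<^sup>2)"]
    unfolding e by (auto simp: incseq_def le_fun_def intro!: mult_right_mono)
  show "(\<lambda>t. sobn2 (real n) (u t) * indicator {0..T} t) \<in> borel_measurable lborel"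
    unfolding eq by (intro borel_measurable_SUP m) auto
  assume le: "\<And>F. finite F \<Longrightarrow> integral {0..T} (\<lambda>t. \<Sum>k\<in>F. (japanese k ^ n)\<^sup>2 * (cmod (fcoef (u t) k))\<^sup>2) \<le> C"
  have "L2H T (real n) u = (SUP m. \<integral>\<^sup>+t. ennreal (?s m t) * indicator {0..T} t \<partial>lborel)"
    unfolding L2H_def eq by (rule nn_integral_monotone_convergence_SUP[OF inc m])
  also have "\<dots> \<le> ennreal C"
  proof (rule SUP_least)
    fix m
    have "(?s m has_integral integral {0..T} (?s m)) {0..T}"
      by (intro integrable_integral integrable_continuous_interval cs)
    then have "(\<integral>\<^sup>+t. ennreal (?s m t) * indicator {0..T} t \<partial>lborel) = ennreal (integral {0..T} (?s m))"
      by (intro nn_integral_has_integral_lebesgue' s0)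
    also have "\<dots> \<le> ennreal C" by (intro ennreal_leI le nn_integral_count_space_SUP(3))
    finally show "(\<integral>\<^sup>+t. ennreal (?s m t) * indicator {0..T} t \<partial>lborel) \<le> ennreal C" .
  qed
  finally show "L2H T (real n) u \<le> ennreal C" .
qed

text \<open>Positive and negative part are densities of finite measures that agree on all
  half-lines; the measures are equal, hence so are the densities almost everywhere.\<close>

lemma AE_zero_of_tail_integrals:
  fixes h :: "real \<Rightarrow> real"
  assumes h: "integrable lborel h" and z: "\<And>x. (LINT s|lborel. indicator {x<..} s * h s) = 0"
  shows "AE s in lborel. h s = 0"
proof -
  let ?p = "\<lambda>s. max 0 (h s)" and ?n = "\<lambda>s. max 0 (- h s)"
  have i: "integrable lborel ?p" "integrable lborel ?n" using h by auto
  have m: "(\<lambda>s. ennreal (?p s)) \<in> borel_measurable lborel" "(\<lambda>s. ennreal (?n s)) \<in> borel_measurable lborel"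
    by (rule measurable_compose[OF borel_measurable_integrable[OF i(1)] measurable_ennreal],
        rule measurable_compose[OF borel_measurable_integrable[OF i(2)] measurable_ennreal])
  have ix: "integrable lborel (\<lambda>s. indicator {x<..} s * ?p s)" "integrable lborel (\<lambda>s. indicator {x<..} s * ?n s)" for x
    using integrable_mult_indicator[of "{x<..}" lborel ?p] integrable_mult_indicator[of "{x<..}" lborel ?n] i by auto
  have E: "emeasure (density lborel (\<lambda>s. ennreal (?p s))) {x<..} = ennreal (LINT s|lborel. indicator {x<..} s * ?p s)"
    "emeasure (density lborel (\<lambda>s. ennreal (?n s))) {x<..} = ennreal (LINT s|lborel. indicator {x<..} s * ?n s)" for x
  proof -
    have c: "ennreal a * indicator {x<..} s = ennreal (indicator {x<..} s * a)" for a s by (simp add: indicator_def)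
    show "emeasure (density lborel (\<lambda>s. ennreal (?p s))) {x<..} = ennreal (LINT s|lborel. indicator {x<..} s * ?p s)"
      by (subst emeasure_density[OF m(1)], simp, unfold c, rule nn_integral_eq_integral[OF ix(1)]) simp
    show "emeasure (density lborel (\<lambda>s. ennreal (?n s))) {x<..} = ennreal (LINT s|lborel. indicator {x<..} s * ?n s)"
      by (subst emeasure_density[OF m(2)], simp, unfold c, rule nn_integral_eq_integral[OF ix(2)]) simp
  qed
  have "(LINT s|lborel. indicator {x<..} s * ?p s) - (LINT s|lborel. indicator {x<..} s * ?n s) = (LINT s|lborel. indicator {x<..} s * h s)" for x
    unfolding Bochner_Integration.integral_diff[OF ix, symmetric]
    by (rule Bochner_Integration.integral_cong[OF refl]) (simp add: max_def indicator_def)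
  note d = this
  have eq: "(LINT s|lborel. indicator {x<..} s * ?p s) = (LINT s|lborel. indicator {x<..} s * ?n s)" for x
    using d[of x] z[of x] by simp
  have "density lborel (\<lambda>s. ennreal (?p s)) = density lborel (\<lambda>s. ennreal (?n s))"
    by (rule measure_eqI_lessThan) (simp_all only: E eq sets_density sets_lborel ennreal_less_top infinity_ennreal_def)
  then have "AE s in lborel. ennreal (?p s) = ennreal (?n s)"
    using sigma_finite_measure.density_unique_iff[OF sigma_finite_lborel m] by simp
  then show ?thesis by (rule eventually_mono) (simp add: max_def split: if_splits)
qed

text \<open>After extension by 0 outside \<open>{0..T}\<close>, every tail integral of the
  difference is a combination of integrals from 0.\<close>

lemma AE_eq_of_interval_integrals:
  fixes f g :: "real \<Rightarrow> complex"
  assumes T: "0 \<le> T" and f: "set_integrable lborel {0..T} f" and g: "set_integrable lborel {0..T} g"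
    and eq: "\<And>t. t \<in> {0..T} \<Longrightarrow> (LBINT s=0..t. f s) = (LBINT s=0..t. g s)"
  shows "AE s in lborel. s \<in> {0..T} \<longrightarrow> f s = g s"
proof -
  let ?e = "\<lambda>s. indicator {0..T} s *\<^sub>R (f s - g s)"
  have e: "integrable lborel ?e" using set_integral_diff(1)[OF f g] by (simp add: set_integrable_def)
  have it: "set_integrable lborel {0..t} f" "set_integrable lborel {0..t} g" if "t \<in> {0..T}" for t
    using that by (auto intro: set_integrable_subset[OF f] set_integrable_subset[OF g])
  have I: "(LINT s|lborel. indicator {0..t} s *\<^sub>R (f s - g s)) = 0" if t: "t \<in> {0..T}" for t
  proof -
    have "(LBINT s:{0..t}. f s) = (LBINT s:{0..t}. g s)"
      using eq[OF t] t interval_integral_Icc[of 0 t f] interval_integral_Icc[of 0 t g] by (simp flip: zero_ereal_def)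
    with set_integral_diff(2)[OF it[OF t]] show ?thesis by (simp add: set_lebesgue_integral_def)
  qed
  have id: "integrable lborel (\<lambda>s. indicator {0..t} s *\<^sub>R (f s - g s))" if "t \<in> {0..T}" for t
    using set_integral_diff(1)[OF it[OF that]] by (simp add: set_integrable_def)
  have IT: "(LINT s|lborel. ?e s) = 0" using I[of T] T by simp
  have z: "(LINT s|lborel. indicator {x<..} s *\<^sub>R ?e s) = 0" for x
  proof -
    consider "x < 0" | "x \<in> {0..T}" | "T < x" by fastforce
    then show ?thesis
    proof cases
      case 1
      then have "indicator {x<..} s *\<^sub>R ?e s = ?e s" for s by (auto simp: indicator_def)
      then show ?thesis by (simp only: IT)
    next
      case 2
      then have "indicator {x<..} s *\<^sub>R ?e s = ?e s - indicator {0..x} s *\<^sub>R (f s - g s)" for s by (auto simp: indicator_def)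
      then show ?thesis using I[of T] I[OF 2] T Bochner_Integration.integral_diff[OF e id[OF 2]] by simp
    next
      case 3
      then have "indicator {x<..} s *\<^sub>R ?e s = 0" for s by (auto simp: indicator_def)
      then show ?thesis by (simp only: Bochner_Integration.integral_zero)
    qed
  qed
  have ie: "integrable lborel (\<lambda>s. indicator {x<..} s *\<^sub>R ?e s)" for x
    by (rule integrable_mult_indicator[OF _ e]) simp
  have "AE s in lborel. Re (?e s) = 0"
  proof (rule AE_zero_of_tail_integrals)
    show "(LINT s|lborel. indicator {x<..} s * Re (?e s)) = 0" for x
      using integral_Re[OF ie[of x]] z[of x] by (simp add: mult.assoc)
  qed (rule integrable_Re[OF e])
  moreover have "AE s in lborel. Im (?e s) = 0"
  proof (rule AE_zero_of_tail_integrals)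
    show "(LINT s|lborel. indicator {x<..} s * Im (?e s)) = 0" for x
      using integral_Im[OF ie[of x]] z[of x] by (simp add: mult.assoc)
  qed (rule integrable_Im[OF e])
  ultimately show ?thesis by eventually_elim (auto simp: complex_eq_iff)
qed

text \<open>\<open>Fnorm\<close> refers to a chosen time derivative. Two choices have equal
  coefficients for almost every time, simultaneously for the countably many frequencies.\<close>

lemma L2H_tderiv_unique:
  fixes u :: "real \<Rightarrow> real^'d \<Rightarrow> real"
  assumes T: "0 \<le> T" and v: "has_tderiv T u v" and w: "has_tderiv T u w"
  shows "L2H T s v = L2H T s w"
proof -
  have "AE t in lborel. t \<in> {0..T} \<longrightarrow> fcoef (v t) k = fcoef (w t) k" for k
  proof (rule AE_eq_of_interval_integrals[OF T])
    show "set_integrable lborel {0..T} (\<lambda>s. fcoef (v s) k)" "set_integrable lborel {0..T} (\<lambda>s. fcoef (w s) k)"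
      using v w unfolding has_tderiv_def by blast+
    show "(LBINT s=0..t. fcoef (v s) k) = (LBINT s=0..t. fcoef (w s) k)" if t: "t \<in> {0..T}" for t
    proof -
      have "fcoef (u t) k = fcoef (u 0) k + (LBINT s=0..t. fcoef (v s) k)" using v t unfolding has_tderiv_def by blast
      moreover have "fcoef (u t) k = fcoef (u 0) k + (LBINT s=0..t. fcoef (w s) k)" using w t unfolding has_tderiv_def by blast
      ultimately show ?thesis by simp
    qed
  qed
  then have "AE t in lborel. \<forall>k. t \<in> {0..T} \<longrightarrow> fcoef (v t) k = fcoef (w t) k" by (intro AE_all_countable[THEN iffD2] allI)
  then show ?thesis unfolding L2H_def
    by (intro nn_integral_cong_AE, elim eventually_mono) (auto simp: sobn2_def indicator_def)
qed

section \<open>The trajectory map into F_beta\<close>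

context torus_problem
begin

lemma rate_continuous: "continuous_on A (\<lambda>t. rate x t k)"
proof -
  have "continuous_on A (\<lambda>t. coef (src x t) k / of_real (japanese k ^ b))"
    by (rule continuous_on_divide[OF coef_snd_continuous continuous_on_const]) (simp del: of_real_power)
  then show ?thesis unfolding rate_def
    by (rule continuous_on_add[OF continuous_on_scaleR[OF continuous_on_const ucoef_continuous] continuous_on_scaleR[OF continuous_on_const]])
qed

lemma rate_integral:
  assumes t: "t \<in> {0..T}"
  shows "ucoef x t k = ucoef x 0 k + (LBINT s=0..t. rate x s k)"
proof -
  have "(LBINT s=ereal 0..ereal t. rate x s k) = ucoef x t k - ucoef x 0 k"
  proof (rule interval_integral_FTC_finite)
    fix s assume s: "min 0 t \<le> s" "s \<le> max 0 t"
    then have "s \<in> {0..T}" "{min 0 t..max 0 t} \<subseteq> {0..T}" using t by auto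
    then show "((\<lambda>t. ucoef x t k) has_vector_derivative rate x s k) (at s within {min 0 t..max 0 t})"
      using ucoef_deriv has_vector_derivative_within_subset by blast
  qed (rule rate_continuous)
  then show ?thesis by (simp flip: zero_ereal_def)
qed

lemma rate_integrable: "set_integrable lborel {0..T} (\<lambda>s. rate x s k)"
  by (rule borel_integrable_atLeastAtMost'[OF rate_continuous])

lemma fourier_coeffs_rate: "fourier_coeffs (rate x t)"
proof
  have "(\<lambda>k. rate x t k) summable_on UNIV" using rate_summable[of x t 0] by simp
  then show "(\<lambda>k. cmod (rate x t k)) summable_on UNIV" by (simp only: summable_on_iff_abs_summable_on_complex)
  show "rate x t (- k) = cnj (rate x t k)" for k
    using fourier_coeffs.hermitian[OF fourier_coeffs_ucoef, of x t k]
    by (simp add: rate_def nu_even kappa_even coef_uminus japanese_uminus)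
qed

definition state_rate :: "(int^'d) traj_data \<Rightarrow> real \<Rightarrow> real^'d \<Rightarrow> real" where
  "state_rate x t = fseries (rate x t)"

lemma fcoef_state_rate: "fcoef (state_rate x t) k = rate x t k"
  unfolding state_rate_def by (rule fourier_coeffs.fcoef_fseries[OF fourier_coeffs_rate])

lemma state_has_tderiv: "has_tderiv T (state x) (state_rate x)"
  unfolding has_tderiv_def fcoef_state fcoef_state_rate using rate_integrable rate_integral by blast

lemma fst_le: "norm (fst x) \<le> norm x" for x :: "(int^'d) traj_data"
  by (metis norm_fst_le prod.collapse)

lemma data_energy_le: "(norm (fst x))\<^sup>2 + integral {0..T} (\<lambda>s. (norm (src x s))\<^sup>2) \<le> (1 + T) * (norm x)\<^sup>2"
  for x :: "(int^'d) traj_data"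
proof -
  have "integral {0..T} (\<lambda>s. (norm (src x s))\<^sup>2) \<le> integral {0..T} (\<lambda>s. (norm x)\<^sup>2)"
    by (intro integral_le integrable_continuous_interval norm_snd_continuous continuous_on_const power_mono norm_src_le) auto
  also have "\<dots> = T * (norm x)\<^sup>2" using T_gt_0 by simp
  finally have "integral {0..T} (\<lambda>s. (norm (src x s))\<^sup>2) \<le> T * (norm x)\<^sup>2" .
  moreover have "(norm (fst x))\<^sup>2 \<le> (norm x)\<^sup>2" by (intro power_mono fst_le) auto
  ultimately show ?thesis unfolding distrib_right mult_1_left by linarith
qed

text \<open>The factor \<open>1 + knorm2 k\<close> beyond order \<open>b\<close> splits: the 1 is
  the trajectory bound integrated in time, giving \<open>T * (1 + T)\<close>, and
  \<open>knorm2 k\<close> is dominated by the dissipation, giving \<open>1 + T\<close>; the sum is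
  \<open>(1 + T)\<^sup>2\<close>.\<close>

lemma state_energy:
  assumes F: "finite F"
  shows "integral {0..T} (\<lambda>s. \<Sum>k\<in>F. (japanese k ^ (b + 1))\<^sup>2 * (cmod (ucoef x s k))\<^sup>2) \<le> ((1 + T) * norm x)\<^sup>2"
proof -
  let ?I = "\<lambda>k. integral {0..T} (\<lambda>s. (cmod (traj_coef x s k))\<^sup>2)"
  have T0: "0 \<le> T" using T_gt_0 by simp
  have ci: "(\<lambda>s. (cmod (traj_coef x s k))\<^sup>2) integrable_on {0..T}" for k
    by (intro integrable_continuous_interval continuous_on_power continuous_on_norm continuous_on_subset[OF traj_coef_continuous]) auto
  have I0: "0 \<le> ?I k" for k by (intro integral_nonneg ci) auto
  have w: "(japanese k ^ (b + 1))\<^sup>2 * (cmod (ucoef x s k))\<^sup>2 = (1 + knorm2 k) * (cmod (traj_coef x s k))\<^sup>2" for s k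
  proof -
    have "(japanese k)\<^sup>2 = 1 + knorm2 k" using knorm2_nonneg[of k] by (simp add: japanese_def)
    moreover have "japanese k ^ b * cmod (ucoef x s k) = cmod (traj_coef x s k)"
      by (simp add: ucoef_eq norm_divide norm_power)
    ultimately show ?thesis by (metis (no_types, lifting) mult.assoc power_add power_mult_distrib power_one_right mult.commute)
  qed
  have "integral {0..T} (\<lambda>s. \<Sum>k\<in>F. (japanese k ^ (b + 1))\<^sup>2 * (cmod (ucoef x s k))\<^sup>2) = (\<Sum>k\<in>F. (1 + knorm2 k) * ?I k)"
    unfolding w using integral_sum[OF F, of "\<lambda>k s. (1 + knorm2 k) * (cmod (traj_coef x s k))\<^sup>2"] integrable_on_mult_right[OF ci] by simp
  also have "\<dots> \<le> (\<Sum>k\<in>F. ?I k) + (\<Sum>k\<in>F. (cmod (traj_coef x T k))\<^sup>2 + decay k * ?I k)"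
    unfolding sum.distrib[symmetric]
  proof (rule sum_mono)
    fix k :: "int^'d"
    have "1 \<le> pi\<^sup>2" using pi_ge_two by (intro one_le_power) simp
    then have "knorm2 k \<le> decay k" using knorm2_nonneg[of k] mult_right_mono[of 1 "4 * pi\<^sup>2" "knorm2 k"] by (simp add: decay_def)
    from mult_right_mono[OF this I0[of k]] show "(1 + knorm2 k) * ?I k \<le> ?I k + ((cmod (traj_coef x T k))\<^sup>2 + decay k * ?I k)"
      using zero_le_power2[of "cmod (traj_coef x T k)"] by (simp only: distrib_right mult_1_left)
  qed
  also have "(\<Sum>k\<in>F. (cmod (traj_coef x T k))\<^sup>2 + decay k * ?I k) \<le> (1 + T) * (norm x)\<^sup>2"
    by (rule order_trans[OF traj_coef_energy[OF _ F] data_energy_le]) (use T0 in simp)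
  also have "(\<Sum>k\<in>F. ?I k) \<le> T * ((1 + T) * (norm x)\<^sup>2)"
  proof -
    have "(\<Sum>k\<in>F. ?I k) = integral {0..T} (\<lambda>s. \<Sum>k\<in>F. (cmod (traj_coef x s k))\<^sup>2)" by (rule integral_sum[OF F ci, symmetric])
    also have "\<dots> \<le> integral {0..T} (\<lambda>s. (1 + T) * (norm x)\<^sup>2)"
    proof (rule integral_le)
      show "(\<Sum>k\<in>F. (cmod (traj_coef x s k))\<^sup>2) \<le> (1 + T) * (norm x)\<^sup>2" if "s \<in> {0..T}" for s
      proof -
        have "(\<Sum>k\<in>F. (cmod (traj_coef x s k))\<^sup>2) \<le> (norm (traj x s))\<^sup>2" using sum_coef_le[OF F, of "traj x s"] by (simp add: coef_traj)
        also have "\<dots> \<le> (sqrt (1 + T) * norm x)\<^sup>2" by (intro power_mono norm_traj_le) auto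
        finally show ?thesis using T0 by (simp add: power_mult_distrib)
      qed
    qed (intro integrable_sum F ci integrable_const_ivl)+
    finally show ?thesis using T0 by (simp add: mult_ac)
  qed
  finally show ?thesis by (simp add: power2_eq_square algebra_simps)
qed

lemma L2H_state: "L2H T (real b + 1) (state x) \<le> ennreal (((1 + T) * norm x)\<^sup>2)"
proof -
  have "L2H T (real (b + 1)) (state x) \<le> ennreal (((1 + T) * norm x)\<^sup>2)"
    by (rule L2H_le(1)) (simp_all only: fcoef_state ucoef_continuous state_energy)
  then show ?thesis by (simp add: add.commute)
qed

lemma b_minus_1: "real b - 1 = real (b - 1)" using b_ge by simp

lemma L2H_state_low: "L2H T (real b - 1) (state x) \<le> ennreal (((1 + T) * norm x)\<^sup>2)"
proof -
  have "sobn2 (real b - 1) f \<le> sobn2 (real b + 1) f" for f :: "real^'d \<Rightarrow> real"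
    unfolding sobn2_def by (intro nn_integral_mono ennreal_leI mult_right_mono powr_mono) (auto simp: knorm2_nonneg)
  then have "L2H T (real b - 1) (state x) \<le> L2H T (real b + 1) (state x)"
    unfolding L2H_def by (intro nn_integral_mono mult_right_mono) auto
  with L2H_state show ?thesis by (rule order_trans[rotated])
qed

text \<open>At order \<open>b - 1\<close> the Laplacian uses order \<open>b + 1\<close> of the
  solution, and the divergence term is bounded by the weighted source. Squaring a sum of two terms
  produces \<open>2 * (4 * pi\<^sup>2)\<^sup>2 = 32 * pi ^ 4\<close> and 2.\<close>

lemma L2H_state_rate: "L2H T (real b - 1) (state_rate x) \<le> ennreal ((32 * pi ^ 4 + 2) * ((1 + T) * norm x)\<^sup>2)"
  unfolding b_minus_1
proof (rule L2H_le(1), unfold fcoef_state_rate)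
  fix F :: "(int^'d) set" assume F: "finite F"
  let ?u = "\<lambda>s k. (japanese k ^ (b + 1))\<^sup>2 * (cmod (ucoef x s k))\<^sup>2" and ?g = "\<lambda>s k. (cmod (coef (src x s) k))\<^sup>2"
  have T0: "0 \<le> T" using T_gt_0 by simp
  have j: "japanese k ^ b = japanese k ^ (b - 1) * japanese k" for k :: "int^'d"
    using b_ge by (metis power_minus_mult less_le_trans zero_less_numeral le_add1)
  have pt: "(japanese k ^ (b - 1))\<^sup>2 * (cmod (rate x s k))\<^sup>2 \<le> 32 * pi ^ 4 * ?u s k + 2 * ?g s k" for s k
  proof -
    let ?A = "4 * pi\<^sup>2 * (japanese k ^ (b + 1) * cmod (ucoef x s k))" and ?B = "cmod (coef (src x s) k)"
    have "cmod (rate x s k) \<le> cmod ((- decay k) *\<^sub>R ucoef x s k) + cmod (freq k *\<^sub>R (coef (src x s) k / of_real (japanese k ^ b)))"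
      unfolding rate_def by (rule norm_triangle_ineq)
    also have "\<dots> = decay k * cmod (ucoef x s k) + freq k * (?B / japanese k ^ b)"
      using nu_nonneg[of k] freq_nonneg[of k] by (simp add: norm_divide norm_power)
    finally have "japanese k ^ (b - 1) * cmod (rate x s k) \<le> japanese k ^ (b - 1) * (decay k * cmod (ucoef x s k) + freq k * (?B / japanese k ^ b))"
      by (rule mult_left_mono) simp
    also have "\<dots> \<le> ?A + ?B"
      unfolding distrib_left
    proof (rule add_mono)
      have d: "decay k \<le> 4 * pi\<^sup>2 * (japanese k)\<^sup>2" using knorm2_nonneg[of k] by (simp add: decay_def japanese_def)
      have "japanese k ^ (b - 1) * (decay k * cmod (ucoef x s k)) \<le> japanese k ^ (b - 1) * ((4 * pi\<^sup>2 * (japanese k)\<^sup>2) * cmod (ucoef x s k))"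
        by (intro mult_left_mono mult_right_mono d) auto
      also have "\<dots> = ?A" by (simp add: j power2_eq_square)
      finally show "japanese k ^ (b - 1) * (decay k * cmod (ucoef x s k)) \<le> ?A" .
      have "japanese k ^ (b - 1) * (freq k * (?B / japanese k ^ b)) \<le> japanese k ^ (b - 1) * (japanese k * (?B / japanese k ^ b))"
        by (intro mult_left_mono mult_right_mono freq_le_japanese) auto
      also have "\<dots> = ?B" by (simp add: j)
      finally show "japanese k ^ (b - 1) * (freq k * (?B / japanese k ^ b)) \<le> ?B" .
    qed
    finally have "(japanese k ^ (b - 1) * cmod (rate x s k))\<^sup>2 \<le> (?A + ?B)\<^sup>2" by (rule power_mono) simp
    also have "\<dots> \<le> 2 * ?A\<^sup>2 + 2 * ?B\<^sup>2" using sum_squares_bound[of ?A ?B] unfolding power2_sum by linarith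
    finally show ?thesis by (simp add: power_mult_distrib)
  qed
  have ci: "(\<lambda>s. ?u s k) integrable_on {0..T}" "(\<lambda>s. ?g s k) integrable_on {0..T}" for k
    by (intro integrable_continuous_interval continuous_intros ucoef_continuous coef_snd_continuous)+
  have "integral {0..T} (\<lambda>s. \<Sum>k\<in>F. (japanese k ^ (b - 1))\<^sup>2 * (cmod (rate x s k))\<^sup>2)
     \<le> integral {0..T} (\<lambda>s. 32 * pi ^ 4 * (\<Sum>k\<in>F. ?u s k) + 2 * (norm x)\<^sup>2)"
  proof (rule integral_le)
    show "(\<lambda>s. \<Sum>k\<in>F. (japanese k ^ (b - 1))\<^sup>2 * (cmod (rate x s k))\<^sup>2) integrable_on {0..T}"
      by (intro integrable_continuous_interval continuous_intros rate_continuous)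
    show "(\<lambda>s. 32 * pi ^ 4 * (\<Sum>k\<in>F. ?u s k) + 2 * (norm x)\<^sup>2) integrable_on {0..T}"
      by (intro integrable_continuous_interval continuous_intros ucoef_continuous)
    fix s
    have "(\<Sum>k\<in>F. ?g s k) \<le> (norm x)\<^sup>2"
      by (rule order_trans[OF sum_coef_le[OF F] power_mono[OF norm_src_le norm_ge_zero]])
    moreover have "(\<Sum>k\<in>F. (japanese k ^ (b - 1))\<^sup>2 * (cmod (rate x s k))\<^sup>2) \<le> (\<Sum>k\<in>F. 32 * pi ^ 4 * ?u s k + 2 * ?g s k)"
      by (intro sum_mono pt)
    ultimately show "(\<Sum>k\<in>F. (japanese k ^ (b - 1))\<^sup>2 * (cmod (rate x s k))\<^sup>2) \<le> 32 * pi ^ 4 * (\<Sum>k\<in>F. ?u s k) + 2 * (norm x)\<^sup>2"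
      unfolding sum.distrib sum_distrib_left[symmetric] by linarith
  qed
  also have "\<dots> = 32 * pi ^ 4 * integral {0..T} (\<lambda>s. \<Sum>k\<in>F. ?u s k) + T * (2 * (norm x)\<^sup>2)"
    using integral_add[OF integrable_on_mult_right[OF integrable_sum[OF F ci(1)]] integrable_const_ivl[of "2 * (norm x)\<^sup>2" 0 T]] T0 by simp
  also have "\<dots> \<le> 32 * pi ^ 4 * ((1 + T) * norm x)\<^sup>2 + 2 * ((1 + T) * norm x)\<^sup>2"
  proof (rule add_mono)
    show "32 * pi ^ 4 * integral {0..T} (\<lambda>s. \<Sum>k\<in>F. ?u s k) \<le> 32 * pi ^ 4 * ((1 + T) * norm x)\<^sup>2"
      by (intro mult_left_mono state_energy F) auto
    have "T \<le> (1 + T)\<^sup>2" using T0 by (simp add: power2_eq_square algebra_simps)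
    from mult_right_mono[OF this, of "(norm x)\<^sup>2"] show "T * (2 * (norm x)\<^sup>2) \<le> 2 * ((1 + T) * norm x)\<^sup>2" by (simp add: power_mult_distrib)
  qed
  finally show "integral {0..T} (\<lambda>s. \<Sum>k\<in>F. (japanese k ^ (b - 1))\<^sup>2 * (cmod (rate x s k))\<^sup>2) \<le> (32 * pi ^ 4 + 2) * ((1 + T) * norm x)\<^sup>2"
    by (simp only: distrib_right)
qed (rule rate_continuous)

lemma state_inF: "inF T b (state x)"
  unfolding inF_def
proof (intro conjI exI[of _ "state_rate x"] ballI allI)
  show "L2per (state x t)" for t by (rule state_L2per)
  show "L2per (state_rate x t)" for t unfolding state_rate_def by (rule fourier_coeffs.fseries_L2per[OF fourier_coeffs_rate])
  show "L2H T (real b + 1) (state x) < \<infinity>" using L2H_state[of x] by (rule le_less_trans) simp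
  show "L2H T (real b - 1) (state_rate x) < \<infinity>" using L2H_state_rate[of x] by (rule le_less_trans) simp
  show "(\<lambda>s. fcoef (state_rate x s) k) \<in> borel_measurable lborel" for k
    unfolding fcoef_state_rate using borel_measurable_continuous_onI[OF rate_continuous] by simp
qed (rule state_has_tderiv)

text \<open>Boundedness of the map from data to F_beta, so that estimates of derivatives can be made
  on the data.\<close>

lemma Fnorm_state_le: "Fnorm T b (state x) \<le> (2 + sqrt (32 * pi ^ 4 + 2)) * (1 + T) * norm x"
proof -
  have T0: "0 \<le> T" using T_gt_0 by simp
  have s: "sqrt (enn2real e) \<le> sqrt C" if "e \<le> ennreal C" "0 \<le> C" for e C
    using enn2real_mono[OF that(1)] that(2) by simp
  have "has_tderiv T (state x) (tderiv T (state x))" unfolding tderiv_def by (rule someI[of "has_tderiv T (state x)", OF state_has_tderiv])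
  then have "L2H T (real b - 1) (tderiv T (state x)) = L2H T (real b - 1) (state_rate x)"
    by (rule L2H_tderiv_unique[OF T0 _ state_has_tderiv])
  then have "Fnorm T b (state x) \<le> sqrt (((1 + T) * norm x)\<^sup>2) + sqrt (((1 + T) * norm x)\<^sup>2)
      + sqrt ((32 * pi ^ 4 + 2) * ((1 + T) * norm x)\<^sup>2)"
    unfolding Fnorm_def by (simp only:) (intro add_mono s L2H_state L2H_state_low L2H_state_rate, auto)
  also have "\<dots> = (2 + sqrt (32 * pi ^ 4 + 2)) * (1 + T) * norm x"
  proof -
    have "Y + Y + S * Y = (2 + S) * (1 + T) * n" if "Y = (1 + T) * n" for S Y n by (simp add: that algebra_simps)
    moreover have "sqrt (((1 + T) * norm x)\<^sup>2) = (1 + T) * norm x" using T0 by simp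
    ultimately show ?thesis by (simp only: real_sqrt_mult[of "32 * pi ^ 4 + 2"])
  qed
  finally show ?thesis .
qed

end

text \<open>The integrand of a weak equation is known almost everywhere; if a continuous function
  represents it, the equation is classical.\<close>

lemma has_vector_derivative_of_AE_integral:
  fixes z G h :: "real \<Rightarrow> complex"
  assumes G: "set_integrable lborel {0..T} G" and z: "\<And>t. t \<in> {0..T} \<Longrightarrow> z t = z 0 + (LBINT s=0..t. G s)"
    and ae: "AE s in lborel. s \<in> {0..T} \<longrightarrow> G s = h s" and h: "continuous_on {0..T} h" and t: "t \<in> {0..T}"
  shows "(z has_vector_derivative h t) (at t within {0..T})"
proof -
  have hi: "set_integrable lborel {0..T} h" by (rule borel_integrable_atLeastAtMost'[OF h])
  have eq: "z r = z 0 + integral {0..r} h" if r: "r \<in> {0..T}" for r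
  proof -
    have sub: "set_integrable lborel {0..r} G" "set_integrable lborel {0..r} h"
      using r by (auto intro: set_integrable_subset[OF G] set_integrable_subset[OF hi])
    have "(LBINT s=0..r. G s) = (LBINT s:{0..r}. G s)"
      using interval_integral_Icc[of 0 r G] r by (simp flip: zero_ereal_def)
    also have "\<dots> = (LBINT s:{0..r}. h s)"
      unfolding set_lebesgue_integral_def
    proof (rule integral_cong_AE)
      show "(\<lambda>s. indicator {0..r} s *\<^sub>R G s) \<in> borel_measurable lborel" "(\<lambda>s. indicator {0..r} s *\<^sub>R h s) \<in> borel_measurable lborel"
        using sub unfolding set_integrable_def by (blast intro: borel_measurable_integrable)+
      show "AE s in lborel. indicator {0..r} s *\<^sub>R G s = indicator {0..r} s *\<^sub>R h s"
        using ae by (rule eventually_mono) (use r in \<open>auto simp: indicator_def\<close>)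
    qed
    also have "\<dots> = integral {0..r} h" by (rule set_borel_integral_eq_integral(2)[OF sub(2)])
    finally show ?thesis using z[OF r] by simp
  qed
  have "((\<lambda>r. z 0 + integral {0..r} h) has_vector_derivative 0 + h t) (at t within {0..T})"
    by (intro has_vector_derivative_add has_vector_derivative_const integral_has_vector_derivative[OF h t])
  from has_vector_derivative_transform[OF t eq this] show ?thesis by simp
qed

section \<open>Uniqueness in F_beta\<close>

interpretation drift: twist_kernel drift_kernel "4 * pi\<^sup>2"
  by (rule twist_kernel_drift_kernel)

text \<open>Coefficients without weight: members of F_beta are compared in plain l2, where
  \<open>drift_kernel\<close> is bounded as it stands.\<close>

definition fvec :: "(real^'d \<Rightarrow> real) \<Rightarrow> (int^'d) hl2" where
  "fvec f = Hl2 (fcoef f)"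

lemma coef_fvec: "L2per f \<Longrightarrow> coef (fvec f) = fcoef f"
  unfolding fvec_def by (rule coef_Hl2[OF fcoef_uminus fcoef_l2_bound])

lemma driftc_fvec:
  assumes "Wdot W" "L2per a" "L2per b" "(\<lambda>k. cmod (fcoef b k)) summable_on UNIV"
  shows "driftc a W b k = of_real (freq k) * coef (tconv drift_kernel (potential W) (fvec a) (fvec b)) k"
  unfolding driftc_eq[OF assms] drift.coef_tconv' coef_fvec[OF assms(2)] coef_fvec[OF assms(3)] ..

lemma inF_L2per: "inF T b u \<Longrightarrow> t \<in> {0..T} \<Longrightarrow> L2per (u t)"
  by (simp add: inF_def)

lemma has_tderiv_continuous:
  assumes "has_tderiv T u v" shows "continuous_on {0..T} (\<lambda>t. fcoef (u t) k)"
proof -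
  have v: "set_integrable lborel {0..T} (\<lambda>s. fcoef (v s) k)" using assms unfolding has_tderiv_def by blast
  have "continuous_on {0..T} (\<lambda>t. fcoef (u 0) k + integral {0..t} (\<lambda>s. fcoef (v s) k))"
    by (intro continuous_on_add continuous_on_const indefinite_integral_continuous_1 set_borel_integral_eq_integral(1)[OF v])
  then show ?thesis
  proof (rule continuous_on_eq)
    fix t assume t: "t \<in> {0..T}"
    have "(LBINT s=0..t. fcoef (v s) k) = integral {0..t} (\<lambda>s. fcoef (v s) k)"
      using interval_integral_eq_integral[of 0 t "\<lambda>s. fcoef (v s) k"] set_integrable_subset[OF v, of "{0..t}"] t
      by (simp flip: zero_ereal_def)
    moreover have "fcoef (u t) k = fcoef (u 0) k + (LBINT s=0..t. fcoef (v s) k)"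
      using assms t unfolding has_tderiv_def by blast
    ultimately show "fcoef (u 0) k + integral {0..t} (\<lambda>s. fcoef (v s) k) = fcoef (u t) k" by simp
  qed
qed

lemma inF_continuous: "inF T b u \<Longrightarrow> continuous_on {0..T} (\<lambda>t. fcoef (u t) k)"
  unfolding inF_def by (elim conjE exE) (rule has_tderiv_continuous)

lemma sum_energy_le_L2H:
  fixes u :: "real \<Rightarrow> real^'d \<Rightarrow> real"
  assumes m: "\<And>k. (\<lambda>s. ennreal ((cmod (fcoef (u s) k))\<^sup>2) * indicator {0..T} s) \<in> borel_measurable lborel"
    and r: "0 \<le> r" and F: "finite F"
  shows "(\<Sum>k\<in>F. \<integral>\<^sup>+s. ennreal ((cmod (fcoef (u s) k))\<^sup>2) * indicator {0..T} s \<partial>lborel) \<le> L2H T r u"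
proof -
  have "(\<Sum>k\<in>F. \<integral>\<^sup>+s. ennreal ((cmod (fcoef (u s) k))\<^sup>2) * indicator {0..T} s \<partial>lborel)
      = (\<integral>\<^sup>+s. (\<Sum>k\<in>F. ennreal ((cmod (fcoef (u s) k))\<^sup>2) * indicator {0..T} s) \<partial>lborel)"
    by (rule nn_integral_sum[symmetric]) (rule m)
  also have "\<dots> \<le> L2H T r u" unfolding L2H_def
  proof (intro nn_integral_mono)
    fix s
    have "(\<Sum>k\<in>F. ennreal ((cmod (fcoef (u s) k))\<^sup>2)) \<le> (\<Sum>k\<in>F. ennreal ((1 + knorm2 k) powr r * (cmod (fcoef (u s) k))\<^sup>2))"
    proof (intro sum_mono ennreal_leI)
      fix k :: "int^'d"
      have "1 \<le> (1 + knorm2 k) powr r" using knorm2_nonneg[of k] r by (intro ge_one_powr_ge_zero) auto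
      from mult_right_mono[OF this, of "(cmod (fcoef (u s) k))\<^sup>2"]
      show "(cmod (fcoef (u s) k))\<^sup>2 \<le> (1 + knorm2 k) powr r * (cmod (fcoef (u s) k))\<^sup>2" by simp
    qed
    also have "\<dots> \<le> sobn2 r (u s)" unfolding sobn2_def by (rule sum_le_nn_integral_count_space[OF F])
    finally show "(\<Sum>k\<in>F. ennreal ((cmod (fcoef (u s) k))\<^sup>2) * indicator {0..T} s) \<le> sobn2 r (u s) * indicator {0..T} s"
      unfolding sum_distrib_right[symmetric] by (rule mult_right_mono) simp
  qed
  finally show ?thesis .
qed

text \<open>Averaging \<open>|z(t)|\<^sup>2 \<le> 2|z(s)|\<^sup>2 + 8(\<integral>|v|)\<^sup>2\<close> over \<open>s\<close>.\<close>
lemma time_trace_bound: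
  fixes z v :: "real \<Rightarrow> complex"
  assumes T: "0 < T" and v: "set_integrable lborel {0..T} v" and zv: "\<And>t. t \<in> {0..T} \<Longrightarrow> z t = z 0 + (LBINT s=0..t. v s)"
    and vm: "v \<in> borel_measurable lborel"
    and zm: "(\<lambda>s. ennreal ((cmod (z s))\<^sup>2) * indicator {0..T} s) \<in> borel_measurable lborel"
    and t: "t \<in> {0..T}"
  shows "ennreal (T * (cmod (z t))\<^sup>2) \<le> 2 * (\<integral>\<^sup>+s. ennreal ((cmod (z s))\<^sup>2) * indicator {0..T} s \<partial>lborel)
    + ennreal (8 * T * T) * (\<integral>\<^sup>+s. ennreal ((cmod (v s))\<^sup>2) * indicator {0..T} s \<partial>lborel)"
    (is "_ \<le> 2 * ?E + _ * ?D")
proof -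
  \<comment> \<open>The L1 norm of \<open>v\<close>. Both \<open>z t\<close> and \<open>z s\<close>
    lie within \<open>c\<close> of \<open>z 0\<close>, so they differ by at most
    \<open>2 * c\<close>, and \<open>2 * (2 * c)\<^sup>2\<close> is the origin of the 8.\<close>
  define c where "c = (LINT s|lborel. cmod (indicator {0..T} s *\<^sub>R v s))"
  have vi: "integrable lborel (\<lambda>s. indicator {0..T} s *\<^sub>R v s)" using v by (simp add: set_integrable_def)
  have c0: "0 \<le> c" unfolding c_def by simp
  have near: "cmod (z r - z 0) \<le> c" if r: "r \<in> {0..T}" for r
  proof -
    have ri: "integrable lborel (\<lambda>s. indicator {0..r} s *\<^sub>R v s)"
      using set_integrable_subset[OF v, of "{0..r}"] r by (simp add: set_integrable_def)
    have "z r - z 0 = (LBINT s:{0..r}. v s)"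
      using zv[OF r] interval_integral_Icc[of 0 r v] r by (simp flip: zero_ereal_def)
    then have "cmod (z r - z 0) \<le> (LINT s|lborel. cmod (indicator {0..r} s *\<^sub>R v s))"
      unfolding set_lebesgue_integral_def by (simp only: integral_norm_bound)
    also have "\<dots> \<le> c" unfolding c_def
      by (rule integral_mono[OF integrable_norm[OF ri] integrable_norm[OF vi]]) (use r in \<open>auto simp: indicator_def\<close>)
    finally show ?thesis .
  qed
  have c2: "ennreal (c\<^sup>2) \<le> ?D * ennreal T"
  proof -
    have "ennreal c = (\<integral>\<^sup>+s. ennreal (cmod (indicator {0..T} s *\<^sub>R v s)) \<partial>lborel)"
      unfolding c_def by (rule nn_integral_eq_integral[OF integrable_norm[OF vi], symmetric]) simp
    also have "\<dots> = (\<integral>\<^sup>+s. (ennreal (cmod (v s)) * indicator {0..T} s) * indicator {0..T} s \<partial>lborel)"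
      by (intro nn_integral_cong) (simp add: indicator_def)
    finally have "(ennreal c)\<^sup>2 = (\<integral>\<^sup>+s. (ennreal (cmod (v s)) * indicator {0..T} s) * indicator {0..T} s \<partial>lborel)\<^sup>2" by simp
    also have "\<dots> \<le> (\<integral>\<^sup>+s. (ennreal (cmod (v s)) * indicator {0..T} s)\<^sup>2 \<partial>lborel) * (\<integral>\<^sup>+s. (indicator {0..T} s)\<^sup>2 \<partial>lborel)"
      by (intro Cauchy_Schwarz_nn_integral borel_measurable_times_ennreal borel_measurable_indicator
          measurable_compose[OF vm measurable_compose[OF borel_measurable_norm measurable_ennreal]]) auto
    also have "(\<integral>\<^sup>+s. (ennreal (cmod (v s)) * indicator {0..T} s)\<^sup>2 \<partial>lborel) = ?D"
      by (intro nn_integral_cong) (simp add: indicator_def ennreal_power)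
    also have "(\<integral>\<^sup>+s. (indicator {0..T} s)\<^sup>2 \<partial>lborel) = (\<integral>\<^sup>+s. indicator {0..T} s \<partial>lborel)"
      by (intro nn_integral_cong) (simp add: indicator_def)
    also have "\<dots> = ennreal T" using T by simp
    finally show ?thesis using c0 by (simp add: ennreal_power)
  qed
  have pt: "(cmod (z t))\<^sup>2 \<le> 2 * (cmod (z s))\<^sup>2 + 8 * c\<^sup>2" if s: "s \<in> {0..T}" for s
  proof -
    have "cmod (z t) \<le> cmod (z s) + (cmod (z t - z 0) + cmod (z s - z 0))"
      using norm_triangle_ineq[of "z s" "z t - z s"] norm_triangle_ineq4[of "z t - z 0" "z s - z 0"] by simp
    also have "\<dots> \<le> cmod (z s) + 2 * c" using near[OF t] near[OF s] by simp
    finally have "(cmod (z t))\<^sup>2 \<le> (cmod (z s) + 2 * c)\<^sup>2" by (rule power_mono) simp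
    also have "\<dots> \<le> 2 * (cmod (z s))\<^sup>2 + 8 * c\<^sup>2"
      using sum_squares_bound[of "cmod (z s)" "2 * c"] unfolding power2_sum by (simp add: power_mult_distrib)
    finally show ?thesis .
  qed
  have "ennreal (T * (cmod (z t))\<^sup>2) = (\<integral>\<^sup>+s. ennreal ((cmod (z t))\<^sup>2) * indicator {0..T} s \<partial>lborel)"
    using T by (simp add: nn_integral_cmult_indicator ennreal_mult' mult.commute[of T])
  also have "\<dots> \<le> (\<integral>\<^sup>+s. 2 * (ennreal ((cmod (z s))\<^sup>2) * indicator {0..T} s) + ennreal (8 * c\<^sup>2) * indicator {0..T} s \<partial>lborel)"
  proof (intro nn_integral_mono)
    fix s
    have e: "2 * ennreal ((cmod (z s))\<^sup>2) + ennreal (8 * c\<^sup>2) = ennreal (2 * (cmod (z s))\<^sup>2 + 8 * c\<^sup>2)"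
      by (simp add: ennreal_plus ennreal_mult)
    show "ennreal ((cmod (z t))\<^sup>2) * indicator {0..T} s
        \<le> 2 * (ennreal ((cmod (z s))\<^sup>2) * indicator {0..T} s) + ennreal (8 * c\<^sup>2) * indicator {0..T} s"
      using ennreal_leI[OF pt[of s]] unfolding e[symmetric] by (cases "s \<in> {0..T}") simp_all
  qed
  also have "\<dots> = 2 * ?E + ennreal (8 * c\<^sup>2) * ennreal T"
    using zm T by (subst nn_integral_add) (simp_all add: nn_integral_cmult nn_integral_cmult_indicator)
  also have "ennreal (8 * c\<^sup>2) * ennreal T \<le> ennreal (8 * T * T) * ?D"
  proof -
    have "ennreal (8 * c\<^sup>2) * ennreal T = ennreal (8 * T) * ennreal (c\<^sup>2)"
      using T by (simp add: ennreal_mult[symmetric] mult_ac)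
    also have "\<dots> \<le> ennreal (8 * T) * (?D * ennreal T)" by (rule mult_left_mono[OF c2]) simp
    also have "\<dots> = ennreal (8 * T * T) * ?D" using T by (simp add: ennreal_mult mult_ac)
    finally show ?thesis .
  qed
  finally show ?thesis by (simp add: add_left_mono)
qed

text \<open>\<open>time_trace_bound\<close> summed over the modes. Since \<open>1 \<le> b\<close>,
  both Sobolev orders are nonnegative, so the plain square sums of \<open>u\<close> and of its time
  derivative are finite after integration in time.\<close>

lemma inF_bounded:
  fixes u :: "real \<Rightarrow> real^'d \<Rightarrow> real"
  assumes T: "0 < T" and b: "1 \<le> b" and u: "inF T b u"
  shows "\<exists>M. \<forall>t\<in>{0..T}. norm (fvec (u t)) \<le> M"
proof -
  from u obtain v where v: "has_tderiv T u v" and vm: "\<And>k. (\<lambda>s. fcoef (v s) k) \<in> borel_measurable lborel"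
    and L: "L2H T (real b + 1) u < \<infinity>" "L2H T (real b - 1) v < \<infinity>" unfolding inF_def by blast
  have mu: "(\<lambda>s. ennreal ((cmod (fcoef (u s) k))\<^sup>2) * indicator {0..T} s) \<in> borel_measurable lborel" for k
  proof -
    have "(\<lambda>s. ennreal (indicator {0..T} s *\<^sub>R (cmod (fcoef (u s) k))\<^sup>2)) \<in> borel_measurable lborel"
      using borel_measurable_continuous_on_indicator[OF _ continuous_on_power[OF continuous_on_norm[OF has_tderiv_continuous[OF v, of k]]], of 2] by simp
    then show ?thesis by (rule measurable_cong[THEN iffD1, rotated]) (simp add: indicator_def)
  qed
  have mv: "(\<lambda>s. ennreal ((cmod (fcoef (v s) k))\<^sup>2) * indicator {0..T} s) \<in> borel_measurable lborel" for k
    using vm[of k] by measurable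
  define B where "B = 2 * L2H T (real b + 1) u + ennreal (8 * T * T) * L2H T (real b - 1) v"
  have B: "B < \<infinity>" unfolding B_def using L by (simp add: ennreal_mult_less_top)
  let ?E = "\<lambda>k. \<integral>\<^sup>+s. ennreal ((cmod (fcoef (u s) k))\<^sup>2) * indicator {0..T} s \<partial>lborel"
  let ?D = "\<lambda>k. \<integral>\<^sup>+s. ennreal ((cmod (fcoef (v s) k))\<^sup>2) * indicator {0..T} s \<partial>lborel"
  have le: "(\<Sum>k\<in>F. (cmod (fcoef (u t) k))\<^sup>2) \<le> enn2real B / T" if F: "finite F" and t: "t \<in> {0..T}" for F t
  proof -
    have "ennreal (T * (\<Sum>k\<in>F. (cmod (fcoef (u t) k))\<^sup>2)) = (\<Sum>k\<in>F. ennreal (T * (cmod (fcoef (u t) k))\<^sup>2))"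
      using T by (simp add: sum_distrib_left sum_ennreal)
    also have "\<dots> \<le> (\<Sum>k\<in>F. 2 * ?E k + ennreal (8 * T * T) * ?D k)"
    proof (rule sum_mono)
      fix k
      show "ennreal (T * (cmod (fcoef (u t) k))\<^sup>2) \<le> 2 * ?E k + ennreal (8 * T * T) * ?D k"
      proof (rule time_trace_bound[OF T _ _ vm mu t])
        show "set_integrable lborel {0..T} (\<lambda>s. fcoef (v s) k)" using v unfolding has_tderiv_def by blast
        show "fcoef (u t) k = fcoef (u 0) k + (LBINT s=0..t. fcoef (v s) k)" if "t \<in> {0..T}" for t
          using v that unfolding has_tderiv_def by blast
      qed
    qed
    also have "\<dots> = 2 * (\<Sum>k\<in>F. ?E k) + ennreal (8 * T * T) * (\<Sum>k\<in>F. ?D k)" by (simp only: sum.distrib sum_distrib_left)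
    also have "\<dots> \<le> B" unfolding B_def
      using b by (intro add_mono mult_left_mono sum_energy_le_L2H mu mv F) auto
    finally have "enn2real (ennreal (T * (\<Sum>k\<in>F. (cmod (fcoef (u t) k))\<^sup>2))) \<le> enn2real B"
      using B by (intro enn2real_mono) auto
    then have "T * (\<Sum>k\<in>F. (cmod (fcoef (u t) k))\<^sup>2) \<le> enn2real B" using T by (simp add: sum_nonneg)
    then show ?thesis using T by (simp add: pos_le_divide_eq mult.commute)
  qed
  have "norm (fvec (u t)) \<le> sqrt (enn2real B / T)" if t: "t \<in> {0..T}" for t
  proof (rule real_le_rsqrt, rule norm_sq_hl2_le)
    show "(\<Sum>k\<in>F. (cmod (coef (fvec (u t)) k))\<^sup>2) \<le> enn2real B / T" if "finite F" for F
      unfolding coef_fvec[OF inF_L2per[OF u t]] by (rule le[OF that t])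
  qed
  then show ?thesis by blast
qed

lemma evolves_cong:
  assumes "\<And>s k. s \<in> {0..T} \<Longrightarrow> G s k = G' s k"
  shows "evolves T u G \<longleftrightarrow> evolves T u G'"
proof -
  have "set_integrable lborel {0..T} (\<lambda>s. G s k) \<longleftrightarrow> set_integrable lborel {0..T} (\<lambda>s. G' s k)" for k
    by (rule set_integrable_cong) (use assms in auto)
  moreover have "(LBINT s=0..t. G s k) = (LBINT s=0..t. G' s k)" if t: "t \<in> {0..T}" for t k
  proof -
    have "(LBINT s:{0..t}. G s k) = (LBINT s:{0..t}. G' s k)"
      by (rule set_lebesgue_integral_cong) (use assms t in auto)
    then show ?thesis
      using interval_integral_Icc[of 0 t "\<lambda>s. G s k"] interval_integral_Icc[of 0 t "\<lambda>s. G' s k"] t by (simp flip: zero_ereal_def)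
  qed
  ultimately show ?thesis unfolding evolves_def by simp
qed

context torus_problem
begin

text \<open>A finite \<open>L2H\<close> norm gives a finite Sobolev norm of order
  \<open>b + 1\<close> for almost every time, and there the weights make the coefficients
  summable.\<close>

lemma inF_AE_summable:
  fixes u :: "real \<Rightarrow> real^'d \<Rightarrow> real"
  assumes u: "inF T b u"
  shows "AE s in lborel. s \<in> {0..T} \<longrightarrow> (\<lambda>k. cmod (fcoef (u s) k)) summable_on UNIV"
proof -
  have eq: "real b + 1 = real (b + 1)" by simp
  let ?I = "\<lambda>t. sobn2 (real (b + 1)) (u t) * indicator {0..T} t"
  have m: "?I \<in> borel_measurable lborel"
    by (rule L2H_le(2)[OF inF_continuous[OF u]])
  have "(\<integral>\<^sup>+t. ?I t \<partial>lborel) \<noteq> \<infinity>" using u unfolding inF_def L2H_def eq by auto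
  from nn_integral_PInf_AE[OF m this] show ?thesis
  proof (rule eventually_mono, intro impI)
    fix s assume "?I s \<noteq> \<infinity>" "s \<in> {0..T}"
    then have "sobn2 (real (b + 1)) (u s) < \<infinity>" by (simp add: less_top)
    note l2 = sobolev_l2_bound[OF this]
    define f where "f = Hl2 (\<lambda>k. of_real (japanese k ^ (b + 1)) * fcoef (u s) k)"
    have cf: "coef f = (\<lambda>k. of_real (japanese k ^ (b + 1)) * fcoef (u s) k)"
      unfolding f_def by (rule coef_Hl2[OF _ l2]) (simp add: japanese_uminus fcoef_uminus)
    show "(\<lambda>k. cmod (fcoef (u s) k)) summable_on UNIV"
    proof (rule summable_on_comparison_test[OF weighted_coef_summable[of f]])
      fix k
      have "japanese k ^ (b - 2) * cmod (fcoef (u s) k) \<le> japanese k ^ (b + 1) * cmod (fcoef (u s) k)"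
        by (intro mult_right_mono power_increasing japanese_ge_1) auto
      then have "cmod (fcoef (u s) k) \<le> japanese k ^ (b + 1) * cmod (fcoef (u s) k) / japanese k ^ (b - 2)"
        using japanese_pos[of k "b - 2"] by (simp only: pos_le_divide_eq mult.commute)
      then show "cmod (fcoef (u s) k) \<le> cmod (coef f k) / japanese k ^ (b - 2)"
        by (simp add: cf norm_mult norm_power)
    qed simp
  qed
qed

text \<open>Serves the nonlinear and the linearised equation: in both, the difference solves a
  linear equation with given coefficients \<open>a\<close> and \<open>c\<close>. The identity is
  asked for almost every time, and \<open>tconv\<close> supplies the continuous representative that
  makes the equation of each mode classical.\<close>

lemma F_unique:
  fixes u d :: "real \<Rightarrow> real^'d \<Rightarrow> real" and a c :: "real \<Rightarrow> (int^'d) hl2"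
  assumes u: "inF T b u" and d: "inF T b d" and eu: "evolves T u G1" and ed: "evolves T d G2"
    and init: "\<And>k. fcoef (u 0) k = fcoef (d 0) k"
    and a: "\<And>k. continuous_on {0..T} (\<lambda>s. coef (a s) k)" "\<And>s. s \<in> {0..T} \<Longrightarrow> norm (a s) \<le> A"
    and c: "\<And>k. continuous_on {0..T} (\<lambda>s. coef (c s) k)" "\<And>s. s \<in> {0..T} \<Longrightarrow> norm (c s) \<le> A"
    and ae: "AE s in lborel. s \<in> {0..T} \<longrightarrow> (\<forall>k. G1 s k - G2 s k = lapc (u s) k - lapc (d s) k
       + of_real (freq k) * coef (tconv drift_kernel p (fvec (u s) - fvec (d s)) (a s) + tconv drift_kernel p (c s) (fvec (u s) - fvec (d s))) k)"
  shows "feq T u d"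
proof -
  define w where "w s = fvec (u s) - fvec (d s)" for s
  define z where "z s k = fcoef (u s) k - fcoef (d s) k" for s k
  define g where "g s = tconv drift_kernel p (w s) (a s) + tconv drift_kernel p (c s) (w s)" for s
  have wz: "coef (w s) = z s" if "s \<in> {0..T}" for s
    unfolding w_def z_def using coef_fvec[OF inF_L2per[OF u that]] coef_fvec[OF inF_L2per[OF d that]] by auto
  obtain Mu where Mu: "\<forall>t\<in>{0..T}. norm (fvec (u t)) \<le> Mu" using inF_bounded[OF T_gt_0 _ u] b_ge by auto
  obtain Md where Md: "\<forall>t\<in>{0..T}. norm (fvec (d t)) \<le> Md" using inF_bounded[OF T_gt_0 _ d] b_ge by auto
  have wM: "norm (w s) \<le> Mu + Md" if "s \<in> {0..T}" for s
    unfolding w_def using norm_triangle_ineq4[of "fvec (u s)" "fvec (d s)"] Mu Md that by (smt (verit))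
  have zc: "continuous_on {0..T} (\<lambda>s. z s k)" for k
    unfolding z_def by (intro continuous_on_diff inF_continuous[OF u] inF_continuous[OF d])
  have wc: "continuous_on {0..T} (\<lambda>s. coef (w s) k)" for k
    using zc[of k] by (rule continuous_on_eq) (simp add: wz)
  have gc: "continuous_on {0..T} (\<lambda>s. coef (g s) k)" for k
    unfolding g_def coef_add drift.coef_tconv'
    by (intro continuous_on_add continuous_on_twist_conv[where P = "norm p" and S = "4 * pi\<^sup>2"] l2_bound_norm
        kernel_bound_abs wc a(1) c(1))
      (rule l2_bound_mono[OF l2_bound_norm], erule wM a(2) c(2))+
  have deriv: "((\<lambda>t. z t k) has_vector_derivative (- decay k) *\<^sub>R z t k + freq k *\<^sub>R coef (g t) k) (at t within {0..T})"
    if t: "t \<in> {0..T}" for t k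
  proof (rule has_vector_derivative_of_AE_integral[OF _ _ _ _ t])
    have i: "set_integrable lborel {0..T} (\<lambda>s. G1 s k)" "set_integrable lborel {0..T} (\<lambda>s. G2 s k)"
      using eu ed unfolding evolves_def by blast+
    show "set_integrable lborel {0..T} (\<lambda>s. G1 s k - G2 s k)" by (rule set_integral_diff(1)[OF i])
    show "continuous_on {0..T} (\<lambda>t. (- decay k) *\<^sub>R z t k + freq k *\<^sub>R coef (g t) k)"
      by (intro continuous_on_add continuous_on_scaleR continuous_on_const zc gc)
    show "z t k = z 0 k + (LBINT s=0..t. G1 s k - G2 s k)" if t: "t \<in> {0..T}" for t
    proof -
      have e: "fcoef (u t) k = fcoef (u 0) k + (LBINT s=0..t. G1 s k)" "fcoef (d t) k = fcoef (d 0) k + (LBINT s=0..t. G2 s k)"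
        using eu ed t unfolding evolves_def by blast+
      have "(LBINT s:{0..t}. G1 s k - G2 s k) = (LBINT s:{0..t}. G1 s k) - (LBINT s:{0..t}. G2 s k)"
        by (rule set_integral_diff(2)) (use t in \<open>auto intro: set_integrable_subset[OF i(1)] set_integrable_subset[OF i(2)]\<close>)
      then have "(LBINT s=0..t. G1 s k - G2 s k) = (LBINT s=0..t. G1 s k) - (LBINT s=0..t. G2 s k)"
        using interval_integral_Icc[of 0 t "\<lambda>s. G1 s k - G2 s k"] interval_integral_Icc[of 0 t "\<lambda>s. G1 s k"]
          interval_integral_Icc[of 0 t "\<lambda>s. G2 s k"] t by (simp flip: zero_ereal_def)
      then show ?thesis unfolding z_def e by simp
    qed
    show "AE s in lborel. s \<in> {0..T} \<longrightarrow> G1 s k - G2 s k = (- decay k) *\<^sub>R z s k + freq k *\<^sub>R coef (g s) k"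
      using ae by (rule eventually_mono)
        (simp add: g_def w_def z_def lapc_def decay_def scaleR_conv_of_real algebra_simps)
  qed
  have A0: "0 \<le> A" using a(2)[of 0] T_gt_0 norm_ge_zero[of "a 0"] by (simp del: norm_ge_zero)
  have "z t k = 0" if t: "t \<in> {0..T}" for t k
  proof (rule parabolic_unique[where w = z and g = "\<lambda>s. coef (g s)" and C = "8 * pi\<^sup>2 * norm p * A", OF deriv gc kappa_le _ _ _ t])
    show "l2_bound (z s) (Mu + Md)" if "s \<in> {0..T}" for s
      using l2_bound_mono[OF l2_bound_norm wM[OF that]] unfolding wz[OF that] .
    show "z 0 k = 0" for k by (simp add: z_def init)
    fix s N assume s: "s \<in> {0..T}" and N: "l2_bound (z s) N"
    have wN: "norm (w s) \<le> N" by (rule norm_hl2_le) (simp add: wz[OF s] N)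
    have N0: "0 \<le> N" by (rule l2_bound_nonneg[OF N])
    have "norm (tconv drift_kernel p (w s) (a s)) \<le> 4 * pi\<^sup>2 * norm p * A * N"
      by (rule order_trans[OF drift.norm_tconv]) (intro mult_mono a(2)[OF s] wN mult_nonneg_nonneg A0; simp)
    moreover have "norm (tconv drift_kernel p (c s) (w s)) \<le> 4 * pi\<^sup>2 * norm p * N * A"
      by (rule order_trans[OF drift.norm_tconv]) (intro mult_mono c(2)[OF s] wN mult_nonneg_nonneg N0; simp)
    ultimately have "norm (g s) \<le> 4 * pi\<^sup>2 * norm p * A * N + 4 * pi\<^sup>2 * norm p * N * A"
      unfolding g_def by (rule norm_triangle_le[OF add_mono])
    also have "\<dots> = 8 * pi\<^sup>2 * norm p * A * N" by simp
    finally have "norm (g s) \<le> 8 * pi\<^sup>2 * norm p * A * N" .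
    with l2_bound_norm show "l2_bound (coef (g s)) (8 * pi\<^sup>2 * norm p * A * N)" by (rule l2_bound_mono)
  qed
  then show ?thesis unfolding feq_def z_def by simp
qed

end

lemma driftc_cong:
  assumes W: "Wdot W" and a: "L2per a" "L2per a'" and b: "L2per b" "L2per b'"
    and eq: "\<And>k. fcoef a k = fcoef a' k" "\<And>k. fcoef b k = fcoef b' k" and s: "(\<lambda>k. cmod (fcoef b k)) summable_on UNIV"
  shows "driftc a W b k = driftc a' W b' k"
proof -
  have "fcoef a = fcoef a'" "fcoef b = fcoef b'" using eq by auto
  with driftc_eq[OF W a(1) b(1) s] driftc_eq[OF W a(2) b(2)] s show ?thesis by simp
qed

lemma AE_wpd_add_le:
  assumes W: "Wdot W" and H: "Wdot H"
  shows "AE y in torus. \<bar>wpd (Wcomb 1 W H) j y\<bar> \<le> Wnorm W + Wnorm H"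
proof -
  have w: "has_wpd W j (wpd W j)" "has_wpd H j (wpd H j)" by (rule has_wpd_wpd[OF W], rule has_wpd_wpd[OF H])
  have s: "has_wpd (Wcomb 1 W H) j (\<lambda>y. 1 * wpd W j y + wpd H j y)"
    unfolding Wcomb_def by (rule has_wpd_lin[OF Wdot_L2per[OF W] Wdot_L2per[OF H] w])
  have c: "has_wpd (Wcomb 1 W H) j (wpd (Wcomb 1 W H) j)" by (rule has_wpd_wpd[OF Wdot_comb[OF W H]])
  have "AE y in torus. wpd (Wcomb 1 W H) j y = 1 * wpd W j y + wpd H j y"
    by (rule AE_eq_of_fcoef_eq) (use s c in \<open>simp_all add: has_wpd_def L2per_L1per\<close>)
  then show ?thesis using AE_wpd_le[OF W, of j] AE_wpd_le[OF H, of j]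
    by eventually_elim linarith
qed

lemma norm_prod_potential_le:
  "set hs \<subseteq> Collect Wdot \<Longrightarrow> norm_prod (map potential hs) \<le> prod_list (map Wnorm hs)"
proof (induction hs)
  case (Cons H hs)
  have "norm (potential H) \<le> Wnorm H" using Cons.prems by (intro norm_potential_le) auto
  moreover from this have "0 \<le> Wnorm H" using norm_ge_zero by (rule order_trans[rotated])
  ultimately have "norm (potential H) * norm_prod (map potential hs) \<le> Wnorm H * prod_list (map Wnorm hs)"
    using Cons by (intro mult_mono norm_prod_nonneg) auto
  then show ?case by simp
qed simp

lemma tconv_diff:
  "tconv drift_kernel p a b - tconv drift_kernel p a' b' = tconv drift_kernel p (a - a') b + tconv drift_kernel p a' (b - b')"
  by (simp add: bounded_bilinear.diff_left[OF drift.bounded_bilinear_tconv] bounded_bilinear.diff_right[OF drift.bounded_bilinear_tconv])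

section \<open>The forward map and its derivatives\<close>

context torus_problem
begin

text \<open>The source of a datum as it enters the equation of the function: weight removed,
  divergence restored. On \<open>Q\<close> it becomes the drift term.\<close>

definition forcing :: "(int^'d) traj_data \<Rightarrow> real \<Rightarrow> int^'d \<Rightarrow> complex" where
  "forcing x s k = of_real (freq k) * (coef (src x s) k / of_real (japanese k ^ b))"

lemma rate_forcing: "rate x s k = lapc (state x s) k + forcing x s k"
  by (simp add: rate_def forcing_def lapc_def fcoef_state decay_def scaleR_conv_of_real)

lemma forcing_init: "forcing (phi0, 0) s k = 0"
  by (simp add: forcing_def zero_bcontfun.rep_eq)

lemma forcing_add: "forcing (x + y) s k = forcing x s k + forcing y s k"
  by (simp add: forcing_def plus_bcontfun.rep_eq add_divide_distrib distrib_left)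

lemma forcing_Q: "Wdot V \<Longrightarrow> forcing (Q (potential V) x y) s k = driftc (state x s) V (state y s) k"
  by (simp add: forcing_def driftc_state)

lemma state_evolves: "evolves T (state x) (\<lambda>s k. lapc (state x s) k + forcing x s k)"
  unfolding evolves_def fcoef_state rate_forcing[symmetric] using rate_integrable rate_integral by blast

lemma state_lin: "state (r *\<^sub>R x + y) t z = r * state x t z + state y t z"
proof -
  have "ucoef (r *\<^sub>R x + y) t = (\<lambda>k. of_real r * ucoef x t k + ucoef y t k)"
    by (auto simp: ucoef_def coef_smooth traj_lin add_divide_distrib)
  then show ?thesis unfolding state_def by (simp add: fseries_lin fourier_coeffs_ucoef)
qed

lemma state_diff: "state (x - y) t z = state x t z - state y t z"
  using state_lin[of "-1" y x t z] by simp

definition control :: "real \<Rightarrow> real" where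
  "control K = K + (norm phi0 + apriori_bound K) + 4 * pi\<^sup>2 * 2 ^ b * K * (norm phi0 + apriori_bound K) * (norm phi0 + apriori_bound K)"

lemma controlled_Wdot: "Wdot W \<Longrightarrow> Wnorm W \<le> K \<Longrightarrow> controlled (control K) (potential W)"
  unfolding control_def
proof (rule controlled_potential)
  assume W: "Wdot W" and K: "Wnorm W \<le> K"
  show "AE y in torus. \<bar>wpd W j y\<bar> \<le> K" for j
    using AE_wpd_le[OF W, of j] by (rule eventually_mono) (use K in linarith)
  show "norm (potential W) \<le> K" using norm_potential_le[OF W] K by (rule order_trans)
qed

text \<open>For the Taylor estimate all \<open>W + H\<close> with small \<open>H\<close> share one
  constant. The bound adds the two gradients almost everywhere and the two norms of
  \<open>potential\<close>.\<close>

lemma controlled_Wdot_add: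
  assumes W: "Wdot W" and H: "Wdot H" and K: "Wnorm W + Wnorm H \<le> K"
  shows "controlled (control K) (potential (Wcomb 1 W H))"
  unfolding control_def
proof (rule controlled_potential[OF Wdot_comb[OF W H]])
  show "AE y in torus. \<bar>wpd (Wcomb 1 W H) j y\<bar> \<le> K" for j
    using AE_wpd_add_le[OF W H, of j] by (rule eventually_mono) (use K in linarith)
  have "norm (potential (Wcomb 1 W H)) \<le> norm (potential W) + norm (potential H)"
    using norm_triangle_ineq[of "potential W" "potential H"] by (simp add: potential_comb[OF W H])
  then show "norm (potential (Wcomb 1 W H)) \<le> K"
    using norm_potential_le[OF W] norm_potential_le[OF H] K by linarith
qed

lemma solvable_Wdot: "Wdot W \<Longrightarrow> solvable (potential W)"
  using controlled_Wdot[OF _ order_refl] by (auto simp: controlled_def)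

abbreviation rho :: "(real^'d \<Rightarrow> real) \<Rightarrow> real \<Rightarrow> real^'d \<Rightarrow> real" where
  "rho W \<equiv> state (sol (potential W))"

lemma rho_solves:
  assumes W: "Wdot W" shows "solves_nl T b \<phi> W (rho W)"
proof -
  let ?x = "sol (potential W)"
  have eq: "?x = (phi0, 0) + Q (potential W) ?x ?x" by (rule sol_eq[OF solvable_Wdot[OF W]])
  have "forcing ?x s k = forcing ((phi0, 0) + Q (potential W) ?x ?x) s k" for s k using eq by simp
  then have f: "forcing ?x s k = driftc (rho W s) W (rho W s) k" for s k
    by (simp only: forcing_add forcing_init forcing_Q[OF W] add_0_left)
  have "fst ?x = fst ((phi0, 0) + Q (potential W) ?x ?x)" using eq by simp
  then have "fst ?x = phi0" by simp
  then have "fcoef (rho W 0) k = fcoef \<phi> k" for k by (simp add: fcoef_state ucoef_init)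
  then show ?thesis using state_evolves[of ?x] state_inF[of ?x] by (simp add: solves_nl_def f)
qed

lemma fvec_continuous: "inF T b u \<Longrightarrow> continuous_on {0..T} (\<lambda>s. coef (fvec (u s)) k)" for u :: "real \<Rightarrow> real^'d \<Rightarrow> real"
  by (rule continuous_on_eq[OF inF_continuous]) (auto simp: coef_fvec[OF inF_L2per])

text \<open>The difference of the quadratic terms telescopes with \<open>u\<close> on the right and
  \<open>d\<close> on the left, both bounded in l2 by \<open>inF_bounded\<close>.\<close>

lemma solves_nl_unique:
  fixes u d :: "real \<Rightarrow> real^'d \<Rightarrow> real"
  assumes W: "Wdot W" and su: "solves_nl T b \<phi> W u" and sd: "solves_nl T b \<phi> W d"
  shows "feq T u d"
proof -
  have u: "inF T b u" and eu: "evolves T u (\<lambda>s k. lapc (u s) k + driftc (u s) W (u s) k)"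
    and d: "inF T b d" and ed: "evolves T d (\<lambda>s k. lapc (d s) k + driftc (d s) W (d s) k)"
    and init: "\<And>k. fcoef (u 0) k = fcoef (d 0) k"
    using su sd by (simp_all add: solves_nl_def)
  obtain Mu where Mu: "\<forall>t\<in>{0..T}. norm (fvec (u t)) \<le> Mu" using inF_bounded[OF T_gt_0 _ u] b_ge by auto
  obtain Md where Md: "\<forall>t\<in>{0..T}. norm (fvec (d t)) \<le> Md" using inF_bounded[OF T_gt_0 _ d] b_ge by auto
  show ?thesis
  proof (rule F_unique[OF u d eu ed init, where a = "\<lambda>s. fvec (u s)" and c = "\<lambda>s. fvec (d s)" and A = "max Mu Md" and p = "potential W"])
    show "AE s in lborel. s \<in> {0..T} \<longrightarrow> (\<forall>k. lapc (u s) k + driftc (u s) W (u s) k - (lapc (d s) k + driftc (d s) W (d s) k)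
        = lapc (u s) k - lapc (d s) k + of_real (freq k) * coef (tconv drift_kernel (potential W) (fvec (u s) - fvec (d s)) (fvec (u s))
          + tconv drift_kernel (potential W) (fvec (d s)) (fvec (u s) - fvec (d s))) k)"
      using inF_AE_summable[OF u] inF_AE_summable[OF d]
    proof eventually_elim
      case (elim s)
      show ?case
      proof (intro impI allI)
        fix k assume s: "s \<in> {0..T}"
        have "driftc (u s) W (u s) k - driftc (d s) W (d s) k = of_real (freq k) * coef (tconv drift_kernel (potential W) (fvec (u s) - fvec (d s)) (fvec (u s))
          + tconv drift_kernel (potential W) (fvec (d s)) (fvec (u s) - fvec (d s))) k"
          using elim s inF_L2per[OF u s] inF_L2per[OF d s]
          by (simp add: driftc_fvec[OF W] tconv_diff[symmetric] right_diff_distrib del: coef_add)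
        then show "lapc (u s) k + driftc (u s) W (u s) k - (lapc (d s) k + driftc (d s) W (d s) k)
          = lapc (u s) k - lapc (d s) k + of_real (freq k) * coef (tconv drift_kernel (potential W) (fvec (u s) - fvec (d s)) (fvec (u s))
          + tconv drift_kernel (potential W) (fvec (d s)) (fvec (u s) - fvec (d s))) k" by (simp only: add_diff_add)
      qed
    qed
    show "norm (fvec (u s)) \<le> max Mu Md" if "s \<in> {0..T}" for s using Mu that by (simp add: le_max_iff_disj)
    show "norm (fvec (d s)) \<le> max Mu Md" if "s \<in> {0..T}" for s using Md that by (simp add: le_max_iff_disj)
  qed (rule fvec_continuous[OF u] fvec_continuous[OF d])+
qed

lemma rhoW_solves: "Wdot W \<Longrightarrow> solves_nl T b \<phi> W (rhoW T b \<phi> W)"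
  unfolding rhoW_def by (rule someI[of "solves_nl T b \<phi> W", OF rho_solves])

lemma rhoW_inF: "Wdot W \<Longrightarrow> inF T b (rhoW T b \<phi> W)"
  using rhoW_solves by (auto simp: solves_nl_def)

lemma rhoW_eq: "Wdot W \<Longrightarrow> feq T (rhoW T b \<phi> W) (rho W)"
  by (rule solves_nl_unique[OF _ rhoW_solves rho_solves])

lemma fcoef_rhoW: "Wdot W \<Longrightarrow> s \<in> {0..T} \<Longrightarrow> fcoef (rhoW T b \<phi> W s) k = fcoef (rho W s) k"
  using rhoW_eq by (simp add: feq_def)

lemma rhoW_summable:
  assumes "Wdot W" "s \<in> {0..T}" shows "(\<lambda>k. cmod (fcoef (rhoW T b \<phi> W s) k)) summable_on UNIV"
  unfolding fcoef_rhoW[OF assms] fcoef_state by (rule ucoef_summable)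

text \<open>\<open>rhoW\<close> is a chosen solution that agrees with \<open>rho\<close> in its
  coefficients. Drift terms depend on no more once the convolved factor has summable
  coefficients.\<close>

lemma driftc_rhoW:
  fixes a :: "real^'d \<Rightarrow> real"
  assumes W: "Wdot W" and V: "Wdot V" and s: "s \<in> {0..T}"
  shows "L2per a \<Longrightarrow> driftc a V (rhoW T b \<phi> W s) k = driftc a V (rho W s) k"
    and "driftc (rhoW T b \<phi> W s) V (state y s) k = driftc (rho W s) V (state y s) k"
    and "driftc (rhoW T b \<phi> W s) V (rhoW T b \<phi> W s) k = driftc (rho W s) V (rho W s) k"
proof -
  note r = inF_L2per[OF rhoW_inF[OF W] s]
  show "driftc a V (rhoW T b \<phi> W s) k = driftc a V (rho W s) k" if "L2per a"
    by (rule driftc_cong[OF V that that r state_L2per refl fcoef_rhoW[OF W s] rhoW_summable[OF W s]])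
  show "driftc (rhoW T b \<phi> W s) V (state y s) k = driftc (rho W s) V (state y s) k"
    by (rule driftc_cong[OF V r state_L2per state_L2per state_L2per fcoef_rhoW[OF W s] refl]) (simp add: fcoef_state ucoef_summable)
  show "driftc (rhoW T b \<phi> W s) V (rhoW T b \<phi> W s) k = driftc (rho W s) V (rho W s) k"
    by (rule driftc_cong[OF V r state_L2per r state_L2per fcoef_rhoW[OF W s] fcoef_rhoW[OF W s] rhoW_summable[OF W s]])
qed

lemma solves_lin_unique:
  fixes u d :: "real \<Rightarrow> real^'d \<Rightarrow> real"
  assumes W: "Wdot W" and su: "solves_lin T b \<phi> W f u" and sd: "solves_lin T b \<phi> W f d"
  shows "feq T u d"
proof -
  let ?r = "rhoW T b \<phi> W" and ?B = "tconv drift_kernel (potential W)"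
  let ?G = "\<lambda>v s k. lapc (v s) k + driftc (v s) W (?r s) k + driftc (?r s) W (v s) k + f s k"
  have u: "inF T b u" and eu: "evolves T u (?G u)" and d: "inF T b d" and ed: "evolves T d (?G d)"
    and init: "\<And>k. fcoef (u 0) k = fcoef (d 0) k"
    using su sd by (simp_all add: solves_lin_def)
  note r = rhoW_inF[OF W]
  obtain M where M: "\<forall>t\<in>{0..T}. norm (fvec (?r t)) \<le> M" using inF_bounded[OF T_gt_0 _ r] b_ge by auto
  show ?thesis
  proof (rule F_unique[OF u d eu ed init, where a = "\<lambda>s. fvec (?r s)" and c = "\<lambda>s. fvec (?r s)" and A = M and p = "potential W"])
    show "AE s in lborel. s \<in> {0..T} \<longrightarrow> (\<forall>k. ?G u s k - ?G d s k
        = lapc (u s) k - lapc (d s) k + of_real (freq k) * coef (?B (fvec (u s) - fvec (d s)) (fvec (?r s))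
          + ?B (fvec (?r s)) (fvec (u s) - fvec (d s))) k)"
      using inF_AE_summable[OF u] inF_AE_summable[OF d]
    proof eventually_elim
      case (elim s)
      show ?case
      proof (intro impI allI)
        fix k assume s: "s \<in> {0..T}"
        note L = inF_L2per[OF u s] inF_L2per[OF d s] inF_L2per[OF r s]
        have 1: "driftc (u s) W (?r s) k - driftc (d s) W (?r s) k = of_real (freq k) * coef (?B (fvec (u s) - fvec (d s)) (fvec (?r s))) k"
          using L rhoW_summable[OF W s]
          by (simp add: driftc_fvec[OF W] bounded_bilinear.diff_left[OF drift.bounded_bilinear_tconv] right_diff_distrib)
        have 2: "driftc (?r s) W (u s) k - driftc (?r s) W (d s) k = of_real (freq k) * coef (?B (fvec (?r s)) (fvec (u s) - fvec (d s))) k"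
          using L elim s
          by (simp add: driftc_fvec[OF W] bounded_bilinear.diff_right[OF drift.bounded_bilinear_tconv] right_diff_distrib)
        show "?G u s k - ?G d s k
          = lapc (u s) k - lapc (d s) k + of_real (freq k) * coef (?B (fvec (u s) - fvec (d s)) (fvec (?r s))
          + ?B (fvec (?r s)) (fvec (u s) - fvec (d s))) k"
          unfolding coef_add distrib_left 1[symmetric] 2[symmetric] by simp
      qed
    qed
    show "norm (fvec (?r s)) \<le> M" "norm (fvec (?r s)) \<le> M" if "s \<in> {0..T}" for s using M that by auto
  qed (rule fvec_continuous[OF r])+
qed

definition deriv_state :: "nat \<Rightarrow> (real^'d \<Rightarrow> real) \<Rightarrow> (real^'d \<Rightarrow> real) list \<Rightarrow> real \<Rightarrow> real^'d \<Rightarrow> real" where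
  "deriv_state n W hs = state (dsol (potential W) (map potential hs))"

text \<open>Translates the linear equation for data into the linearised equation: the initial
  component is 0 and the inhomogeneity \<open>g\<close> has forcing \<open>f\<close>.\<close>

lemma solves_linI:
  assumes W: "Wdot W" and eq: "x = g + (Q (potential W) x (sol (potential W)) + Q (potential W) (sol (potential W)) x)"
    and g: "fst g = 0" "\<And>s k. s \<in> {0..T} \<Longrightarrow> forcing g s k = f s k"
  shows "solves_lin T b \<phi> W f (state x)"
proof -
  let ?R = "g + (Q (potential W) x (sol (potential W)) + Q (potential W) (sol (potential W)) x)"
  have "forcing x s k = forcing ?R s k" for s k using eq by simp
  then have f: "forcing x s k = driftc (state x s) W (rhoW T b \<phi> W s) k + driftc (rhoW T b \<phi> W s) W (state x s) k + f s k"
    if "s \<in> {0..T}" for s k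
    by (simp add: forcing_add forcing_Q[OF W] g(2)[OF that] driftc_rhoW[OF W W that] state_L2per)
  have "fst x = fst ?R" using eq by simp
  then have "fst x = 0" by (simp add: g)
  then have "fcoef (state x 0) k = 0" for k by (simp add: fcoef_state ucoef_0)
  moreover have "evolves T (state x) (\<lambda>s k. lapc (state x s) k + driftc (state x s) W (rhoW T b \<phi> W s) k + driftc (rhoW T b \<phi> W s) W (state x s) k + f s k)"
    using state_evolves[of x] by (rule evolves_cong[THEN iffD1, rotated]) (simp add: f)
  ultimately show ?thesis by (simp add: solves_lin_def state_inF)
qed

lemma deriv_state_1:
  assumes W: "Wdot W" and H: "Wdot H"
  shows "solves_lin T b \<phi> W (\<lambda>s k. driftc (rhoW T b \<phi> W s) H (rhoW T b \<phi> W s) k) (deriv_state 1 W [H])"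
  unfolding deriv_state_def list.map
proof (rule solves_linI[OF W])
  let ?p = "potential W" and ?h = "potential H"
  show "dsol ?p [?h] = Q ?h (sol ?p) (sol ?p) + (Q ?p (dsol ?p [?h]) (sol ?p) + Q ?p (sol ?p) (dsol ?p [?h]))"
    by (rule trans[OF dsol_eq[OF solvable_Wdot[OF W]]]) simp
  show "forcing (Q ?h (sol ?p) (sol ?p)) s k = driftc (rhoW T b \<phi> W s) H (rhoW T b \<phi> W s) k" if "s \<in> {0..T}" for s k
    by (simp add: forcing_Q[OF H] driftc_rhoW[OF W H that])
qed simp

text \<open>Two directions give eight terms: four with one direction on the parameter, two with one
  direction on each factor, and two with both on the same factor, which belong to the linearised
  operator.\<close>

lemma deriv_state_2:
  assumes W: "Wdot W" and H1: "Wdot H1" and H2: "Wdot H2"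
  defines "r \<equiv> rhoW T b \<phi> W" and "d1 \<equiv> deriv_state 1 W [H1]" and "d2 \<equiv> deriv_state 1 W [H2]"
  shows "solves_lin T b \<phi> W (\<lambda>s k. driftc (d2 s) H1 (r s) k + driftc (r s) H1 (d2 s) k
      + driftc (d1 s) H2 (r s) k + driftc (r s) H2 (d1 s) k
      + driftc (d1 s) W (d2 s) k + driftc (d2 s) W (d1 s) k) (deriv_state 2 W [H1, H2])"
  unfolding deriv_state_def list.map
proof (rule solves_linI[OF W])
  let ?p = "potential W" and ?h1 = "potential H1" and ?h2 = "potential H2"
  let ?x = "sol ?p" and ?x1 = "dsol ?p [?h1]" and ?x2 = "dsol ?p [?h2]" and ?y = "dsol ?p [?h1, ?h2]"
  let ?g = "Q ?h1 ?x2 ?x + Q ?h1 ?x ?x2 + (Q ?h2 ?x1 ?x + Q ?h2 ?x ?x1) + (Q ?p ?x1 ?x2 + Q ?p ?x2 ?x1)"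
  show "?y = ?g + (Q ?p ?y ?x + Q ?p ?x ?y)"
    by (rule trans[OF dsol_eq[OF solvable_Wdot[OF W]]]) (simp add: add_ac)
  show "fst ?g = 0" by simp
  show "forcing ?g s k = driftc (d2 s) H1 (r s) k + driftc (r s) H1 (d2 s) k
      + driftc (d1 s) H2 (r s) k + driftc (r s) H2 (d1 s) k
      + driftc (d1 s) W (d2 s) k + driftc (d2 s) W (d1 s) k" if s: "s \<in> {0..T}" for s k
    unfolding r_def d1_def d2_def deriv_state_def list.map
    by (simp add: forcing_add forcing_Q W H1 H2 driftc_rhoW[OF W _ s] state_L2per)
qed

text \<open>Everything is proved for the data and carried over by the bounded linear map
  \<open>state\<close>; the smallness in the Frechet condition comes from the quadratic
  \<open>dsol_remainder\<close>.\<close>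

lemma deriv_state_smooth: "smooth_with_derivs T b (rhoW T b \<phi>) deriv_state"
  unfolding smooth_with_derivs_def
proof (intro conjI allI impI)
  fix W :: "real^'d \<Rightarrow> real" assume W: "Wdot W"
  show "inF T b (rhoW T b \<phi> W)" by (rule rhoW_inF[OF W])
  show "feq T (deriv_state 0 W []) (rhoW T b \<phi> W)"
    using rhoW_eq[OF W] by (simp add: deriv_state_def feq_def)
next
  fix n and W :: "real^'d \<Rightarrow> real" and hs :: "(real^'d \<Rightarrow> real) list" assume "Wdot W"
  show "inF T b (deriv_state n W hs)" unfolding deriv_state_def by (rule state_inF)
next
  fix n and W :: "real^'d \<Rightarrow> real" and Hs1 Hs2 :: "(real^'d \<Rightarrow> real) list" and H H' :: "real^'d \<Rightarrow> real" and a :: real assume W: "Wdot W"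
    and l: "set Hs1 \<subseteq> Collect Wdot \<and> set Hs2 \<subseteq> Collect Wdot \<and> Wdot H \<and> Wdot H' \<and> length Hs1 + length Hs2 + 1 = n"
  have "dsol (potential W) (map potential (Hs1 @ Wcomb a H H' # Hs2))
      = a *\<^sub>R dsol (potential W) (map potential (Hs1 @ H # Hs2)) + dsol (potential W) (map potential (Hs1 @ H' # Hs2))"
    using l by (simp add: potential_comb dsol_list_comb[OF solvable_Wdot[OF W] list_comb_append])
  then show "feq T (deriv_state n W (Hs1 @ Wcomb a H H' # Hs2))
      (\<lambda>t x. a * deriv_state n W (Hs1 @ H # Hs2) t x + deriv_state n W (Hs1 @ H' # Hs2) t x)"
    unfolding deriv_state_def by (simp add: feq_def state_lin[symmetric])
next
  fix n and W :: "real^'d \<Rightarrow> real" assume W: "Wdot W"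
  let ?cF = "(2 + sqrt (32 * pi ^ 4 + 2)) * (1 + T)"
  have cF: "0 \<le> ?cF" using T_gt_0 by (intro mult_nonneg_nonneg add_nonneg_nonneg) auto
  obtain C where C: "0 \<le> C" "\<forall>p hs. controlled (control (Wnorm W)) p \<longrightarrow> length hs \<le> n \<longrightarrow> norm (dsol p hs) \<le> C * norm_prod hs"
    using dsol_bound by blast
  show "\<exists>C. \<forall>hs. set hs \<subseteq> Collect Wdot \<and> length hs = n \<longrightarrow> Fnorm T b (deriv_state n W hs) \<le> C * prod_list (map Wnorm hs)"
  proof (intro exI[of _ "?cF * C"] allI impI)
    fix hs :: "(real^'d \<Rightarrow> real) list" assume l: "set hs \<subseteq> Collect Wdot \<and> length hs = n"
    have "Fnorm T b (deriv_state n W hs) \<le> ?cF * norm (dsol (potential W) (map potential hs))"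
      unfolding deriv_state_def by (rule Fnorm_state_le)
    also have "\<dots> \<le> ?cF * (C * norm_prod (map potential hs))"
      using C(2)[rule_format, OF controlled_Wdot[OF W order_refl], of "map potential hs"] l by (intro mult_left_mono[OF _ cF]) simp
    also have "\<dots> \<le> ?cF * (C * prod_list (map Wnorm hs))"
      using l by (intro mult_left_mono[OF _ cF] mult_left_mono[OF _ C(1)] norm_prod_potential_le) simp
    finally show "Fnorm T b (deriv_state n W hs) \<le> ?cF * C * prod_list (map Wnorm hs)" by (simp only: mult.assoc)
  qed
next
  fix n and W :: "real^'d \<Rightarrow> real" and \<epsilon> :: real assume W: "Wdot W" and \<epsilon>: "0 < \<epsilon>"
  \<comment> \<open>\<open>?M\<close> controls the potentials of \<open>W\<close> and of every
    \<open>W + H\<close> with \<open>Wnorm H \<le> 1\<close>.\<close>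
  let ?cF = "(2 + sqrt (32 * pi ^ 4 + 2)) * (1 + T)" and ?M = "control (Wnorm W + 1)"
  have cF: "0 \<le> ?cF" using T_gt_0 by (intro mult_nonneg_nonneg add_nonneg_nonneg) auto
  obtain C where C: "0 \<le> C" "\<forall>p q hs. controlled ?M p \<longrightarrow> controlled ?M q \<longrightarrow> length hs \<le> n \<longrightarrow>
      norm (dsol q hs - dsol p hs - dsol p ((q - p) # hs)) \<le> C * (norm (q - p))\<^sup>2 * norm_prod hs"
    using dsol_remainder by blast
  have D: "0 \<le> ?cF * C" using cF C(1) by (rule mult_nonneg_nonneg)
  \<comment> \<open>At most 1 for the control constant. The second bound turns the quadratic
    remainder into \<open>\<epsilon> * Wnorm H\<close>; adding 1 keeps the denominator
    positive.\<close>
  define \<delta> where "\<delta> = min 1 (\<epsilon> / (?cF * C + 1))"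
  have "0 < \<delta>" unfolding \<delta>_def using \<epsilon> D by simp
  show "\<exists>\<delta>>0. \<forall>H. Wdot H \<and> Wnorm H < \<delta> \<longrightarrow> (\<forall>hs. set hs \<subseteq> Collect Wdot \<and> length hs = n \<longrightarrow>
      Fnorm T b (\<lambda>t x. deriv_state n (\<lambda>y. W y + H y) hs t x - deriv_state n W hs t x - deriv_state (Suc n) W (H # hs) t x)
        \<le> \<epsilon> * Wnorm H * prod_list (map Wnorm hs))"
  proof (intro exI[of _ \<delta>] conjI allI impI)
    show "0 < \<delta>" by fact
    fix H :: "real^'d \<Rightarrow> real" and hs :: "(real^'d \<Rightarrow> real) list"
    assume H': "Wdot H \<and> Wnorm H < \<delta>" and l: "set hs \<subseteq> Collect Wdot \<and> length hs = n"
    then have H: "Wdot H" and small: "Wnorm H < \<delta>" by auto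
    let ?p = "potential W" and ?h = "potential H" and ?hs = "map potential hs"
    have h: "norm ?h \<le> Wnorm H" by (rule norm_potential_le[OF H])
    have H0: "0 \<le> Wnorm H" using norm_ge_zero h by (rule order_trans)
    have P: "norm_prod ?hs \<le> prod_list (map Wnorm hs)" using l by (intro norm_prod_potential_le) simp
    have q: "potential (\<lambda>y. W y + H y) = ?p + ?h" using potential_comb[OF W H, of 1] by (simp add: Wcomb_def)
    have cp: "controlled ?M ?p" by (rule controlled_Wdot[OF W]) simp
    have cq: "controlled ?M (?p + ?h)"
      using controlled_Wdot_add[OF W H, of "Wnorm W + 1"] small by (simp add: potential_comb[OF W H] \<delta>_def)
    have n: "norm (dsol (?p + ?h) ?hs - dsol ?p ?hs - dsol ?p (?h # ?hs)) \<le> C * (norm ?h)\<^sup>2 * norm_prod ?hs"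
      using C(2)[rule_format, OF cp cq, of ?hs] l by simp
    have "(\<lambda>t x. deriv_state n (\<lambda>y. W y + H y) hs t x - deriv_state n W hs t x - deriv_state (Suc n) W (H # hs) t x)
        = state (dsol (?p + ?h) ?hs - dsol ?p ?hs - dsol ?p (?h # ?hs))"
      unfolding deriv_state_def q by (simp add: state_diff fun_eq_iff)
    then have "Fnorm T b (\<lambda>t x. deriv_state n (\<lambda>y. W y + H y) hs t x - deriv_state n W hs t x - deriv_state (Suc n) W (H # hs) t x)
        \<le> ?cF * norm (dsol (?p + ?h) ?hs - dsol ?p ?hs - dsol ?p (?h # ?hs))" by (simp only: Fnorm_state_le)
    also have "\<dots> \<le> ?cF * (C * (norm ?h)\<^sup>2 * norm_prod ?hs)" by (rule mult_left_mono[OF n cF])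
    also have "\<dots> \<le> ?cF * (C * (Wnorm H)\<^sup>2 * prod_list (map Wnorm hs))"
      using h P H0 C(1) by (intro mult_left_mono[OF _ cF] mult_mono mult_nonneg_nonneg power_mono norm_prod_nonneg) auto
    also have "\<dots> = (?cF * C * Wnorm H) * (Wnorm H * prod_list (map Wnorm hs))" by (simp add: power2_eq_square)
    also have "\<dots> \<le> \<epsilon> * (Wnorm H * prod_list (map Wnorm hs))"
    proof (rule mult_right_mono)
      have "?cF * C * Wnorm H \<le> (?cF * C + 1) * (\<epsilon> / (?cF * C + 1))"
        using small D H0 by (intro mult_mono) (auto simp: \<delta>_def)
      also have "\<dots> = \<epsilon>" using D by simp
      finally show "?cF * C * Wnorm H \<le> \<epsilon>" .
      show "0 \<le> Wnorm H * prod_list (map Wnorm hs)" using H0 order_trans[OF norm_prod_nonneg P] by (rule mult_nonneg_nonneg)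
    qed
    finally show "Fnorm T b (\<lambda>t x. deriv_state n (\<lambda>y. W y + H y) hs t x - deriv_state n W hs t x - deriv_state (Suc n) W (H # hs) t x)
        \<le> \<epsilon> * Wnorm H * prod_list (map Wnorm hs)" by (simp only: mult.assoc)
  qed
qed

end

theorem theorem2p6:
  fixes T :: real and b :: nat and \<phi> :: "real^'d \<Rightarrow> real"
  assumes "T > 0" and "A1 b \<phi>"
  shows "\<exists>D. smooth_with_derivs T b (rhoW T b \<phi>) D
    \<and> (\<forall>W H. Wdot W \<and> Wdot H \<longrightarrow>
         (let f = (\<lambda>s k. driftc (rhoW T b \<phi> W s) H (rhoW T b \<phi> W s) k) in
            solves_lin T b \<phi> W f (D 1 W [H])
            \<and> (\<forall>v. solves_lin T b \<phi> W f v \<longrightarrow> feq T v (D 1 W [H]))))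
    \<and> (\<forall>W H1 H2. Wdot W \<and> Wdot H1 \<and> Wdot H2 \<longrightarrow>
         (let r = rhoW T b \<phi> W; d1 = D 1 W [H1]; d2 = D 1 W [H2];
              f = (\<lambda>s k. driftc (d2 s) H1 (r s) k + driftc (r s) H1 (d2 s) k
                        + driftc (d1 s) H2 (r s) k + driftc (r s) H2 (d1 s) k
                        + driftc (d1 s) W (d2 s) k + driftc (d2 s) W (d1 s) k) in
            solves_lin T b \<phi> W f (D 2 W [H1, H2])
            \<and> (\<forall>v. solves_lin T b \<phi> W f v \<longrightarrow> feq T v (D 2 W [H1, H2]))))"
proof -
  interpret torus_problem T b \<phi> using assms by unfold_locales
  show ?thesis
    unfolding Let_def
    by (intro exI[of _ deriv_state] conjI allI impI deriv_state_smooth)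
      (blast intro: deriv_state_1 deriv_state_2 solves_lin_unique)+
qed

end
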